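(* Let $\Omega\subset\mathbb{R}^3$ be a smooth bounded axisymmetric domain. Let $(u_n)_n$ be a minimizing sequence for $E$ in $\mathcal{A}_{nc}^{axi}$ and assume that $u_n\rightharpoonup u$ weakly in $W^{1,2}(\Omega,\mathbb{R}^3)$. Then, after extraction of a subsequence, $G_{u_n}\rightharpoonup G_u+S$ in the sense of currents in $\Omega\times\mathbb{R}^3$ for some $3$-current $S$, and $$\operatorname{supp}S\subset(\Omega\cap O_z)\times\mathbb{R}^3.$$
   Context: Axisymmetric means with respect to the $z$-axis, denoted $O_z$. $\Omega'\subset\mathbb{R}^3$ is a smooth bounded axisymmetric domain, $g:\overline{\Omega}\to\overline{\Omega'}$ is a $C^1$ axisymmetric diffeomorphism, and $M>0$. $H:(0,\infty)\to[0,\infty)$ is a (smooth) convex function with $\lim_{t\to+\infty}H(t)/t=\lim_{s\to0^+}H(s)=+\infty$. The energy is $E(u)=\int_\Omega |Du|^2+H(\det Du)\,dx$. Let $\Omega_0=\{(r,z): r>0,\ (r,0,z)\in\Omega\}$. A map $u:\Omega\to\mathbb{R}^3$ is axisymmetric if there is $v=(v_1,v_2):\Omega_0\to\mathbb{R}^2$ with $v_1\ge0$ a.e. and $u(r\cos\theta,r\sin\theta,z)=v_1(r,z)(\cos\theta\, e_x+\sin\theta\, e_y)+v_2(r,z)e_z$. For $u\in W^{1,2}(\Omega,\mathbb{R}^3)$ with $\det Du\in L^1(\Omega)$ and $f\in C^\infty_c(\Omega\times\mathbb{R}^3,\mathbb{R}^3)$ set $$\mathcal{E}_u(f)=\int_\Omega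 \langle\operatorname{cof}Du(x),D_xf(x,u(x))\rangle+\det Du(x)\,\operatorname{div}_yf(x,u(x))\,dx,\qquad \mathcal{E}(u)=\sup\{\mathcal{E}_u(f): \|f\|_\infty\le1\},$$ where $\langle A,B\rangle=\operatorname{tr}(A^TB)$ and $A^T\operatorname{cof}A=(\det A)I$. $\mathcal{A}$ is the set of $u\in W^{1,2}\cap L^\infty(\Omega,\mathbb{R}^3)$ with $u|_{\partial\Omega}=g|_{\partial\Omega}$, $\|u\|_\infty\le M$, $\det Du>0$ a.e. and $u$ one-to-one a.e. $\mathcal{A}_{nc}=\{u\in\mathcal{A}:\mathcal{E}(u)=0\}$ and $\mathcal{A}_{nc}^{axi}=\{u\in\mathcal{A}_{nc}:u\text{ axisymmetric}\}$. It is assumed that $0<\inf\{E(w):w\in\mathcal{A}_{nc}^{axi}\}<+\infty$. A minimizing sequence is a sequence $u_n\in\mathcal{A}_{nc}^{axi}$ with $E(u_n)\to\inf_{\mathcal{A}_{nc}^{axi}}E$. $3$-currents in $\Omega\times\mathbb{R}^3$ are linear forms on smooth compactly supported $3$-forms; convergence in the sense of currents is pointwise convergence on such forms. The support of a current $T$ is the smallest relatively closed $K\subset\Omega\times\mathbb{R}^3$ such that $\langle T,\omega\rangle=0$ whenever $\operatorname{supp}\omega\subset(\Omega\times\mathbb{R}^3)\setminus K$. For $u\in W^{1,2}(\Omega,\mathbb{R}^3)$ with $\det Du\in L^1$, the graph current is $$\langle G_u,\omega\rangle=\int_\Omega\langle\omega(x,u(x)),M(Du)(x)\rangle\,dx,\qquad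 M(Du)=(e_1,Du\,e_1)\wedge(e_2,Du\,e_2)\wedge(e_3,Du\,e_3).$$ *)

theory Defs
  imports "HOL-Analysis.Analysis"
begin

primrec Ck_on :: "nat \<Rightarrow> ('a::euclidean_space \<Rightarrow> 'b::euclidean_space) \<Rightarrow> 'a set \<Rightarrow> bool" where
  "Ck_on 0 f S \<longleftrightarrow> continuous_on S f"
| "Ck_on (Suc k) f S \<longleftrightarrow>
     (\<forall>x\<in>S. f differentiable (at x)) \<and> (\<forall>v. Ck_on k (\<lambda>x. frechet_derivative f (at x) v) S)"

definition smooth_on :: "'a set \<Rightarrow> ('a::euclidean_space \<Rightarrow> 'b::euclidean_space) \<Rightarrow> bool" where
  "smooth_on S f \<longleftrightarrow> (\<forall>k. Ck_on k f S)"

text \<open>Compactly supported smooth functions on an open set \<open>U\<close> are represented by their extension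
  by zero to the whole space.\<close>

definition test_functions :: "'a set \<Rightarrow> ('a::euclidean_space \<Rightarrow> 'b::euclidean_space) set" where
  "test_functions U = {f. smooth_on UNIV f \<and>
     compact (closure {x. f x \<noteq> 0}) \<and> closure {x. f x \<noteq> 0} \<subseteq> U}"

definition C1_on_closed :: "'a set \<Rightarrow> ('a::euclidean_space \<Rightarrow> 'b::euclidean_space) \<Rightarrow> bool" where
  "C1_on_closed S f \<longleftrightarrow> (\<exists>U h. open U \<and> S \<subseteq> U \<and> Ck_on 1 h U \<and> (\<forall>x\<in>S. h x = f x))"

definition C1_diffeomorphism ::
  "'a set \<Rightarrow> 'b set \<Rightarrow> ('a::euclidean_space \<Rightarrow> 'b::euclidean_space) \<Rightarrow> bool" where
  "C1_diffeomorphism S T f \<longleftrightarrow>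
     bij_betw f S T \<and> C1_on_closed S f \<and> C1_on_closed T (the_inv_into S f)"

text \<open>The boundary is smooth when the domain is, near each boundary point, the sublevel set of a
  smooth function with nonvanishing differential.\<close>

definition smooth_bounded_domain :: "'a::euclidean_space set \<Rightarrow> bool" where
  "smooth_bounded_domain \<Omega> \<longleftrightarrow> open \<Omega> \<and> connected \<Omega> \<and> \<Omega> \<noteq> {} \<and> bounded \<Omega> \<and>
     (\<forall>p\<in>frontier \<Omega>. \<exists>U (\<psi> :: 'a \<Rightarrow> real). open U \<and> p \<in> U \<and> smooth_on U \<psi> \<and>
        (\<forall>x\<in>U. \<exists>v. frechet_derivative \<psi> (at x) v \<noteq> 0) \<and>
        \<Omega> \<inter> U = {x\<in>U. \<psi> x < 0})"


definition axis_z :: "(real^3) set" where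
  "axis_z = {x. x $ 1 = 0 \<and> x $ 2 = 0}"

definition rotation_z :: "real \<Rightarrow> real^3 \<Rightarrow> real^3" where
  "rotation_z \<theta> x = vector [cos \<theta> * x $ 1 - sin \<theta> * x $ 2, sin \<theta> * x $ 1 + cos \<theta> * x $ 2, x $ 3]"

definition axisymmetric_set :: "(real^3) set \<Rightarrow> bool" where
  "axisymmetric_set \<Omega> \<longleftrightarrow> (\<forall>\<theta>. rotation_z \<theta> ` \<Omega> = \<Omega>)"

definition half_section :: "(real^3) set \<Rightarrow> (real \<times> real) set" where
  "half_section \<Omega> = {(r, z). r > 0 \<and> vector [r, 0, z] \<in> \<Omega>}"

text \<open>Maps are representatives of Lebesgue classes, so the defining identity is required
  for almost every point of \<open>\<Omega>\<close>.\<close>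

definition axisymmetric_map :: "(real^3) set \<Rightarrow> (real^3 \<Rightarrow> real^3) \<Rightarrow> bool" where
  "axisymmetric_map \<Omega> u \<longleftrightarrow> (\<exists>v :: real \<times> real \<Rightarrow> real \<times> real.
     (AE p in lebesgue_on (half_section \<Omega>). fst (v p) \<ge> 0) \<and>
     (AE x in lebesgue_on \<Omega>. \<forall>r \<theta> z.
        (r, z) \<in> half_section \<Omega> \<and> x = vector [r * cos \<theta>, r * sin \<theta>, z] \<longrightarrow>
        u x = fst (v (r, z)) *\<^sub>R (cos \<theta> *\<^sub>R axis 1 1 + sin \<theta> *\<^sub>R axis 2 1)
              + snd (v (r, z)) *\<^sub>R axis 3 1))"


definition L2_on :: "(real^3) set \<Rightarrow> (real^3 \<Rightarrow> 'b::euclidean_space) \<Rightarrow> bool" where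
  "L2_on \<Omega> f \<longleftrightarrow> f \<in> borel_measurable (lebesgue_on \<Omega>) \<and>
     integrable (lebesgue_on \<Omega>) (\<lambda>x. (norm (f x))\<^sup>2)"

text \<open>Row \<open>i\<close>, column \<open>j\<close> of the gradient is the weak partial derivative of the \<open>i\<close>-th component
  in direction \<open>j\<close>.\<close>

definition has_weak_gradient ::
  "(real^3) set \<Rightarrow> (real^3 \<Rightarrow> real^3) \<Rightarrow> (real^3 \<Rightarrow> real^3^3) \<Rightarrow> bool" where
  "has_weak_gradient \<Omega> u D \<longleftrightarrow>
     (\<forall>K. compact K \<and> K \<subseteq> \<Omega> \<longrightarrow> integrable (lebesgue_on K) u \<and> integrable (lebesgue_on K) D) \<and>
     (\<forall>\<phi> \<in> test_functions \<Omega>. \<forall>i j.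
        (\<integral>x. u x $ i * frechet_derivative \<phi> (at x) (axis j 1) \<partial>lebesgue_on \<Omega>)
        = - (\<integral>x. D x $ i $ j * \<phi> x \<partial>lebesgue_on \<Omega>))"

definition weak_gradient :: "(real^3) set \<Rightarrow> (real^3 \<Rightarrow> real^3) \<Rightarrow> (real^3 \<Rightarrow> real^3^3)" where
  "weak_gradient \<Omega> u = (SOME D. has_weak_gradient \<Omega> u D)"

definition W12 :: "(real^3) set \<Rightarrow> (real^3 \<Rightarrow> real^3) set" where
  "W12 \<Omega> = {u. L2_on \<Omega> u \<and> (\<exists>D. has_weak_gradient \<Omega> u D) \<and> L2_on \<Omega> (weak_gradient \<Omega> u)}"

definition W12_norm :: "(real^3) set \<Rightarrow> (real^3 \<Rightarrow> real^3) \<Rightarrow> real" where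
  "W12_norm \<Omega> u =
     sqrt (\<integral>x. (norm (u x))\<^sup>2 + (norm (weak_gradient \<Omega> u x))\<^sup>2 \<partial>lebesgue_on \<Omega>)"

text \<open>The bound makes a functional on representatives descend to Lebesgue classes.\<close>

definition W12_dual :: "(real^3) set \<Rightarrow> ((real^3 \<Rightarrow> real^3) \<Rightarrow> real) set" where
  "W12_dual \<Omega> = {L.
     (\<forall>v\<in>W12 \<Omega>. \<forall>w\<in>W12 \<Omega>. L (\<lambda>x. v x + w x) = L v + L w) \<and>
     (\<forall>w\<in>W12 \<Omega>. \<forall>c. L (\<lambda>x. c *\<^sub>R w x) = c * L w) \<and>
     (\<exists>C. \<forall>w\<in>W12 \<Omega>. \<bar>L w\<bar> \<le> C * W12_norm \<Omega> w)}"

definition weakly_converges_W12 ::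
  "(real^3) set \<Rightarrow> (nat \<Rightarrow> real^3 \<Rightarrow> real^3) \<Rightarrow> (real^3 \<Rightarrow> real^3) \<Rightarrow> bool" where
  "weakly_converges_W12 \<Omega> un u \<longleftrightarrow>
     (\<forall>n. un n \<in> W12 \<Omega>) \<and> u \<in> W12 \<Omega> \<and> (\<forall>L\<in>W12_dual \<Omega>. (\<lambda>n. L (un n)) \<longlonglongrightarrow> L u)"


text \<open>Two-dimensional Hausdorff measure, normalised to agree with surface area. It is a metric
  outer measure, hence countably additive on the Borel sets.\<close>

definition hausdorff2_delta :: "real \<Rightarrow> (real^3) set \<Rightarrow> ennreal" where
  "hausdorff2_delta \<delta> A =
     (INF C \<in> {C :: nat \<Rightarrow> (real^3) set. A \<subseteq> (\<Union>i. C i) \<and> (\<forall>i. bounded (C i) \<and> diameter (C i) \<le> \<delta>)}.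
        \<Sum>i. ennreal (pi / 4 * (diameter (C i))\<^sup>2))"

definition hausdorff2 :: "(real^3) measure" where
  "hausdorff2 = measure_of UNIV (sets borel) (\<lambda>A. SUP \<delta>\<in>{0<..}. hausdorff2_delta \<delta> A)"

text \<open>The trace operator is the continuous extension of restriction to the boundary from functions
  smooth up to the boundary: \<open>h\<close> is the trace of \<open>u\<close> if smooth functions converging to \<open>u\<close> in
  $W^{1,2}(\Omega)$ have boundary values converging to \<open>h\<close> in $L^2(\partial\Omega)$.\<close>

definition has_trace :: "(real^3) set \<Rightarrow> (real^3 \<Rightarrow> real^3) \<Rightarrow> (real^3 \<Rightarrow> real^3) \<Rightarrow> bool" where
  "has_trace \<Omega> u h \<longleftrightarrow> u \<in> W12 \<Omega> \<and> (\<exists>\<phi> :: nat \<Rightarrow> real^3 \<Rightarrow> real^3.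
     (\<forall>k. smooth_on UNIV (\<phi> k)) \<and>
     (\<lambda>k. W12_norm \<Omega> (\<lambda>x. \<phi> k x - u x)) \<longlonglongrightarrow> 0 \<and>
     (\<lambda>k. \<integral>\<^sup>+x. ennreal ((norm (\<phi> k x - h x))\<^sup>2) * indicator (frontier \<Omega>) x \<partial>hausdorff2)
       \<longlonglongrightarrow> 0)"


definition cofactor :: "real^'n^'n \<Rightarrow> real^'n^'n" where
  "cofactor A = (\<chi> i j. det (\<chi> k l. if k = i then (if l = j then 1 else 0) else A $ k $ l))"

lemma transpose_mult_cofactor:
  fixes A :: "real^3^3"
  shows "transpose A ** cofactor A = mat (det A)"
  by (simp add: vec_eq_iff forall_3 matrix_matrix_mult_def transpose_def cofactor_def mat_def
      det_3 sum_3 algebra_simps)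

definition frobenius_inner :: "real^'n^'n \<Rightarrow> real^'n^'n \<Rightarrow> real" where
  "frobenius_inner A B = trace (transpose A ** B)"

definition neo_hookean_energy ::
  "(real^3) set \<Rightarrow> (real \<Rightarrow> real) \<Rightarrow> (real^3 \<Rightarrow> real^3) \<Rightarrow> ennreal" where
  "neo_hookean_energy \<Omega> H u =
     (\<integral>\<^sup>+x. ennreal ((norm (weak_gradient \<Omega> u x))\<^sup>2 + H (det (weak_gradient \<Omega> u x)))
        \<partial>lebesgue_on \<Omega>)"

definition surface_functional ::
  "(real^3) set \<Rightarrow> (real^3 \<Rightarrow> real^3) \<Rightarrow> ((real^3) \<times> (real^3) \<Rightarrow> real^3) \<Rightarrow> real" where
  "surface_functional \<Omega> u f =
     (\<integral>x. frobenius_inner (cofactor (weak_gradient \<Omega> u x)) (jacobian (\<lambda>x'. f (x', u x)) (at x))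
           + det (weak_gradient \<Omega> u x) * trace (jacobian (\<lambda>y. f (x, y)) (at (u x)))
        \<partial>lebesgue_on \<Omega>)"

definition surface_energy :: "(real^3) set \<Rightarrow> (real^3 \<Rightarrow> real^3) \<Rightarrow> ereal" where
  "surface_energy \<Omega> u =
     (SUP f \<in> {f \<in> test_functions (\<Omega> \<times> UNIV). \<forall>p. norm (f p) \<le> 1}. ereal (surface_functional \<Omega> u f))"

definition one_to_one_ae :: "(real^3) set \<Rightarrow> (real^3 \<Rightarrow> real^3) \<Rightarrow> bool" where
  "one_to_one_ae \<Omega> u \<longleftrightarrow> (\<exists>N \<in> null_sets lebesgue. inj_on u (\<Omega> - N))"

definition det_integrable :: "(real^3) set \<Rightarrow> (real^3 \<Rightarrow> real^3) \<Rightarrow> bool" where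
  "det_integrable \<Omega> u \<longleftrightarrow> integrable (lebesgue_on \<Omega>) (\<lambda>x. det (weak_gradient \<Omega> u x))"

definition admissible ::
  "(real^3) set \<Rightarrow> (real^3 \<Rightarrow> real^3) \<Rightarrow> real \<Rightarrow> (real^3 \<Rightarrow> real^3) set" where
  "admissible \<Omega> g M = {u \<in> W12 \<Omega>.
     has_trace \<Omega> u g \<and>
     (AE x in lebesgue_on \<Omega>. norm (u x) \<le> M) \<and>
     (AE x in lebesgue_on \<Omega>. det (weak_gradient \<Omega> u x) > 0) \<and>
     one_to_one_ae \<Omega> u}"

text \<open>The surface energy is only defined for maps with integrable Jacobian determinant, whence the
  clause \<^const>\<open>det_integrable\<close>. It is no restriction: by the area formula it holds for every
  bounded map that is one-to-one almost everywhere.\<close>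

definition admissible_nc ::
  "(real^3) set \<Rightarrow> (real^3 \<Rightarrow> real^3) \<Rightarrow> real \<Rightarrow> (real^3 \<Rightarrow> real^3) set" where
  "admissible_nc \<Omega> g M = {u \<in> admissible \<Omega> g M. det_integrable \<Omega> u \<and> surface_energy \<Omega> u = 0}"

definition admissible_nc_axi ::
  "(real^3) set \<Rightarrow> (real^3 \<Rightarrow> real^3) \<Rightarrow> real \<Rightarrow> (real^3 \<Rightarrow> real^3) set" where
  "admissible_nc_axi \<Omega> g M = {u \<in> admissible_nc \<Omega> g M. axisymmetric_map \<Omega> u}"

definition minimizing_sequence ::
  "('a \<Rightarrow> 'b::{complete_lattice, topological_space}) \<Rightarrow> 'a set \<Rightarrow> (nat \<Rightarrow> 'a) \<Rightarrow> bool" where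
  "minimizing_sequence E A un \<longleftrightarrow> (\<forall>n. un n \<in> A) \<and> (\<lambda>n. E (un n)) \<longlonglongrightarrow> (INF w\<in>A. E w)"


text \<open>A 3-form assigns to each point an alternating trilinear form on the tangent space.\<close>

type_synonym 'a form3 = "'a \<Rightarrow> 'a \<Rightarrow> 'a \<Rightarrow> 'a \<Rightarrow> real"

definition alternating3 :: "('a::real_vector \<Rightarrow> 'a \<Rightarrow> 'a \<Rightarrow> real) \<Rightarrow> bool" where
  "alternating3 \<alpha> \<longleftrightarrow>
     (\<forall>b c. linear (\<lambda>a. \<alpha> a b c)) \<and> (\<forall>a c. linear (\<lambda>b. \<alpha> a b c)) \<and> (\<forall>a b. linear (\<lambda>c. \<alpha> a b c)) \<and>
     (\<forall>a b. \<alpha> a a b = 0 \<and> \<alpha> a b a = 0 \<and> \<alpha> b a a = 0)"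

definition form_support :: "'a::euclidean_space form3 \<Rightarrow> 'a set" where
  "form_support \<omega> = closure {p. \<exists>a b c. \<omega> p a b c \<noteq> 0}"

definition test_forms3 :: "'a::euclidean_space set \<Rightarrow> 'a form3 set" where
  "test_forms3 U = {\<omega>. (\<forall>p. alternating3 (\<omega> p)) \<and>
     (\<forall>a b c. smooth_on UNIV (\<lambda>p. \<omega> p a b c)) \<and>
     compact (form_support \<omega>) \<and> form_support \<omega> \<subseteq> U}"

definition current3 :: "'a::euclidean_space set \<Rightarrow> ('a form3 \<Rightarrow> real) \<Rightarrow> bool" where
  "current3 U T \<longleftrightarrow>
     (\<forall>\<omega>\<in>test_forms3 U. \<forall>\<eta>\<in>test_forms3 U. T (\<lambda>p a b c. \<omega> p a b c + \<eta> p a b c) = T \<omega> + T \<eta>) \<and>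
     (\<forall>\<omega>\<in>test_forms3 U. \<forall>k. T (\<lambda>p a b c. k * \<omega> p a b c) = k * T \<omega>)"

definition currents_converge ::
  "'a::euclidean_space set \<Rightarrow> (nat \<Rightarrow> 'a form3 \<Rightarrow> real) \<Rightarrow> ('a form3 \<Rightarrow> real) \<Rightarrow> bool" where
  "currents_converge U Tn T \<longleftrightarrow> (\<forall>\<omega>\<in>test_forms3 U. (\<lambda>n. Tn n \<omega>) \<longlonglongrightarrow> T \<omega>)"

definition current_support :: "'a::euclidean_space set \<Rightarrow> ('a form3 \<Rightarrow> real) \<Rightarrow> 'a set" where
  "current_support U T = \<Inter>{K. closedin (top_of_set U) K \<and>
     (\<forall>\<omega>\<in>test_forms3 U. form_support \<omega> \<subseteq> U - K \<longrightarrow> T \<omega> = 0)}"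

text \<open>The duality between 3-covectors and the simple 3-vector \<open>\<xi>\<^sub>1 \<and> \<xi>\<^sub>2 \<and> \<xi>\<^sub>3\<close> is evaluation of the
  alternating form at \<open>(\<xi>\<^sub>1, \<xi>\<^sub>2, \<xi>\<^sub>3)\<close>.\<close>

definition graph_current ::
  "(real^3) set \<Rightarrow> (real^3 \<Rightarrow> real^3) \<Rightarrow> ((real^3) \<times> (real^3)) form3 \<Rightarrow> real" where
  "graph_current \<Omega> u \<omega> =
     (let \<xi> = (\<lambda>x i. (axis i 1, weak_gradient \<Omega> u x *v axis i 1))
      in \<integral>x. \<omega> (x, u x) (\<xi> x 1) (\<xi> x 2) (\<xi> x 3) \<partial>lebesgue_on \<Omega>)"

end

theory Submission
  imports Defs "HOL-Complex_Analysis.Great_Picard"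
begin

text \<open>Write an axisymmetric map as \<open>(r, z) \<mapsto> (v\<^sub>1, v\<^sub>2)\<close> and put \<open>q = r v\<^sub>1\<close>, \<open>s = v\<^sub>2\<close>. Away from the axis the
  integrand of the graph current is affine in the first derivatives of \<open>q\<close> and \<open>s\<close>, apart from the
  single quadratic term given by their two-dimensional Jacobian, with coefficients continuous in
  \<open>(x, q, s)\<close>. That Jacobian is a divergence, hence weakly continuous under the energy bound, also
  against functions of \<open>(q, s)\<close>: integrate by parts for monomials and approximate. So the graph currents
  converge to \<open>G\<^sub>u\<close> on forms supported off the axis.

  On all of \<open>\<Omega> \<times> \<real>\<^sup>3\<close> the minors of the gradients are bounded in \<open>L\<^sup>1\<close>, the determinant by superlinearity of
  \<open>H\<close>, so a diagonal subsequence makes the graph currents converge, and the defect lives on the axis.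
  The determinant of the limit is integrable because its total variation off the null set \<open>O\<^sub>z\<close> is
  bounded by duality with test functions.\<close>

section \<open>Smooth functions\<close>

text \<open>In three dimensions an L2 bound on the gradient leaves its minors uncontrolled: a
  product of two weakly convergent derivatives need not converge to the product of the limits, and
  the determinant is cubic. Off the axis axisymmetry removes one derivative from every product,
  because the image \<open>Jrot (u x)\<close> of the angular direction \<open>Jrot x\<close>
  involves only values of \<open>u\<close>, which are bounded and converge strongly. The two other
  directions carry the derivatives of \<open>q\<close> and \<open>s\<close>, whence the single
  quadratic term. Its weight depends on \<open>u\<close> and converges only almost everywhere, while
  the Jacobian is bounded only in L1, so no weak-strong pairing applies to it directly. Polynomial
  weights are absorbed into the divergence structure before the limit is taken, and a uniform
  approximation of the weight then costs no more than its size times the L1 bound. The frame has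
  coefficients in \<open>1 / rsq x\<close>, so the supports must keep away from the axis.
  Convergence almost everywhere is itself drawn from the gradient bound, through a rate of
  mollification that is uniform along the sequence.\<close>

lemma Ck_on_Suc_imp: "Ck_on (Suc k) f S \<Longrightarrow> Ck_on k f S"
proof (induction k arbitrary: f)
  case 0
  then have "continuous (at x) f" if "x \<in> S" for x
    using that differentiable_imp_continuous_within by auto
  then show ?case
    by (simp add: continuous_at_imp_continuous_on)
next
  case (Suc k)
  then show ?case by auto
qed

lemma smooth_onD:
  assumes "smooth_on UNIV f"
  shows smooth_differentiable: "f differentiable (at x)"
    and smooth_derivative: "smooth_on UNIV (\<lambda>x. frechet_derivative f (at x) v)"
    and smooth_continuous: "continuous_on UNIV f"
proof -
  have 1: "Ck_on (Suc k) f UNIV" for k using assms by (auto simp: smooth_on_def)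
  show "f differentiable (at x)" using 1[of 0] by auto
  show "smooth_on UNIV (\<lambda>x. frechet_derivative f (at x) v)"
    unfolding smooth_on_def using 1 by auto
  show "continuous_on UNIV f" using assms unfolding smooth_on_def using Ck_on.simps(1) by blast
qed

lemma smooth_has_derivative:
  "smooth_on UNIV f \<Longrightarrow> (f has_derivative frechet_derivative f (at x)) (at x)"
  using smooth_differentiable frechet_derivative_works by blast

lemma smooth_has_real_derivative:
  fixes f :: "real \<Rightarrow> real"
  assumes "smooth_on UNIV f"
  shows "(f has_real_derivative frechet_derivative f (at x) 1) (at x)"
proof -
  have d: "(f has_derivative frechet_derivative f (at x)) (at x)" by (rule smooth_has_derivative[OF assms])
  have "frechet_derivative f (at x) v = frechet_derivative f (at x) 1 * v" for v
    using linear_scale[OF has_derivative_linear[OF d], of v 1] by simp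
  then have "frechet_derivative f (at x) = (*) (frechet_derivative f (at x) 1)" by blast
  with d show ?thesis unfolding has_field_derivative_def by simp
qed

lemma frechet_derivative_eq:
  "(f has_derivative f') (at x) \<Longrightarrow> frechet_derivative f (at x) = f'"
  using frechet_derivative_at by metis

lemma Ck_on_add:
  "Ck_on k f UNIV \<Longrightarrow> Ck_on k g UNIV \<Longrightarrow> Ck_on k (\<lambda>x. f x + g x) UNIV"
proof (induction k arbitrary: f g)
  case 0
  then show ?case by (auto intro: continuous_intros)
next
  case (Suc k)
  have "frechet_derivative (\<lambda>x. f x + g x) (at x) v
      = frechet_derivative f (at x) v + frechet_derivative g (at x) v" for x v
    using Suc.prems by (subst frechet_derivative_eq[where f="\<lambda>x. f x + g x"])
      (auto intro!: has_derivative_add simp flip: frechet_derivative_works)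
  with Suc show ?case by (auto intro!: derivative_intros)
qed

lemma Ck_on_mult:
  fixes f g :: "'a::euclidean_space \<Rightarrow> real"
  shows "Ck_on k f UNIV \<Longrightarrow> Ck_on k g UNIV \<Longrightarrow> Ck_on k (\<lambda>x. f x * g x) UNIV"
proof (induction k arbitrary: f g)
  case 0
  then show ?case by (auto intro: continuous_intros)
next
  case (Suc k)
  have "frechet_derivative (\<lambda>x. f x * g x) (at x) v
      = f x * frechet_derivative g (at x) v + frechet_derivative f (at x) v * g x" for x v
    using Suc.prems by (subst frechet_derivative_eq[where f="\<lambda>x. f x * g x"])
      (auto intro!: has_derivative_mult simp flip: frechet_derivative_works)
  moreover have "Ck_on k f UNIV" "Ck_on k g UNIV" using Suc.prems Ck_on_Suc_imp by blast+
  ultimately show ?case using Suc by (auto intro!: Ck_on_add derivative_intros)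
qed

lemma Ck_on_const: "Ck_on k (\<lambda>x. c) UNIV"
  by (induction k arbitrary: c) (auto simp: frechet_derivative_const)

lemma Ck_on_bounded_linear: "bounded_linear f \<Longrightarrow> Ck_on k f UNIV"
proof (cases k)
  case (Suc m)
  assume b: "bounded_linear f"
  have "frechet_derivative f (at x) = f" for x
    by (rule frechet_derivative_eq) (rule bounded_linear_imp_has_derivative[OF b])
  then show ?thesis
    using Suc b by (auto simp: Ck_on_const intro: bounded_linear_imp_differentiable)
qed (simp add: linear_continuous_on)

text \<open>The derivative of a composition again contains a composition, with a derivative of
  \<open>f\<close> as the outer function. The outer function is therefore assumed smooth, so that no
  order is lost on its side, and both functions are generalised in the induction.\<close>

lemma Ck_on_compose:
  fixes f :: "real \<Rightarrow> real" and g :: "'a::euclidean_space \<Rightarrow> real"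
  shows "smooth_on UNIV f \<Longrightarrow> Ck_on k g UNIV \<Longrightarrow> Ck_on k (\<lambda>x. f (g x)) UNIV"
proof (induction k arbitrary: f g)
  case 0
  then show ?case
    using continuous_on_compose2[OF smooth_continuous[OF 0(1)], of UNIV g] by simp
next
  case (Suc k)
  have "frechet_derivative (\<lambda>x. f (g x)) (at x) v
      = frechet_derivative f (at (g x)) 1 * frechet_derivative g (at x) v" for x v
  proof -
    have "(g has_derivative frechet_derivative g (at x)) (at x)"
      using Suc.prems by (simp flip: frechet_derivative_works)
    from DERIV_compose_FDERIV[OF smooth_has_real_derivative[OF Suc.prems(1)] this]
    show ?thesis by (simp add: frechet_derivative_eq mult.commute)
  qed
  moreover have "(\<lambda>x. f (g x)) differentiable at x" for x
  proof -
    have "(g has_derivative frechet_derivative g (at x)) (at x)"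
      using Suc.prems by (simp flip: frechet_derivative_works)
    from DERIV_compose_FDERIV[OF smooth_has_real_derivative[OF Suc.prems(1)] this]
    show ?thesis unfolding differentiable_def by blast
  qed
  moreover have "Ck_on k (\<lambda>x. frechet_derivative f (at (g x)) 1 * frechet_derivative g (at x) v) UNIV" for v
  proof (rule Ck_on_mult)
    show "Ck_on k (\<lambda>x. frechet_derivative f (at (g x)) 1) UNIV"
      by (rule Suc.IH[OF smooth_derivative[OF Suc.prems(1)] Ck_on_Suc_imp[OF Suc.prems(2)]])
    show "Ck_on k (\<lambda>x. frechet_derivative g (at x) v) UNIV" using Suc.prems(2) by simp
  qed
  ultimately show ?case by simp
qed

lemma smooth_add: "smooth_on UNIV f \<Longrightarrow> smooth_on UNIV g \<Longrightarrow> smooth_on UNIV (\<lambda>x. f x + g x)"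
  by (simp add: smooth_on_def Ck_on_add)

lemma smooth_mult:
  fixes f g :: "'a::euclidean_space \<Rightarrow> real"
  shows "smooth_on UNIV f \<Longrightarrow> smooth_on UNIV g \<Longrightarrow> smooth_on UNIV (\<lambda>x. f x * g x)"
  by (simp add: smooth_on_def Ck_on_mult)

lemma smooth_const: "smooth_on UNIV (\<lambda>x. c)"
  by (simp add: smooth_on_def Ck_on_const)

lemma smooth_bounded_linear: "bounded_linear f \<Longrightarrow> smooth_on UNIV f"
  by (simp add: smooth_on_def Ck_on_bounded_linear)

lemma smooth_compose:
  fixes f :: "real \<Rightarrow> real" and g :: "'a::euclidean_space \<Rightarrow> real"
  shows "smooth_on UNIV f \<Longrightarrow> smooth_on UNIV g \<Longrightarrow> smooth_on UNIV (\<lambda>x. f (g x))"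
  by (metis Ck_on_compose smooth_on_def)

lemma smooth_power:
  fixes f :: "'a::euclidean_space \<Rightarrow> real"
  shows "smooth_on UNIV f \<Longrightarrow> smooth_on UNIV (\<lambda>x. f x ^ k)"
  by (induction k) (auto intro: smooth_mult smooth_const)

text \<open>Kernels enter convolutions as functions of \<open>x - y\<close>; to serve as test
  functions in \<open>y\<close> for weak derivatives they must be smooth in that variable. Each
  differentiation only changes the sign.\<close>

lemma smooth_affine_arg:
  fixes f :: "'a::euclidean_space \<Rightarrow> real"
  assumes "smooth_on UNIV f"
  shows "smooth_on UNIV (\<lambda>y. f (x - y))"
proof -
  have *: "((\<lambda>y. f (x - y)) has_derivative (\<lambda>v. - frechet_derivative f (at (x - y)) v)) (at y)"
    if "f differentiable (at (x - y))" for f :: "'a \<Rightarrow> real" and y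
  proof -
    have "((\<lambda>y. x - y) has_derivative (\<lambda>v. - v)) (at y)" by (auto intro!: derivative_eq_intros)
    from has_derivative_compose[OF this, of f] that
    have "((\<lambda>y. f (x - y)) has_derivative (\<lambda>v. frechet_derivative f (at (x - y)) (- v))) (at y)"
      using frechet_derivative_works by blast
    moreover have "linear (frechet_derivative f (at (x - y)))"
      using that linear_frechet_derivative by blast
    ultimately show ?thesis by (simp add: linear_neg)
  qed
  have "Ck_on k f UNIV \<Longrightarrow> Ck_on k (\<lambda>y. f (x - y)) UNIV" for k
  proof (induction k arbitrary: f)
    case 0
    then show ?case by (auto intro!: continuous_on_compose2[of UNIV f] continuous_intros)
  next
    case (Suc k)
    have "frechet_derivative (\<lambda>y. f (x - y)) (at y) v = (-1) * frechet_derivative f (at (x - y)) v" for y v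
      using Suc.prems by (subst frechet_derivative_eq[OF *]) auto
    then have d: "(\<lambda>y. frechet_derivative (\<lambda>y. f (x - y)) (at y) v)
        = (\<lambda>y. (-1) * frechet_derivative f (at (x - y)) v)" for v by blast
    moreover have "Ck_on k (\<lambda>y. (-1) * frechet_derivative f (at (x - y)) v) UNIV" for v
      using Suc.IH[of "\<lambda>y. frechet_derivative f (at y) v"] Suc.prems by (intro Ck_on_mult Ck_on_const) simp
    moreover have "(\<lambda>y. f (x - y)) differentiable at y" for y
    proof -
      have "f differentiable (at (x - y))" using Suc.prems by simp
      from *[OF this] show ?thesis unfolding differentiable_def by blast
    qed
    ultimately show ?case unfolding Ck_on.simps d by blast
  qed
  then show ?thesis using assms by (auto simp: smooth_on_def)
qed

section \<open>A smooth radial bump function\<close>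

text \<open>For \<open>k = 0\<close> this is the standard function that is flat at 0. The powers of
  \<open>inverse t\<close> make the family closed under differentiation up to linear combinations,
  so that all members are smooth by one induction.\<close>

definition exp_inverse_power :: "nat \<Rightarrow> real \<Rightarrow> real" where
  "exp_inverse_power k t = (if t > 0 then exp (- inverse t) * inverse t ^ k else 0)"

text \<open>With \<open>x = inverse t\<close> the limit from the right becomes that of
  \<open>x ^ k / exp x\<close> at infinity; on the left the function is constantly 0.\<close>

lemma exp_inverse_power_tendsto_0: "(exp_inverse_power k \<longlongrightarrow> 0) (at 0)"
proof -
  have "((\<lambda>x::real. x ^ k / exp x) \<longlongrightarrow> 0) at_top" by (rule tendsto_power_div_exp_0)
  then have "((\<lambda>x::real. inverse x ^ k / exp (inverse x)) \<longlongrightarrow> 0) (at_right 0)"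
    by (rule filterlim_compose[OF _ filterlim_inverse_at_top_right])
  moreover have "eventually (\<lambda>x::real. inverse x ^ k / exp (inverse x) = exp_inverse_power k x) (at_right 0)"
    by (auto simp: exp_inverse_power_def eventually_at_right_less exp_minus field_simps
        intro!: eventually_mono[OF eventually_at_right_less])
  ultimately have "(exp_inverse_power k \<longlongrightarrow> 0) (at_right 0)"
    by (rule Lim_transform_eventually)
  moreover have "(exp_inverse_power k \<longlongrightarrow> 0) (at_left 0)"
    by (rule tendsto_eventually) (auto simp: exp_inverse_power_def eventually_at_left_real
        intro!: eventually_mono[OF eventually_at_left_real[of "-1" 0]])
  ultimately show ?thesis by (simp add: filterlim_split_at)
qed

lemma exp_inverse_power_has_derivative:
  "(exp_inverse_power k has_real_derivative
      (exp_inverse_power (k + 2) t - real k * exp_inverse_power (k + 1) t)) (at t)"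
proof (cases t "0::real" rule: linorder_cases)
  case less
  have "((\<lambda>t. 0) has_real_derivative 0) (at t)" by simp
  then have "(exp_inverse_power k has_real_derivative 0) (at t)"
    by (rule has_field_derivative_transform_within_open[where S="{..<0}"])
      (use less in \<open>auto simp: exp_inverse_power_def\<close>)
  then show ?thesis using less by (simp add: exp_inverse_power_def)
next
  case equal
  have "((\<lambda>h. (exp_inverse_power k (0 + h) - exp_inverse_power k 0) / h) \<longlongrightarrow> 0) (at 0)"
  proof -
    \<comment> \<open>Dividing by \<open>h\<close> raises the power of \<open>inverse h\<close> by
      one, so the difference quotient at 0 is the next member of the family.\<close>
    have "(exp_inverse_power k (0 + h) - exp_inverse_power k 0) / h = exp_inverse_power (k + 1) h" for h
      by (auto simp: exp_inverse_power_def field_simps)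
    then show ?thesis using exp_inverse_power_tendsto_0[of "k + 1"] by presburger
  qed
  then show ?thesis using equal by (simp add: DERIV_def exp_inverse_power_def)
next
  case greater
  have "((\<lambda>t. exp (- inverse t) * inverse t ^ k) has_real_derivative
      exp (- inverse t) * (inverse t ^ 2) * inverse t ^ k
      + exp (- inverse t) * (real k * (inverse t ^ (k - 1) * (- (inverse t ^ 2))))) (at t)"
    using greater
    by (auto intro!: derivative_eq_intros simp: power2_eq_square)
  also have "exp (- inverse t) * (inverse t ^ 2) * inverse t ^ k
      + exp (- inverse t) * (real k * (inverse t ^ (k - 1) * (- (inverse t ^ 2))))
      = exp_inverse_power (k + 2) t - real k * exp_inverse_power (k + 1) t"
    using greater by (cases k) (simp_all add: exp_inverse_power_def power_add power2_eq_square)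
  finally have "((\<lambda>t. exp (- inverse t) * inverse t ^ k) has_real_derivative
      (exp_inverse_power (k + 2) t - real k * exp_inverse_power (k + 1) t)) (at t)" .
  then show ?thesis
    by (rule has_field_derivative_transform_within_open[where S="{0<..}"])
      (use greater in \<open>auto simp: exp_inverse_power_def\<close>)
qed

lemma smooth_exp_inverse_power: "smooth_on UNIV (exp_inverse_power k)"
proof -
  have "Ck_on m (exp_inverse_power k) UNIV" for m
  proof (induction m arbitrary: k)
    case 0
    then show ?case
      by (auto intro!: continuous_at_imp_continuous_on DERIV_isCont exp_inverse_power_has_derivative)
  next
    case (Suc m)
    have "frechet_derivative (exp_inverse_power k) (at x) v =
       (exp_inverse_power (k + 2) x + (- real k) * exp_inverse_power (k + 1) x) * v" for x v
      using exp_inverse_power_has_derivative[of k x] unfolding has_field_derivative_def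
      by (subst frechet_derivative_eq) auto
    moreover have "exp_inverse_power k differentiable at x" for x
      using exp_inverse_power_has_derivative real_differentiable_def by blast
    moreover have "Ck_on m (\<lambda>x. (exp_inverse_power (k + 2) x + (- real k) * exp_inverse_power (k + 1) x) * v) UNIV" for v
      by (intro Ck_on_mult Ck_on_const Ck_on_add Suc)
    ultimately show ?case by (simp only: Ck_on.simps) simp
  qed
  then show ?thesis by (simp add: smooth_on_def)
qed

text \<open>The squared norm is a polynomial, which avoids the corner of the norm at the origin.
  Dependence on \<open>x \<bullet> x\<close> alone makes the function radial, and this later makes
  mollification compatible with rotations.\<close>

definition bump :: "real \<Rightarrow> 'a::euclidean_space \<Rightarrow> real" where
  "bump \<epsilon> x = exp_inverse_power 0 (\<epsilon>\<^sup>2 - x \<bullet> x)"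

lemma smooth_bump: "smooth_on UNIV (bump \<epsilon> :: 'a::euclidean_space \<Rightarrow> real)"
proof -
  have *: "(x::'a) \<bullet> x = (\<Sum>b\<in>Basis. (x \<bullet> b) * (x \<bullet> b))" for x by (rule euclidean_inner)
  have "smooth_on UNIV (\<lambda>x::'a. \<Sum>b\<in>B. (x \<bullet> b) * (x \<bullet> b))" if "finite B" for B
    using that by induction (simp_all add: smooth_const smooth_add smooth_mult
        smooth_bounded_linear[OF bounded_linear_inner_left])
  then have "smooth_on UNIV (\<lambda>x::'a. \<epsilon>\<^sup>2 + (-1) * (x \<bullet> x))"
    unfolding * by (intro smooth_add smooth_const smooth_mult) auto
  then have "smooth_on UNIV (\<lambda>x::'a. exp_inverse_power 0 (\<epsilon>\<^sup>2 + (-1) * (x \<bullet> x)))"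
    by (rule smooth_compose[OF smooth_exp_inverse_power])
  then show ?thesis by (simp add: bump_def[abs_def])
qed

lemma bump_nonneg: "bump \<epsilon> x \<ge> 0"
  by (simp add: bump_def exp_inverse_power_def)

lemma bump_eq_0: "norm x \<ge> \<epsilon> \<Longrightarrow> \<epsilon> > 0 \<Longrightarrow> bump \<epsilon> x = 0"
  using power_mono[of \<epsilon> "norm x" 2]
  by (auto simp: bump_def exp_inverse_power_def power2_norm_eq_inner)

lemma bump_pos: "norm x < \<epsilon> \<Longrightarrow> bump \<epsilon> x > 0"
  using power_strict_mono[of "norm x" \<epsilon> 2]
  by (auto simp: bump_def exp_inverse_power_def power2_norm_eq_inner)

section \<open>Calculus with test functions\<close>

lemma test_functionsI:
  assumes "smooth_on UNIV f" "\<And>x. x \<notin> C \<Longrightarrow> f x = 0" "compact C" "C \<subseteq> U"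
  shows "f \<in> test_functions U"
proof -
  have "closure {x. f x \<noteq> 0} \<subseteq> C"
    using assms(2,3) by (intro closure_minimal) (auto intro: compact_imp_closed)
  moreover from this have "compact (closure {x. f x \<noteq> 0})"
    using assms(3) compact_Int_closed[OF assms(3) closed_closure, of "{x. f x \<noteq> 0}"]
    by (simp only: Int_absorb1)
  ultimately show ?thesis using assms unfolding test_functions_def by auto
qed

lemma test_functions_support:
  assumes "f \<in> test_functions U"
  obtains C where "compact C" "C \<subseteq> U" "\<And>x. x \<notin> C \<Longrightarrow> f x = 0"
  using assms closure_subset[of "{x. f x \<noteq> 0}"] unfolding test_functions_def by fast

lemma test_functions_smooth: "f \<in> test_functions U \<Longrightarrow> smooth_on UNIV f"
  by (simp add: test_functions_def)

lemma test_functions_mult: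
  fixes f g :: "'a::euclidean_space \<Rightarrow> real"
  assumes "f \<in> test_functions U" "smooth_on UNIV g"
  shows "(\<lambda>x. f x * g x) \<in> test_functions U"
proof -
  obtain C where "compact C" "C \<subseteq> U" "\<And>x. x \<notin> C \<Longrightarrow> f x = 0"
    by (rule test_functions_support[OF assms(1)], rule that)
  then show ?thesis
    by (intro test_functionsI[where C=C] smooth_mult test_functions_smooth[OF assms(1)] assms(2)) auto
qed

lemma test_functions_derivative:
  assumes "f \<in> test_functions U"
  shows "(\<lambda>x. frechet_derivative f (at x) v) \<in> test_functions U"
proof -
  obtain C where C: "compact C" "C \<subseteq> U" "\<And>x. x \<notin> C \<Longrightarrow> f x = 0"
    by (rule test_functions_support[OF assms(1)], rule that)
  have "frechet_derivative f (at x) v = 0" if "x \<notin> C" for x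
  proof -
    have "((\<lambda>x. 0) has_derivative (\<lambda>v. 0)) (at x)" by simp
    then have "(f has_derivative (\<lambda>v. 0)) (at x)"
      by (rule has_derivative_transform_within_open[where s="- C"])
        (use C that compact_imp_closed in auto)
    then show ?thesis by (simp add: frechet_derivative_eq)
  qed
  then show ?thesis
    by (intro test_functionsI[where C=C] smooth_derivative test_functions_smooth[OF assms(1)] C) auto
qed

lemma continuous_compact_support_bounded:
  fixes f :: "'a::euclidean_space \<Rightarrow> real"
  assumes "continuous_on UNIV f" "compact C" "\<And>x. x \<notin> C \<Longrightarrow> f x = 0"
  obtains B :: real where "B > 0" "\<And>x. \<bar>f x\<bar> \<le> B"
proof -
  have "compact (f ` C)" using assms by (intro compact_continuous_image continuous_on_subset[OF assms(1)]) auto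
  then obtain B where B: "B > 0" "\<And>x. x \<in> C \<Longrightarrow> norm (f x) \<le> B"
    by (metis compact_imp_bounded bounded_pos imageI)
  then have "\<bar>f x\<bar> \<le> B" for x using assms(3)[of x] by (cases "x \<in> C") auto
  with B show ?thesis using that by blast
qed

text \<open>The ball of radius \<open>r + 1\<close> leaves a margin of 1 around the support: two
  points at distance below 1 either both lie in the ball, where compactness gives uniform
  continuity, or both miss the support.\<close>

lemma continuous_compact_support_uniform:
  fixes f :: "'a::euclidean_space \<Rightarrow> real"
  assumes "continuous_on UNIV f" "compact C" "\<And>x. x \<notin> C \<Longrightarrow> f x = 0" "e > 0"
  obtains d :: real where "d > 0" "\<And>x y. norm (x - y) < d \<Longrightarrow> \<bar>f x - f y\<bar> < e"
proof -
  obtain r where r: "\<And>x. x \<in> C \<Longrightarrow> norm x \<le> r"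
    using assms(2) compact_imp_bounded bounded_iff by metis
  have "uniformly_continuous_on (cball 0 (r + 1)) f"
    by (intro compact_uniformly_continuous continuous_on_subset[OF assms(1)]) auto
  then obtain d where d: "d > 0"
    "\<And>x y. x \<in> cball 0 (r+1) \<Longrightarrow> y \<in> cball 0 (r+1) \<Longrightarrow> dist y x < d \<Longrightarrow> dist (f y) (f x) < e"
    unfolding uniformly_continuous_on_def using \<open>e > 0\<close> by metis
  have "\<bar>f x - f y\<bar> < e" if "norm (x - y) < min d 1" for x y
  proof (cases "norm x \<le> r + 1 \<and> norm y \<le> r + 1")
    case True
    then show ?thesis using d(2)[of y x] that by (auto simp: dist_norm)
  next
    case False
    then have "norm x > r" "norm y > r"
      using that norm_triangle_ineq2[of x y] norm_triangle_ineq2[of y x] by (auto simp: norm_minus_commute)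
    then have "x \<notin> C" "y \<notin> C" using r by force+
    then show ?thesis using assms by simp
  qed
  then show ?thesis using that[of "min d 1"] d by auto
qed

lemma test_functions_bounded:
  fixes f :: "'a::euclidean_space \<Rightarrow> real"
  assumes "f \<in> test_functions U"
  obtains B :: real where "B > 0" "\<And>x. \<bar>f x\<bar> \<le> B"
proof -
  obtain C where C: "compact C" "C \<subseteq> U" "\<And>x. x \<notin> C \<Longrightarrow> f x = 0"
    by (rule test_functions_support[OF assms], rule that)
  show ?thesis
    using continuous_compact_support_bounded[OF smooth_continuous[OF test_functions_smooth[OF assms]] C(1,3)]
      that by blast
qed

lemma continuous_borel_lebesgue:
  fixes f :: "'a::euclidean_space \<Rightarrow> real"
  shows "continuous_on UNIV f \<Longrightarrow> f \<in> borel_measurable lebesgue"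
  using borel_measurable_continuous_onI[of f] by (simp add: measurable_completion)

lemma smooth_borel_lebesgue:
  fixes f :: "'a::euclidean_space \<Rightarrow> real"
  shows "smooth_on UNIV f \<Longrightarrow> f \<in> borel_measurable lebesgue"
  using continuous_borel_lebesgue smooth_continuous by blast

lemma integrable_mult_bounded:
  fixes f g :: "'a \<Rightarrow> real"
  assumes "integrable M f" "g \<in> borel_measurable M" "AE x in M. \<bar>g x\<bar> \<le> B"
  shows "integrable M (\<lambda>x. f x * g x)"
proof (rule Bochner_Integration.integrable_bound[where f="\<lambda>x. B * f x"])
  show "AE x in M. norm (f x * g x) \<le> norm (B * f x)"
    using assms(3)
  proof eventually_elim
    case (elim x)
    have "\<bar>f x\<bar> * \<bar>g x\<bar> \<le> \<bar>f x\<bar> * \<bar>B\<bar>" using elim by (intro mult_left_mono) auto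
    then show ?case by (simp add: abs_mult mult.commute)
  qed
qed (use assms in auto)

section \<open>Mollification\<close>

definition convolution :: "('a::euclidean_space \<Rightarrow> real) \<Rightarrow> ('a \<Rightarrow> real) \<Rightarrow> 'a \<Rightarrow> real" where
  "convolution f \<phi> x = (\<integral>y. f y * \<phi> (x - y) \<partial>lebesgue)"

lemma convolution_integrable:
  fixes f \<phi> :: "'a::euclidean_space \<Rightarrow> real"
  assumes "integrable lebesgue f" "continuous_on UNIV \<phi>" "\<And>x. \<bar>\<phi> x\<bar> \<le> B"
  shows "integrable lebesgue (\<lambda>y. f y * \<phi> (x - y))"
  using assms by (intro integrable_mult_bounded[where B=B] continuous_borel_lebesgue
      continuous_on_compose2[OF assms(2)] continuous_intros) auto

lemma convolution_integrable_test:
  fixes f \<phi> :: "'a::euclidean_space \<Rightarrow> real"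
  assumes "integrable lebesgue f" "\<phi> \<in> test_functions U"
  shows "integrable lebesgue (\<lambda>y. f y * \<phi> (x - y))"
proof -
  obtain B where "B > 0" "\<And>x. \<bar>\<phi> x\<bar> \<le> B" by (rule test_functions_bounded[OF assms(2)], rule that)
  then show ?thesis
    by (intro convolution_integrable[OF assms(1)] smooth_continuous[OF test_functions_smooth[OF assms(2)]])
qed

lemma frechet_derivative_basis_sum:
  fixes f :: "'a::euclidean_space \<Rightarrow> real"
  assumes "f differentiable (at x)"
  shows "frechet_derivative f (at x) v = (\<Sum>b\<in>Basis. (v \<bullet> b) * frechet_derivative f (at x) b)"
proof -
  have l: "linear (frechet_derivative f (at x))" using assms by (rule linear_frechet_derivative)
  have "frechet_derivative f (at x) v = frechet_derivative f (at x) (\<Sum>b\<in>Basis. (v \<bullet> b) *\<^sub>R b)"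
    by (simp add: euclidean_representation)
  also have "\<dots> = (\<Sum>b\<in>Basis. (v \<bullet> b) *\<^sub>R frechet_derivative f (at x) b)"
    by (simp add: linear_sum[OF l] linear_scale[OF l])
  finally show ?thesis by simp
qed

text \<open>The derivatives of a test function are uniformly continuous, so the remainder in the
  first-order expansion is small uniformly in the base point; this replaces dominated convergence
  when differentiating under the integral.\<close>

lemma test_function_uniform_linearization:
  fixes \<phi> :: "'a::euclidean_space \<Rightarrow> real"
  assumes \<phi>: "\<phi> \<in> test_functions U" and "e > 0"
  obtains d :: real where "d > 0"
    "\<And>z h. norm h < d \<Longrightarrow> \<bar>\<phi> (z + h) - \<phi> z - frechet_derivative \<phi> (at z) h\<bar> \<le> e * norm h"
proof -
  let ?D = "\<lambda>z. frechet_derivative \<phi> (at z)"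
  \<comment> \<open>A directional derivative is a sum over the basis with coefficients at most
    \<open>norm v\<close>, so an error \<open>e'\<close> in each partial derivative adds up to
    \<open>e * norm v\<close>.\<close>
  define e' where "e' = e / DIM('a)"
  have e': "e' > 0" using \<open>e > 0\<close> by (simp add: e'_def)
  have "\<exists>d>0. \<forall>x y. norm (x - y) < d \<longrightarrow> \<bar>?D x b - ?D y b\<bar> < e'" for b
  proof -
    have t: "(\<lambda>z. ?D z b) \<in> test_functions U" by (rule test_functions_derivative[OF \<phi>])
    obtain C where C: "compact C" "C \<subseteq> U" "\<And>x. x \<notin> C \<Longrightarrow> ?D x b = 0"
      by (rule test_functions_support[OF t], rule that)
    obtain d where "d > 0" "\<And>x y. norm (x - y) < d \<Longrightarrow> \<bar>?D x b - ?D y b\<bar> < e'"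
      using continuous_compact_support_uniform[where f="\<lambda>z. ?D z b",
          OF smooth_continuous[OF test_functions_smooth[OF t]] C(1) _ e'] C(3) by metis
    then show ?thesis by (intro exI[of _ d]) simp
  qed
  then obtain dd where dd: "\<And>b. dd b > 0" "\<And>b x y. norm (x - y) < dd b \<Longrightarrow> \<bar>?D x b - ?D y b\<bar> < e'"
    by metis
  define d where "d = Min (dd ` (Basis :: 'a set))"
  have d: "d > 0" "\<And>b. b \<in> Basis \<Longrightarrow> d \<le> dd b" unfolding d_def using dd by auto
  have diff: "\<phi> differentiable (at z)" for z by (rule smooth_differentiable[OF test_functions_smooth[OF \<phi>]])
  have bd: "\<bar>?D x v - ?D y v\<bar> \<le> e * norm v" if "norm (x - y) < d" for x y v
  proof -
    have "\<bar>?D x v - ?D y v\<bar> = \<bar>\<Sum>b\<in>Basis. (v \<bullet> b) * (?D x b - ?D y b)\<bar>"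
      using frechet_derivative_basis_sum[OF diff, of x v] frechet_derivative_basis_sum[OF diff, of y v]
      by (simp add: sum_subtractf right_diff_distrib)
    also have "\<dots> \<le> (\<Sum>b\<in>Basis. \<bar>v \<bullet> b\<bar> * \<bar>?D x b - ?D y b\<bar>)"
      by (rule order_trans[OF sum_abs]) (simp add: abs_mult)
    also have "\<dots> \<le> (\<Sum>b\<in>(Basis::'a set). norm v * e')"
    proof (rule sum_mono, rule mult_mono)
      fix b :: 'a assume b: "b \<in> Basis"
      show "\<bar>v \<bullet> b\<bar> \<le> norm v" using b by (rule Basis_le_norm)
      show "\<bar>?D x b - ?D y b\<bar> \<le> e'" using dd(2)[of x y b] d(2)[OF b] that by linarith
    qed auto
    also have "\<dots> = e * norm v" by (simp add: e'_def)
    finally show ?thesis .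
  qed
  have "\<bar>\<phi> (z + h) - \<phi> z - ?D z h\<bar> \<le> e * norm h" if "norm h < d" for z h
  proof -
    have "norm (\<phi> (z + h) - \<phi> z - ?D z (z + h - z)) \<le> norm (z + h - z) * e"
    proof (rule differentiable_bound_linearization[where S="ball z d"])
      show "z + t *\<^sub>R (z + h - z) \<in> ball z d" if "t \<in> {0..1}" for t
      proof -
        have "norm (t *\<^sub>R h) \<le> norm h" using that by (auto simp: mult_left_le_one_le)
        then show ?thesis using \<open>norm h < d\<close> by (simp add: dist_norm)
      qed
      show "(\<phi> has_derivative ?D x) (at x within ball z d)" for x
        using smooth_has_derivative[OF test_functions_smooth[OF \<phi>]] has_derivative_at_withinI by blast
      show "onorm (?D x - ?D z) \<le> e" if "x \<in> ball z d" for x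
      proof (rule onorm_bound)
        show "norm ((?D x - ?D z) v) \<le> e * norm v" for v
          using bd[of x z v] that by (auto simp: dist_norm norm_minus_commute)
      qed (use \<open>e > 0\<close> in auto)
    qed (use d in auto)
    then show ?thesis by (simp add: mult.commute)
  qed
  with d that show ?thesis by blast
qed

text \<open>The remainder at \<open>x\<close> is the integral of \<open>f\<close> against the
  linearization error of \<phi> at \<open>x - t\<close>. That error is at most
  \<open>e' * norm (y - x)\<close> for all \<open>t\<close> at once, so integrability of
  \<open>f\<close> bounds the remainder.\<close>

lemma convolution_has_derivative:
  assumes f: "integrable lebesgue f" and \<phi>: "\<phi> \<in> test_functions U"
  shows "(convolution f \<phi> has_derivative
      (\<lambda>v. convolution f (\<lambda>z. frechet_derivative \<phi> (at z) v) x)) (at x)"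
proof -
  let ?D = "\<lambda>z. frechet_derivative \<phi> (at z)"
  have diff: "\<phi> differentiable (at z)" for z by (rule smooth_differentiable[OF test_functions_smooth[OF \<phi>]])
  have lin: "linear (?D z)" for z by (rule linear_frechet_derivative[OF diff])
  have int: "integrable lebesgue (\<lambda>y. f y * ?D (x - y) v)" for v x
    by (rule convolution_integrable_test[OF f test_functions_derivative[OF \<phi>]])
  have int0: "integrable lebesgue (\<lambda>y. f y * \<phi> (x - y))" for x
    by (rule convolution_integrable_test[OF f \<phi>])
  have "linear (\<lambda>v. convolution f (\<lambda>z. ?D z v) x)"
    by (rule linearI) (simp_all add: convolution_def linear_add[OF lin] linear_scale[OF lin]
        distrib_left int mult.left_commute)
  then have bl: "bounded_linear (\<lambda>v. convolution f (\<lambda>z. ?D z v) x)" by (simp add: linear_conv_bounded_linear)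
  show ?thesis unfolding has_derivative_at_alt
  proof (intro conjI bl allI impI)
    fix e :: real assume "e > 0"
    define I where "I = (\<integral>y. \<bar>f y\<bar> \<partial>lebesgue)"
    have I: "I \<ge> 0" unfolding I_def by simp
    \<comment> \<open>The added 1 covers the case \<open>I = 0\<close>.\<close>
    define e' where "e' = e / (I + 1)"
    have e': "e' > 0" "I * e' \<le> e" using I \<open>e > 0\<close> by (auto simp: e'_def field_simps)
    obtain d where d: "d > 0" "\<And>z h. norm h < d \<Longrightarrow> \<bar>\<phi> (z + h) - \<phi> z - ?D z h\<bar> \<le> e' * norm h"
      by (rule test_function_uniform_linearization[OF \<phi> e'(1)], rule that)
    have "norm (convolution f \<phi> y - convolution f \<phi> x - convolution f (\<lambda>z. ?D z (y - x)) x)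
         \<le> e * norm (y - x)" if "norm (y - x) < d" for y
    proof -
      let ?g = "\<lambda>t. f t * \<phi> (y - t) - f t * \<phi> (x - t) - f t * ?D (x - t) (y - x)"
      have "norm (convolution f \<phi> y - convolution f \<phi> x - convolution f (\<lambda>z. ?D z (y - x)) x)
          = norm (\<integral>t. ?g t \<partial>lebesgue)"
        by (simp add: convolution_def int int0)
      also have "\<dots> \<le> (\<integral>t. norm (?g t) \<partial>lebesgue)"
        by (rule integral_norm_bound)
      also have "\<dots> \<le> (\<integral>t. \<bar>f t\<bar> * (e' * norm (y - x)) \<partial>lebesgue)"
      proof (rule integral_mono)
        show "norm (?g t) \<le> \<bar>f t\<bar> * (e' * norm (y - x))" for t
        proof -
          have "?g t = f t * (\<phi> (x - t + (y - x)) - \<phi> (x - t) - ?D (x - t) (y - x))"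
            by (simp add: algebra_simps)
          then show ?thesis using d(2)[OF that, of "x - t"]
            by (simp add: abs_mult mult_left_mono)
        qed
      qed (use f int int0 in \<open>auto intro!: integrable_norm Bochner_Integration.integrable_diff integrable_abs\<close>)
      also have "\<dots> = I * e' * norm (y - x)" by (simp add: I_def)
      also have "\<dots> \<le> e * norm (y - x)" using e' by (intro mult_right_mono) auto
      finally show ?thesis .
    qed
    with d show "\<exists>d>0. \<forall>y. norm (y - x) < d \<longrightarrow> norm (convolution f \<phi> y - convolution f \<phi> x
        - convolution f (\<lambda>z. ?D z (y - x)) x) \<le> e * norm (y - x)" by blast
  qed
qed

lemma frechet_derivative_convolution:
  assumes "integrable lebesgue f" "\<phi> \<in> test_functions U"
  shows "frechet_derivative (convolution f \<phi>) (at x) v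
      = convolution f (\<lambda>z. frechet_derivative \<phi> (at z) v) x"
  using frechet_derivative_eq[OF convolution_has_derivative[OF assms]] by simp

text \<open>The derivative of a convolution is the convolution with a derivative of \<phi>, which is
  again a test function; this drives the induction.\<close>

lemma smooth_convolution:
  assumes f: "integrable lebesgue f" and \<phi>: "\<phi> \<in> test_functions U"
  shows "smooth_on UNIV (convolution f \<phi>)"
proof -
  have "Ck_on k (convolution f \<phi>) UNIV" for k
    using \<phi>
  proof (induction k arbitrary: \<phi>)
    case 0
    have "isCont (convolution f \<phi>) x" for x
      by (rule has_derivative_continuous[OF convolution_has_derivative[OF f 0]])
    then show ?case by (simp add: continuous_at_imp_continuous_on)
  next
    case (Suc k)
    have "convolution f \<phi> differentiable at x" for x
      using convolution_has_derivative[OF f Suc.prems] differentiable_def by blast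
    then show ?case
      using Suc.IH[OF test_functions_derivative[OF Suc.prems]]
      by (simp add: frechet_derivative_convolution[OF f Suc.prems])
  qed
  then show ?thesis by (simp add: smooth_on_def)
qed

definition mollifier :: "real \<Rightarrow> 'a::euclidean_space \<Rightarrow> real" where
  "mollifier \<epsilon> x = bump \<epsilon> x / (\<integral>y. bump \<epsilon> (y::'a) \<partial>lebesgue)"

context
  fixes \<epsilon> :: real assumes \<epsilon>: "\<epsilon> > 0"
begin

lemma bump_test: "(bump \<epsilon> :: 'a::euclidean_space \<Rightarrow> real) \<in> test_functions UNIV"
  by (rule test_functionsI[where C="cball 0 \<epsilon>"]) (auto simp: smooth_bump intro!: bump_eq_0 \<epsilon>)

lemma continuous_compact_support_integrable:
  fixes f :: "'a::euclidean_space \<Rightarrow> real"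
  assumes "continuous_on UNIV f" "compact C" "\<And>x. x \<notin> C \<Longrightarrow> f x = 0"
  shows "integrable lebesgue f"
proof -
  have "integrable lborel (\<lambda>x. indicator C x *\<^sub>R f x)"
    by (rule borel_integrable_compact[OF assms(2) continuous_on_subset[OF assms(1)]]) auto
  moreover have "(\<lambda>x. indicator C x *\<^sub>R f x) = f" using assms(3) by (auto simp: indicator_def fun_eq_iff)
  ultimately show ?thesis using integrable_completion[of f lborel] assms(1) borel_measurable_continuous_onI
    by auto
qed

lemma test_functions_integrable:
  fixes f :: "'a::euclidean_space \<Rightarrow> real"
  assumes "f \<in> test_functions U"
  shows "integrable lebesgue f"
proof -
  obtain C where C: "compact C" "C \<subseteq> U" "\<And>x. x \<notin> C \<Longrightarrow> f x = 0"
    by (rule test_functions_support[OF assms], rule that)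
  show ?thesis
    by (rule continuous_compact_support_integrable[OF smooth_continuous[OF test_functions_smooth[OF assms]] C(1,3)])
qed

text \<open>A nonnegative function with integral 0 vanishes almost everywhere, whereas the bump is
  positive on a ball, which has positive measure.\<close>

lemma bump_integral_pos: "(\<integral>y. bump \<epsilon> (y::'a::euclidean_space) \<partial>lebesgue) > 0"
proof -
  have i: "integrable lebesgue (bump \<epsilon> :: 'a \<Rightarrow> real)" by (rule test_functions_integrable[OF bump_test])
  have "(\<integral>y. bump \<epsilon> (y::'a) \<partial>lebesgue) \<noteq> 0"
  proof
    assume "(\<integral>y. bump \<epsilon> (y::'a) \<partial>lebesgue) = 0"
    then have "AE y::'a in lebesgue. bump \<epsilon> y = 0"
      using integral_nonneg_eq_0_iff_AE[OF i] bump_nonneg by blast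
    then have "AE y::'a in lborel. y \<notin> ball 0 \<epsilon>"
      unfolding AE_completion_iff by (auto elim!: eventually_mono dest: bump_pos)
    then have "emeasure lborel (ball (0::'a) \<epsilon>) = 0"
      by (subst (asm) AE_iff_measurable[where N="ball 0 \<epsilon>"]) auto
    then show False using open_not_negligible[of "ball (0::'a) \<epsilon>"] \<epsilon>
      by (simp add: negligible_iff_emeasure0)
  qed
  moreover have "(\<integral>y. bump \<epsilon> (y::'a) \<partial>lebesgue) \<ge> 0" by (simp add: bump_nonneg)
  ultimately show ?thesis by linarith
qed

lemma mollifier_nonneg: "mollifier \<epsilon> x \<ge> 0"
  using bump_integral_pos by (simp add: mollifier_def bump_nonneg less_imp_le)

lemma mollifier_eq_0: "norm x \<ge> \<epsilon> \<Longrightarrow> mollifier \<epsilon> x = 0"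
  by (simp add: mollifier_def bump_eq_0[OF _ \<epsilon>])

lemma mollifier_norm_eq: "norm (x::'a::euclidean_space) = norm (y::'a) \<Longrightarrow> mollifier \<epsilon> x = mollifier \<epsilon> y"
  unfolding mollifier_def bump_def by (simp add: norm_eq)

lemma smooth_mollifier: "smooth_on UNIV (mollifier \<epsilon> :: 'a::euclidean_space \<Rightarrow> real)"
  unfolding mollifier_def[abs_def] divide_inverse by (intro smooth_mult smooth_bump smooth_const)

lemma mollifier_test: "(mollifier \<epsilon> :: 'a::euclidean_space \<Rightarrow> real) \<in> test_functions UNIV"
  by (rule test_functionsI[where C="cball 0 \<epsilon>"]) (auto simp: smooth_mollifier intro!: mollifier_eq_0)

lemma mollifier_integral: "(\<integral>x. mollifier \<epsilon> (x::'a::euclidean_space) \<partial>lebesgue) = 1"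
  using bump_integral_pos[where 'a='a] by (simp add: mollifier_def)

lemma mollifier_shift_test:
  fixes x :: "'a::euclidean_space"
  assumes "cball x \<epsilon> \<subseteq> U"
  shows "(\<lambda>y. mollifier \<epsilon> (x - y)) \<in> test_functions U"
  using assms
  by (intro test_functionsI[where C="cball x \<epsilon>"] smooth_affine_arg smooth_mollifier)
    (auto intro!: mollifier_eq_0 simp: dist_norm)

end

section \<open>Invariance of Lebesgue measure and estimates for convolutions in L2\<close>

lemma lborel_distr_reflect: "distr lborel borel (\<lambda>z. x - z) = (lborel :: 'a::euclidean_space measure)"
proof -
  have "lborel = density (distr lborel borel (\<lambda>z::'a. x + (-1) *\<^sub>R z)) (\<lambda>_. \<bar>-1::real\<bar>^DIM('a))"
    by (rule lborel_affine) simp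
  then show ?thesis by (simp add: density_1)
qed

lemma lborel_distr_translate: "distr lborel borel (\<lambda>z. z - x) = (lborel :: 'a::euclidean_space measure)"
proof -
  have "(\<lambda>z. z - x) = (+) (- x)" by auto
  then show ?thesis using lborel_distr_plus[of "-x"] by simp
qed

lemma nn_integral_translate:
  fixes f :: "'a::euclidean_space \<Rightarrow> ennreal"
  assumes [measurable]: "f \<in> borel_measurable borel"
  shows "(\<integral>\<^sup>+z. f (z - x) \<partial>lborel) = (\<integral>\<^sup>+z. f z \<partial>lborel)"
  by (subst (2) lborel_distr_translate[of x, symmetric]) (simp add: nn_integral_distr)

lemma integral_reflect:
  fixes f :: "'a::euclidean_space \<Rightarrow> real"
  assumes [measurable]: "f \<in> borel_measurable borel"
  shows "(\<integral>z. f (x - z) \<partial>lborel) = (\<integral>z. f z \<partial>lborel)"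
  by (subst (2) lborel_distr_reflect[of x, symmetric]) (simp add: integral_distr)

text \<open>Cauchy-Schwarz after splitting the weight as \<open>sqrt (w x) * sqrt (w x)\<close>; the
  factor formed by the total mass is at most 1. If the product is not integrable, its Bochner
  integral is 0 by convention and the claim is trivial.\<close>

lemma jensen_square:
  fixes h w :: "'a \<Rightarrow> real"
  assumes [measurable]: "h \<in> borel_measurable M" "w \<in> borel_measurable M"
    and w: "\<And>x. w x \<ge> 0" "(\<integral>\<^sup>+x. w x \<partial>M) \<le> 1"
  shows "ennreal ((\<integral>x. h x * w x \<partial>M)\<^sup>2) \<le> (\<integral>\<^sup>+x. ennreal ((h x)\<^sup>2 * w x) \<partial>M)"
proof (cases "integrable M (\<lambda>x. h x * w x)")
  case True
  have "ennreal \<bar>\<integral>x. h x * w x \<partial>M\<bar> \<le> (\<integral>\<^sup>+x. ennreal \<bar>h x * w x\<bar> \<partial>M)"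
    using integral_norm_bound_ennreal[OF True] by simp
  also have "\<dots> = (\<integral>\<^sup>+x. ennreal (\<bar>h x\<bar> * sqrt (w x)) * ennreal (sqrt (w x)) \<partial>M)"
    by (intro nn_integral_cong) (simp add: abs_mult w mult.assoc flip: ennreal_mult)
  finally have "(ennreal \<bar>\<integral>x. h x * w x \<partial>M\<bar>)\<^sup>2 \<le> \<dots>\<^sup>2"
    by (rule power_mono) simp
  also have "\<dots> \<le> (\<integral>\<^sup>+x. (ennreal (\<bar>h x\<bar> * sqrt (w x)))\<^sup>2 \<partial>M) * (\<integral>\<^sup>+x. (ennreal (sqrt (w x)))\<^sup>2 \<partial>M)"
    by (rule Cauchy_Schwarz_nn_integral) auto
  also have "\<dots> = (\<integral>\<^sup>+x. ennreal ((h x)\<^sup>2 * w x) \<partial>M) * (\<integral>\<^sup>+x. w x \<partial>M)"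
    by (simp add: ennreal_power power_mult_distrib w)
  also have "\<dots> \<le> (\<integral>\<^sup>+x. ennreal ((h x)\<^sup>2 * w x) \<partial>M) * 1"
    by (intro mult_left_mono w) simp
  finally show ?thesis by (simp add: ennreal_power)
qed (simp add: not_integrable_integral_eq)

lemma lebesgue_borel_representative:
  fixes f :: "'a::euclidean_space \<Rightarrow> real"
  assumes "f \<in> borel_measurable lebesgue"
  obtains g where "g \<in> borel_measurable borel" "AE x in lebesgue. f x = g x"
  using completion_ex_borel_measurable_real[OF assms] AE_completion by auto

text \<open>Permits the replacement of \<open>f\<close> by a Borel representative, as the change of
  variables and Fubini on \<open>lborel\<close> require.\<close>

lemma convolution_cong_AE:
  assumes "AE x in lebesgue. f x = g x" "f \<in> borel_measurable lebesgue" "g \<in> borel_measurable lebesgue"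
    "continuous_on UNIV \<phi>"
  shows "convolution f \<phi> = convolution g \<phi>"
proof
  fix x
  have "(\<lambda>y. \<phi> (x - y)) \<in> borel_measurable lebesgue"
    by (intro continuous_borel_lebesgue continuous_on_compose2[OF assms(4)] continuous_intros) auto
  then show "convolution f \<phi> x = convolution g \<phi> x"
    unfolding convolution_def using assms by (intro integral_cong_AE) auto
qed

lemma convolution_reflect:
  fixes f \<phi> :: "'a::euclidean_space \<Rightarrow> real"
  assumes [measurable]: "f \<in> borel_measurable borel" "\<phi> \<in> borel_measurable borel"
  shows "convolution f \<phi> x = (\<integral>z. f (x - z) * \<phi> z \<partial>lborel)"
proof -
  have "convolution f \<phi> x = (\<integral>y. f y * \<phi> (x - y) \<partial>lborel)"
    unfolding convolution_def by (rule integral_completion) simp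
  also have "\<dots> = (\<integral>z. f (x - z) * \<phi> (x - (x - z)) \<partial>lborel)"
    by (rule integral_reflect[symmetric, of "\<lambda>y. f y * \<phi> (x - y)"]) simp
  finally show ?thesis by simp
qed

lemma convolution_borel:
  assumes "integrable lebesgue f" "\<phi> \<in> test_functions U"
  shows "convolution f \<phi> \<in> borel_measurable borel" "continuous_on UNIV (convolution f \<phi>)"
  using smooth_continuous[OF smooth_convolution[OF assms]] borel_measurable_continuous_onI by auto

lemma convolution_diff:
  assumes "integrable lebesgue f" "integrable lebesgue g" "\<phi> \<in> test_functions U"
  shows "convolution (\<lambda>x. f x - g x) \<phi> x = convolution f \<phi> x - convolution g \<phi> x"
  using convolution_integrable_test[OF assms(1,3)] convolution_integrable_test[OF assms(2,3)]
  by (simp add: convolution_def left_diff_distrib)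

text \<open>The square of the L2 norm, with values in \<open>ennreal\<close> so that estimates can
  be chained before integrability is known.\<close>

abbreviation sqnorm :: "('a::euclidean_space \<Rightarrow> real) \<Rightarrow> ennreal" where
  "sqnorm f \<equiv> (\<integral>\<^sup>+x. ennreal ((f x)\<^sup>2) \<partial>lebesgue)"

lemma mollifier_borel [measurable]: "\<epsilon> > 0 \<Longrightarrow> (mollifier \<epsilon> :: 'a::euclidean_space \<Rightarrow> real) \<in> borel_measurable borel"
  using smooth_continuous[OF smooth_mollifier] borel_measurable_continuous_onI by blast

lemma mollifier_nn_integral:
  "\<epsilon> > 0 \<Longrightarrow> (\<integral>\<^sup>+x. mollifier \<epsilon> (x::'a::euclidean_space) \<partial>lborel) = 1"
  using nn_integral_eq_integral[OF test_functions_integrable[OF _ mollifier_test], of \<epsilon> \<epsilon>, where 'a1='a]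
  by (simp add: mollifier_nonneg mollifier_integral nn_integral_completion)

lemma sqnorm_mono_AE: "AE x in lebesgue. \<bar>f x\<bar> \<le> \<bar>g x\<bar> \<Longrightarrow> sqnorm f \<le> sqnorm g"
  by (rule nn_integral_mono_AE) (auto simp: abs_le_square_iff elim!: eventually_mono intro!: ennreal_leI)

text \<open>Pointwise, the two sides differ by the sum of the squared pairwise differences. The
  fractions \<open>e / 6\<close>, \<open>e / 9\<close> and \<open>e / 15\<close> of later proofs
  compensate the factor 3.\<close>

lemma sqnorm_triangle3:
  assumes [measurable]: "f \<in> borel_measurable lebesgue" "g \<in> borel_measurable lebesgue" "h \<in> borel_measurable lebesgue"
  shows "sqnorm (\<lambda>x. f x + g x + h x) \<le> 3 * (sqnorm f + sqnorm g + sqnorm h)"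
proof -
  have "(a + b + c)\<^sup>2 \<le> 3 * (a\<^sup>2 + b\<^sup>2 + c\<^sup>2)" for a b c :: real
  proof -
    have "3 * (a\<^sup>2 + b\<^sup>2 + c\<^sup>2) - (a + b + c)\<^sup>2 = (a - b)\<^sup>2 + (b - c)\<^sup>2 + (a - c)\<^sup>2"
      by (simp add: power2_eq_square algebra_simps)
    then show ?thesis by (smt (verit) zero_le_power2)
  qed
  then have "sqnorm (\<lambda>x. f x + g x + h x) \<le> (\<integral>\<^sup>+x. ennreal (3 * ((f x)\<^sup>2 + (g x)\<^sup>2 + (h x)\<^sup>2)) \<partial>lebesgue)"
    by (intro nn_integral_mono ennreal_leI)
  also have "\<dots> = 3 * (sqnorm f + sqnorm g + sqnorm h)"
    by (simp add: ennreal_mult ennreal_plus nn_integral_cmult nn_integral_add)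
  finally show ?thesis .
qed

text \<open>The kernel is a probability density, so Jensen bounds the square of an average by the
  average of the squares; after exchanging the integrals every translate of \<open>g\<close> has the
  same L2 norm.\<close>

lemma sqnorm_convolution_le:
  fixes f :: "'a::euclidean_space \<Rightarrow> real"
  assumes f: "integrable lebesgue f" and \<epsilon>: "\<epsilon> > 0"
  shows "sqnorm (convolution f (mollifier \<epsilon>)) \<le> sqnorm f"
proof -
  let ?\<rho> = "mollifier \<epsilon> :: 'a \<Rightarrow> real"
  obtain g where g[measurable]: "g \<in> borel_measurable borel" and fg: "AE x in lebesgue. f x = g x"
    using lebesgue_borel_representative f by blast
  note [measurable] = mollifier_borel[OF \<epsilon>]
  have g': "g \<in> borel_measurable lebesgue" using g by (simp add: measurable_completion)
  have c: "convolution f ?\<rho> = convolution g ?\<rho>"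
    using f g' by (intro convolution_cong_AE[OF fg] smooth_continuous smooth_mollifier \<epsilon>) auto
  have m: "convolution g ?\<rho> \<in> borel_measurable borel"
    using convolution_borel[OF f mollifier_test[OF \<epsilon>]] c by simp
  have "sqnorm (convolution g ?\<rho>) = (\<integral>\<^sup>+x. ennreal ((convolution g ?\<rho> x)\<^sup>2) \<partial>lborel)"
    using m by (intro nn_integral_completion) 
  also have "\<dots> \<le> (\<integral>\<^sup>+x. (\<integral>\<^sup>+z. ennreal ((g (x - z))\<^sup>2 * ?\<rho> z) \<partial>lborel) \<partial>lborel)"
  proof (rule nn_integral_mono)
    fix x
    show "ennreal ((convolution g ?\<rho> x)\<^sup>2) \<le> (\<integral>\<^sup>+z. ennreal ((g (x - z))\<^sup>2 * ?\<rho> z) \<partial>lborel)"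
      unfolding convolution_reflect[OF g mollifier_borel[OF \<epsilon>]]
      by (rule jensen_square) (simp_all add: mollifier_nonneg[OF \<epsilon>] mollifier_nn_integral[OF \<epsilon>])
  qed
  also have "\<dots> = (\<integral>\<^sup>+z. (\<integral>\<^sup>+x. ennreal ((g (x - z))\<^sup>2 * ?\<rho> z) \<partial>lborel) \<partial>lborel)"
    by (rule lborel_pair.Fubini') measurable
  also have "\<dots> = (\<integral>\<^sup>+z. (\<integral>\<^sup>+x. ennreal ((g (x - z))\<^sup>2) \<partial>lborel) * ?\<rho> z \<partial>lborel)"
    by (intro nn_integral_cong) (simp add: ennreal_mult mollifier_nonneg[OF \<epsilon>] nn_integral_multc)
  also have "\<dots> = (\<integral>\<^sup>+z. (\<integral>\<^sup>+x. ennreal ((g x)\<^sup>2) \<partial>lborel) * ?\<rho> z \<partial>lborel)"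
    by (simp add: nn_integral_translate[of "\<lambda>x. ennreal ((g x)\<^sup>2)"])
  also have "\<dots> = (\<integral>\<^sup>+x. ennreal ((g x)\<^sup>2) \<partial>lborel)"
    by (simp add: nn_integral_cmult mollifier_nn_integral[OF \<epsilon>])
  also have "\<dots> = sqnorm f" using fg g
    by (subst nn_integral_completion[symmetric]) (auto intro!: nn_integral_cong_AE)
  finally show ?thesis unfolding c .
qed

lemma convolution_mollifier_bound:
  fixes f :: "'a::euclidean_space \<Rightarrow> real"
  assumes f: "integrable lebesgue f" and \<epsilon>: "\<epsilon> > 0" and M: "AE x in lebesgue. \<bar>f x\<bar> \<le> M"
  shows "\<bar>convolution f (mollifier \<epsilon>) x\<bar> \<le> M"
proof -
  let ?\<rho> = "mollifier \<epsilon> :: 'a \<Rightarrow> real"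
  have ri: "integrable lebesgue (\<lambda>y. ?\<rho> (x - y))"
    by (rule test_functions_integrable[OF \<epsilon> mollifier_shift_test[OF \<epsilon> subset_UNIV]])
  have "\<bar>convolution f ?\<rho> x\<bar> \<le> (\<integral>y. \<bar>f y * ?\<rho> (x - y)\<bar> \<partial>lebesgue)"
    unfolding convolution_def by simp
  also have "\<dots> \<le> (\<integral>y. M * ?\<rho> (x - y) \<partial>lebesgue)"
    using M by (intro integral_mono_AE integrable_abs convolution_integrable_test[OF f mollifier_test[OF \<epsilon>]])
      (auto simp: ri abs_mult mollifier_nonneg[OF \<epsilon>] elim!: eventually_mono intro!: mult_right_mono)
  also have "\<dots> = M * (\<integral>y. ?\<rho> (x - y) \<partial>lborel)"
    by (simp add: integral_completion[of "\<lambda>y. ?\<rho> (x - y)"] \<epsilon>)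
  also have "\<dots> = M * (\<integral>y. ?\<rho> y \<partial>lebesgue)"
    by (simp add: integral_reflect \<epsilon> integral_completion)
  finally show ?thesis by (simp add: mollifier_integral[OF \<epsilon>])
qed

lemma convolution_mollifier_uniform:
  fixes g :: "'a::euclidean_space \<Rightarrow> real"
  assumes g: "integrable lebesgue g" and \<epsilon>: "\<epsilon> > 0"
    and d: "\<And>x y. norm (x - y) < \<epsilon> \<Longrightarrow> \<bar>g x - g y\<bar> \<le> e"
  shows "\<bar>convolution g (mollifier \<epsilon>) x - g x\<bar> \<le> e"
proof -
  let ?\<rho> = "mollifier \<epsilon> :: 'a \<Rightarrow> real"
  have ri: "integrable lebesgue (\<lambda>y. ?\<rho> (x - y))"
    by (rule test_functions_integrable[OF \<epsilon> mollifier_shift_test[OF \<epsilon> subset_UNIV]])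
  have r1: "(\<integral>y. ?\<rho> (x - y) \<partial>lebesgue) = 1"
    using mollifier_integral[OF \<epsilon>, where 'a='a]
    by (simp add: integral_completion[of "\<lambda>y. ?\<rho> (x - y)"] integral_completion[of ?\<rho>] \<epsilon> integral_reflect)
  have ci: "integrable lebesgue (\<lambda>y. g y * ?\<rho> (x - y))"
    by (rule convolution_integrable_test[OF g mollifier_test[OF \<epsilon>]])
  have "convolution g ?\<rho> x - g x = (\<integral>y. g y * ?\<rho> (x - y) \<partial>lebesgue) - (\<integral>y. g x * ?\<rho> (x - y) \<partial>lebesgue)"
    by (simp add: convolution_def r1)
  also have "\<dots> = (\<integral>y. (g y - g x) * ?\<rho> (x - y) \<partial>lebesgue)"
    by (subst Bochner_Integration.integral_diff[symmetric]) (auto simp: ri ci left_diff_distrib)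
  finally have "\<bar>convolution g ?\<rho> x - g x\<bar> \<le> (\<integral>y. \<bar>(g y - g x) * ?\<rho> (x - y)\<bar> \<partial>lebesgue)"
    by simp
  also have "\<dots> \<le> (\<integral>y. e * ?\<rho> (x - y) \<partial>lebesgue)"
  proof (rule integral_mono)
    show "\<bar>(g y - g x) * ?\<rho> (x - y)\<bar> \<le> e * ?\<rho> (x - y)" for y
      using d[of y x] mollifier_nonneg[OF \<epsilon>, of "x - y"] mollifier_eq_0[OF \<epsilon>, of "x - y"]
      by (cases "norm (x - y) < \<epsilon>") (auto simp: abs_mult norm_minus_commute intro!: mult_right_mono)
    show "integrable lebesgue (\<lambda>y. \<bar>(g y - g x) * ?\<rho> (x - y)\<bar>)"
      using ri ci by (simp add: left_diff_distrib)
  qed (simp add: ri)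
  finally show ?thesis by (simp add: r1)
qed

lemma sqnorm_dominated:
  fixes f :: "'a::euclidean_space \<Rightarrow> real"
  assumes "\<And>k. h k \<in> borel_measurable lebesgue" "f \<in> borel_measurable lebesgue"
    and "AE x in lebesgue. (\<lambda>k. h k x) \<longlonglongrightarrow> f x"
    and "\<And>k. AE x in lebesgue. (h k x - f x)\<^sup>2 \<le> w x"
    and "integrable lebesgue w"
  shows "(\<lambda>k. sqnorm (\<lambda>x. h k x - f x)) \<longlonglongrightarrow> 0"
proof -
  have "(\<lambda>k. \<integral>\<^sup>+x. ennreal ((h k x - f x)\<^sup>2) \<partial>lebesgue) \<longlonglongrightarrow> (\<integral>\<^sup>+(x::'a). 0 \<partial>lebesgue)"
  proof (rule nn_integral_dominated_convergence[where w="\<lambda>x. ennreal \<bar>w x\<bar>"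
        and u'="\<lambda>_. 0" and u="\<lambda>k x. ennreal ((h k x - f x)\<^sup>2)"])
    show "(\<integral>\<^sup>+x. ennreal \<bar>w x\<bar> \<partial>lebesgue) < \<infinity>"
      using assms(5) unfolding integrable_iff_bounded by simp
    show "AE x in lebesgue. (\<lambda>k. ennreal ((h k x - f x)\<^sup>2)) \<longlonglongrightarrow> 0"
      using assms(3)
    proof eventually_elim
      case (elim x)
      have "(\<lambda>k. (h k x - f x)\<^sup>2) \<longlonglongrightarrow> (f x - f x)\<^sup>2"
        by (intro tendsto_intros elim)
      then show ?case using tendsto_ennrealI[of "\<lambda>k. (h k x - f x)\<^sup>2" 0] by simp
    qed
    show "AE x in lebesgue. ennreal ((h k x - f x)\<^sup>2) \<le> ennreal \<bar>w x\<bar>" for k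
      using assms(4)[of k] by (auto elim!: eventually_mono intro!: ennreal_leI)
  qed (use assms in auto)
  then show ?thesis by simp
qed

text \<open>Truncation in size and in space brings \<open>f\<close> to a bounded function on a ball.
  Continuous functions converging to \<open>f\<close> almost everywhere, truncated in the same way,
  converge to the truncated \<open>f\<close> with a constant on a ball as dominating
  function.\<close>

lemma sqnorm_density:
  fixes f :: "'a::euclidean_space \<Rightarrow> real"
  assumes f: "f \<in> borel_measurable lebesgue" "integrable lebesgue (\<lambda>x. (f x)\<^sup>2)" and "e > (0::real)"
  obtains g r where "continuous_on UNIV g" "\<And>x. norm x > r \<Longrightarrow> g x = 0"
    "sqnorm (\<lambda>x. g x - f x) < ennreal e"
proof -
  define clamp where "clamp R t = max (- R) (min R t)" for R t :: real
  define cut where "cut R x = max 0 (min 1 (R + 1 - norm x))" for R and x :: 'a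
  have [measurable]: "f \<in> borel_measurable lebesgue" by (rule f)
  have "f measurable_on UNIV" using lebesgue_measurable_imp_measurable_on[of f UNIV] f(1) by simp
  then obtain N G where N: "negligible N" and G: "\<And>n. continuous_on UNIV (G n)"
    and lim: "\<And>x. x \<notin> N \<Longrightarrow> (\<lambda>n. G n x) \<longlonglongrightarrow> f x"
    unfolding measurable_on_def by auto
  have Gm [measurable]: "G n \<in> borel_measurable lebesgue" for n by (rule continuous_borel_lebesgue[OF G])
  have cutc: "continuous_on UNIV (cut R)" for R unfolding cut_def by (intro continuous_intros)
  have [measurable]: "cut R \<in> borel_measurable lebesgue" for R by (rule continuous_borel_lebesgue[OF cutc])
  have cut01: "0 \<le> cut R x" "cut R x \<le> 1" for R x by (auto simp: cut_def)
  have clamp_abs: "\<bar>clamp R t\<bar> \<le> R" "\<bar>clamp R t\<bar> \<le> \<bar>t\<bar>" "\<bar>clamp R t - t\<bar> \<le> \<bar>t\<bar>" if "R \<ge> 0" for R t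
    using that by (auto simp: clamp_def)
  define F where "F R x = cut R x * clamp R (f x)" for R x
  have [measurable]: "F R \<in> borel_measurable lebesgue" for R unfolding F_def clamp_def by measurable
  have F1: "\<bar>F R x - f x\<bar> \<le> \<bar>f x\<bar>" if "R \<ge> 0" for R x
  proof -
    show ?thesis
    proof (cases "f x \<ge> 0")
      case True
      then have "0 \<le> clamp R (f x)" "clamp R (f x) \<le> f x" using that by (auto simp: clamp_def)
      moreover have "0 \<le> F R x" "F R x \<le> clamp R (f x)"
        using cut01[of R x] calculation by (auto simp: F_def mult_left_le_one_le)
      ultimately show ?thesis by simp
    next
      case False
      then have "clamp R (f x) \<le> 0" "f x \<le> clamp R (f x)" using that by (auto simp: clamp_def)
      moreover have "F R x \<le> 0" "clamp R (f x) \<le> F R x"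
        using cut01[of R x] calculation mult_left_le_one_le[of "- clamp R (f x)" "cut R x"]
        by (auto simp: F_def mult_le_0_iff)
      ultimately show ?thesis by simp
    qed
  qed
  have "(\<lambda>k. sqnorm (\<lambda>x. F (real k) x - f x)) \<longlonglongrightarrow> 0"
  proof (rule sqnorm_dominated[where w="\<lambda>x. (f x)\<^sup>2"])
    show "AE x in lebesgue. (\<lambda>k. F (real k) x) \<longlonglongrightarrow> f x"
    proof (rule AE_I2, rule tendsto_eventually)
      fix x
      have "eventually (\<lambda>k. real k \<ge> max (norm x) \<bar>f x\<bar>) sequentially"
        using filterlim_real_sequentially unfolding filterlim_at_top by blast
      then show "eventually (\<lambda>k. F (real k) x = f x) sequentially"
        by eventually_elim (auto simp: F_def cut_def clamp_def)
    qed
    show "AE x in lebesgue. (F (real k) x - f x)\<^sup>2 \<le> (f x)\<^sup>2" for k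
      using F1[of "real k"] by (auto simp flip: abs_le_square_iff)
  qed (use f in auto)
  \<comment> \<open>Two errors of size \<open>e / 6\<close>, multiplied by the 3 of
    \<open>sqnorm_triangle3\<close>, add up to \<open>e\<close>; the third slot is filled with
    0.\<close>
  then have "eventually (\<lambda>k. sqnorm (\<lambda>x. F (real k) x - f x) < ennreal (e / 6)) sequentially"
    by (rule order_tendstoD) (use \<open>e > 0\<close> in auto)
  then obtain K :: nat where K: "sqnorm (\<lambda>x. F (real K) x - f x) < ennreal (e / 6)" by (auto simp: eventually_sequentially)
  define R where "R = real K"
  have R0: "R \<ge> 0" by (simp add: R_def)
  define H where "H k x = cut R x * clamp R (G k x)" for k x
  have Hc: "continuous_on UNIV (H k)" for k
    unfolding H_def clamp_def by (intro continuous_intros cutc G)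
  have [measurable]: "H k \<in> borel_measurable lebesgue" for k by (rule continuous_borel_lebesgue[OF Hc])
  have "(\<lambda>k. sqnorm (\<lambda>x. H k x - F R x)) \<longlonglongrightarrow> 0"
  proof (rule sqnorm_dominated[where w="\<lambda>x. (2 * R)\<^sup>2 * indicator (cball (0::'a) (R + 1)) x"])
    have "AE x in lebesgue. x \<notin> N" using N by (simp add: negligible_iff_null_sets AE_not_in)
    then show "AE x in lebesgue. (\<lambda>k. H k x) \<longlonglongrightarrow> F R x"
    proof eventually_elim
      case (elim x)
      then show ?case unfolding H_def F_def clamp_def by (intro tendsto_intros lim)
    qed
    have "(H k x - F R x)\<^sup>2 \<le> (2 * R)\<^sup>2 * indicator (cball (0::'a) (R + 1)) x" for k x
    proof (cases "norm x \<le> R + 1")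
      case True
      have "\<bar>H k x\<bar> \<le> R" "\<bar>F R x\<bar> \<le> R"
        unfolding H_def F_def abs_mult using cut01[of R x] clamp_abs(1)[OF R0]
        by (metis abs_of_nonneg mult_left_le_one_le abs_ge_zero order_trans)+
      then have "\<bar>H k x - F R x\<bar> \<le> \<bar>2 * R\<bar>" using R0 by linarith
      then show ?thesis using True by (auto simp: abs_le_square_iff)
    next
      case False
      then show ?thesis by (simp add: H_def F_def cut_def)
    qed
    then show "AE x in lebesgue. (H k x - F R x)\<^sup>2 \<le> (2 * R)\<^sup>2 * indicator (cball (0::'a) (R + 1)) x" for k
      by simp
    show "integrable lebesgue (\<lambda>x. (2 * R)\<^sup>2 * indicat_real (cball (0::'a) (R + 1)) x)"
      by (intro integrable_mult_right integrable_real_indicator)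
        (use emeasure_lborel_cball_finite[of "0::'a" "R + 1"] in auto)
  qed auto
  then have "eventually (\<lambda>k. sqnorm (\<lambda>x. H k x - F R x) < ennreal (e / 6)) sequentially"
    by (rule order_tendstoD) (use \<open>e > 0\<close> in auto)
  then obtain k where k: "sqnorm (\<lambda>x. H k x - F R x) < ennreal (e / 6)" by (auto simp: eventually_sequentially)
  have "sqnorm (\<lambda>x. H k x - f x) = sqnorm (\<lambda>x. (H k x - F R x) + (F R x - f x) + 0)" by simp
  also have "\<dots> \<le> 3 * (sqnorm (\<lambda>x. H k x - F R x) + sqnorm (\<lambda>x. F R x - f x) + sqnorm (\<lambda>x::'a. 0))"
    by (rule sqnorm_triangle3) auto
  also have "\<dots> < 3 * (ennreal (e / 6) + ennreal (e / 6))"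
    using K k by (intro ennreal_mult_strict_left_mono) (auto simp: R_def add_strict_mono)
  also have "\<dots> = ennreal e"
      using \<open>e > 0\<close> by (simp flip: ennreal_plus ennreal_mult ennreal_numeral)
  finally have "sqnorm (\<lambda>x. H k x - f x) < ennreal e" .
  moreover have "H k x = 0" if "norm x > R + 1" for x using that by (simp add: H_def cut_def)
  ultimately show ?thesis using that[of "H k" "R + 1"] Hc by blast
qed

lemma sqnorm_finite: "integrable lebesgue (\<lambda>x. (f x)\<^sup>2) \<Longrightarrow> sqnorm f < \<infinity>"
  using integrableD(2)[of lebesgue "\<lambda>x. (f x)\<^sup>2"] by (simp add: top.not_eq_extremum)

text \<open>Mollification is a contraction in L2, so it suffices to treat a nearby continuous
  function \<open>g\<close> of compact support, for which the convergence is uniform and confined to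
  a fixed ball.\<close>

lemma mollification_converges:
  fixes f :: "'a::euclidean_space \<Rightarrow> real"
  assumes f: "integrable lebesgue f" "integrable lebesgue (\<lambda>x. (f x)\<^sup>2)" and "e > (0::real)"
  obtains d where "d > 0" "\<And>\<epsilon>. 0 < \<epsilon> \<Longrightarrow> \<epsilon> < d \<Longrightarrow>
    sqnorm (\<lambda>x. convolution f (mollifier \<epsilon>) x - f x) < ennreal e"
proof -
  have e': "e / 9 > 0" using \<open>e > 0\<close> by simp
  obtain g r0 where gc: "continuous_on UNIV g" and g0: "\<And>x. norm x > r0 \<Longrightarrow> g x = 0"
    and gf: "sqnorm (\<lambda>x. g x - f x) < ennreal (e / 9)"
    using sqnorm_density[OF borel_measurable_integrable[OF f(1)] f(2) e'] by blast
  have gi: "integrable lebesgue g"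
    by (rule continuous_compact_support_integrable[where C="cball 0 r0" and \<epsilon>=1])
      (use gc g0 in auto)
  have [measurable]: "f \<in> borel_measurable lebesgue" "g \<in> borel_measurable lebesgue" using f gi by auto
  let ?V = "measure lebesgue (cball (0::'a) (r0 + 1))"
  obtain \<eta> :: real where \<eta>: "\<eta> > 0" "ennreal (\<eta>\<^sup>2 * ?V) < ennreal (e / 9)"
  proof -
    have "((\<lambda>\<eta>. ennreal (\<eta>\<^sup>2 * ?V)) \<longlongrightarrow> ennreal (0\<^sup>2 * ?V)) (at_right 0)"
      by (intro tendsto_intros tendsto_ennrealI)
    then have "eventually (\<lambda>\<eta>. ennreal (\<eta>\<^sup>2 * ?V) < ennreal (e / 9)) (at_right 0)"
      using e' by (intro order_tendstoD) auto
    moreover have "eventually (\<lambda>\<eta>::real. \<eta> > 0) (at_right 0)" by (simp add: eventually_at_right_less)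
    ultimately have "eventually (\<lambda>\<eta>. \<eta> > 0 \<and> ennreal (\<eta>\<^sup>2 * ?V) < ennreal (e / 9)) (at_right 0)" by eventually_elim simp
    then have "\<exists>\<eta>. \<eta> > 0 \<and> ennreal (\<eta>\<^sup>2 * ?V) < ennreal (e / 9)" by (rule eventually_happens'[OF trivial_limit_at_right_real])
    then show ?thesis using that by blast
  qed
  have g0': "g x = 0" if "x \<notin> cball 0 r0" for x using that by (intro g0) simp
  obtain d where d: "d > 0" "\<And>x y. norm (x - y) < d \<Longrightarrow> \<bar>g x - g y\<bar> < \<eta>"
    using continuous_compact_support_uniform[where f=g and C="cball 0 r0", OF gc compact_cball g0' \<eta>(1)]
    by blast
  show ?thesis
  \<comment> \<open>Radii below 1 keep the support of the mollified \<open>g\<close> inside the ball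
    of radius \<open>r0 + 1\<close>, for which \<eta> was calibrated.\<close>
  proof (rule that[of "min d 1"])
    fix \<epsilon> :: real assume \<epsilon>: "0 < \<epsilon>" "\<epsilon> < min d 1"
    let ?c = "\<lambda>f. convolution f (mollifier \<epsilon> :: 'a \<Rightarrow> real)"
    have m [measurable]: "?c f \<in> borel_measurable lebesgue" "?c g \<in> borel_measurable lebesgue"
      "?c (\<lambda>x. f x - g x) \<in> borel_measurable lebesgue"
      using f gi by (auto intro!: continuous_borel_lebesgue convolution_borel(2)[OF _ mollifier_test[OF \<epsilon>(1)]])
    have "sqnorm (\<lambda>x. ?c f x - f x) = sqnorm (\<lambda>x. ?c (\<lambda>x. f x - g x) x + (?c g x - g x) + (g x - f x))"
      by (simp add: convolution_diff[OF f(1) gi mollifier_test[OF \<epsilon>(1)]])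
    also have "\<dots> \<le> 3 * (sqnorm (?c (\<lambda>x. f x - g x)) + sqnorm (\<lambda>x. ?c g x - g x) + sqnorm (\<lambda>x. g x - f x))"
      by (rule sqnorm_triangle3) auto
    also have "\<dots> < 3 * (ennreal (e / 9) + ennreal (e / 9) + ennreal (e / 9))"
    proof (rule ennreal_mult_strict_left_mono)
      have "sqnorm (?c (\<lambda>x. f x - g x)) \<le> sqnorm (\<lambda>x. f x - g x)"
        using f gi by (intro sqnorm_convolution_le \<epsilon>) auto
      also have "\<dots> = sqnorm (\<lambda>x. g x - f x)" by (simp add: power2_commute)
      finally have 1: "sqnorm (?c (\<lambda>x. f x - g x)) < ennreal (e / 9)" using gf by simp
      have "(?c g x - g x)\<^sup>2 \<le> \<eta>\<^sup>2 * indicator (cball (0::'a) (r0 + 1)) x" for x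
      proof (cases "norm x \<le> r0 + 1")
        case True
        have "\<bar>?c g x - g x\<bar> \<le> \<eta>"
          by (rule convolution_mollifier_uniform[OF gi \<epsilon>(1)])
            (use d(2) \<epsilon> in \<open>auto intro: less_imp_le\<close>)
        then show ?thesis using True \<eta>(1) abs_le_square_iff[of "?c g x - g x" \<eta>] by simp
      next
        case False
        have "g y * mollifier \<epsilon> (x - y) = 0" for y
        proof (cases "norm y > r0")
          case False
          then have "norm (x - y) \<ge> \<epsilon>" using \<open>\<not> norm x \<le> r0 + 1\<close> \<epsilon> norm_triangle_ineq2[of x y] by simp
          then show ?thesis by (simp add: mollifier_eq_0[OF \<epsilon>(1)])
        qed (simp add: g0)
        then have "?c g x = 0" unfolding convolution_def by (simp only:) simp
        moreover have "g x = 0" using False by (intro g0) simp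
        ultimately show ?thesis by simp
      qed
      then have "sqnorm (\<lambda>x. ?c g x - g x) \<le> (\<integral>\<^sup>+x. ennreal (\<eta>\<^sup>2 * indicator (cball (0::'a) (r0 + 1)) x) \<partial>lebesgue)"
        by (intro nn_integral_mono) (blast intro: ennreal_leI)
      also have "\<dots> = ennreal (\<eta>\<^sup>2) * emeasure lebesgue (cball (0::'a) (r0 + 1))"
        by (simp add: ennreal_mult ennreal_indicator nn_integral_cmult_indicator)
      also have "\<dots> = ennreal (\<eta>\<^sup>2 * ?V)"
        using emeasure_lborel_cball_finite[of "0::'a" "r0 + 1"]
        by (subst emeasure_eq_ennreal_measure) (auto simp: ennreal_mult less_top)
      finally have 2: "sqnorm (\<lambda>x. ?c g x - g x) < ennreal (e / 9)" using \<eta>(2) by simp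
      show "sqnorm (?c (\<lambda>x. f x - g x)) + sqnorm (\<lambda>x. ?c g x - g x) + sqnorm (\<lambda>x. g x - f x)
          < ennreal (e / 9) + ennreal (e / 9) + ennreal (e / 9)"
        by (intro add_strict_mono 1 2 gf)
    qed auto
    also have "\<dots> = ennreal e"
      using \<open>e > 0\<close> by (simp flip: ennreal_plus ennreal_mult ennreal_numeral)
    finally show "sqnorm (\<lambda>x. ?c f x - f x) < ennreal e" .
  qed (use d in auto)
qed

lemma frechet_derivative_affine_arg:
  fixes \<phi> :: "'a::euclidean_space \<Rightarrow> real"
  assumes "smooth_on UNIV \<phi>"
  shows "frechet_derivative (\<lambda>y. \<phi> (x - y)) (at y) v = - frechet_derivative \<phi> (at (x - y)) v"
proof -
  have "((\<lambda>y. x - y) has_derivative (\<lambda>v. - v)) (at y)" by (auto intro!: derivative_eq_intros)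
  from has_derivative_compose[OF this smooth_has_derivative[OF assms]]
  have "frechet_derivative (\<lambda>y. \<phi> (x - y)) (at y) v = frechet_derivative \<phi> (at (x - y)) (- v)"
    by (simp add: frechet_derivative_eq)
  then show ?thesis
    using linear_neg[OF linear_frechet_derivative[OF smooth_differentiable[OF assms]]] by simp
qed

section \<open>Weak partial derivatives\<close>

text \<open>The integrals run over the whole space, and \<open>f\<close> and \<open>G\<close> are
  meant as extensions by zero. As the test functions have support in \<Omega>, a jump of the
  extension across the boundary is not seen.\<close>

definition weak_partials ::
  "'a::euclidean_space set \<Rightarrow> ('a \<Rightarrow> real) \<Rightarrow> ('a \<Rightarrow> 'a \<Rightarrow> real) \<Rightarrow> bool" where
  "weak_partials \<Omega> f G \<longleftrightarrow> (\<forall>\<phi>\<in>test_functions \<Omega>. \<forall>b\<in>Basis.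
     (\<integral>x. f x * frechet_derivative \<phi> (at x) b \<partial>lebesgue) = - (\<integral>x. G b x * \<phi> x \<partial>lebesgue))"

text \<open>The derivative of the kernel in \<open>x\<close> is minus its derivative in
  \<open>y\<close>, and the shifted kernel is a test function on \<Omega> as soon as the closed ball
  around \<open>x\<close> lies in \<Omega>.\<close>

lemma mollified_derivative:
  assumes f: "integrable lebesgue f" and w: "weak_partials \<Omega> f G" and \<epsilon>: "\<epsilon> > 0"
    and x: "cball x \<epsilon> \<subseteq> \<Omega>" and b: "b \<in> Basis"
  shows "frechet_derivative (convolution f (mollifier \<epsilon>)) (at x) b = convolution (G b) (mollifier \<epsilon>) x"
proof -
  have "frechet_derivative (convolution f (mollifier \<epsilon>)) (at x) b
      = - (\<integral>y. f y * frechet_derivative (\<lambda>y. mollifier \<epsilon> (x - y)) (at y) b \<partial>lebesgue)"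
    by (simp add: frechet_derivative_convolution[OF f mollifier_test[OF \<epsilon>]] convolution_def
        frechet_derivative_affine_arg[OF smooth_mollifier[OF \<epsilon>]])
  also have "\<dots> = (\<integral>y. G b y * mollifier \<epsilon> (x - y) \<partial>lebesgue)"
    using w mollifier_shift_test[OF \<epsilon> x] b unfolding weak_partials_def by simp
  finally show ?thesis by (simp add: convolution_def)
qed

section \<open>A rate of mollification governed by the gradient\<close>

text \<open>The fundamental theorem of calculus on the segment from \<open>x\<close> to
  \<open>x - z\<close>, then Jensen for the uniform measure on the unit interval and Cauchy-Schwarz
  over the basis.\<close>

lemma translation_pointwise:
  fixes v :: "'a::euclidean_space \<Rightarrow> real"
  assumes v: "smooth_on UNIV v"
  shows "ennreal ((v (x - z) - v x)\<^sup>2) \<le> (\<integral>\<^sup>+t. ennreal ((norm z)\<^sup>2 *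
      (\<Sum>b\<in>Basis. (frechet_derivative v (at (x - t *\<^sub>R z)) b)\<^sup>2) * indicator {0..1} t) \<partial>lborel)"
proof -
  let ?D = "\<lambda>t. frechet_derivative v (at (x - t *\<^sub>R z))"
  define h where "h t = ?D t (- z)" for t :: real
  have hc: "continuous_on A h" for A
    unfolding h_def using smooth_continuous[OF smooth_derivative[OF v]]
    by (rule continuous_on_compose2) (auto intro!: continuous_intros)
  have der: "((\<lambda>t. v (x - t *\<^sub>R z)) has_vector_derivative h t) (at t within {0..1})" for t
  proof -
    have "((\<lambda>t. x - t *\<^sub>R z) has_derivative (\<lambda>s. s *\<^sub>R (- z))) (at t)"
      by (auto intro!: derivative_eq_intros)
    from has_derivative_compose[OF this smooth_has_derivative[OF v]]
    have "((\<lambda>t. v (x - t *\<^sub>R z)) has_derivative (\<lambda>s. ?D t (s *\<^sub>R (- z)))) (at t)" .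
    then have "((\<lambda>t. v (x - t *\<^sub>R z)) has_derivative (\<lambda>s. s *\<^sub>R h t)) (at t)"
      unfolding h_def
      using linear_scale[OF linear_frechet_derivative[OF smooth_differentiable[OF v]], of "x - t *\<^sub>R z" _ "- z"]
      by simp
    then show ?thesis
      unfolding has_vector_derivative_def by (rule has_derivative_at_withinI)
  qed
  have "(\<integral>t. h t * indicator {0..1} t \<partial>lborel) = v (x - z) - v x"
    using integral_FTC_Icc[of 0 1 "\<lambda>t. v (x - t *\<^sub>R z)" h, OF _ der hc] by (simp add: mult.commute)
  then have "ennreal ((v (x - z) - v x)\<^sup>2) \<le> (\<integral>\<^sup>+t. ennreal ((h t)\<^sup>2 * indicator {0..1} t) \<partial>lborel)"
    using jensen_square[of h lborel "indicator {0..1}"] borel_measurable_continuous_onI[OF hc]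
    by (simp add: ennreal_indicator)
  also have "\<dots> \<le> (\<integral>\<^sup>+t. ennreal ((norm z)\<^sup>2 *
      (\<Sum>b\<in>Basis. (?D t b)\<^sup>2) * indicator {0..1} t) \<partial>lborel)"
  proof (intro nn_integral_mono ennreal_leI mult_right_mono)
    fix t
    have "h t = (\<Sum>b\<in>Basis. (- z \<bullet> b) * ?D t b)"
      unfolding h_def by (rule frechet_derivative_basis_sum[OF smooth_differentiable[OF v]])
    then have "(h t)\<^sup>2 \<le> (\<Sum>b\<in>Basis. (- z \<bullet> b)\<^sup>2) * (\<Sum>b\<in>Basis. (?D t b)\<^sup>2)"
      using Cauchy_Schwarz_ineq_sum[of "\<lambda>b. - z \<bullet> b" "?D t" Basis] by simp
    also have "(\<Sum>b\<in>Basis. (- z \<bullet> b)\<^sup>2) = (norm z)\<^sup>2"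
      unfolding power2_norm_eq_inner euclidean_inner[of z z] by (simp add: power2_eq_square)
    finally show "(h t)\<^sup>2 \<le> (norm z)\<^sup>2 * (\<Sum>b\<in>Basis. (?D t b)\<^sup>2)" .
  qed auto
  finally show ?thesis .
qed

text \<open>After the exchange of integrals the shift by \<open>t *\<^sub>R z\<close> disappears by
  translation invariance, because the factor \<open>indicator S\<close> travels with the shifted
  point.\<close>

lemma translation_estimate:
  fixes v :: "'a::euclidean_space \<Rightarrow> real"
  assumes v: "smooth_on UNIV v" and [measurable]: "K \<in> sets borel" "S \<in> sets borel"
    and KS: "\<And>x. x \<in> K \<Longrightarrow> cball x \<epsilon> \<subseteq> S" and z: "norm z \<le> \<epsilon>"
  shows "(\<integral>\<^sup>+x. ennreal (indicator K x * (v (x - z) - v x)\<^sup>2) \<partial>lborel) \<le>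
    ennreal (\<epsilon>\<^sup>2) * (\<integral>\<^sup>+x. ennreal (indicator S x * (\<Sum>b\<in>Basis. (frechet_derivative v (at x) b)\<^sup>2)) \<partial>lborel)"
proof -
  define g where "g x = (\<Sum>b\<in>Basis. (frechet_derivative v (at x) b)\<^sup>2)" for x
  have "continuous_on UNIV g" unfolding g_def
    by (intro continuous_intros smooth_continuous smooth_derivative v)
  then have [measurable]: "g \<in> borel_measurable borel" by (rule borel_measurable_continuous_onI)
  have g0: "g x \<ge> 0" for x by (simp add: g_def sum_nonneg)
  have nz: "(norm z)\<^sup>2 \<le> \<epsilon>\<^sup>2" using z by (simp add: power_mono)
  have "(\<integral>\<^sup>+x. ennreal (indicator K x * (v (x - z) - v x)\<^sup>2) \<partial>lborel)
      \<le> (\<integral>\<^sup>+x. (\<integral>\<^sup>+t. ennreal (\<epsilon>\<^sup>2 * (indicator S (x - t *\<^sub>R z) * g (x - t *\<^sub>R z)) * indicator {0..1} t) \<partial>lborel) \<partial>lborel)"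
  proof (rule nn_integral_mono)
    fix x
    show "ennreal (indicator K x * (v (x - z) - v x)\<^sup>2)
      \<le> (\<integral>\<^sup>+t. ennreal (\<epsilon>\<^sup>2 * (indicator S (x - t *\<^sub>R z) * g (x - t *\<^sub>R z)) * indicator {0..1} t) \<partial>lborel)"
    proof (cases "x \<in> K")
      case True
      have "ennreal ((v (x - z) - v x)\<^sup>2) \<le> (\<integral>\<^sup>+t. ennreal ((norm z)\<^sup>2 * g (x - t *\<^sub>R z) * indicator {0..1} t) \<partial>lborel)"
        unfolding g_def by (rule translation_pointwise[OF v])
      also have "\<dots> \<le> (\<integral>\<^sup>+t. ennreal (\<epsilon>\<^sup>2 * (indicator S (x - t *\<^sub>R z) * g (x - t *\<^sub>R z)) * indicator {0..1} t) \<partial>lborel)"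
      proof (intro nn_integral_mono ennreal_leI)
        fix t :: real
        have "x - t *\<^sub>R z \<in> S" if "t \<in> {0..1}"
        proof -
          have "norm (t *\<^sub>R z) \<le> norm z" using that by (auto simp: mult_left_le_one_le)
          then show ?thesis using KS[OF True] z by (auto simp: subset_iff dist_norm)
        qed
        then show "(norm z)\<^sup>2 * g (x - t *\<^sub>R z) * indicator {0..1} t
          \<le> \<epsilon>\<^sup>2 * (indicator S (x - t *\<^sub>R z) * g (x - t *\<^sub>R z)) * indicator {0..1} t"
          using nz g0 by (auto simp: indicator_def mult_right_mono)
      qed
      finally show ?thesis using True by simp
    qed simp
  qed
  also have "\<dots> = (\<integral>\<^sup>+t. (\<integral>\<^sup>+x. ennreal (\<epsilon>\<^sup>2 * (indicator S (x - t *\<^sub>R z) * g (x - t *\<^sub>R z)) * indicator {0..1} t) \<partial>lborel) \<partial>lborel)"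
    by (rule lborel_pair.Fubini') measurable
  also have "\<dots> = (\<integral>\<^sup>+(t::real). indicator {0..1} t * (ennreal (\<epsilon>\<^sup>2) * (\<integral>\<^sup>+x. ennreal (indicator S x * g x) \<partial>lborel)) \<partial>lborel)"
  proof (rule nn_integral_cong)
    fix t :: real
    have "(\<integral>\<^sup>+x. ennreal (\<epsilon>\<^sup>2 * (indicator S (x - t *\<^sub>R z) * g (x - t *\<^sub>R z)) * indicator {0..1} t) \<partial>lborel)
       = (\<integral>\<^sup>+x. ennreal (\<epsilon>\<^sup>2) * indicator {0..1} t * ennreal (indicator S (x - t *\<^sub>R z) * g (x - t *\<^sub>R z)) \<partial>lborel)"
      by (intro nn_integral_cong) (auto simp: indicator_def ennreal_mult g0)
    also have "\<dots> = ennreal (\<epsilon>\<^sup>2) * indicator {0..1} t * (\<integral>\<^sup>+x. ennreal (indicator S (x - t *\<^sub>R z) * g (x - t *\<^sub>R z)) \<partial>lborel)"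
      by (rule nn_integral_cmult) measurable
    also have "(\<integral>\<^sup>+x. ennreal (indicator S (x - t *\<^sub>R z) * g (x - t *\<^sub>R z)) \<partial>lborel) = (\<integral>\<^sup>+x. ennreal (indicator S x * g x) \<partial>lborel)"
      by (rule nn_integral_translate) measurable
    finally show "(\<integral>\<^sup>+x. ennreal (\<epsilon>\<^sup>2 * (indicator S (x - t *\<^sub>R z) * g (x - t *\<^sub>R z)) * indicator {0..1} t) \<partial>lborel)
      = indicator {0..1} t * (ennreal (\<epsilon>\<^sup>2) * (\<integral>\<^sup>+x. ennreal (indicator S x * g x) \<partial>lborel))"
      by (simp add: mult_ac)
  qed
  also have "\<dots> = ennreal (\<epsilon>\<^sup>2) * (\<integral>\<^sup>+x. ennreal (indicator S x * g x) \<partial>lborel)"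
    by (simp add: nn_integral_multc)
  finally show ?thesis by (simp add: g_def)
qed

text \<open>The mollification error at \<open>x\<close> is an average of the differences
  \<open>v (x - z) - v x\<close> with \<open>norm z \<le> \<epsilon>\<close>; Jensen reduces it to
  the estimate for translations.\<close>

lemma mollification_smooth_rate:
  fixes v :: "'a::euclidean_space \<Rightarrow> real"
  assumes v: "smooth_on UNIV v" "integrable lebesgue v" and [measurable]: "K \<in> sets borel" "S \<in> sets borel"
    and KS: "\<And>x. x \<in> K \<Longrightarrow> cball x \<epsilon> \<subseteq> S" and \<epsilon>: "\<epsilon> > 0"
  shows "sqnorm (\<lambda>x. indicator K x * (convolution v (mollifier \<epsilon>) x - v x)) \<le>
    ennreal (\<epsilon>\<^sup>2) * (\<integral>\<^sup>+x. ennreal (indicator S x * (\<Sum>b\<in>Basis. (frechet_derivative v (at x) b)\<^sup>2)) \<partial>lborel)"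
proof -
  let ?\<rho> = "mollifier \<epsilon> :: 'a \<Rightarrow> real"
  let ?c = "convolution v ?\<rho>"
  let ?I = "\<integral>\<^sup>+x. ennreal (indicator S x * (\<Sum>b\<in>Basis. (frechet_derivative v (at x) b)\<^sup>2)) \<partial>lborel"
  have vm [measurable]: "v \<in> borel_measurable borel"
    using smooth_continuous[OF v(1)] by (rule borel_measurable_continuous_onI)
  note [measurable] = mollifier_borel[OF \<epsilon>]
  have [measurable]: "?c \<in> borel_measurable borel" by (rule convolution_borel[OF v(2) mollifier_test[OF \<epsilon>]])
  have "sqnorm (\<lambda>x. indicator K x * (?c x - v x)) = (\<integral>\<^sup>+x. ennreal ((indicator K x * (?c x - v x))\<^sup>2) \<partial>lborel)"
    by (rule nn_integral_completion) measurable
  also have "\<dots> \<le> (\<integral>\<^sup>+x. (\<integral>\<^sup>+z. ennreal (indicator K x * (v (x - z) - v x)\<^sup>2 * ?\<rho> z) \<partial>lborel) \<partial>lborel)"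
  proof (rule nn_integral_mono)
    fix x
    have r: "integrable lborel (\<lambda>z. v (x - z) * ?\<rho> z)"
    proof -
      have "integrable lborel (\<lambda>y. v y * ?\<rho> (x - y))"
        using convolution_integrable_test[OF v(2) mollifier_test[OF \<epsilon>], of x]
        by (subst (asm) integrable_completion) auto
      then have "integrable (distr lborel borel (\<lambda>z. x - z)) (\<lambda>y. v y * ?\<rho> (x - y))"
        by (simp add: lborel_distr_reflect)
      then show ?thesis by (subst (asm) integrable_distr_eq) auto
    qed
    have r0: "integrable lborel ?\<rho>"
      using test_functions_integrable[OF \<epsilon> mollifier_test[OF \<epsilon>]] by (subst (asm) integrable_completion) auto
    have r1: "(\<integral>z. ?\<rho> z \<partial>lborel) = 1"
      using mollifier_integral[OF \<epsilon>, where 'a='a] by (subst (asm) integral_completion) auto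
    have "?c x - v x = (\<integral>z. v (x - z) * ?\<rho> z \<partial>lborel) - (\<integral>z. v x * ?\<rho> z \<partial>lborel)"
      by (simp add: convolution_reflect r1)
    also have "\<dots> = (\<integral>z. (v (x - z) - v x) * ?\<rho> z \<partial>lborel)"
      using r r0 by (simp add: left_diff_distrib)
    finally have "ennreal ((?c x - v x)\<^sup>2) \<le> (\<integral>\<^sup>+z. ennreal ((v (x - z) - v x)\<^sup>2 * ?\<rho> z) \<partial>lborel)"
      using jensen_square[of "\<lambda>z. v (x - z) - v x" lborel ?\<rho>]
      by (simp add: mollifier_nonneg[OF \<epsilon>] mollifier_nn_integral[OF \<epsilon>])
    then show "ennreal ((indicator K x * (?c x - v x))\<^sup>2)
        \<le> (\<integral>\<^sup>+z. ennreal (indicator K x * (v (x - z) - v x)\<^sup>2 * ?\<rho> z) \<partial>lborel)"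
      by (cases "x \<in> K") auto
  qed
  also have "\<dots> = (\<integral>\<^sup>+z. (\<integral>\<^sup>+x. ennreal (indicator K x * (v (x - z) - v x)\<^sup>2 * ?\<rho> z) \<partial>lborel) \<partial>lborel)"
    by (rule lborel_pair.Fubini') measurable
  also have "\<dots> \<le> (\<integral>\<^sup>+z. (ennreal (\<epsilon>\<^sup>2) * ?I) * ?\<rho> z \<partial>lborel)"
  proof (rule nn_integral_mono)
    fix z :: 'a
    have "(\<integral>\<^sup>+x. ennreal (indicator K x * (v (x - z) - v x)\<^sup>2 * ?\<rho> z) \<partial>lborel)
       = (\<integral>\<^sup>+x. ennreal (indicator K x * (v (x - z) - v x)\<^sup>2) \<partial>lborel) * ?\<rho> z"
      by (subst nn_integral_multc[symmetric]) (auto simp: ennreal_mult mollifier_nonneg[OF \<epsilon>])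
    also have "\<dots> \<le> (ennreal (\<epsilon>\<^sup>2) * ?I) * ?\<rho> z"
    proof (cases "norm z \<le> \<epsilon>")
      case True
      show ?thesis by (intro mult_right_mono translation_estimate v KS True) auto
    next
      case False
      then show ?thesis using mollifier_eq_0[OF \<epsilon>, of z] by simp
    qed
    finally show "(\<integral>\<^sup>+x. ennreal (indicator K x * (v (x - z) - v x)\<^sup>2 * ?\<rho> z) \<partial>lborel)
       \<le> (ennreal (\<epsilon>\<^sup>2) * ?I) * ?\<rho> z" .
  qed
  also have "\<dots> = ennreal (\<epsilon>\<^sup>2) * ?I"
    by (simp add: nn_integral_cmult mollifier_nn_integral[OF \<epsilon>])
  finally show ?thesis .
qed

lemma convolution_bounded_support:
  fixes f :: "'a::euclidean_space \<Rightarrow> real"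
  assumes f: "\<And>x. norm x > r \<Longrightarrow> f x = 0" and \<epsilon>: "\<epsilon> > 0" and x: "norm x > r + \<epsilon>"
  shows "convolution f (mollifier \<epsilon>) x = 0"
proof -
  have "f y * mollifier \<epsilon> (x - y) = 0" for y
  proof (cases "norm y > r")
    case False
    then have "norm (x - y) \<ge> \<epsilon>" using x norm_triangle_ineq2[of x y] by simp
    then show ?thesis by (simp add: mollifier_eq_0[OF \<epsilon>])
  qed (simp add: f)
  then show ?thesis unfolding convolution_def by (simp only:) simp
qed

lemma convolution_integrable_support:
  fixes f :: "'a::euclidean_space \<Rightarrow> real"
  assumes f: "integrable lebesgue f" "\<And>x. norm x > r \<Longrightarrow> f x = 0" and \<epsilon>: "\<epsilon> > 0"
  shows "integrable lebesgue (convolution f (mollifier \<epsilon>))"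
proof (rule continuous_compact_support_integrable[OF \<epsilon>, where C="cball 0 (r + \<epsilon>)"])
  show "convolution f (mollifier \<epsilon>) x = 0" if "x \<notin> cball 0 (r + \<epsilon>)" for x
    using that by (intro convolution_bounded_support[OF f(2) \<epsilon>]) auto
qed (use convolution_borel(2)[OF f(1) mollifier_test[OF \<epsilon>]] in auto)

text \<open>The quantitative core of Rellich compactness: the L2 error on \<open>K\<close> is of
  order \<epsilon> times the norm of the weak gradient, uniformly over all such \<open>f\<close>.
  The smooth case is applied to a mollification \<open>v\<close> at a finer scale \<delta>; near
  \<open>K\<close> its gradient is the mollified \<open>G\<close>, whose norm does not exceed that
  of \<open>G\<close>, and \<open>v\<close> is as close to \<open>f\<close> as desired.\<close>

lemma mollification_rate:
  fixes f :: "'a::euclidean_space \<Rightarrow> real"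
  assumes f: "integrable lebesgue f" "integrable lebesgue (\<lambda>x. (f x)\<^sup>2)" "\<And>x. norm x > r \<Longrightarrow> f x = 0"
    and G: "\<And>b. b \<in> Basis \<Longrightarrow> integrable lebesgue (G b)"
    and w: "weak_partials \<Omega> f G" and K: "K \<in> sets borel"
    and KO: "\<And>x. x \<in> K \<Longrightarrow> cball x (2 * \<epsilon>) \<subseteq> \<Omega>" and \<epsilon>: "\<epsilon> > 0"
  shows "sqnorm (\<lambda>x. indicator K x * (convolution f (mollifier \<epsilon>) x - f x))
     \<le> 3 * ennreal (\<epsilon>\<^sup>2) * (\<Sum>b\<in>Basis. sqnorm (G b))"
proof (rule ennreal_le_epsilon)
  fix e :: real assume "e > 0"
  let ?c = "\<lambda>\<delta> f. convolution f (mollifier \<delta> :: 'a \<Rightarrow> real)"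
  obtain d where d: "d > 0" "\<And>\<delta>. 0 < \<delta> \<Longrightarrow> \<delta> < d \<Longrightarrow> sqnorm (\<lambda>x. ?c \<delta> f x - f x) < ennreal (e / 6)"
    using mollification_converges[OF f(1,2), of "e / 6"] \<open>e > 0\<close> by auto
  \<comment> \<open>The points of \<open>S\<close> below are within
    \<open>3 / 2 * \<epsilon>\<close> of \<open>K\<close>. With \<delta> at most
    \<open>\<epsilon> / 2\<close>, their balls of radius \<delta> stay within
    \<open>2 * \<epsilon>\<close> of \<open>K\<close>, hence in \<Omega>, where the weak derivative
    is available.\<close>
  define \<delta> where "\<delta> = min (d / 2) (\<epsilon> / 2)"
  have \<delta>: "0 < \<delta>" "\<delta> < d" "\<delta> \<le> \<epsilon> / 2" using d \<epsilon> by (auto simp: \<delta>_def)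
  define v where "v = ?c \<delta> f"
  have vs: "smooth_on UNIV v" unfolding v_def by (rule smooth_convolution[OF f(1) mollifier_test[OF \<delta>(1)]])
  have vi: "integrable lebesgue v" unfolding v_def by (rule convolution_integrable_support[OF f(1,3) \<delta>(1)])
  have Kl [measurable]: "K \<in> sets lebesgue" using K by simp
  have m [measurable]: "f \<in> borel_measurable lebesgue" "v \<in> borel_measurable lebesgue"
    "?c \<epsilon> f \<in> borel_measurable lebesgue" "?c \<epsilon> v \<in> borel_measurable lebesgue"
    "?c \<epsilon> (\<lambda>x. f x - v x) \<in> borel_measurable lebesgue"
    using f vi by (auto intro!: continuous_borel_lebesgue convolution_borel(2)[OF _ mollifier_test[OF \<epsilon>]])
  define S where "S = (\<Union>x\<in>K. ball x (3 / 2 * \<epsilon>))"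
  have S: "S \<in> sets borel" unfolding S_def by (intro borel_open) auto
  have KS: "cball x \<epsilon> \<subseteq> S" if "x \<in> K" for x
    using that \<epsilon> by (force simp: S_def)
  let ?I = "\<integral>\<^sup>+x. ennreal (indicator S x * (\<Sum>b\<in>Basis. (frechet_derivative v (at x) b)\<^sup>2)) \<partial>lborel"
  have vf: "sqnorm (\<lambda>x. v x - f x) \<le> ennreal (e / 6)" using d(2)[OF \<delta>(1,2)] by (simp add: v_def)
  have DI: "?I \<le> (\<Sum>b\<in>Basis. sqnorm (G b))"
  proof -
    have Gm: "?c \<delta> (G b) \<in> borel_measurable borel" if "b \<in> Basis" for b
      using convolution_borel(1)[OF G[OF that] mollifier_test[OF \<delta>(1)]] .
    have "?I \<le> (\<integral>\<^sup>+x. (\<Sum>b\<in>Basis. ennreal ((?c \<delta> (G b) x)\<^sup>2)) \<partial>lborel)"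
    proof (rule nn_integral_mono)
      fix x
      show "ennreal (indicator S x * (\<Sum>b\<in>Basis. (frechet_derivative v (at x) b)\<^sup>2))
          \<le> (\<Sum>b\<in>Basis. ennreal ((?c \<delta> (G b) x)\<^sup>2))"
      proof (cases "x \<in> S")
        case True
        then obtain y where y: "y \<in> K" "dist y x < 3 / 2 * \<epsilon>" by (auto simp: S_def)
        have "cball x \<delta> \<subseteq> cball y (2 * \<epsilon>)"
        proof
          fix w assume "w \<in> cball x \<delta>"
          then show "w \<in> cball y (2 * \<epsilon>)" using y \<delta> dist_triangle[of y w x] by (simp add: dist_commute)
        qed
        then have "frechet_derivative v (at x) b = ?c \<delta> (G b) x" if "b \<in> Basis" for b
          unfolding v_def using KO[OF y(1)] by (intro mollified_derivative[OF f(1) w \<delta>(1) _ that]) blast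
        then show ?thesis using True by simp
      qed simp
    qed
    also have "\<dots> = (\<Sum>b\<in>Basis. \<integral>\<^sup>+x. ennreal ((?c \<delta> (G b) x)\<^sup>2) \<partial>lborel)"
      using Gm by (intro nn_integral_sum) auto
    also have "\<dots> = (\<Sum>b\<in>Basis. sqnorm (?c \<delta> (G b)))"
      using Gm by (intro sum.cong refl nn_integral_completion[symmetric])
    also have "\<dots> \<le> (\<Sum>b\<in>Basis. sqnorm (G b))"
      using \<delta> by (intro sum_mono sqnorm_convolution_le G) auto
    finally show ?thesis .
  qed
  show "sqnorm (\<lambda>x. indicator K x * (?c \<epsilon> f x - f x)) \<le> 3 * ennreal (\<epsilon>\<^sup>2) * (\<Sum>b\<in>Basis. sqnorm (G b)) + ennreal e"
  proof -
    let ?k = "indicator K :: 'a \<Rightarrow> real"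
    have ki: "sqnorm (\<lambda>x. ?k x * h x) \<le> sqnorm h" for h
      by (rule sqnorm_mono_AE) (auto simp: indicator_def)
    have "sqnorm (\<lambda>x. ?k x * (?c \<epsilon> f x - f x))
        = sqnorm (\<lambda>x. ?k x * ?c \<epsilon> (\<lambda>x. f x - v x) x + ?k x * (?c \<epsilon> v x - v x) + ?k x * (v x - f x))"
      by (simp add: convolution_diff[OF f(1) vi mollifier_test[OF \<epsilon>]] algebra_simps)
    also have "\<dots> \<le> 3 * (sqnorm (\<lambda>x. ?k x * ?c \<epsilon> (\<lambda>x. f x - v x) x)
        + sqnorm (\<lambda>x. ?k x * (?c \<epsilon> v x - v x)) + sqnorm (\<lambda>x. ?k x * (v x - f x)))"
      by (rule sqnorm_triangle3) measurable
    also have "\<dots> \<le> 3 * (ennreal (e / 6) + ennreal (\<epsilon>\<^sup>2) * (\<Sum>b\<in>Basis. sqnorm (G b)) + ennreal (e / 6))"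
    proof (intro mult_left_mono add_mono)
      have "sqnorm (\<lambda>x. ?k x * ?c \<epsilon> (\<lambda>x. f x - v x) x) \<le> sqnorm (?c \<epsilon> (\<lambda>x. f x - v x))" by (rule ki)
      also have "\<dots> \<le> sqnorm (\<lambda>x. f x - v x)"
        using f vi by (intro sqnorm_convolution_le \<epsilon>) auto
      also have "\<dots> = sqnorm (\<lambda>x. v x - f x)" by (simp add: power2_commute)
      finally show "sqnorm (\<lambda>x. ?k x * ?c \<epsilon> (\<lambda>x. f x - v x) x) \<le> ennreal (e / 6)" using vf by simp
      have "sqnorm (\<lambda>x. ?k x * (?c \<epsilon> v x - v x)) \<le> ennreal (\<epsilon>\<^sup>2) * ?I"
        by (rule mollification_smooth_rate[OF vs vi K S KS \<epsilon>])
      also have "\<dots> \<le> ennreal (\<epsilon>\<^sup>2) * (\<Sum>b\<in>Basis. sqnorm (G b))" by (intro mult_left_mono DI) simp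
      finally show "sqnorm (\<lambda>x. ?k x * (?c \<epsilon> v x - v x)) \<le> ennreal (\<epsilon>\<^sup>2) * (\<Sum>b\<in>Basis. sqnorm (G b))" .
      show "sqnorm (\<lambda>x. ?k x * (v x - f x)) \<le> ennreal (e / 6)" using ki vf by (rule order_trans)
    qed simp
    also have "\<dots> = 3 * ennreal (\<epsilon>\<^sup>2) * (\<Sum>b\<in>Basis. sqnorm (G b)) + 3 * (ennreal (e / 6) + ennreal (e / 6))"
      by (simp add: distrib_left add_ac mult_ac)
    also have "3 * (ennreal (e / 6) + ennreal (e / 6)) = ennreal e"
      using \<open>e > 0\<close> by (simp flip: ennreal_plus ennreal_mult ennreal_numeral)
    finally show ?thesis .
  qed
qed

section \<open>Approximation by test functions and the fundamental lemma\<close>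

lemma compact_fattening:
  fixes K :: "'a::euclidean_space set"
  assumes "compact K" "open U" "K \<subseteq> U"
  obtains e C where "e > (0::real)" "compact C" "C \<subseteq> U" "\<And>x. x \<in> K \<Longrightarrow> cball x e \<subseteq> C"
proof -
  obtain e where e: "e > 0" "(\<Union>x\<in>K. cball x e) \<subseteq> U"
    using compact_subset_open_imp_cball_epsilon_subset[OF assms] .
  let ?C = "{x + y |x y. x \<in> K \<and> y \<in> cball 0 e}"
  have "compact ?C" by (intro compact_sums assms) auto
  moreover have "?C \<subseteq> U" using e by (fastforce simp: dist_norm)
  moreover have "cball x e \<subseteq> ?C" if "x \<in> K" for x
  proof
    fix z assume "z \<in> cball x e"
    then have "z = x + (z - x)" "z - x \<in> cball 0 e" by (auto simp: dist_norm norm_minus_commute)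
    then show "z \<in> ?C" using that by blast
  qed
  ultimately show ?thesis using that[OF e(1)] by blast
qed

text \<open>One sequence of radii serves finitely many functions: the sum of their squared errors
  tends to 0 in L1, a subsequence of it tends to 0 almost everywhere, and the sum dominates each
  summand. The common sequence allows a map and its weak derivatives to be mollified
  together.\<close>

lemma mollification_AE_sequence:
  fixes f :: "'i \<Rightarrow> 'a::euclidean_space \<Rightarrow> real"
  assumes I: "finite I" and f: "\<And>i. i \<in> I \<Longrightarrow> integrable lebesgue (f i)"
    "\<And>i. i \<in> I \<Longrightarrow> integrable lebesgue (\<lambda>x. (f i x)\<^sup>2)" and e0: "e0 > 0"
  obtains \<epsilon> :: "nat \<Rightarrow> real" where "\<And>k. 0 < \<epsilon> k" "\<And>k. \<epsilon> k \<le> e0 / real (Suc k)"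
    "\<And>i. i \<in> I \<Longrightarrow> AE x in lebesgue. (\<lambda>k. convolution (f i) (mollifier (\<epsilon> k)) x) \<longlonglongrightarrow> f i x"
    "\<And>i. i \<in> I \<Longrightarrow> (\<lambda>k. sqnorm (\<lambda>x. convolution (f i) (mollifier (\<epsilon> k)) x - f i x)) \<longlonglongrightarrow> 0"
proof -
  let ?h = "\<lambda>i e x. convolution (f i) (mollifier e) x - f i x"
  have "\<exists>e>0. e \<le> e0 / real (Suc n) \<and> (\<forall>i\<in>I. sqnorm (?h i e) < ennreal (1 / Suc n))" for n
  proof -
    have "\<exists>d>0. \<forall>e. 0 < e \<longrightarrow> e < d \<longrightarrow> sqnorm (?h i e) < ennreal (1 / Suc n)" if "i \<in> I" for i
      using mollification_converges[OF f[OF that], of "1 / Suc n"] by auto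
    then obtain d where d: "\<And>i. i \<in> I \<Longrightarrow> d i > 0"
      "\<And>i e. i \<in> I \<Longrightarrow> 0 < e \<Longrightarrow> e < d i \<Longrightarrow> sqnorm (?h i e) < ennreal (1 / Suc n)" by metis
    define m where "m = Min (insert (e0 / real (Suc n)) (d ` I))"
    have m0: "m > 0" unfolding m_def using I d(1) e0 by auto
    have m1: "m \<le> e0 / real (Suc n)" "m \<le> d i" if "i \<in> I" for i unfolding m_def using I that by auto
    have m2: "m \<le> e0 / real (Suc n)" unfolding m_def using I by auto
    show ?thesis
    proof (intro exI[of _ "m / 2"] conjI ballI)
      show "m / 2 > 0" "m / 2 \<le> e0 / real (Suc n)" using m0 m2 by linarith+
      show "sqnorm (?h i (m / 2)) < ennreal (1 / Suc n)" if "i \<in> I" for i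
        using m0 m1(2)[OF that] by (intro d(2)[OF that]) auto
    qed
  qed
  then obtain \<delta> where \<delta>: "\<And>n. \<delta> n > 0" "\<And>n. \<delta> n \<le> e0 / real (Suc n)"
    "\<And>n i. i \<in> I \<Longrightarrow> sqnorm (?h i (\<delta> n)) < ennreal (1 / Suc n)" by metis
  have m [measurable]: "?h i e \<in> borel_measurable lebesgue" if "i \<in> I" "e > 0" for i e
    by (rule borel_measurable_diff[OF continuous_borel_lebesgue[OF convolution_borel(2)[OF
            f(1)[OF that(1)] mollifier_test[OF that(2)]]] borel_measurable_integrable[OF f(1)[OF that(1)]]])
  have int: "integrable lebesgue (\<lambda>x. (?h i (\<delta> n) x)\<^sup>2)" if "i \<in> I" for i n
  proof -
    have "sqnorm (?h i (\<delta> n)) < \<infinity>" using \<delta>(3)[OF that, of n] by (metis less_trans ennreal_less_top infinity_ennreal_def)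
    then show ?thesis using m[OF that \<delta>(1)] by (intro integrableI_nonneg) auto
  qed
  have eq: "sqnorm (?h i (\<delta> n)) = ennreal (\<integral>x. (?h i (\<delta> n) x)\<^sup>2 \<partial>lebesgue)" if "i \<in> I" for i n
    by (rule nn_integral_eq_integral[OF int[OF that]]) simp
  have lim: "(\<lambda>n. \<integral>x. (?h i (\<delta> n) x)\<^sup>2 \<partial>lebesgue) \<longlonglongrightarrow> 0" if "i \<in> I" for i
  proof (rule tendsto_sandwich[OF _ _ tendsto_const LIMSEQ_inverse_real_of_nat])
    show "eventually (\<lambda>n. (\<integral>x. (?h i (\<delta> n) x)\<^sup>2 \<partial>lebesgue) \<le> inverse (real (Suc n))) sequentially"
      using \<delta>(3)[OF that] unfolding eq[OF that]
      by (auto simp: ennreal_less_iff inverse_eq_divide intro!: always_eventually less_imp_le)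
  qed auto
  define s where "s n x = (\<Sum>i\<in>I. (?h i (\<delta> n) x)\<^sup>2)" for n x
  have s0: "s n x \<ge> 0" for n x by (simp add: s_def sum_nonneg)
  have si: "integrable lebesgue (s n)" for n unfolding s_def using int by auto
  have "(\<lambda>n. \<integral>x. norm (s n x) \<partial>lebesgue) \<longlonglongrightarrow> 0"
  proof -
    have "(\<integral>x. norm (s n x) \<partial>lebesgue) = (\<Sum>i\<in>I. \<integral>x. (?h i (\<delta> n) x)\<^sup>2 \<partial>lebesgue)" for n
    proof -
      have "(\<integral>x. norm (s n x) \<partial>lebesgue) = (\<integral>x. s n x \<partial>lebesgue)" using s0 by simp
      then show ?thesis unfolding s_def using int by (simp add: Bochner_Integration.integral_sum)
    qed
    moreover have "(\<lambda>n. \<Sum>i\<in>I. \<integral>x. (?h i (\<delta> n) x)\<^sup>2 \<partial>lebesgue) \<longlonglongrightarrow> (\<Sum>i\<in>I. 0)"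
      by (intro tendsto_sum lim)
    ultimately show ?thesis by simp
  qed
  from tendsto_L1_AE_subseq[OF si this] obtain r :: "nat \<Rightarrow> nat" where r: "strict_mono r"
    "AE x in lebesgue. (\<lambda>n. s (r n) x) \<longlonglongrightarrow> 0" by blast
  show ?thesis
  proof (rule that[of "\<lambda>k. \<delta> (r k)"])
    fix i assume i: "i \<in> I"
    show "AE x in lebesgue. (\<lambda>k. convolution (f i) (mollifier (\<delta> (r k))) x) \<longlonglongrightarrow> f i x"
      using r(2)
    proof eventually_elim
      case (elim x)
      have "(\<lambda>n. (?h i (\<delta> (r n)) x)\<^sup>2) \<longlonglongrightarrow> 0"
        by (rule tendsto_sandwich[OF _ _ tendsto_const elim])
          (auto simp: s_def intro!: always_eventually member_le_sum[OF i, of "\<lambda>i. (?h i (\<delta> (r _)) x)\<^sup>2"] I)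
      then have "(\<lambda>n. ?h i (\<delta> (r n)) x) \<longlonglongrightarrow> 0" by (simp add: tendsto_null_power)
      then show ?case by (simp add: LIM_zero_iff)
    qed
    have "(\<lambda>n. sqnorm (?h i (\<delta> n))) \<longlonglongrightarrow> ennreal 0"
      unfolding eq[OF i] by (intro tendsto_ennrealI lim i)
    then show "(\<lambda>k. sqnorm (?h i (\<delta> (r k)))) \<longlonglongrightarrow> 0"
      using LIMSEQ_subseq_LIMSEQ[OF _ r(1)] by (force simp: o_def)
  next
    show "\<delta> (r k) \<le> e0 / real (Suc k)" for k
    proof -
      have "\<delta> (r k) \<le> e0 / real (Suc (r k))" by (rule \<delta>(2))
      also have "\<dots> \<le> e0 / real (Suc k)"
        using seq_suble[OF r(1), of k] e0 by (intro divide_left_mono) auto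
      finally show ?thesis .
    qed
  qed (use \<delta> in auto)
qed

text \<open>Mollify \<open>s\<close> itself with radii below the width of a compact neighbourhood
  \<open>C\<close> of \<open>K\<close>: the support stays in \<open>C\<close> and the bound 1 is
  preserved.\<close>

lemma test_function_approximation:
  fixes s :: "'a::euclidean_space \<Rightarrow> real"
  assumes s: "s \<in> borel_measurable lebesgue" "\<And>x. \<bar>s x\<bar> \<le> 1"
    and K: "compact K" "\<And>x. x \<notin> K \<Longrightarrow> s x = 0" and U: "open U" "K \<subseteq> U"
  obtains \<psi> C where "\<And>k. \<psi> k \<in> test_functions U" "\<And>k x. \<bar>\<psi> k x\<bar> \<le> 1"
    "compact C" "C \<subseteq> U" "\<And>k x. x \<notin> C \<Longrightarrow> \<psi> k x = 0"
    "AE x in lebesgue. (\<lambda>k. \<psi> k x) \<longlonglongrightarrow> s x"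
proof -
  obtain e C where C: "e > 0" "compact C" "C \<subseteq> U" "\<And>x. x \<in> K \<Longrightarrow> cball x e \<subseteq> C"
    using compact_fattening[OF K(1) U] by blast
  have Kf: "integrable lebesgue (indicator K :: 'a \<Rightarrow> real)"
    using lmeasurable_compact[OF K(1)] by (auto simp: fmeasurable_def intro!: integrable_real_indicator)
  have s1: "integrable lebesgue s" using s K(2)
    by (intro Bochner_Integration.integrable_bound[OF Kf]) (auto simp: indicator_def)
  have s2: "integrable lebesgue (\<lambda>x. (s x)\<^sup>2)"
  proof (rule Bochner_Integration.integrable_bound[OF Kf])
    have "(s x)\<^sup>2 \<le> 1" for x using s(2)[of x] by (simp add: abs_square_le_1)
    then show "AE x in lebesgue. norm ((s x)\<^sup>2) \<le> norm (indicator K x :: real)"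
      using K(2) by (auto simp: indicator_def)
  qed (use s in auto)
  obtain \<epsilon> :: "nat \<Rightarrow> real" where \<epsilon>: "\<And>k. 0 < \<epsilon> k" "\<And>k. \<epsilon> k \<le> e"
    "AE x in lebesgue. (\<lambda>k. convolution s (mollifier (\<epsilon> k)) x) \<longlonglongrightarrow> s x"
  proof (rule mollification_AE_sequence[of "{()}" "\<lambda>_. s" e])
    fix \<epsilon> :: "nat \<Rightarrow> real"
    assume \<epsilon>: "\<And>k. 0 < \<epsilon> k" "\<And>k. \<epsilon> k \<le> e / real (Suc k)"
      "\<And>i. i \<in> {()} \<Longrightarrow> AE x in lebesgue. (\<lambda>k. convolution s (mollifier (\<epsilon> k)) x) \<longlonglongrightarrow> s x"
    moreover have "\<epsilon> k \<le> e" for k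
    proof -
      have "e / real (Suc k) \<le> e" using C(1) by (simp add: divide_le_eq)
      then show ?thesis using \<epsilon>(2)[of k] by linarith
    qed
    ultimately show thesis using that by blast
  qed (use s1 s2 C(1) in auto)
  have 0: "convolution s (mollifier (\<epsilon> k)) x = 0" if "x \<notin> C" for k x
  proof -
    have "s y * mollifier (\<epsilon> k) (x - y) = 0" for y
    proof (cases "y \<in> K")
      case True
      then have "x \<notin> cball y e" using C(4) that by blast
      then have "norm (x - y) \<ge> \<epsilon> k" using \<epsilon>(2)[of k] by (simp add: dist_norm norm_minus_commute)
      then show ?thesis by (simp add: mollifier_eq_0[OF \<epsilon>(1)])
    qed (simp add: K(2))
    then show ?thesis unfolding convolution_def by (simp only:) simp
  qed
  show ?thesis
  proof (rule that[of "\<lambda>k. convolution s (mollifier (\<epsilon> k))" C])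
    show "convolution s (mollifier (\<epsilon> k)) \<in> test_functions U" for k
      by (rule test_functionsI[OF smooth_convolution[OF s1 mollifier_test[OF \<epsilon>(1)]] 0 C(2,3)])
    show "\<bar>convolution s (mollifier (\<epsilon> k)) x\<bar> \<le> 1" for k x
      by (rule convolution_mollifier_bound[OF s1 \<epsilon>(1)]) (use s in auto)
  qed (use C 0 \<epsilon> in auto)
qed

lemma lebesgue_on_iff:
  fixes f :: "'a::euclidean_space \<Rightarrow> real"
  assumes "S \<in> sets lebesgue"
  shows integrable_lebesgue_on: "integrable (lebesgue_on S) f \<longleftrightarrow> integrable lebesgue (\<lambda>x. indicator S x * f x)"
    and integral_lebesgue_on: "integral\<^sup>L (lebesgue_on S) f = integral\<^sup>L lebesgue (\<lambda>x. indicator S x * f x)"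
    and measurable_lebesgue_on: "f \<in> borel_measurable (lebesgue_on S) \<longleftrightarrow> (\<lambda>x. indicator S x * f x) \<in> borel_measurable lebesgue"
    and AE_lebesgue_on: "(AE x in lebesgue_on S. P x) \<longleftrightarrow> (AE x in lebesgue. x \<in> S \<longrightarrow> P x)"
  using assms integrable_restrict_space[of S lebesgue f] integral_restrict_space[of S lebesgue f]
    borel_measurable_restrict_space_iff[of S lebesgue f] AE_restrict_space_iff[of S lebesgue P]
  by simp_all

definition locally_integrable :: "'a::euclidean_space set \<Rightarrow> ('a \<Rightarrow> real) \<Rightarrow> bool" where
  "locally_integrable U f \<longleftrightarrow> (\<forall>K. compact K \<and> K \<subseteq> U \<longrightarrow> integrable (lebesgue_on K) f)"

text \<open>An integral over \<open>U\<close> against a compactly supported weight becomes one of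
  \<open>indicator C x * f x\<close>, which is integrable on the whole space and can serve as a
  fixed dominating function.\<close>

lemma locally_integrable_mult:
  fixes f \<phi> :: "'a::euclidean_space \<Rightarrow> real"
  assumes f: "locally_integrable U f" and U: "open U"
    and C: "compact C" "C \<subseteq> U" "\<And>x. x \<notin> C \<Longrightarrow> \<phi> x = 0"
    and \<phi>: "\<phi> \<in> borel_measurable lebesgue" "\<And>x. \<bar>\<phi> x\<bar> \<le> B"
  shows "integrable (lebesgue_on U) (\<lambda>x. f x * \<phi> x)"
    and "integrable lebesgue (\<lambda>x. indicator C x * f x)"
    and "integrable lebesgue (\<lambda>x. indicator C x * f x * \<phi> x)"
    and "integral\<^sup>L (lebesgue_on U) (\<lambda>x. f x * \<phi> x) = integral\<^sup>L lebesgue (\<lambda>x. indicator C x * f x * \<phi> x)"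
proof -
  have Cs: "C \<in> sets lebesgue" "U \<in> sets lebesgue"
    using fmeasurableD[OF lmeasurable_compact[OF C(1)]] U by auto
  have "integrable (lebesgue_on C) f" using f C unfolding locally_integrable_def by blast
  then show 1: "integrable lebesgue (\<lambda>x. indicator C x * f x)"
    by (simp add: integrable_lebesgue_on[OF Cs(1)])
  show 2: "integrable lebesgue (\<lambda>x. indicator C x * f x * \<phi> x)"
    by (rule integrable_mult_bounded[OF 1 \<phi>(1)]) (use \<phi> in auto)
  have eq: "(\<lambda>x. indicator U x * (f x * \<phi> x)) = (\<lambda>x. indicator C x * f x * \<phi> x)"
    using C by (auto simp: indicator_def fun_eq_iff)
  show "integrable (lebesgue_on U) (\<lambda>x. f x * \<phi> x)"
    "integral\<^sup>L (lebesgue_on U) (\<lambda>x. f x * \<phi> x) = integral\<^sup>L lebesgue (\<lambda>x. indicator C x * f x * \<phi> x)"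
    using 2 by (simp_all add: integrable_lebesgue_on[OF Cs(2)] integral_lebesgue_on[OF Cs(2)] eq)
qed

lemma locally_integrable_mult_test:
  assumes f: "locally_integrable U f" and U: "open U" and \<phi>: "\<phi> \<in> test_functions U"
  shows "integrable (lebesgue_on U) (\<lambda>x. f x * \<phi> x)"
proof -
  obtain C where C: "compact C" "C \<subseteq> U" "\<And>x. x \<notin> C \<Longrightarrow> \<phi> x = 0"
    by (rule test_functions_support[OF \<phi>], rule that)
  obtain B where B: "B > 0" "\<And>x. \<bar>\<phi> x\<bar> \<le> B" by (rule test_functions_bounded[OF \<phi>], rule that)
  show ?thesis
    by (rule locally_integrable_mult[OF f U C smooth_borel_lebesgue[OF test_functions_smooth[OF \<phi>]] B(2)])
qed

text \<open>The test functions are mollifications of the sign of \<open>f\<close> on \<open>K\<close>.\<close>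

lemma local_L1_bound_by_tests:
  assumes f: "locally_integrable U f" and U: "open U" and K: "compact K" "K \<subseteq> U"
    and B: "\<And>\<phi>. \<phi> \<in> test_functions U \<Longrightarrow> (\<And>x. \<bar>\<phi> x\<bar> \<le> 1) \<Longrightarrow> (\<integral>x. f x * \<phi> x \<partial>lebesgue_on U) \<le> B"
  shows "(\<integral>x. \<bar>f x\<bar> \<partial>lebesgue_on K) \<le> B"
proof -
  have Ks: "K \<in> sets lebesgue" by (rule fmeasurableD[OF lmeasurable_compact[OF K(1)]])
  have fK: "integrable lebesgue (\<lambda>x. indicator K x * f x)"
    using f K unfolding locally_integrable_def by (simp add: integrable_lebesgue_on[OF Ks, symmetric])
  define s where "s x = sgn (indicator K x * f x)" for x
  have sm: "s \<in> borel_measurable lebesgue" unfolding s_def using fK by measurable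
  have s1: "\<bar>s x\<bar> \<le> 1" for x by (simp add: s_def sgn_if)
  have s0: "s x = 0" if "x \<notin> K" for x using that by (simp add: s_def)
  obtain \<psi> C where \<psi>: "\<And>k. \<psi> k \<in> test_functions U" "\<And>k x. \<bar>\<psi> k x\<bar> \<le> 1"
    and C: "compact C" "C \<subseteq> U" "\<And>k x. x \<notin> C \<Longrightarrow> \<psi> k x = 0"
    and lim: "AE x in lebesgue. (\<lambda>k. \<psi> k x) \<longlonglongrightarrow> s x"
    using test_function_approximation[OF sm s1 K(1) s0 U K(2)] by blast
  have \<psi>m: "\<psi> k \<in> borel_measurable lebesgue" for k
    by (rule smooth_borel_lebesgue[OF test_functions_smooth[OF \<psi>(1)]])
  have li: "(\<integral>x. f x * \<psi> k x \<partial>lebesgue_on U) = (\<integral>x. indicator C x * f x * \<psi> k x \<partial>lebesgue)" for k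
    by (rule locally_integrable_mult(4)[OF f U C(1,2) C(3) \<psi>m \<psi>(2)])
  have Cf: "integrable lebesgue (\<lambda>x. indicator C x * f x)"
    by (rule locally_integrable_mult(2)[OF f U C(1,2) C(3) \<psi>m \<psi>(2)])
  have "(\<lambda>k. \<integral>x. indicator C x * f x * \<psi> k x \<partial>lebesgue) \<longlonglongrightarrow> (\<integral>x. indicator C x * f x * s x \<partial>lebesgue)"
  proof (rule integral_dominated_convergence[where w="\<lambda>x. \<bar>indicator C x * f x\<bar>"])
    show "AE x in lebesgue. (\<lambda>k. indicator C x * f x * \<psi> k x) \<longlonglongrightarrow> indicator C x * f x * s x"
      using lim by eventually_elim (intro tendsto_intros)
    show "AE x in lebesgue. norm (indicator C x * f x * \<psi> k x) \<le> \<bar>indicator C x * f x\<bar>" for k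
      using \<psi>(2) by (auto simp: abs_mult mult_left_le)
  qed (use Cf sm \<psi>m in \<open>auto intro!: borel_measurable_times borel_measurable_integrable[OF Cf]\<close>)
  then have "(\<lambda>k. \<integral>x. f x * \<psi> k x \<partial>lebesgue_on U) \<longlonglongrightarrow> (\<integral>x. indicator C x * f x * s x \<partial>lebesgue)"
    unfolding li .
  then have le: "(\<integral>x. indicator C x * f x * s x \<partial>lebesgue) \<le> B"
    by (rule LIMSEQ_le_const2) (use B \<psi> in blast)
  \<comment> \<open>The inclusion of \<open>K\<close> in \<open>C\<close> is not among the obtained
    facts; as far as \<open>s\<close> is concerned it follows almost everywhere from the pointwise
    limit.\<close>
  have "AE x in lebesgue. x \<notin> C \<longrightarrow> s x = 0"
    using lim
  proof eventually_elim
    case (elim x)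
    show ?case
    proof
      assume "x \<notin> C"
      then have "(\<lambda>k. \<psi> k x) \<longlonglongrightarrow> 0" using C(3) by simp
      with elim show "s x = 0" using LIMSEQ_unique by blast
    qed
  qed
  then have "AE x in lebesgue. indicator C x * f x * s x = indicator K x * \<bar>f x\<bar>"
    by eventually_elim (auto simp: s_def indicator_def sgn_if)
  then have "(\<integral>x. indicator C x * f x * s x \<partial>lebesgue) = (\<integral>x. indicator K x * \<bar>f x\<bar> \<partial>lebesgue)"
  proof (rule integral_cong_AE[rotated 2])
    show "(\<lambda>x. indicator C x * f x * s x) \<in> borel_measurable lebesgue"
      using borel_measurable_integrable[OF Cf] sm by measurable
    have "(\<lambda>x. indicator K x * \<bar>f x\<bar>) = (\<lambda>x. \<bar>indicator K x * f x\<bar>)" by (auto simp: indicator_def)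
    then show "(\<lambda>x. indicator K x * \<bar>f x\<bar>) \<in> borel_measurable lebesgue"
      using borel_measurable_integrable[OF fK] by simp
  qed
  with le show ?thesis by (simp add: integral_lebesgue_on[OF Ks])
qed

text \<open>With all test integrals zero, the bound by test functions holds with
  \<open>B = 0\<close> on every set of a compact exhaustion.\<close>

lemma fundamental_lemma:
  assumes f: "locally_integrable U f" and U: "open U"
    and 0: "\<And>\<phi>. \<phi> \<in> test_functions U \<Longrightarrow> (\<integral>x. f x * \<phi> x \<partial>lebesgue_on U) = 0"
  shows "AE x in lebesgue_on U. f x = 0"
proof -
  obtain C :: "nat \<Rightarrow> 'a set" where C: "\<And>n. compact (C n)" "\<And>n. C n \<subseteq> U" "(\<Union>n. C n) = U"
    using open_Union_compact_subsets[OF U] by metis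
  have "AE x in lebesgue. x \<in> C n \<longrightarrow> f x = 0" for n
  proof -
    have s: "C n \<in> sets lebesgue" by (rule fmeasurableD[OF lmeasurable_compact[OF C(1)]])
    have i: "integrable (lebesgue_on (C n)) f" using f C unfolding locally_integrable_def by blast
    have "(\<integral>x. \<bar>f x\<bar> \<partial>lebesgue_on (C n)) \<le> 0"
      by (rule local_L1_bound_by_tests[OF f U C(1,2)]) (simp add: 0)
    moreover have "(\<integral>x. \<bar>f x\<bar> \<partial>lebesgue_on (C n)) \<ge> 0" by simp
    ultimately have "(\<integral>x. \<bar>f x\<bar> \<partial>lebesgue_on (C n)) = 0" by linarith
    then have "AE x in lebesgue_on (C n). \<bar>f x\<bar> = 0"
      by (subst (asm) integral_nonneg_eq_0_iff_AE) (use i in auto)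
    then show ?thesis by (simp add: AE_lebesgue_on[OF s])
  qed
  then have "AE x in lebesgue. \<forall>n. x \<in> C n \<longrightarrow> f x = 0" by (rule AE_all_countable[THEN iffD2, rule_format])
  then have "AE x in lebesgue. x \<in> U \<longrightarrow> f x = 0" by eventually_elim (use C(3) in blast)
  moreover have "U \<in> sets lebesgue" using U by simp
  ultimately show ?thesis by (simp add: AE_lebesgue_on)
qed

section \<open>Strong L2 convergence from weak convergence and bounded gradients\<close>

text \<open>The inequality expresses that the variance of \<open>\<bar>g x\<bar>\<close> is
  nonnegative, \<open>I / m\<close> being the mean; a space of measure 0 is treated apart because of
  the division.\<close>

lemma finite_measure_L1_L2:
  fixes g :: "'a \<Rightarrow> real"
  assumes "finite_measure M" "g \<in> borel_measurable M" "integrable M (\<lambda>x. (g x)\<^sup>2)"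
  shows "integrable M g" "(\<integral>x. \<bar>g x\<bar> \<partial>M) \<le> sqrt (measure M (space M)) * sqrt (\<integral>x. (g x)\<^sup>2 \<partial>M)"
proof -
  interpret finite_measure M by fact
  show i: "integrable M g" by (rule square_integrable_imp_integrable[OF assms(2,3)])
  define m I where "m = measure M (space M)" and "I = (\<integral>x. \<bar>g x\<bar> \<partial>M)"
  have I0: "I \<ge> 0" by (simp add: I_def)
  have m0: "m \<ge> 0" by (simp add: m_def)
  show "I \<le> sqrt m * sqrt (\<integral>x. (g x)\<^sup>2 \<partial>M)"
  proof (cases "m = 0")
    case True
    then have "emeasure M (space M) = 0" by (simp add: emeasure_eq_measure m_def)
    then have "AE x in M. False" by (simp add: AE_iff_null null_sets_def)
    then have "I = (\<integral>x. 0 \<partial>M)" unfolding I_def using assms(2) by (intro integral_cong_AE) auto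
    then show ?thesis using True by simp
  next
    case False
    with m0 have m: "m > 0" by simp
    have "0 \<le> (\<integral>x. (\<bar>g x\<bar> - I / m)\<^sup>2 \<partial>M)" by simp
    also have "\<dots> = (\<integral>x. (g x)\<^sup>2 - 2 * (I / m) * \<bar>g x\<bar> + (I / m)\<^sup>2 \<partial>M)"
      by (simp add: power2_diff algebra_simps)
    also have "\<dots> = (\<integral>x. (g x)\<^sup>2 \<partial>M) - 2 * (I / m) * I + (I / m)\<^sup>2 * m"
      using assms(3) i by (simp add: I_def m_def)
    also have "\<dots> = (\<integral>x. (g x)\<^sup>2 \<partial>M) - I\<^sup>2 / m" using m by (simp add: power2_eq_square field_simps)
    finally have "I\<^sup>2 \<le> m * (\<integral>x. (g x)\<^sup>2 \<partial>M)" using m by (simp add: field_simps)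
    then have "sqrt (I\<^sup>2) \<le> sqrt (m * (\<integral>x. (g x)\<^sup>2 \<partial>M))" by (rule real_sqrt_le_mono)
    then show ?thesis using I0 by (simp add: real_sqrt_mult)
  qed
qed

text \<open>Rellich compactness for uniformly bounded functions. At a fixed scale \<epsilon> the
  mollified functions converge pointwise, since shifted kernels are test functions, and on a compact
  \<open>K\<close> mollification changes every \<open>fn n\<close> by a uniformly small amount. On
  the thin remainder \<open>U - K\<close> the bound \<open>M\<close> suffices.\<close>

lemma strong_convergence_scalar:
  fixes f :: "'a::euclidean_space \<Rightarrow> real"
  assumes U: "open U" "bounded U"
    and fn: "\<And>n. integrable lebesgue (fn n)" "\<And>n. AE x in lebesgue. \<bar>fn n x\<bar> \<le> M" "\<And>n x. x \<notin> U \<Longrightarrow> fn n x = 0"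
    and f: "integrable lebesgue f" "AE x in lebesgue. \<bar>f x\<bar> \<le> M" "\<And>x. x \<notin> U \<Longrightarrow> f x = 0"
    and G: "\<And>n b. b \<in> Basis \<Longrightarrow> integrable lebesgue (G n b)"
    and w: "\<And>n. weak_partials U (fn n) (G n)"
    and C: "\<And>n. (\<Sum>b\<in>Basis. sqnorm (G n b)) \<le> ennreal C"
    and conv: "\<And>\<phi>. \<phi> \<in> test_functions UNIV \<Longrightarrow>
      (\<lambda>n. \<integral>y. fn n y * \<phi> y \<partial>lebesgue) \<longlonglongrightarrow> (\<integral>y. f y * \<phi> y \<partial>lebesgue)"
  shows "(\<lambda>n. sqnorm (\<lambda>x. fn n x - f x)) \<longlonglongrightarrow> 0"
proof -
  have Um: "U \<in> lmeasurable" using U by (simp add: lmeasurable_open)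
  obtain r where r: "\<And>x. x \<in> U \<Longrightarrow> norm x \<le> r" using U(2) bounded_iff by metis
  have rU: "x \<notin> U" if "norm x > r" for x using r[of x] that by linarith
  have sq: "integrable lebesgue (\<lambda>x. (g x)\<^sup>2)" if g: "integrable lebesgue g" "AE x in lebesgue. \<bar>g x\<bar> \<le> M" for g :: "'a \<Rightarrow> real"
    using integrable_mult_bounded[OF g(1) borel_measurable_integrable[OF g(1)] g(2)] by (simp add: power2_eq_square)
  have M0: "\<bar>M\<bar>\<^sup>2 = M\<^sup>2" by simp
  have [measurable]: "fn n \<in> borel_measurable lebesgue" "f \<in> borel_measurable lebesgue" for n using fn f by auto
  have ev: "eventually (\<lambda>n. sqnorm (\<lambda>x. fn n x - f x) < ennreal e) sequentially" if e: "e > 0" for e :: real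
  proof -
    \<comment> \<open>The squared difference is at most \<open>4 * M\<^sup>2\<close>, so the
      remainder \<open>U - K\<close> contributes at most \<open>e / 5\<close>; the added 1 covers
      \<open>M = 0\<close>.\<close>
    define e1 where "e1 = e / (5 * (4 * M\<^sup>2 + 1))"
    have e1: "e1 > 0" unfolding e1_def using e by (intro divide_pos_pos mult_pos_pos add_nonneg_pos) auto
    obtain K where K': "closed K" "K \<subseteq> U" "(U - K) \<in> lmeasurable" "emeasure lebesgue (U - K) < ennreal e1"
      using sets_lebesgue_inner_closed[OF fmeasurableD[OF Um] e1] by blast
    have K: "compact K" "K \<subseteq> U" "measure lebesgue (U - K) < e1"
      using K' U(2) e1 bounded_subset[OF U(2) K'(2)]
      by (auto simp: compact_eq_bounded_closed emeasure_eq_measure2 ennreal_less_iff)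
    have Kb: "K \<in> sets borel" using K(1) by (rule borel_compact)
    have Kl [measurable]: "K \<in> sets lebesgue" using Kb by simp
    have Ul [measurable]: "U \<in> sets lebesgue" using U by simp
    obtain \<epsilon>1 where \<epsilon>1: "\<epsilon>1 > 0" "(\<Union>x\<in>K. cball x \<epsilon>1) \<subseteq> U"
      using compact_subset_open_imp_cball_epsilon_subset[OF K(1) U(1) K(2)] .
    obtain d where d: "d > 0" "\<And>\<epsilon>. 0 < \<epsilon> \<Longrightarrow> \<epsilon> < d \<Longrightarrow> sqnorm (\<lambda>x. convolution f (mollifier \<epsilon>) x - f x) < ennreal (e / 15)"
      using mollification_converges[OF f(1) sq[OF f(1,2)], of "e / 15"] e by auto
    \<comment> \<open>The balls of radius \<open>2 * \<epsilon>\<close> around \<open>K\<close> stay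
      in \<open>U\<close>, and \<epsilon> is below the threshold \<open>d\<close> for the limit. The
      last two bounds make \<open>9 * \<epsilon>\<^sup>2 * \<bar>C\<bar>\<close> at most
      \<open>e / 5\<close>, where 9 is the product of the 3 in \<open>mollification_rate\<close> and
      the 3 in \<open>sqnorm_triangle3\<close>.\<close>
    define \<epsilon> where "\<epsilon> = min (min (\<epsilon>1 / 2) (d / 2)) (min 1 (e / (45 * (\<bar>C\<bar> + 1))))"
    have \<epsilon>: "\<epsilon> > 0" "2 * \<epsilon> \<le> \<epsilon>1" "\<epsilon> < d" "\<epsilon> \<le> 1" "\<epsilon> \<le> e / (45 * (\<bar>C\<bar> + 1))"
      unfolding \<epsilon>_def using d \<epsilon>1 e by auto
    have \<epsilon>2: "9 * \<epsilon>\<^sup>2 * \<bar>C\<bar> \<le> e / 5"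
    proof -
      have "\<epsilon>\<^sup>2 \<le> \<epsilon>" using \<epsilon> by (simp add: power2_eq_square mult_left_le)
      then have "\<epsilon>\<^sup>2 * \<bar>C\<bar> \<le> (e / (45 * (\<bar>C\<bar> + 1))) * (\<bar>C\<bar> + 1)"
        using \<epsilon> by (intro mult_mono) auto
      also have "\<dots> = e / 45" by (simp add: field_simps)
      finally show ?thesis by simp
    qed
    let ?c = "\<lambda>f. convolution f (mollifier \<epsilon> :: 'a \<Rightarrow> real)"
    let ?k = "indicator K :: 'a \<Rightarrow> real"
    have [measurable]: "?c g \<in> borel_measurable lebesgue" if "integrable lebesgue g" for g
      by (rule continuous_borel_lebesgue[OF convolution_borel(2)[OF that mollifier_test[OF \<epsilon>(1)]]])
    note cm [measurable] = this[OF f(1)] this[OF fn(1)]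
    have KO: "cball x (2 * \<epsilon>) \<subseteq> U" if "x \<in> K" for x
      using \<epsilon>1(2) \<epsilon>(2) that by fastforce
    have "(\<lambda>n. sqnorm (\<lambda>x. ?k x * ?c (fn n) x - ?k x * ?c f x)) \<longlonglongrightarrow> 0"
    proof (rule sqnorm_dominated[where w="\<lambda>x. (2 * M)\<^sup>2 * ?k x"])
      show "AE x in lebesgue. (\<lambda>n. ?k x * ?c (fn n) x) \<longlonglongrightarrow> ?k x * ?c f x"
        unfolding convolution_def
        using mollifier_shift_test[OF \<epsilon>(1) subset_UNIV] by (intro AE_I2 tendsto_intros conv) auto
      show "integrable lebesgue (\<lambda>x. (2 * M)\<^sup>2 * ?k x)"
        using lmeasurable_compact[OF K(1)]
        by (intro integrable_mult_right integrable_real_indicator) (auto simp: fmeasurable_def)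
      have "(?k x * ?c (fn n) x - ?k x * ?c f x)\<^sup>2 \<le> (2 * M)\<^sup>2 * ?k x" for n x
      proof (cases "x \<in> K")
        case True
        have "\<bar>?c (fn n) x - ?c f x\<bar> \<le> \<bar>2 * M\<bar>"
          using convolution_mollifier_bound[OF fn(1) \<epsilon>(1) fn(2), of n x] convolution_mollifier_bound[OF f(1) \<epsilon>(1) f(2), of x]
          by linarith
        then show ?thesis using True by (simp only: abs_le_square_iff) simp
      qed simp
      then show "AE x in lebesgue. (?k x * ?c (fn n) x - ?k x * ?c f x)\<^sup>2 \<le> (2 * M)\<^sup>2 * ?k x" for n by simp
    qed measurable
    then have "eventually (\<lambda>n. sqnorm (\<lambda>x. ?k x * ?c (fn n) x - ?k x * ?c f x) < ennreal (e / 15)) sequentially"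
      by (rule order_tendstoD) (use e in auto)
    then show ?thesis
    proof eventually_elim
      case (elim n)
      let ?o = "indicator (U - K) :: 'a \<Rightarrow> real"
      have o: "sqnorm (\<lambda>x. ?o x * (fn n x - f x)) \<le> ennreal (e / 5)"
      proof -
        have "sqnorm (\<lambda>x. ?o x * (fn n x - f x)) \<le> (\<integral>\<^sup>+x. ennreal ((2 * M)\<^sup>2) * indicator (U - K) x \<partial>lebesgue)"
        proof (rule nn_integral_mono_AE)
          show "AE x in lebesgue. ennreal ((?o x * (fn n x - f x))\<^sup>2) \<le> ennreal ((2 * M)\<^sup>2) * indicator (U - K) x"
            using fn(2)[of n] f(2)
          proof eventually_elim
            case (elim x)
            then have "\<bar>fn n x - f x\<bar> \<le> \<bar>2 * M\<bar>" by linarith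
            then have "(fn n x - f x)\<^sup>2 \<le> (2 * M)\<^sup>2" by (simp only: abs_le_square_iff)
            then show ?case by (auto simp: indicator_def intro!: ennreal_leI)
          qed
        qed
        also have "\<dots> = ennreal ((2 * M)\<^sup>2) * emeasure lebesgue (U - K)"
          by (rule nn_integral_cmult_indicator) measurable
        also have "\<dots> = ennreal ((2 * M)\<^sup>2 * measure lebesgue (U - K))"
          using fmeasurable_Diff[OF Um Kl]
          by (subst emeasure_eq_measure2) (auto simp: ennreal_mult)
        also have "\<dots> \<le> ennreal (e / 5)"
        proof (rule ennreal_leI)
          have "(2 * M)\<^sup>2 * measure lebesgue (U - K) \<le> (4 * M\<^sup>2 + 1) * e1"
            using K(3) by (intro mult_mono) (auto simp: power_mult_distrib)
          also have "\<dots> = e / 5"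
          proof -
            have "4 * M\<^sup>2 + 1 \<noteq> (0::real)" by (smt (verit) zero_le_power2)
            moreover have "X * (e / (5 * X)) = e / 5" if "X \<noteq> 0" for X :: real using that by simp
            ultimately show ?thesis unfolding e1_def by blast
          qed
          finally show "(2 * M)\<^sup>2 * measure lebesgue (U - K) \<le> e / 5" .
        qed
        finally show ?thesis .
      qed
      have k: "sqnorm (\<lambda>x. ?k x * (fn n x - f x)) \<le> ennreal (3 * e / 5)"
      proof -
        have "sqnorm (\<lambda>x. ?k x * (fn n x - f x)) = sqnorm (\<lambda>x. ?k x * (fn n x - ?c (fn n) x)
          + (?k x * ?c (fn n) x - ?k x * ?c f x) + ?k x * (?c f x - f x))"
          by (simp add: algebra_simps)
        also have "\<dots> \<le> 3 * (sqnorm (\<lambda>x. ?k x * (fn n x - ?c (fn n) x))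
          + sqnorm (\<lambda>x. ?k x * ?c (fn n) x - ?k x * ?c f x) + sqnorm (\<lambda>x. ?k x * (?c f x - f x)))"
          by (rule sqnorm_triangle3) measurable
        also have "\<dots> \<le> 3 * (ennreal (e / 15) + ennreal (e / 15) + ennreal (e / 15))"
        proof (intro mult_left_mono add_mono)
          have "sqnorm (\<lambda>x. ?k x * (fn n x - ?c (fn n) x)) = sqnorm (\<lambda>x. ?k x * (?c (fn n) x - fn n x))"
            by (intro nn_integral_cong) (simp add: power_mult_distrib power2_commute)
          also have "\<dots> \<le> 3 * ennreal (\<epsilon>\<^sup>2) * (\<Sum>b\<in>Basis. sqnorm (G n b))"
            by (rule mollification_rate[OF fn(1) sq[OF fn(1,2)] fn(3)[OF rU] G w Kb KO \<epsilon>(1)])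
          also have "\<dots> \<le> 3 * ennreal (\<epsilon>\<^sup>2) * ennreal \<bar>C\<bar>"
            by (intro mult_left_mono order_trans[OF C] ennreal_leI) auto
          also have "\<dots> = ennreal (3 * \<epsilon>\<^sup>2 * \<bar>C\<bar>)" by (simp add: ennreal_mult)
          also have "\<dots> \<le> ennreal (e / 15)" using \<epsilon>2 by (intro ennreal_leI) simp
          finally show "sqnorm (\<lambda>x. ?k x * (fn n x - ?c (fn n) x)) \<le> ennreal (e / 15)" .
          show "sqnorm (\<lambda>x. ?k x * ?c (fn n) x - ?k x * ?c f x) \<le> ennreal (e / 15)" using elim by simp
          have "sqnorm (\<lambda>x. ?k x * (?c f x - f x)) \<le> sqnorm (\<lambda>x. ?c f x - f x)"
            by (rule sqnorm_mono_AE) (auto simp: indicator_def)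
          then show "sqnorm (\<lambda>x. ?k x * (?c f x - f x)) \<le> ennreal (e / 15)"
            using d(2)[OF \<epsilon>(1,3)] by simp
        qed simp
        also have "\<dots> = ennreal (3 * e / 5)" using e by (simp flip: ennreal_plus ennreal_mult ennreal_numeral)
        finally show ?thesis .
      qed
      have "sqnorm (\<lambda>x. fn n x - f x) = (\<integral>\<^sup>+x. ennreal ((?o x * (fn n x - f x))\<^sup>2) + ennreal ((?k x * (fn n x - f x))\<^sup>2) \<partial>lebesgue)"
        using K(2) fn(3) f(3) by (intro nn_integral_cong) (auto simp: indicator_def)
      also have "\<dots> = sqnorm (\<lambda>x. ?o x * (fn n x - f x)) + sqnorm (\<lambda>x. ?k x * (fn n x - f x))"
        by (rule nn_integral_add) measurable
      also have "\<dots> \<le> ennreal (e / 5) + ennreal (3 * e / 5)" by (intro add_mono o k)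
      also have "\<dots> < ennreal e" using e by (simp add: ennreal_less_iff flip: ennreal_plus)
      finally show ?case .
    qed
  qed
  show ?thesis
  proof (rule order_tendstoI)
    fix a :: ennreal assume a: "0 < a"
    obtain e :: real where "e > 0" "ennreal e \<le> a"
    proof (cases a rule: ennreal_cases)
      case (real r)
      then show ?thesis using that[of r] a by auto
    next
      case top
      then show ?thesis using that[of 1] by simp
    qed
    then show "eventually (\<lambda>n. sqnorm (\<lambda>x. fn n x - f x) < a) sequentially"
      using ev[of e] by (auto elim!: eventually_mono)
  qed simp
qed

section \<open>Weak convergence in the Sobolev space\<close>

lemma weak_gradient_works: "has_weak_gradient \<Omega> u D \<Longrightarrow> has_weak_gradient \<Omega> u (weak_gradient \<Omega> u)"
  unfolding weak_gradient_def by (rule someI[where P="has_weak_gradient \<Omega> u"])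

lemma W12_weak_gradient: "u \<in> W12 \<Omega> \<Longrightarrow> has_weak_gradient \<Omega> u (weak_gradient \<Omega> u)"
  using weak_gradient_works unfolding W12_def by blast

lemma has_weak_gradient_locally_integrable:
  assumes "has_weak_gradient \<Omega> u D"
  shows "locally_integrable \<Omega> (\<lambda>x. u x $ i)" "locally_integrable \<Omega> (\<lambda>x. D x $ i $ j)"
  using assms unfolding has_weak_gradient_def locally_integrable_def
  by (auto intro!: integrable_bounded_linear[OF bounded_linear_vec_nth])

lemma has_weak_gradientD:
  "has_weak_gradient \<Omega> u D \<Longrightarrow> \<phi> \<in> test_functions \<Omega> \<Longrightarrow>
    (\<integral>x. u x $ i * frechet_derivative \<phi> (at x) (axis j 1) \<partial>lebesgue_on \<Omega>)
    = - (\<integral>x. D x $ i $ j * \<phi> x \<partial>lebesgue_on \<Omega>)"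
  unfolding has_weak_gradient_def by blast

text \<open>Also the means of handling \<open>weak_gradient\<close>: as the latter is a choice,
  identities such as additivity are obtained only almost everywhere, and they follow from
  uniqueness.\<close>

lemma has_weak_gradient_unique:
  assumes \<Omega>: "open \<Omega>" and D: "has_weak_gradient \<Omega> u D" "has_weak_gradient \<Omega> u D'"
  shows "AE x in lebesgue_on \<Omega>. D x = D' x"
proof -
  have "AE x in lebesgue_on \<Omega>. D x $ i $ j - D' x $ i $ j = 0" for i j
  proof (rule fundamental_lemma[OF _ \<Omega>])
    show "locally_integrable \<Omega> (\<lambda>x. D x $ i $ j - D' x $ i $ j)"
      using has_weak_gradient_locally_integrable(2)[OF D(1)] has_weak_gradient_locally_integrable(2)[OF D(2)]
      unfolding locally_integrable_def by auto
    fix \<phi> :: "real^3 \<Rightarrow> real" assume \<phi>: "\<phi> \<in> test_functions \<Omega>"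
    have "integrable (lebesgue_on \<Omega>) (\<lambda>x. D x $ i $ j * \<phi> x)" "integrable (lebesgue_on \<Omega>) (\<lambda>x. D' x $ i $ j * \<phi> x)"
      by (rule locally_integrable_mult_test[OF has_weak_gradient_locally_integrable(2)[OF D(1)] \<Omega> \<phi>],
          rule locally_integrable_mult_test[OF has_weak_gradient_locally_integrable(2)[OF D(2)] \<Omega> \<phi>])
    then show "(\<integral>x. (D x $ i $ j - D' x $ i $ j) * \<phi> x \<partial>lebesgue_on \<Omega>) = 0"
      using has_weak_gradientD[OF D(1) \<phi>, of i j] has_weak_gradientD[OF D(2) \<phi>, of i j]
      by (simp add: left_diff_distrib)
  qed
  then have "AE x in lebesgue_on \<Omega>. \<forall>i j. D x $ i $ j - D' x $ i $ j = 0"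
    by (simp add: eventually_all_finite AE_finite_allI)
  then show ?thesis by eventually_elim (simp add: vec_eq_iff)
qed

lemma has_weak_gradient_add:
  assumes \<Omega>: "open \<Omega>" and D: "has_weak_gradient \<Omega> u D" and E: "has_weak_gradient \<Omega> v E"
  shows "has_weak_gradient \<Omega> (\<lambda>x. u x + v x) (\<lambda>x. D x + E x)"
  unfolding has_weak_gradient_def
proof (intro conjI allI impI ballI)
  fix K assume "compact K \<and> K \<subseteq> \<Omega>"
  then show "integrable (lebesgue_on K) (\<lambda>x. u x + v x)" "integrable (lebesgue_on K) (\<lambda>x. D x + E x)"
    using D E unfolding has_weak_gradient_def by auto
next
  fix \<phi> :: "real^3 \<Rightarrow> real" and i j :: 3
  assume \<phi>: "\<phi> \<in> test_functions \<Omega>"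
  note d\<phi> = test_functions_derivative[OF \<phi>]
  note i1 = locally_integrable_mult_test[OF has_weak_gradient_locally_integrable(1)[OF D] \<Omega> d\<phi>, of i "axis j 1"]
    locally_integrable_mult_test[OF has_weak_gradient_locally_integrable(1)[OF E] \<Omega> d\<phi>, of i "axis j 1"]
    locally_integrable_mult_test[OF has_weak_gradient_locally_integrable(2)[OF D] \<Omega> \<phi>, of i j]
    locally_integrable_mult_test[OF has_weak_gradient_locally_integrable(2)[OF E] \<Omega> \<phi>, of i j]
  show "(\<integral>x. (u x + v x) $ i * frechet_derivative \<phi> (at x) (axis j 1) \<partial>lebesgue_on \<Omega>)
      = - (\<integral>x. (D x + E x) $ i $ j * \<phi> x \<partial>lebesgue_on \<Omega>)"
    using i1 by (simp add: distrib_right has_weak_gradientD[OF D \<phi>] has_weak_gradientD[OF E \<phi>])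
qed

lemma has_weak_gradient_scaleR:
  assumes D: "has_weak_gradient \<Omega> u D"
  shows "has_weak_gradient \<Omega> (\<lambda>x. c *\<^sub>R u x) (\<lambda>x. c *\<^sub>R D x)"
  using D unfolding has_weak_gradient_def by (auto simp: mult.assoc)

lemma weak_gradient_add:
  assumes \<Omega>: "open \<Omega>" and u: "u \<in> W12 \<Omega>" "v \<in> W12 \<Omega>"
  shows "AE x in lebesgue_on \<Omega>. weak_gradient \<Omega> (\<lambda>x. u x + v x) x = weak_gradient \<Omega> u x + weak_gradient \<Omega> v x"
proof -
  have h: "has_weak_gradient \<Omega> (\<lambda>x. u x + v x) (\<lambda>x. weak_gradient \<Omega> u x + weak_gradient \<Omega> v x)"
    by (intro has_weak_gradient_add \<Omega> W12_weak_gradient u)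
  then have "has_weak_gradient \<Omega> (\<lambda>x. u x + v x) (weak_gradient \<Omega> (\<lambda>x. u x + v x))"
    by (rule weak_gradient_works)
  then show ?thesis using has_weak_gradient_unique[OF \<Omega> _ h] by blast
qed

lemma weak_gradient_scaleR:
  assumes \<Omega>: "open \<Omega>" and u: "u \<in> W12 \<Omega>"
  shows "AE x in lebesgue_on \<Omega>. weak_gradient \<Omega> (\<lambda>x. c *\<^sub>R u x) x = c *\<^sub>R weak_gradient \<Omega> u x"
proof -
  have h: "has_weak_gradient \<Omega> (\<lambda>x. c *\<^sub>R u x) (\<lambda>x. c *\<^sub>R weak_gradient \<Omega> u x)"
    by (intro has_weak_gradient_scaleR W12_weak_gradient u)
  then have "has_weak_gradient \<Omega> (\<lambda>x. c *\<^sub>R u x) (weak_gradient \<Omega> (\<lambda>x. c *\<^sub>R u x))"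
    by (rule weak_gradient_works)
  then show ?thesis using has_weak_gradient_unique[OF \<Omega> _ h] by blast
qed

lemma W12_integrable:
  assumes "u \<in> W12 \<Omega>"
  shows W12_measurable: "u \<in> borel_measurable (lebesgue_on \<Omega>)"
    and W12_measurable_gradient: "weak_gradient \<Omega> u \<in> borel_measurable (lebesgue_on \<Omega>)"
    and W12_square: "integrable (lebesgue_on \<Omega>) (\<lambda>x. (norm (u x))\<^sup>2)"
    and W12_square_gradient: "integrable (lebesgue_on \<Omega>) (\<lambda>x. (norm (weak_gradient \<Omega> u x))\<^sup>2)"
  using assms unfolding W12_def L2_on_def by auto

lemma measurable_vec_nth [measurable]: "f \<in> borel_measurable N \<Longrightarrow> (\<lambda>x. f x $ i) \<in> borel_measurable N"
  for f :: "'a \<Rightarrow> 'b::euclidean_space ^ 'n"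
  by (rule borel_measurable_continuous_on[where f="\<lambda>y. y $ i" and g=f]) (auto intro: continuous_intros)

lemma abs_matrix_le_norm: "\<bar>(D :: real^'n^'m) $ i $ j\<bar> \<le> norm D"
  using component_le_norm_cart[of "D $ i" j] Finite_Cartesian_Product.norm_nth_le[of D i] by linarith

lemma component_square_le_norm:
  "((v :: real^'n) $ i)\<^sup>2 \<le> (norm v)\<^sup>2" "((D :: real^'n^'m) $ k $ j)\<^sup>2 \<le> (norm D)\<^sup>2"
  using power_mono[OF component_le_norm_cart[of v i], of 2] power_mono[OF abs_matrix_le_norm[of D k j], of 2] by auto

text \<open>A pointwise limit of restrictions to an increasing compact exhaustion. It supplies
  measurability for the chosen gradient of a sum or a multiple, of which only the defining
  properties of a weak gradient are at hand.\<close>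

lemma locally_integrable_measurable:
  assumes f: "locally_integrable U f" and U: "open U"
  shows "f \<in> borel_measurable (lebesgue_on U)"
proof -
  obtain C :: "nat \<Rightarrow> 'a set" where C: "\<And>n. compact (C n)" "\<And>n. C n \<subseteq> U" "(\<Union>n. C n) = U"
    using open_Union_compact_subsets[OF U] by metis
  define K where "K n = (\<Union>k\<le>n. C k)" for n
  have K: "compact (K n)" "K n \<subseteq> U" for n
    using C by (auto simp: K_def intro!: compact_UN)
  have Ks: "K n \<in> sets lebesgue" for n by (rule fmeasurableD[OF lmeasurable_compact[OF K(1)]])
  have "(\<lambda>x. indicator U x * f x) \<in> borel_measurable lebesgue"
  proof (rule borel_measurable_LIMSEQ_real)
    show "(\<lambda>x. indicator (K n) x * f x) \<in> borel_measurable lebesgue" for n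
    proof -
      have "integrable (lebesgue_on (K n)) f" using f K unfolding locally_integrable_def by blast
      then show ?thesis
        unfolding integrable_lebesgue_on[OF Ks] by (rule borel_measurable_integrable)
    qed
    show "(\<lambda>n. indicator (K n) x * f x) \<longlonglongrightarrow> indicator U x * f x" for x
    proof (cases "x \<in> U")
      case True
      then obtain m where "x \<in> C m" using C(3) by blast
      then have "x \<in> K n" if "n \<ge> m" for n using that by (auto simp: K_def)
      then have "eventually (\<lambda>n. indicator (K n) x * f x = indicator U x * f x) sequentially"
        using True by (auto simp: eventually_sequentially intro!: exI[of _ m])
      then show ?thesis by (rule tendsto_eventually)
    next
      case False
      then have "x \<notin> K n" for n using K(2) by blast
      then show ?thesis using False by simp
    qed
  qed
  then show ?thesis using U by (simp add: measurable_lebesgue_on)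
qed

lemma W12_components:
  assumes "u \<in> W12 \<Omega>"
  shows W12_comp_measurable: "(\<lambda>x. u x $ i) \<in> borel_measurable (lebesgue_on \<Omega>)"
      "(\<lambda>x. weak_gradient \<Omega> u x $ i $ j) \<in> borel_measurable (lebesgue_on \<Omega>)"
    and W12_comp_square: "integrable (lebesgue_on \<Omega>) (\<lambda>x. (u x $ i)\<^sup>2)"
      "integrable (lebesgue_on \<Omega>) (\<lambda>x. (weak_gradient \<Omega> u x $ i $ j)\<^sup>2)"
proof -
  note [measurable] = W12_measurable[OF assms] W12_measurable_gradient[OF assms]
  show "(\<lambda>x. u x $ i) \<in> borel_measurable (lebesgue_on \<Omega>)"
      "(\<lambda>x. weak_gradient \<Omega> u x $ i $ j) \<in> borel_measurable (lebesgue_on \<Omega>)" by measurable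
  show "integrable (lebesgue_on \<Omega>) (\<lambda>x. (u x $ i)\<^sup>2)"
    by (rule Bochner_Integration.integrable_bound[OF W12_square[OF assms]])
      (auto intro!: component_square_le_norm)
  show "integrable (lebesgue_on \<Omega>) (\<lambda>x. (weak_gradient \<Omega> u x $ i $ j)\<^sup>2)"
    by (rule Bochner_Integration.integrable_bound[OF W12_square_gradient[OF assms]])
      (auto intro!: component_square_le_norm)
qed

lemma finite_measure_bounded_open:
  "open \<Omega> \<Longrightarrow> bounded \<Omega> \<Longrightarrow> finite_measure (lebesgue_on (\<Omega> :: 'a::euclidean_space set))"
  by (simp add: finite_measure_lebesgue_on lmeasurable_open)

lemma W12_comp_integrable:
  assumes "open \<Omega>" "bounded \<Omega>" "u \<in> W12 \<Omega>"
  shows "integrable (lebesgue_on \<Omega>) (\<lambda>x. u x $ i)"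
    and "integrable (lebesgue_on \<Omega>) (\<lambda>x. weak_gradient \<Omega> u x $ i $ j)"
  using finite_measure_L1_L2(1)[OF finite_measure_bounded_open[OF assms(1,2)] W12_comp_measurable(1)[OF assms(3)]
      W12_comp_square(1)[OF assms(3)]]
    finite_measure_L1_L2(1)[OF finite_measure_bounded_open[OF assms(1,2)] W12_comp_measurable(2)[OF assms(3)]
      W12_comp_square(2)[OF assms(3)]] .

text \<open>Cauchy-Schwarz on a domain of finite measure. The condition on \<open>g\<close> is
  shaped to cover both the components of \<open>w\<close> and the entries of its gradient.\<close>

lemma W12_functional_bound:
  assumes \<Omega>: "open \<Omega>" "bounded \<Omega>" and w: "w \<in> W12 \<Omega>"
    and g: "g \<in> borel_measurable (lebesgue_on \<Omega>)"
    "\<And>x. (g x)\<^sup>2 \<le> (norm (w x))\<^sup>2 + (norm (weak_gradient \<Omega> w x))\<^sup>2"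
    and \<phi>: "\<phi> \<in> borel_measurable (lebesgue_on \<Omega>)" "\<And>x. \<bar>\<phi> x\<bar> \<le> B"
  shows "\<bar>\<integral>x. g x * \<phi> x \<partial>lebesgue_on \<Omega>\<bar> \<le> (B * sqrt (measure lebesgue \<Omega>)) * W12_norm \<Omega> w"
proof -
  let ?N = "\<lambda>x. (norm (w x))\<^sup>2 + (norm (weak_gradient \<Omega> w x))\<^sup>2"
  have N: "integrable (lebesgue_on \<Omega>) ?N" using W12_square[OF w] W12_square_gradient[OF w] by auto
  have g2: "integrable (lebesgue_on \<Omega>) (\<lambda>x. (g x)\<^sup>2)"
    by (rule Bochner_Integration.integrable_bound[OF N]) (use g in auto)
  note fm = finite_measure_bounded_open[OF \<Omega>]
  have gi: "integrable (lebesgue_on \<Omega>) g" by (rule finite_measure_L1_L2(1)[OF fm g(1) g2])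
  have B: "B \<ge> 0" using \<phi>(2)[of undefined] by linarith
  have gp: "integrable (lebesgue_on \<Omega>) (\<lambda>x. g x * \<phi> x)"
    by (rule integrable_mult_bounded[OF gi \<phi>(1)]) (use \<phi> in auto)
  have "\<bar>\<integral>x. g x * \<phi> x \<partial>lebesgue_on \<Omega>\<bar> \<le> (\<integral>x. \<bar>g x * \<phi> x\<bar> \<partial>lebesgue_on \<Omega>)" by simp
  also have "\<dots> \<le> (\<integral>x. B * \<bar>g x\<bar> \<partial>lebesgue_on \<Omega>)"
    using gi \<phi>(2) integrable_abs[OF gp] by (intro integral_mono) (auto simp: abs_mult mult.commute mult_right_mono)
  also have "\<dots> = B * (\<integral>x. \<bar>g x\<bar> \<partial>lebesgue_on \<Omega>)" by simp
  also have "\<dots> \<le> B * (sqrt (measure lebesgue \<Omega>) * sqrt (\<integral>x. (g x)\<^sup>2 \<partial>lebesgue_on \<Omega>))"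
    using finite_measure_L1_L2(2)[OF fm g(1) g2] \<Omega> B
    by (intro mult_left_mono) (simp_all add: measure_restrict_space)
  also have "\<dots> \<le> B * (sqrt (measure lebesgue \<Omega>) * W12_norm \<Omega> w)"
    unfolding W12_norm_def using g2 N g(2) B
    by (intro mult_left_mono real_sqrt_le_mono integral_mono) auto
  finally show ?thesis by (simp add: mult.assoc)
qed

text \<open>Pairing a component with a bounded measurable \<phi> is a bounded linear functional on
  \<open>W12 \<Omega>\<close>, to which weak convergence applies. For the gradient, linearity of the
  functional rests on the almost everywhere linearity of \<open>weak_gradient\<close>.\<close>

lemma weak_convergence_components:
  assumes \<Omega>: "open \<Omega>" "bounded \<Omega>" and c: "weakly_converges_W12 \<Omega> un u"
    and \<phi>: "\<phi> \<in> borel_measurable (lebesgue_on \<Omega>)" "\<And>x. \<bar>\<phi> x\<bar> \<le> B"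
  shows "(\<lambda>n. \<integral>x. un n x $ i * \<phi> x \<partial>lebesgue_on \<Omega>) \<longlonglongrightarrow> (\<integral>x. u x $ i * \<phi> x \<partial>lebesgue_on \<Omega>)"
    and "(\<lambda>n. \<integral>x. weak_gradient \<Omega> (un n) x $ i $ j * \<phi> x \<partial>lebesgue_on \<Omega>)
      \<longlonglongrightarrow> (\<integral>x. weak_gradient \<Omega> u x $ i $ j * \<phi> x \<partial>lebesgue_on \<Omega>)"
proof -
  let ?D = "weak_gradient \<Omega>"
  have int: "integrable (lebesgue_on \<Omega>) (\<lambda>x. w x $ i * \<phi> x)"
    "integrable (lebesgue_on \<Omega>) (\<lambda>x. ?D w x $ i $ j * \<phi> x)" if "w \<in> W12 \<Omega>" for w
    using W12_comp_integrable[OF \<Omega> that] \<phi> by (auto intro!: integrable_mult_bounded[where B=B])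
  have 1: "(\<lambda>w. \<integral>x. w x $ i * \<phi> x \<partial>lebesgue_on \<Omega>) \<in> W12_dual \<Omega>"
    unfolding W12_dual_def mem_Collect_eq
  proof (intro conjI ballI allI exI)
    fix w assume w: "w \<in> W12 \<Omega>"
    show "\<bar>\<integral>x. w x $ i * \<phi> x \<partial>lebesgue_on \<Omega>\<bar> \<le> (B * sqrt (measure lebesgue \<Omega>)) * W12_norm \<Omega> w"
    proof (rule W12_functional_bound[OF \<Omega> w W12_comp_measurable(1)[OF w] _ \<phi>])
      fix x
      have "(w x $ i)\<^sup>2 \<le> (norm (w x))\<^sup>2"
        by (rule component_square_le_norm)
      then show "(w x $ i)\<^sup>2 \<le> (norm (w x))\<^sup>2 + (norm (?D w x))\<^sup>2" by (simp add: add_increasing2)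
    qed
    show "(\<integral>x. (c *\<^sub>R w x) $ i * \<phi> x \<partial>lebesgue_on \<Omega>) = c * (\<integral>x. w x $ i * \<phi> x \<partial>lebesgue_on \<Omega>)" for c
      by (simp add: mult.assoc)
    fix v assume "v \<in> W12 \<Omega>"
    then show "(\<integral>x. (w x + v x) $ i * \<phi> x \<partial>lebesgue_on \<Omega>)
      = (\<integral>x. w x $ i * \<phi> x \<partial>lebesgue_on \<Omega>) + (\<integral>x. v x $ i * \<phi> x \<partial>lebesgue_on \<Omega>)"
      using int w by (simp add: distrib_right)
  qed
  have 2: "(\<lambda>w. \<integral>x. ?D w x $ i $ j * \<phi> x \<partial>lebesgue_on \<Omega>) \<in> W12_dual \<Omega>"
    unfolding W12_dual_def mem_Collect_eq
  proof (intro conjI ballI allI exI)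
    fix w assume w: "w \<in> W12 \<Omega>"
    show "\<bar>\<integral>x. ?D w x $ i $ j * \<phi> x \<partial>lebesgue_on \<Omega>\<bar> \<le> (B * sqrt (measure lebesgue \<Omega>)) * W12_norm \<Omega> w"
    proof (rule W12_functional_bound[OF \<Omega> w W12_comp_measurable(2)[OF w] _ \<phi>])
      fix x
      have "(?D w x $ i $ j)\<^sup>2 \<le> (norm (?D w x))\<^sup>2"
        by (rule component_square_le_norm)
      then show "(?D w x $ i $ j)\<^sup>2 \<le> (norm (w x))\<^sup>2 + (norm (?D w x))\<^sup>2" by (simp add: add_increasing)
    qed
    show "(\<integral>x. ?D (\<lambda>x. c *\<^sub>R w x) x $ i $ j * \<phi> x \<partial>lebesgue_on \<Omega>) = c * (\<integral>x. ?D w x $ i $ j * \<phi> x \<partial>lebesgue_on \<Omega>)" for c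
    proof -
      have h: "has_weak_gradient \<Omega> (\<lambda>x. c *\<^sub>R w x) (?D (\<lambda>x. c *\<^sub>R w x))"
        using has_weak_gradient_scaleR[OF W12_weak_gradient[OF w]] by (rule weak_gradient_works)
      have "(\<integral>x. ?D (\<lambda>x. c *\<^sub>R w x) x $ i $ j * \<phi> x \<partial>lebesgue_on \<Omega>) = (\<integral>x. c * (?D w x $ i $ j * \<phi> x) \<partial>lebesgue_on \<Omega>)"
      proof (rule integral_cong_AE)
        show "AE x in lebesgue_on \<Omega>. ?D (\<lambda>x. c *\<^sub>R w x) x $ i $ j * \<phi> x = c * (?D w x $ i $ j * \<phi> x)"
          using weak_gradient_scaleR[OF \<Omega>(1) w, of c] by eventually_elim simp
      qed (use W12_comp_measurable(2)[OF w] \<phi>(1) in \<open>auto intro!: borel_measurable_times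
          locally_integrable_measurable[OF has_weak_gradient_locally_integrable(2)[OF h] \<Omega>(1)]\<close>)
      then show ?thesis by simp
    qed
    fix v assume v: "v \<in> W12 \<Omega>"
    have "(\<integral>x. ?D (\<lambda>x. w x + v x) x $ i $ j * \<phi> x \<partial>lebesgue_on \<Omega>)
      = (\<integral>x. ?D w x $ i $ j * \<phi> x + ?D v x $ i $ j * \<phi> x \<partial>lebesgue_on \<Omega>)"
    proof (rule integral_cong_AE)
      have h: "has_weak_gradient \<Omega> (\<lambda>x. w x + v x) (?D (\<lambda>x. w x + v x))"
        using has_weak_gradient_add[OF \<Omega>(1) W12_weak_gradient[OF w] W12_weak_gradient[OF v]]
        by (rule weak_gradient_works)
      show "(\<lambda>x. ?D (\<lambda>x. w x + v x) x $ i $ j * \<phi> x) \<in> borel_measurable (lebesgue_on \<Omega>)"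
        by (intro borel_measurable_times \<phi>(1)
            locally_integrable_measurable[OF has_weak_gradient_locally_integrable(2)[OF h] \<Omega>(1)])
      show "AE x in lebesgue_on \<Omega>. ?D (\<lambda>x. w x + v x) x $ i $ j * \<phi> x = ?D w x $ i $ j * \<phi> x + ?D v x $ i $ j * \<phi> x"
        using weak_gradient_add[OF \<Omega>(1) w v] by eventually_elim (simp add: distrib_right)
    qed (use int w v in auto)
    then show "(\<integral>x. ?D (\<lambda>x. w x + v x) x $ i $ j * \<phi> x \<partial>lebesgue_on \<Omega>)
      = (\<integral>x. ?D w x $ i $ j * \<phi> x \<partial>lebesgue_on \<Omega>) + (\<integral>x. ?D v x $ i $ j * \<phi> x \<partial>lebesgue_on \<Omega>)"
      using int w v by simp
  qed
  show "(\<lambda>n. \<integral>x. un n x $ i * \<phi> x \<partial>lebesgue_on \<Omega>) \<longlonglongrightarrow> (\<integral>x. u x $ i * \<phi> x \<partial>lebesgue_on \<Omega>)"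
    "(\<lambda>n. \<integral>x. ?D (un n) x $ i $ j * \<phi> x \<partial>lebesgue_on \<Omega>) \<longlonglongrightarrow> (\<integral>x. ?D u x $ i $ j * \<phi> x \<partial>lebesgue_on \<Omega>)"
    using c 1 2 unfolding weakly_converges_W12_def by auto
qed

section \<open>Weak convergence in L1\<close>

text \<open>The bound on \<phi> is asked only almost everywhere, so that weights known up to null
  sets can be used as test functions.\<close>

definition weak_L1 :: "'a measure \<Rightarrow> (nat \<Rightarrow> 'a \<Rightarrow> real) \<Rightarrow> ('a \<Rightarrow> real) \<Rightarrow> bool" where
  "weak_L1 N fn f \<longleftrightarrow> (\<forall>n. integrable N (fn n)) \<and> integrable N f \<and>
     (\<forall>\<phi> B. \<phi> \<in> borel_measurable N \<longrightarrow> (AE x in N. \<bar>\<phi> x\<bar> \<le> B) \<longrightarrow>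
       (\<lambda>n. \<integral>x. fn n x * \<phi> x \<partial>N) \<longlonglongrightarrow> (\<integral>x. f x * \<phi> x \<partial>N))"

lemma weak_L1D:
  assumes "weak_L1 N fn f"
  shows "integrable N (fn n)" "integrable N f"
    "\<phi> \<in> borel_measurable N \<Longrightarrow> AE x in N. \<bar>\<phi> x\<bar> \<le> B \<Longrightarrow> (\<lambda>n. \<integral>x. fn n x * \<phi> x \<partial>N) \<longlonglongrightarrow> (\<integral>x. f x * \<phi> x \<partial>N)"
  using assms unfolding weak_L1_def by auto

text \<open>Truncating \<phi> at the level \<open>\<bar>B\<bar>\<close> changes it only on a null
  set and turns a bound almost everywhere into a pointwise one.\<close>

lemma weak_L1_boundedI:
  assumes i: "\<And>n. integrable N (fn n)" "integrable N f"
    and lim: "\<And>\<phi> B. \<phi> \<in> borel_measurable N \<Longrightarrow> (\<And>x. \<bar>\<phi> x\<bar> \<le> B) \<Longrightarrow>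
      (\<lambda>n. \<integral>x. fn n x * \<phi> x \<partial>N) \<longlonglongrightarrow> (\<integral>x. f x * \<phi> x \<partial>N)"
  shows "weak_L1 N fn f"
  unfolding weak_L1_def
proof (intro conjI allI impI i)
  fix \<phi> :: "'a \<Rightarrow> real" and B :: real
  assume \<phi>[measurable]: "\<phi> \<in> borel_measurable N" and B: "AE x in N. \<bar>\<phi> x\<bar> \<le> B"
  define \<psi> where "\<psi> x = max (- \<bar>B\<bar>) (min \<bar>B\<bar> (\<phi> x))" for x
  have [measurable]: "\<psi> \<in> borel_measurable N" unfolding \<psi>_def by measurable
  have b: "\<bar>\<psi> x\<bar> \<le> \<bar>B\<bar>" for x by (auto simp: \<psi>_def)
  have "AE x in N. \<psi> x = \<phi> x" using B by eventually_elim (auto simp: \<psi>_def)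
  then have eq: "(\<integral>x. g x * \<psi> x \<partial>N) = (\<integral>x. g x * \<phi> x \<partial>N)" if "integrable N g" for g
    using borel_measurable_integrable[OF that] by (intro integral_cong_AE) auto
  show "(\<lambda>n. \<integral>x. fn n x * \<phi> x \<partial>N) \<longlonglongrightarrow> (\<integral>x. f x * \<phi> x \<partial>N)"
    using lim[of \<psi> "\<bar>B\<bar>"] b by (simp add: eq i)
qed

lemma weak_L1_add:
  assumes "weak_L1 N fn f" "weak_L1 N gn g"
  shows "weak_L1 N (\<lambda>n x. fn n x + gn n x) (\<lambda>x. f x + g x)"
  unfolding weak_L1_def
proof (intro conjI allI impI)
  fix \<phi> :: "'a \<Rightarrow> real" and B :: real
  assume \<phi>: "\<phi> \<in> borel_measurable N" "AE x in N. \<bar>\<phi> x\<bar> \<le> B"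
  have "integrable N (\<lambda>x. fn n x * \<phi> x)" "integrable N (\<lambda>x. gn n x * \<phi> x)" for n
    using weak_L1D(1)[OF assms(1)] weak_L1D(1)[OF assms(2)] \<phi> by (auto intro: integrable_mult_bounded)
  moreover have "integrable N (\<lambda>x. f x * \<phi> x)" "integrable N (\<lambda>x. g x * \<phi> x)"
    using weak_L1D(2)[OF assms(1)] weak_L1D(2)[OF assms(2)] \<phi> by (auto intro: integrable_mult_bounded)
  ultimately show "(\<lambda>n. \<integral>x. (fn n x + gn n x) * \<phi> x \<partial>N) \<longlonglongrightarrow> (\<integral>x. (f x + g x) * \<phi> x \<partial>N)"
    using tendsto_add[OF weak_L1D(3)[OF assms(1) \<phi>] weak_L1D(3)[OF assms(2) \<phi>]] by (simp add: distrib_right)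
qed (use weak_L1D[OF assms(1)] weak_L1D[OF assms(2)] in auto)

lemma weak_L1_mult:
  assumes f: "weak_L1 N fn f" and c: "c \<in> borel_measurable N" "AE x in N. \<bar>c x\<bar> \<le> C"
  shows "weak_L1 N (\<lambda>n x. c x * fn n x) (\<lambda>x. c x * f x)"
  unfolding weak_L1_def
proof (intro conjI allI impI)
  fix \<phi> :: "'a \<Rightarrow> real" and B :: real
  assume \<phi>: "\<phi> \<in> borel_measurable N" "AE x in N. \<bar>\<phi> x\<bar> \<le> B"
  have "AE x in N. \<bar>c x * \<phi> x\<bar> \<le> \<bar>C\<bar> * \<bar>B\<bar>"
    using c(2) \<phi>(2) by eventually_elim (auto simp: abs_mult intro!: mult_mono)
  then have "(\<lambda>n. \<integral>x. fn n x * (c x * \<phi> x) \<partial>N) \<longlonglongrightarrow> (\<integral>x. f x * (c x * \<phi> x) \<partial>N)"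
    using c \<phi> by (intro weak_L1D(3)[OF f]) auto
  then show "(\<lambda>n. \<integral>x. c x * fn n x * \<phi> x \<partial>N) \<longlonglongrightarrow> (\<integral>x. c x * f x * \<phi> x \<partial>N)"
    by (simp add: mult_ac)
qed (use weak_L1D[OF f] c integrable_mult_bounded[of N _ c C] in \<open>auto simp: mult.commute[of "c _"]\<close>)

lemma weak_L1_diff:
  assumes "weak_L1 N fn f" "weak_L1 N gn g"
  shows "weak_L1 N (\<lambda>n x. fn n x - gn n x) (\<lambda>x. f x - g x)"
  using weak_L1_add[OF assms(1) weak_L1_mult[OF assms(2), of "\<lambda>_. -1" 1]] by simp

text \<open>Testing with the indicator of the set where the limit exceeds \<open>M\<close> forces
  the excess to have integral 0.\<close>

lemma weak_L1_limit_le: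
  assumes "finite_measure N" and f: "weak_L1 N fn f" and le: "\<And>n. AE x in N. fn n x \<le> M"
  shows "AE x in N. f x \<le> M"
proof -
  interpret finite_measure N by fact
  define \<phi> where "\<phi> x = (if f x > M then 1 else 0 :: real)" for x
  have fm [measurable]: "f \<in> borel_measurable N" "fn n \<in> borel_measurable N" for n using weak_L1D[OF f] by auto
  have \<phi>[measurable]: "\<phi> \<in> borel_measurable N" unfolding \<phi>_def by measurable
  have \<phi>1: "\<bar>\<phi> x\<bar> \<le> 1" for x by (simp add: \<phi>_def)
  have i: "integrable N (\<lambda>x. g x * \<phi> x)" if "integrable N g" for g
    by (rule integrable_mult_bounded[OF that \<phi>]) (use \<phi>1 in auto)
  have \<phi>i: "integrable N \<phi>" using i[of "\<lambda>_. 1"] by simp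
  have "(\<integral>x. f x * \<phi> x \<partial>N) \<le> (\<integral>x. M * \<phi> x \<partial>N)"
  proof (rule LIMSEQ_le_const2[OF weak_L1D(3)[OF f \<phi>]])
    show "AE x in N. \<bar>\<phi> x\<bar> \<le> 1" using \<phi>1 by simp
    show "\<exists>n0. \<forall>n\<ge>n0. (\<integral>x. fn n x * \<phi> x \<partial>N) \<le> (\<integral>x. M * \<phi> x \<partial>N)"
    proof (intro exI allI impI integral_mono_AE)
      show "AE x in N. fn n x * \<phi> x \<le> M * \<phi> x" for n
        using le[of n] by eventually_elim (simp add: \<phi>_def)
    qed (use i weak_L1D[OF f] \<phi>i in auto)
  qed
  then have "(\<integral>x. (f x - M) * \<phi> x \<partial>N) \<le> 0"
    using i[OF weak_L1D(2)[OF f]] \<phi>i by (simp add: left_diff_distrib)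
  moreover have nn: "(f x - M) * \<phi> x \<ge> 0" for x by (simp add: \<phi>_def)
  moreover have ii: "integrable N (\<lambda>x. (f x - M) * \<phi> x)"
    by (rule i) (use weak_L1D[OF f] in auto)
  ultimately have "(\<integral>x. (f x - M) * \<phi> x \<partial>N) = 0"
    using Bochner_Integration.integral_nonneg[of N "\<lambda>x. (f x - M) * \<phi> x"] by (meson antisym)
  then have "AE x in N. (f x - M) * \<phi> x = 0"
    using integral_nonneg_eq_0_iff_AE[OF ii] nn by blast
  then show ?thesis by eventually_elim (auto simp: \<phi>_def split: if_splits)
qed

lemma weak_L1_limit_abs_le:
  assumes N: "finite_measure N" and f: "weak_L1 N fn f" and le: "\<And>n. AE x in N. \<bar>fn n x\<bar> \<le> M"
  shows "AE x in N. \<bar>f x\<bar> \<le> M"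
proof -
  have "AE x in N. f x \<le> M"
  proof (rule weak_L1_limit_le[OF N f])
    show "AE x in N. fn n x \<le> M" for n using le[of n] by eventually_elim auto
  qed
  moreover have "AE x in N. -1 * f x \<le> M"
  proof (rule weak_L1_limit_le[OF N weak_L1_mult[OF f, of "\<lambda>_. -1" 1]])
    show "AE x in N. - 1 * fn n x \<le> M" for n using le[of n] by eventually_elim auto
  qed auto
  ultimately show ?thesis by eventually_elim auto
qed

lemma weak_L1_limit_0:
  assumes N: "finite_measure N" and f: "weak_L1 N fn f" and le: "\<And>n. AE x in N. fn n x = 0"
  shows "AE x in N. f x = 0"
proof -
  have "AE x in N. \<bar>f x\<bar> \<le> 0" by (rule weak_L1_limit_abs_le[OF N f]) (use le in simp)
  then show ?thesis by eventually_elim simp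
qed

text \<open>Takes the place of Cauchy-Schwarz under the integral: the free weight \<open>t\<close>
  trades a factor that becomes small against one that is merely bounded.\<close>

lemma young_weighted:
  fixes d b t :: real
  assumes "t > 0"
  shows "\<bar>d * b\<bar> \<le> (1 / (2 * t)) * d\<^sup>2 + (t / 2) * b\<^sup>2"
proof -
  have "0 \<le> (\<bar>d\<bar> - t * \<bar>b\<bar>)\<^sup>2" by simp
  also have "\<dots> = d\<^sup>2 - 2 * t * \<bar>d * b\<bar> + t\<^sup>2 * b\<^sup>2"
    by (simp add: power2_diff power_mult_distrib abs_mult)
  finally have "\<bar>d * b\<bar> \<le> (d\<^sup>2 + t\<^sup>2 * b\<^sup>2) / (2 * t)"
    using assms by (simp add: pos_le_divide_eq mult_ac)
  also have "\<dots> = (1 / (2 * t)) * d\<^sup>2 + (t / 2) * b\<^sup>2"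
    using assms by (simp add: field_simps power2_eq_square)
  finally show ?thesis .
qed

text \<open>On a finite measure space a bounded sequence converging almost everywhere converges in
  L2, so against \<open>bn\<close>, bounded in L2, the difference of \<open>an n\<close> and
  \<open>a\<close> contributes nothing in the limit. The fixed factor \<open>a\<close> is an
  admissible weight for the weak convergence of \<open>bn\<close>.\<close>

lemma weak_strong_product:
  assumes N: "finite_measure N" and b: "weak_L1 N bn b"
    and b2: "\<And>n. integrable N (\<lambda>x. (bn n x)\<^sup>2)" "\<And>n. (\<integral>x. (bn n x)\<^sup>2 \<partial>N) \<le> C"
    and am [measurable]: "\<And>n. an n \<in> borel_measurable N" "a \<in> borel_measurable N"
    and ab: "\<And>n. AE x in N. \<bar>an n x\<bar> \<le> A" and lim: "AE x in N. (\<lambda>n. an n x) \<longlonglongrightarrow> a x"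
  shows "(\<lambda>n. \<integral>x. an n x * bn n x \<partial>N) \<longlonglongrightarrow> (\<integral>x. a x * b x \<partial>N)"
proof -
  interpret finite_measure N by fact
  have [measurable]: "bn n \<in> borel_measurable N" "b \<in> borel_measurable N" for n using weak_L1D[OF b] by auto
  have "AE x in N. \<forall>n. \<bar>an n x\<bar> \<le> A" using ab by (simp add: AE_all_countable)
  then have aA: "AE x in N. \<bar>a x\<bar> \<le> A"
    using lim
  proof eventually_elim
    case (elim x)
    have "(\<lambda>n. \<bar>an n x\<bar>) \<longlonglongrightarrow> \<bar>a x\<bar>" by (intro tendsto_intros elim)
    then show ?case by (rule LIMSEQ_le_const2) (use elim in auto)
  qed
  have d2: "AE x in N. (an n x - a x)\<^sup>2 \<le> (2 * A)\<^sup>2" for n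
    using aA ab[of n]
  proof eventually_elim
    case (elim x)
    then have "\<bar>an n x - a x\<bar> \<le> \<bar>2 * A\<bar>" by linarith
    then show ?case by (simp only: abs_le_square_iff)
  qed
  have di: "integrable N (\<lambda>x. (an n x - a x)\<^sup>2)" for n
    by (rule Bochner_Integration.integrable_bound[of _ "\<lambda>_. (2 * A)\<^sup>2"]) (use d2[of n] in auto)
  have dlim: "(\<lambda>n. \<integral>x. (an n x - a x)\<^sup>2 \<partial>N) \<longlonglongrightarrow> (\<integral>x. 0 \<partial>N)"
  proof (rule integral_dominated_convergence[where w="\<lambda>_. (2 * A)\<^sup>2"])
    show "AE x in N. (\<lambda>n. (an n x - a x)\<^sup>2) \<longlonglongrightarrow> 0"
      using lim
    proof eventually_elim
      case (elim x)
      have "(\<lambda>n. (an n x - a x)\<^sup>2) \<longlonglongrightarrow> (a x - a x)\<^sup>2" by (intro tendsto_intros elim)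
      then show ?case by simp
    qed
  qed (use d2 in auto)
  have ib: "integrable N (\<lambda>x. an n x * bn n x)" "integrable N (\<lambda>x. a x * bn n x)" for n
    using integrable_mult_bounded[OF weak_L1D(1)[OF b] am(1) ab] integrable_mult_bounded[OF weak_L1D(1)[OF b] am(2) aA]
    by (simp_all add: mult.commute)
  have "(\<lambda>n. \<integral>x. (an n x - a x) * bn n x \<partial>N) \<longlonglongrightarrow> 0"
  proof (rule LIMSEQ_I)
    fix e :: real assume e: "e > 0"
    have C: "C \<ge> 0" using order_trans[OF integral_nonneg_AE b2(2)[of 0]] by simp
    \<comment> \<open>With this weight in Young's inequality the term in \<open>bn\<close> is at
      most \<open>e / 2\<close>; the other one drops below \<open>e / 2\<close> once the L2 error is
      less than \<open>e * t\<close>.\<close>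
    define t where "t = e / (C + 1)"
    have t: "t > 0" "t * C \<le> e" using e C by (auto simp: t_def field_simps)
    have "eventually (\<lambda>n. (\<integral>x. (an n x - a x)\<^sup>2 \<partial>N) < e * t) sequentially"
      using dlim e t by (intro order_tendstoD) auto
    then obtain n0 where n0: "\<And>n. n \<ge> n0 \<Longrightarrow> (\<integral>x. (an n x - a x)\<^sup>2 \<partial>N) < e * t"
      by (auto simp: eventually_sequentially)
    have "norm ((\<integral>x. (an n x - a x) * bn n x \<partial>N) - 0) < e" if "n \<ge> n0" for n
    proof -
      have "\<bar>\<integral>x. (an n x - a x) * bn n x \<partial>N\<bar> \<le> (\<integral>x. \<bar>(an n x - a x) * bn n x\<bar> \<partial>N)" by simp
      also have "\<dots> \<le> (\<integral>x. (1 / (2 * t)) * (an n x - a x)\<^sup>2 + (t / 2) * (bn n x)\<^sup>2 \<partial>N)"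
      proof (rule integral_mono)
        show "\<bar>(an n x - a x) * bn n x\<bar> \<le> (1 / (2 * t)) * (an n x - a x)\<^sup>2 + (t / 2) * (bn n x)\<^sup>2" for x
          by (rule young_weighted[OF t(1)])
      qed (use ib di b2 in \<open>auto simp: left_diff_distrib\<close>)
      also have "\<dots> = (1 / (2 * t)) * (\<integral>x. (an n x - a x)\<^sup>2 \<partial>N) + (t / 2) * (\<integral>x. (bn n x)\<^sup>2 \<partial>N)"
        using di b2 by simp
      also have "\<dots> < (1 / (2 * t)) * (e * t) + (t / 2) * C"
        using n0[OF that] b2(2)[of n] t by (intro add_less_le_mono mult_strict_left_mono mult_left_mono) auto
      also have "\<dots> \<le> e" using t by (simp add: field_simps)
      finally show ?thesis by simp
    qed
    then show "\<exists>n0. \<forall>n\<ge>n0. norm ((\<integral>x. (an n x - a x) * bn n x \<partial>N) - 0) < e" by blast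
  qed
  moreover have "(\<lambda>n. \<integral>x. a x * bn n x \<partial>N) \<longlonglongrightarrow> (\<integral>x. a x * b x \<partial>N)"
    using weak_L1D(3)[OF b am(2) aA] by (simp add: mult.commute)
  ultimately have "(\<lambda>n. (\<integral>x. (an n x - a x) * bn n x \<partial>N) + (\<integral>x. a x * bn n x \<partial>N)) \<longlonglongrightarrow> 0 + (\<integral>x. a x * b x \<partial>N)"
    by (rule tendsto_add)
  moreover have "(\<integral>x. (an n x - a x) * bn n x \<partial>N) + (\<integral>x. a x * bn n x \<partial>N) = (\<integral>x. an n x * bn n x \<partial>N)" for n
    using ib by (simp add: left_diff_distrib)
  ultimately show ?thesis by simp
qed

lemma weak_L1_components:
  assumes \<Omega>: "open \<Omega>" "bounded \<Omega>" and c: "weakly_converges_W12 \<Omega> un u"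
  shows "weak_L1 (lebesgue_on \<Omega>) (\<lambda>n x. un n x $ i) (\<lambda>x. u x $ i)"
    and "weak_L1 (lebesgue_on \<Omega>) (\<lambda>n x. weak_gradient \<Omega> (un n) x $ i $ j) (\<lambda>x. weak_gradient \<Omega> u x $ i $ j)"
proof -
  have W: "un n \<in> W12 \<Omega>" "u \<in> W12 \<Omega>" for n using c unfolding weakly_converges_W12_def by auto
  show "weak_L1 (lebesgue_on \<Omega>) (\<lambda>n x. un n x $ i) (\<lambda>x. u x $ i)"
    by (rule weak_L1_boundedI[OF W12_comp_integrable(1)[OF \<Omega> W(1)] W12_comp_integrable(1)[OF \<Omega> W(2)]
          weak_convergence_components(1)[OF \<Omega> c]])
  show "weak_L1 (lebesgue_on \<Omega>) (\<lambda>n x. weak_gradient \<Omega> (un n) x $ i $ j) (\<lambda>x. weak_gradient \<Omega> u x $ i $ j)"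
    by (rule weak_L1_boundedI[OF W12_comp_integrable(2)[OF \<Omega> W(1)] W12_comp_integrable(2)[OF \<Omega> W(2)]
          weak_convergence_components(2)[OF \<Omega> c]])
qed

section \<open>Convergence almost everywhere along a subsequence\<close>

definition zero_ext :: "'a set \<Rightarrow> ('a \<Rightarrow> real) \<Rightarrow> 'a \<Rightarrow> real" where
  "zero_ext \<Omega> f x = indicator \<Omega> x * f x"

lemma zero_ext_simps [simp]:
  "x \<notin> \<Omega> \<Longrightarrow> zero_ext \<Omega> f x = 0" "x \<in> \<Omega> \<Longrightarrow> zero_ext \<Omega> f x = f x"
  by (simp_all add: zero_ext_def)

lemma zero_ext_square: "(zero_ext \<Omega> f x)\<^sup>2 = zero_ext \<Omega> (\<lambda>x. (f x)\<^sup>2) x"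
  by (cases "x \<in> \<Omega>") auto

lemma integrable_zero_ext:
  "open \<Omega> \<Longrightarrow> integrable lebesgue (zero_ext \<Omega> f) \<longleftrightarrow> integrable (lebesgue_on \<Omega>) f"
  for \<Omega> :: "'a::euclidean_space set"
  using integrable_lebesgue_on[of \<Omega> f] by (simp add: zero_ext_def[abs_def])

lemma integral_zero_ext_mult:
  "open \<Omega> \<Longrightarrow> (\<integral>x. zero_ext \<Omega> f x * \<phi> x \<partial>lebesgue) = (\<integral>x. f x * \<phi> x \<partial>lebesgue_on \<Omega>)"
  for \<Omega> :: "'a::euclidean_space set"
  using integral_lebesgue_on[of \<Omega> "\<lambda>x. f x * \<phi> x"] by (simp add: zero_ext_def mult.assoc)

lemma Basis_real_vec_axis: "b \<in> (Basis :: (real^'n) set) \<Longrightarrow> \<exists>j. b = axis j 1"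
  by (auto simp: Basis_vec_def)

lemma matrix_vector_axis: "((D :: real^'n^'m) *v axis j 1) $ i = D $ i $ j"
  by (simp add: matrix_vector_mult_basis column_def)

lemma W12_zero_ext:
  assumes \<Omega>: "open \<Omega>" "bounded \<Omega>" and u: "u \<in> W12 \<Omega>"
  shows "integrable lebesgue (zero_ext \<Omega> (\<lambda>x. u x $ i))"
    "integrable lebesgue (\<lambda>x. (zero_ext \<Omega> (\<lambda>x. u x $ i) x)\<^sup>2)"
    "integrable lebesgue (zero_ext \<Omega> (\<lambda>x. weak_gradient \<Omega> u x $ i $ j))"
    "integrable lebesgue (\<lambda>x. (zero_ext \<Omega> (\<lambda>x. weak_gradient \<Omega> u x $ i $ j) x)\<^sup>2)"
    "weak_partials \<Omega> (zero_ext \<Omega> (\<lambda>x. u x $ i)) (\<lambda>b. zero_ext \<Omega> (\<lambda>x. (weak_gradient \<Omega> u x *v b) $ i))"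
proof -
  show "weak_partials \<Omega> (zero_ext \<Omega> (\<lambda>x. u x $ i)) (\<lambda>b. zero_ext \<Omega> (\<lambda>x. (weak_gradient \<Omega> u x *v b) $ i))"
    unfolding weak_partials_def
  proof (intro ballI)
    fix \<phi> :: "real^3 \<Rightarrow> real" and b :: "real^3" assume \<phi>: "\<phi> \<in> test_functions \<Omega>" and b: "b \<in> Basis"
    then obtain j where j: "b = axis j 1" using Basis_real_vec_axis by blast
    show "(\<integral>x. zero_ext \<Omega> (\<lambda>x. u x $ i) x * frechet_derivative \<phi> (at x) b \<partial>lebesgue)
      = - (\<integral>x. zero_ext \<Omega> (\<lambda>x. (weak_gradient \<Omega> u x *v b) $ i) x * \<phi> x \<partial>lebesgue)"
      unfolding integral_zero_ext_mult[OF \<Omega>(1)] j matrix_vector_axis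
      by (rule has_weak_gradientD[OF W12_weak_gradient[OF u] \<phi>])
  qed
qed (use \<Omega> W12_comp_integrable[OF \<Omega> u] W12_comp_square[OF u] in
    \<open>simp_all add: zero_ext_square integrable_zero_ext\<close>)

text \<open>Each component converges in L2, so the sum of the squared errors converges in L1, and a
  subsequence of this sum tends to 0 almost everywhere; all components then converge
  together.\<close>

lemma weak_convergence_AE_subsequence:
  assumes \<Omega>: "open \<Omega>" "bounded \<Omega>" and c: "weakly_converges_W12 \<Omega> un u"
    and M: "\<And>n. AE x in lebesgue_on \<Omega>. norm (un n x) \<le> M"
    and C: "\<And>n. (\<integral>x. (norm (weak_gradient \<Omega> (un n) x))\<^sup>2 \<partial>lebesgue_on \<Omega>) \<le> C"
  obtains r :: "nat \<Rightarrow> nat" where "strict_mono r" "AE x in lebesgue_on \<Omega>. (\<lambda>n. un (r n) x) \<longlonglongrightarrow> u x"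
proof -
  have W: "un n \<in> W12 \<Omega>" "u \<in> W12 \<Omega>" for n using c unfolding weakly_converges_W12_def by auto
  have s: "\<Omega> \<in> sets lebesgue" using \<Omega> by simp
  note fm = finite_measure_bounded_open[OF \<Omega>]
  have Mi: "AE x in lebesgue_on \<Omega>. \<bar>un n x $ i\<bar> \<le> M" for n i
    using M[of n] by eventually_elim (metis component_le_norm_cart order_trans)
  have Mu: "AE x in lebesgue_on \<Omega>. \<bar>u x $ i\<bar> \<le> M" for i
    by (rule weak_L1_limit_abs_le[OF fm weak_L1_components(1)[OF \<Omega> c] Mi])
  have ext: "AE x in lebesgue. \<bar>zero_ext \<Omega> f x\<bar> \<le> \<bar>M\<bar>" if "AE x in lebesgue_on \<Omega>. \<bar>f x\<bar> \<le> M" for f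
    using that unfolding AE_lebesgue_on[OF s] by eventually_elim (auto simp: zero_ext_def indicator_def)
  let ?f = "\<lambda>n i. zero_ext \<Omega> (\<lambda>x. un n x $ i)" and ?g = "\<lambda>i. zero_ext \<Omega> (\<lambda>x. u x $ i)"
  have lim: "(\<lambda>n. sqnorm (\<lambda>x. ?f n i x - ?g i x)) \<longlonglongrightarrow> 0" for i
  \<comment> \<open>Each of the three partial derivatives of a component has squared norm at most
    \<open>C\<close>, whence \<open>3 * C\<close>. Outside \<Omega> the extension is 0 and asks for
    a nonnegative bound, whence \<open>\<bar>M\<bar>\<close>.\<close>
  proof (rule strong_convergence_scalar[OF \<Omega>, where G="\<lambda>n b. zero_ext \<Omega> (\<lambda>x. (weak_gradient \<Omega> (un n) x *v b) $ i)" and C="3 * C" and M="\<bar>M\<bar>"])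
    show "integrable lebesgue (?f n i)" for n by (rule W12_zero_ext[OF \<Omega> W(1)])
    show "integrable lebesgue (?g i)" by (rule W12_zero_ext[OF \<Omega> W(2)])
    show "AE x in lebesgue. \<bar>?f n i x\<bar> \<le> \<bar>M\<bar>" for n by (rule ext[OF Mi])
    show "AE x in lebesgue. \<bar>?g i x\<bar> \<le> \<bar>M\<bar>" by (rule ext[OF Mu])
    show "integrable lebesgue (zero_ext \<Omega> (\<lambda>x. (weak_gradient \<Omega> (un n) x *v b) $ i))" if b: "b \<in> Basis" for n b
      using Basis_real_vec_axis[OF b] W12_zero_ext(3)[OF \<Omega> W(1)] by (auto simp: matrix_vector_axis)
    show "weak_partials \<Omega> (?f n i) (\<lambda>b. zero_ext \<Omega> (\<lambda>x. (weak_gradient \<Omega> (un n) x *v b) $ i))" for n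
      by (rule W12_zero_ext[OF \<Omega> W(1)])
    show "(\<Sum>b\<in>Basis. sqnorm (zero_ext \<Omega> (\<lambda>x. (weak_gradient \<Omega> (un n) x *v b) $ i))) \<le> ennreal (3 * C)" for n
    proof -
      have C0: "C \<ge> 0" using order_trans[OF _ C[of n]] by simp
      have "sqnorm (zero_ext \<Omega> (\<lambda>x. (weak_gradient \<Omega> (un n) x *v b) $ i)) \<le> ennreal C" if b: "b \<in> Basis" for b
      proof -
        obtain j where j: "b = axis j 1" using Basis_real_vec_axis[OF b] by blast
        let ?d = "zero_ext \<Omega> (\<lambda>x. weak_gradient \<Omega> (un n) x $ i $ j)"
        have "sqnorm ?d = ennreal (\<integral>x. (?d x)\<^sup>2 \<partial>lebesgue)"
          by (rule nn_integral_eq_integral[OF W12_zero_ext(4)[OF \<Omega> W(1)]]) simp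
        also have "(\<integral>x. (?d x)\<^sup>2 \<partial>lebesgue) = (\<integral>x. (weak_gradient \<Omega> (un n) x $ i $ j)\<^sup>2 \<partial>lebesgue_on \<Omega>)"
          unfolding zero_ext_square using integral_zero_ext_mult[OF \<Omega>(1), of _ "\<lambda>_. 1"] by simp
        also have "\<dots> \<le> (\<integral>x. (norm (weak_gradient \<Omega> (un n) x))\<^sup>2 \<partial>lebesgue_on \<Omega>)"
          by (intro integral_mono component_square_le_norm W12_comp_square W12_square_gradient W)
        also have "\<dots> \<le> C" by (rule C)
        finally show ?thesis by (simp add: j matrix_vector_axis ennreal_leI)
      qed
      then have "(\<Sum>b\<in>Basis. sqnorm (zero_ext \<Omega> (\<lambda>x. (weak_gradient \<Omega> (un n) x *v b) $ i))) \<le> (\<Sum>b\<in>(Basis::(real^3) set). ennreal C)"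
        by (rule sum_mono)
      also have "\<dots> = ennreal (3 * C)" using C0 by (simp add: ennreal_mult)
      finally show ?thesis .
    qed
    fix \<phi> :: "real^3 \<Rightarrow> real" assume \<phi>: "\<phi> \<in> test_functions UNIV"
    obtain B where B: "B > 0" "\<And>x. \<bar>\<phi> x\<bar> \<le> B" by (rule test_functions_bounded[OF \<phi>], rule that)
    have "\<phi> \<in> borel_measurable (lebesgue_on \<Omega>)"
      using smooth_borel_lebesgue[OF test_functions_smooth[OF \<phi>]] by (rule measurable_restrict_space1)
    then show "(\<lambda>n. \<integral>y. ?f n i y * \<phi> y \<partial>lebesgue) \<longlonglongrightarrow> (\<integral>y. ?g i y * \<phi> y \<partial>lebesgue)"
      unfolding integral_zero_ext_mult[OF \<Omega>(1)] using B(2) by (rule weak_convergence_components[OF \<Omega> c])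
  qed auto
  let ?d = "\<lambda>n x. (\<Sum>i\<in>UNIV. (?f n i x - ?g i x)\<^sup>2)"
  have di: "integrable lebesgue (\<lambda>x. (?f n i x - ?g i x)\<^sup>2)" for n i
  proof -
    have "(\<lambda>x. (?f n i x - ?g i x)\<^sup>2) = zero_ext \<Omega> (\<lambda>x. (un n x $ i - u x $ i)\<^sup>2)"
      by (auto simp: fun_eq_iff zero_ext_def indicator_def)
    moreover have "integrable (lebesgue_on \<Omega>) (\<lambda>x. (un n x $ i - u x $ i)\<^sup>2)"
    proof (rule Bochner_Integration.integrable_bound[where f="\<lambda>x. 2 * (un n x $ i)\<^sup>2 + 2 * (u x $ i)\<^sup>2"])
      show "AE x in lebesgue_on \<Omega>. norm ((un n x $ i - u x $ i)\<^sup>2) \<le> norm (2 * (un n x $ i)\<^sup>2 + 2 * (u x $ i)\<^sup>2)"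
      proof (rule AE_I2)
        fix x
        have "0 \<le> (un n x $ i + u x $ i)\<^sup>2" by simp
        then have "(un n x $ i - u x $ i)\<^sup>2 \<le> 2 * (un n x $ i)\<^sup>2 + 2 * (u x $ i)\<^sup>2"
          by (simp add: power2_diff power2_sum)
        then show "norm ((un n x $ i - u x $ i)\<^sup>2) \<le> norm (2 * (un n x $ i)\<^sup>2 + 2 * (u x $ i)\<^sup>2)" by simp
      qed
    qed (use W12_comp_square(1)[OF W(1)] W12_comp_square(1)[OF W(2)] W12_comp_measurable(1)[OF W(1)] W12_comp_measurable(1)[OF W(2)] in auto)
    ultimately show ?thesis by (simp add: integrable_zero_ext \<Omega>)
  qed
  have "(\<lambda>n. \<integral>x. norm (?d n x) \<partial>lebesgue) \<longlonglongrightarrow> 0"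
  proof -
    have l: "(\<lambda>n. \<integral>x. (?f n i x - ?g i x)\<^sup>2 \<partial>lebesgue) \<longlonglongrightarrow> 0" for i
    proof (rule tendsto_ennrealD)
      show "(\<lambda>n. ennreal (\<integral>x. (?f n i x - ?g i x)\<^sup>2 \<partial>lebesgue)) \<longlonglongrightarrow> ennreal 0"
        using lim[of i] nn_integral_eq_integral[OF di] by simp
    qed auto
    have "norm (?d n x) = ?d n x" for n x by (simp add: sum_nonneg)
    then have "(\<integral>x. norm (?d n x) \<partial>lebesgue) = (\<Sum>i\<in>UNIV. \<integral>x. (?f n i x - ?g i x)\<^sup>2 \<partial>lebesgue)" for n
      using di by (simp only:) (rule Bochner_Integration.integral_sum)
    moreover have "(\<lambda>n. \<Sum>i\<in>UNIV. \<integral>x. (?f n i x - ?g i x)\<^sup>2 \<partial>lebesgue) \<longlonglongrightarrow> (\<Sum>i\<in>(UNIV::3 set). 0)"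
      by (intro tendsto_sum l)
    ultimately show ?thesis by simp
  qed
  moreover have "integrable lebesgue (?d n)" for n using di by auto
  ultimately obtain r :: "nat \<Rightarrow> nat" where r: "strict_mono r" "AE x in lebesgue. (\<lambda>n. ?d (r n) x) \<longlonglongrightarrow> 0"
    using tendsto_L1_AE_subseq[of lebesgue ?d] by blast
  have "AE x in lebesgue. x \<in> \<Omega> \<longrightarrow> (\<lambda>n. un (r n) x) \<longlonglongrightarrow> u x"
    using r(2)
  proof eventually_elim
    case (elim x)
    show ?case
    proof (intro impI vec_tendstoI)
      fix i assume x: "x \<in> \<Omega>"
      have "(\<lambda>n. (?f (r n) i x - ?g i x)\<^sup>2) \<longlonglongrightarrow> 0"
        by (rule tendsto_sandwich[OF _ _ tendsto_const elim])
          (auto intro!: always_eventually member_le_sum[where f="\<lambda>i. (?f (r _) i x - ?g i x)\<^sup>2"])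
      then show "(\<lambda>n. un (r n) x $ i) \<longlonglongrightarrow> u x $ i" using x by (simp add: LIM_zero_iff)
    qed
  qed
  then show ?thesis using that[OF r(1)] by (simp add: AE_lebesgue_on[OF s])
qed

section \<open>Axisymmetric maps\<close>

lemma vector3_eq: "(x :: real^3) = y \<longleftrightarrow> x $ 1 = y $ 1 \<and> x $ 2 = y $ 2 \<and> x $ 3 = y $ 3"
  by (simp add: vec_eq_iff forall_3)

lemma rotation_z_nth [simp]:
  "rotation_z \<theta> x $ 1 = cos \<theta> * x $ 1 - sin \<theta> * x $ 2"
  "rotation_z \<theta> x $ 2 = sin \<theta> * x $ 1 + cos \<theta> * x $ 2"
  "rotation_z \<theta> x $ 3 = x $ 3"
  by (simp_all add: rotation_z_def)

lemma rotation_z_linear: "linear (rotation_z \<theta>)"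
  by (rule linearI) (simp_all add: vector3_eq algebra_simps)

lemma rotation_z_diff: "rotation_z \<theta> (x - y) = rotation_z \<theta> x - rotation_z \<theta> y"
  using linear_diff[OF rotation_z_linear] .

lemma inner3: "(x :: real^3) \<bullet> y = x $ 1 * y $ 1 + x $ 2 * y $ 2 + x $ 3 * y $ 3"
  by (simp add: inner_vec_def sum_3)

lemma sin_cos_sq: "cos \<theta> * cos \<theta> + sin \<theta> * sin \<theta> = (1::real)"
  using sin_cos_squared_add[of \<theta>] by (simp add: power2_eq_square)

lemma rotation_z_orthogonal: "orthogonal_transformation (rotation_z \<theta>)"
proof -
  have "(c * a - s * b) * (c * a' - s * b') + (s * a + c * b) * (s * a' + c * b')
      = (c * c + s * s) * (a * a' + b * b')" for a b a' b' c s :: real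
    by (simp add: algebra_simps)
  then have "rotation_z \<theta> x \<bullet> rotation_z \<theta> y = x \<bullet> y" for x y
    unfolding inner3 rotation_z_nth by (simp only: sin_cos_sq mult_1)
  then show ?thesis by (simp add: orthogonal_transformation_def rotation_z_linear)
qed

lemma rotation_z_norm: "norm (rotation_z \<theta> x) = norm x"
  using orthogonal_transformation_norm[OF rotation_z_orthogonal] .

lemma rotation_z_inverse: "rotation_z (- \<theta>) (rotation_z \<theta> x) = x" "rotation_z \<theta> (rotation_z (- \<theta>) x) = x"
proof -
  have "c * (c * a - s * b) - (- s) * (s * a + c * b) = (c * c + s * s) * a"
    "(- s) * (c * a - s * b) + c * (s * a + c * b) = (c * c + s * s) * b"
    "c * (c * a - (- s) * b) - s * ((- s) * a + c * b) = (c * c + s * s) * a"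
    "s * (c * a - (- s) * b) + c * ((- s) * a + c * b) = (c * c + s * s) * b" for a b c s :: real
    by (simp_all add: algebra_simps)
  then show "rotation_z (- \<theta>) (rotation_z \<theta> x) = x" "rotation_z \<theta> (rotation_z (- \<theta>) x) = x"
    unfolding vector3_eq rotation_z_nth cos_minus sin_minus by (simp_all only: sin_cos_sq mult_1)
qed

lemma rotation_z_0: "rotation_z 0 x = x"
  by (simp add: vector3_eq)

lemma rotation_z_continuous: "continuous_on A (rotation_z \<theta>)"
  by (rule linear_continuous_on) (simp add: rotation_z_linear linear_conv_bounded_linear[symmetric])

lemma rotation_z_borel [measurable]: "rotation_z \<theta> \<in> borel_measurable borel"
  by (rule borel_measurable_continuous_onI[OF rotation_z_continuous])

text \<open>It suffices to compare boxes: the preimage of a box is its image under the inverse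
  rotation, and orthogonal images keep their measure.\<close>

lemma lborel_distr_rotation_z: "distr lborel borel (rotation_z \<theta>) = (lborel :: (real^3) measure)"
proof (rule lborel_eqI[symmetric])
  fix l u :: "real^3" assume lu: "\<And>b. b \<in> Basis \<Longrightarrow> l \<bullet> b \<le> u \<bullet> b"
  have vim: "rotation_z \<theta> -` box l u = rotation_z (- \<theta>) ` box l u"
    by (auto simp: rotation_z_inverse image_iff) (metis rotation_z_inverse(1))
  have "emeasure (distr lborel borel (rotation_z \<theta>)) (box l u) = emeasure lborel (rotation_z (- \<theta>) ` box l u)"
    by (simp add: emeasure_distr vim)
  also have "\<dots> = emeasure lebesgue (rotation_z (- \<theta>) ` box l u)"
    using measurable_sets[OF rotation_z_borel, of "box l u" \<theta>] by (simp add: vim)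
  also have "\<dots> = ennreal (measure lebesgue (rotation_z (- \<theta>) ` box l u))"
    using measurable_orthogonal_image[OF rotation_z_orthogonal, of "box l u" "- \<theta>"]
    by (simp add: emeasure_eq_measure2 lmeasurable_box)
  also have "measure lebesgue (rotation_z (- \<theta>) ` box l u) = measure lebesgue (box l u)"
    by (rule measure_orthogonal_image[OF rotation_z_orthogonal]) simp
  also have "\<dots> = (\<Prod>b\<in>Basis. (u - l) \<bullet> b)"
    using lu by (simp add: measure_lborel_box_eq)
  finally show "emeasure (distr lborel borel (rotation_z \<theta>)) (box l u) = ennreal (\<Prod>b\<in>Basis. (u - l) \<bullet> b)" .
qed simp

lemma AE_rotation_z:
  assumes "AE x in lebesgue. P x"
  shows "AE x in lebesgue. P (rotation_z \<theta> x)"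
proof -
  obtain N where N: "N \<in> null_sets lborel" "{x. \<not> P x} \<subseteq> N"
    using assms unfolding AE_completion_iff by (auto elim!: AE_E simp: null_sets_def)
  have "emeasure lborel (rotation_z \<theta> -` N) = emeasure (distr lborel borel (rotation_z \<theta>)) N"
    using N by (subst emeasure_distr) (auto simp: null_sets_def)
  also have "\<dots> = 0" using N(1) by (simp add: lborel_distr_rotation_z null_sets_def)
  finally have "rotation_z \<theta> -` N \<in> null_sets lborel"
    using N(1) measurable_sets[OF rotation_z_borel, of N \<theta>] by (auto simp: null_sets_def)
  then have "AE x in lborel. x \<notin> rotation_z \<theta> -` N" by (rule AE_not_in)
  then have "AE x in lborel. P (rotation_z \<theta> x)" by eventually_elim (use N(2) in auto)
  then show ?thesis by (rule AE_completion)
qed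

text \<open>The relation between \<open>h\<close> and \<open>k\<close> is only asked almost
  everywhere, because the equivariance of a Sobolev map is known only up to null sets.\<close>

lemma integral_rotation_z:
  fixes h k :: "real^3 \<Rightarrow> real"
  assumes h: "h \<in> borel_measurable lebesgue" and k: "k \<in> borel_measurable lebesgue"
    and hk: "AE x in lebesgue. h (rotation_z \<theta> x) = k x"
  shows "integral\<^sup>L lebesgue h = integral\<^sup>L lebesgue k"
proof -
  obtain g where g [measurable]: "g \<in> borel_measurable borel" and hg: "AE x in lebesgue. h x = g x"
    by (rule lebesgue_borel_representative[OF h])
  have gR: "(\<lambda>x. g (rotation_z \<theta> x)) \<in> borel_measurable borel" by measurable
  have "integral\<^sup>L lebesgue h = integral\<^sup>L lebesgue g"
    by (rule integral_cong_AE[OF h _ hg]) (simp add: measurable_completion)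
  also have "\<dots> = integral\<^sup>L lborel g" by (rule integral_completion) simp
  also have "\<dots> = integral\<^sup>L (distr lborel borel (rotation_z \<theta>)) g" by (simp add: lborel_distr_rotation_z)
  also have "\<dots> = (\<integral>x. g (rotation_z \<theta> x) \<partial>lborel)" by (rule integral_distr) auto
  also have "\<dots> = (\<integral>x. g (rotation_z \<theta> x) \<partial>lebesgue)" by (rule integral_completion[symmetric]) simp
  also have "\<dots> = integral\<^sup>L lebesgue k"
  proof (rule integral_cong_AE[OF _ k])
    show "(\<lambda>x. g (rotation_z \<theta> x)) \<in> borel_measurable lebesgue" using gR by (simp add: measurable_completion)
    show "AE x in lebesgue. g (rotation_z \<theta> x) = k x"
      using hk AE_rotation_z[OF hg, of \<theta>] by eventually_elim simp
  qed
  finally show ?thesis .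
qed

lemma axisymmetric_set_rotation: "axisymmetric_set \<Omega> \<Longrightarrow> rotation_z \<theta> x \<in> \<Omega> \<longleftrightarrow> x \<in> \<Omega>"
  unfolding axisymmetric_set_def by (metis imageE image_eqI rotation_z_inverse(1))

lemma cylindrical_coordinates:
  assumes "\<not> (x $ 1 = 0 \<and> x $ 2 = 0)"
  obtains r \<theta> where "r > 0" "(x :: real^3) = vector [r * cos \<theta>, r * sin \<theta>, x $ 3]"
proof -
  define r where "r = sqrt ((x $ 1)\<^sup>2 + (x $ 2)\<^sup>2)"
  have r: "r > 0" using assms by (simp add: r_def sum_power2_gt_zero_iff)
  have "r\<^sup>2 = (x $ 1)\<^sup>2 + (x $ 2)\<^sup>2" by (simp add: r_def)
  then have "(x $ 1 / r)\<^sup>2 + (x $ 2 / r)\<^sup>2 = r\<^sup>2 / r\<^sup>2"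
    by (simp only: power_divide add_divide_distrib)
  then have "(x $ 1 / r)\<^sup>2 + (x $ 2 / r)\<^sup>2 = 1" using r by simp
  then obtain \<theta> where "x $ 1 / r = cos \<theta>" "x $ 2 / r = sin \<theta>" by (metis sincos_total_2pi)
  then have "x = vector [r * cos \<theta>, r * sin \<theta>, x $ 3]" using r by (simp add: vector3_eq field_simps)
  then show ?thesis using that r by blast
qed

text \<open>The definition ties the formula to points of \<open>half_section \<Omega>\<close>.
  Turning a point back by its angle shows that, for an axisymmetric \<Omega>, membership of
  \<open>x\<close> in \<Omega> is enough.\<close>

lemma axisymmetric_map_formula:
  assumes \<Omega>: "open \<Omega>" "axisymmetric_set \<Omega>" and u: "axisymmetric_map \<Omega> u"
  obtains v :: "real \<times> real \<Rightarrow> real \<times> real" where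
    "AE x in lebesgue. x \<in> \<Omega> \<longrightarrow> (\<forall>r \<theta>. r > 0 \<and> x = vector [r * cos \<theta>, r * sin \<theta>, x $ 3] \<longrightarrow>
        u x = vector [fst (v (r, x $ 3)) * cos \<theta>, fst (v (r, x $ 3)) * sin \<theta>, snd (v (r, x $ 3))])"
proof -
  have s: "\<Omega> \<in> sets lebesgue" using \<Omega> by simp
  obtain v :: "real \<times> real \<Rightarrow> real \<times> real" where v: "AE x in lebesgue_on \<Omega>. \<forall>r \<theta> z.
        (r, z) \<in> half_section \<Omega> \<and> x = vector [r * cos \<theta>, r * sin \<theta>, z] \<longrightarrow>
        u x = fst (v (r, z)) *\<^sub>R (cos \<theta> *\<^sub>R axis 1 1 + sin \<theta> *\<^sub>R axis 2 1)
              + snd (v (r, z)) *\<^sub>R axis 3 1"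
    using u unfolding axisymmetric_map_def by blast
  have hs: "(r, x $ 3) \<in> half_section \<Omega>"
    if "r > 0" "x = vector [r * cos \<theta>, r * sin \<theta>, x $ 3]" "x \<in> \<Omega>" for x r \<theta>
  proof -
    have "rotation_z \<theta> (vector [r, 0, x $ 3]) = vector [r * cos \<theta>, r * sin \<theta>, x $ 3]"
      by (simp add: vector3_eq)
    then have "rotation_z \<theta> (vector [r, 0, x $ 3]) \<in> \<Omega>" using that by metis
    then show ?thesis using axisymmetric_set_rotation[OF \<Omega>(2)] that(1) by (simp add: half_section_def)
  qed
  have "AE x in lebesgue. x \<in> \<Omega> \<longrightarrow> (\<forall>r \<theta>. r > 0 \<and> x = vector [r * cos \<theta>, r * sin \<theta>, x $ 3] \<longrightarrow>
        u x = vector [fst (v (r, x $ 3)) * cos \<theta>, fst (v (r, x $ 3)) * sin \<theta>, snd (v (r, x $ 3))])"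
    using v unfolding AE_lebesgue_on[OF s]
  proof eventually_elim
    case (elim x)
    show ?case
    proof (intro impI allI, elim conjE)
      fix r \<theta> assume x: "x \<in> \<Omega>" and r: "r > 0" "x = vector [r * cos \<theta>, r * sin \<theta>, x $ 3]"
      have "u x = fst (v (r, x $ 3)) *\<^sub>R (cos \<theta> *\<^sub>R axis 1 1 + sin \<theta> *\<^sub>R axis 2 1) + snd (v (r, x $ 3)) *\<^sub>R axis 3 1"
        using elim x r hs[OF r x] by blast
      then show "u x = vector [fst (v (r, x $ 3)) * cos \<theta>, fst (v (r, x $ 3)) * sin \<theta>, snd (v (r, x $ 3))]"
        by (simp add: vector3_eq axis_def)
    qed
  qed
  then show ?thesis using that by blast
qed

text \<open>The horizontal parts of \<open>x\<close> and \<open>u x\<close> are both multiples of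
  \<open>(cos \<theta>, sin \<theta>)\<close>; on the axis both sides vanish.\<close>

lemma axisymmetric_map_no_swirl:
  assumes \<Omega>: "open \<Omega>" "axisymmetric_set \<Omega>" and u: "axisymmetric_map \<Omega> u"
  shows "AE x in lebesgue_on \<Omega>. x $ 2 * u x $ 1 = x $ 1 * u x $ 2"
proof -
  have s: "\<Omega> \<in> sets lebesgue" using \<Omega> by simp
  obtain v :: "real \<times> real \<Rightarrow> real \<times> real" where v: "AE x in lebesgue. x \<in> \<Omega> \<longrightarrow> (\<forall>r \<theta>. r > 0 \<and> x = vector [r * cos \<theta>, r * sin \<theta>, x $ 3] \<longrightarrow>
        u x = vector [fst (v (r, x $ 3)) * cos \<theta>, fst (v (r, x $ 3)) * sin \<theta>, snd (v (r, x $ 3))])"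
    by (rule axisymmetric_map_formula[OF assms])
  show ?thesis unfolding AE_lebesgue_on[OF s] using v
  proof eventually_elim
    case (elim x)
    show ?case
    proof (intro impI, cases "x $ 1 = 0 \<and> x $ 2 = 0")
      case False
      assume x: "x \<in> \<Omega>"
      obtain r \<theta> where r: "r > 0" "x = vector [r * cos \<theta>, r * sin \<theta>, x $ 3]"
        by (rule cylindrical_coordinates[OF False])
      then have "u x = vector [fst (v (r, x $ 3)) * cos \<theta>, fst (v (r, x $ 3)) * sin \<theta>, snd (v (r, x $ 3))]"
        using elim x by blast
      moreover have "x $ 1 = r * cos \<theta>" "x $ 2 = r * sin \<theta>" using r(2) by (metis vector_3)+
      ultimately show "x $ 2 * u x $ 1 = x $ 1 * u x $ 2" by simp
    qed simp
  qed
qed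

lemma axis_z_negligible: "AE x in lebesgue. x \<notin> axis_z"
proof -
  have "negligible {x::real^3. x \<bullet> axis 1 1 = 0}"
    by (rule negligible_standard_hyperplane) (simp add: axis_in_Basis_iff)
  then have "negligible axis_z"
    by (rule negligible_subset) (auto simp: axis_z_def inner_axis)
  then show ?thesis by (simp add: negligible_iff_null_sets AE_not_in)
qed

text \<open>A rotation keeps the radius and the height and adds \<alpha> to the angle, so both
  values of \<open>u\<close> come from the same \<open>v (r, x $ 3)\<close>. The formula is used at
  \<open>x\<close> and at the rotated point, each time outside a null set.\<close>

lemma axisymmetric_map_equivariant:
  assumes \<Omega>: "open \<Omega>" "axisymmetric_set \<Omega>" and u: "axisymmetric_map \<Omega> u"
  shows "AE x in lebesgue. x \<in> \<Omega> \<longrightarrow> u (rotation_z \<alpha> x) = rotation_z \<alpha> (u x)"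
proof -
  obtain v :: "real \<times> real \<Rightarrow> real \<times> real" where v: "AE x in lebesgue. x \<in> \<Omega> \<longrightarrow> (\<forall>r \<theta>. r > 0 \<and> x = vector [r * cos \<theta>, r * sin \<theta>, x $ 3] \<longrightarrow>
        u x = vector [fst (v (r, x $ 3)) * cos \<theta>, fst (v (r, x $ 3)) * sin \<theta>, snd (v (r, x $ 3))])"
    by (rule axisymmetric_map_formula[OF assms])
  show ?thesis using v AE_rotation_z[OF v, of \<alpha>] axis_z_negligible
  proof eventually_elim
    case (elim x)
    show ?case
    proof
      assume x: "x \<in> \<Omega>"
      obtain r \<theta> where r: "r > 0" "x = vector [r * cos \<theta>, r * sin \<theta>, x $ 3]"
        using cylindrical_coordinates[of x] elim(3) by (auto simp: axis_z_def)
      have x12: "x $ 1 = r * cos \<theta>" "x $ 2 = r * sin \<theta>" using r(2) by (metis vector_3)+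
      have R: "rotation_z \<alpha> x = vector [r * cos (\<alpha> + \<theta>), r * sin (\<alpha> + \<theta>), rotation_z \<alpha> x $ 3]"
        by (simp add: vector3_eq x12 cos_add sin_add algebra_simps)
      have "u x = vector [fst (v (r, x $ 3)) * cos \<theta>, fst (v (r, x $ 3)) * sin \<theta>, snd (v (r, x $ 3))]"
        using elim(1) x r by blast
      moreover have "u (rotation_z \<alpha> x) = vector [fst (v (r, x $ 3)) * cos (\<alpha> + \<theta>), fst (v (r, x $ 3)) * sin (\<alpha> + \<theta>), snd (v (r, x $ 3))]"
        using elim(2) R r(1) x axisymmetric_set_rotation[OF \<Omega>(2), of \<alpha> x] by (metis rotation_z_nth(3))
      ultimately show "u (rotation_z \<alpha> x) = rotation_z \<alpha> (u x)"
        by (simp add: vector3_eq cos_add sin_add algebra_simps)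
    qed
  qed
qed

section \<open>Infinitesimal consequences of axisymmetry\<close>

text \<open>The generator of the rotations about the axis, that is the derivative of
  \<open>rotation_z\<close> at angle 0. Off the axis it points in the angular direction, with length
  the distance to the axis.\<close>

definition Jrot :: "real^3 \<Rightarrow> real^3" where
  "Jrot y = vector [- y $ 2, y $ 1, 0]"

lemma Jrot_nth [simp]: "Jrot y $ 1 = - y $ 2" "Jrot y $ 2 = y $ 1" "Jrot y $ 3 = 0"
  by (simp_all add: Jrot_def)

lemma has_derivative_rotation_z: "((\<lambda>\<alpha>. rotation_z \<alpha> x) has_derivative (\<lambda>t. t *\<^sub>R Jrot x)) (at 0)"
proof -
  have "rotation_z \<alpha> x = cos \<alpha> *\<^sub>R vector [x $ 1, x $ 2, 0] + sin \<alpha> *\<^sub>R Jrot x + vector [0, 0, x $ 3]" for \<alpha>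
    by (simp add: vector3_eq)
  moreover have "((\<lambda>\<alpha>. cos \<alpha> *\<^sub>R (vector [x $ 1, x $ 2, 0] :: real^3) + sin \<alpha> *\<^sub>R Jrot x + vector [0, 0, x $ 3])
      has_derivative (\<lambda>t. t *\<^sub>R Jrot x)) (at 0)"
    by (auto intro!: derivative_eq_intros)
  ultimately show ?thesis by simp
qed

text \<open>Mollification with a radial kernel commutes with rotations, so the mollified map is
  equivariant everywhere and the identity \<open>Du X = J u\<close> may be obtained by differentiating it in the
  rotation angle.\<close>

lemma axisymmetric_map_rotation_derivative:
  assumes \<Omega>: "open \<Omega>" "bounded \<Omega>" "axisymmetric_set \<Omega>" and u: "axisymmetric_map \<Omega> u" "u \<in> W12 \<Omega>"
  shows "AE x in lebesgue_on \<Omega>. weak_gradient \<Omega> u x *v Jrot x = Jrot (u x)"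
proof -
  have s: "\<Omega> \<in> sets lebesgue" using \<Omega> by simp
  define f where "f i = zero_ext \<Omega> (\<lambda>x. u x $ i)" for i :: 3
  define G where "G i j = zero_ext \<Omega> (\<lambda>x. weak_gradient \<Omega> u x $ i $ j)" for i j :: 3
  note fi = W12_zero_ext(1,2)[OF \<Omega>(1,2) u(2), folded f_def] and Gi = W12_zero_ext(3,4)[OF \<Omega>(1,2) u(2), folded G_def]
  \<comment> \<open>All components and all their partial derivatives are indexed together,
    \<open>None\<close> standing for the function itself, so that one sequence of radii serves them
    all.\<close>
  define F where "F p = (case snd p of None \<Rightarrow> f (fst p) | Some j \<Rightarrow> G (fst p) j)" for p :: "3 \<times> 3 option"
  obtain \<epsilon> :: "nat \<Rightarrow> real" where \<epsilon>: "\<And>k. 0 < \<epsilon> k" "\<And>k. \<epsilon> k \<le> 1 / real (Suc k)"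
    and lim: "\<And>p. AE x in lebesgue. (\<lambda>k. convolution (F p) (mollifier (\<epsilon> k)) x) \<longlonglongrightarrow> F p x"
  proof (rule mollification_AE_sequence[of "UNIV :: (3 \<times> 3 option) set" F 1])
    show "integrable lebesgue (F p)" "integrable lebesgue (\<lambda>x. (F p x)\<^sup>2)" for p
      using fi Gi by (auto simp: F_def split: option.split)
  qed auto
  define c where "c k i = convolution (f i) (mollifier (\<epsilon> k))" for k i
  have equiv: "c k i (rotation_z \<alpha> x) = rotation_z \<alpha> (vector [c k 1 x, c k 2 x, c k 3 x]) $ i" for k i \<alpha> x
  proof -
    let ?\<rho> = "mollifier (\<epsilon> k) :: real^3 \<Rightarrow> real"
    have ci: "integrable lebesgue (\<lambda>y. f i y * ?\<rho> (x - y))" for i x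
      by (rule convolution_integrable_test[OF fi(1) mollifier_test[OF \<epsilon>(1)]])
    have "c k i (rotation_z \<alpha> x) = (\<integral>y. rotation_z \<alpha> (vector [f 1 y, f 2 y, f 3 y]) $ i * ?\<rho> (x - y) \<partial>lebesgue)"
      unfolding c_def convolution_def
    proof (rule integral_rotation_z[where \<theta>=\<alpha>])
      show "(\<lambda>y. f i y * ?\<rho> (rotation_z \<alpha> x - y)) \<in> borel_measurable lebesgue" using ci by blast
      have "(\<lambda>y. rotation_z \<alpha> (vector [f 1 y, f 2 y, f 3 y]) $ i) \<in> borel_measurable lebesgue"
        using exhaust_3[of i] borel_measurable_integrable[OF fi(1)] by (elim disjE) (auto intro!: borel_measurable_add borel_measurable_diff)
      moreover have "(\<lambda>y. ?\<rho> (x - y)) \<in> borel_measurable lebesgue"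
        by (rule smooth_borel_lebesgue[OF smooth_affine_arg[OF smooth_mollifier[OF \<epsilon>(1)]]])
      ultimately show "(\<lambda>y. rotation_z \<alpha> (vector [f 1 y, f 2 y, f 3 y]) $ i * ?\<rho> (x - y)) \<in> borel_measurable lebesgue"
        by (rule borel_measurable_times)
      show "AE y in lebesgue. f i (rotation_z \<alpha> y) * ?\<rho> (rotation_z \<alpha> x - rotation_z \<alpha> y)
          = rotation_z \<alpha> (vector [f 1 y, f 2 y, f 3 y]) $ i * ?\<rho> (x - y)"
        using axisymmetric_map_equivariant[OF \<Omega>(1,3) u(1), of \<alpha>]
      proof eventually_elim
        case (elim y)
        have "?\<rho> (rotation_z \<alpha> x - rotation_z \<alpha> y) = ?\<rho> (x - y)"
          by (rule mollifier_norm_eq[OF \<epsilon>(1)]) (simp add: rotation_z_norm flip: rotation_z_diff)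
        moreover have "f i (rotation_z \<alpha> y) = rotation_z \<alpha> (vector [f 1 y, f 2 y, f 3 y]) $ i"
        proof (cases "y \<in> \<Omega>")
          case True
          then have "vector [f 1 y, f 2 y, f 3 y] = u y" by (simp add: vector3_eq f_def)
          then show ?thesis using True elim axisymmetric_set_rotation[OF \<Omega>(3), of \<alpha> y] by (simp add: f_def)
        next
          case False
          then have "vector [f 1 y, f 2 y, f 3 y] = (0 :: real^3)" by (simp add: vector3_eq f_def)
          then show ?thesis using False axisymmetric_set_rotation[OF \<Omega>(3), of \<alpha> y]
            linear_0[OF rotation_z_linear, of \<alpha>] by (simp add: f_def)
        qed
        ultimately show ?case by simp
      qed
    qed
    also have "\<dots> = rotation_z \<alpha> (vector [c k 1 x, c k 2 x, c k 3 x]) $ i"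
      using exhaust_3[of i] ci by (elim disjE) (simp_all add: c_def convolution_def distrib_right left_diff_distrib mult.assoc)
    finally show ?thesis .
  qed
  have der: "frechet_derivative (c k i) (at x) (Jrot x) = Jrot (vector [c k 1 x, c k 2 x, c k 3 x]) $ i" for k i x
  proof -
    have d: "(c k i has_derivative frechet_derivative (c k i) (at x)) (at (rotation_z 0 x))"
      using smooth_has_derivative[OF smooth_convolution[OF fi(1) mollifier_test[OF \<epsilon>(1)]]]
      by (simp add: c_def rotation_z_0)
    have 1: "((\<lambda>\<alpha>. c k i (rotation_z \<alpha> x)) has_derivative (\<lambda>t. frechet_derivative (c k i) (at x) (t *\<^sub>R Jrot x))) (at 0)"
      by (rule has_derivative_compose[OF has_derivative_rotation_z d])
    have "((\<lambda>\<alpha>. rotation_z \<alpha> (vector [c k 1 x, c k 2 x, c k 3 x]) $ i) has_derivative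
        (\<lambda>t. (t *\<^sub>R Jrot (vector [c k 1 x, c k 2 x, c k 3 x])) $ i)) (at 0)"
      by (rule bounded_linear.has_derivative[OF bounded_linear_vec_nth has_derivative_rotation_z])
    then have 2: "((\<lambda>\<alpha>. c k i (rotation_z \<alpha> x)) has_derivative
        (\<lambda>t. (t *\<^sub>R Jrot (vector [c k 1 x, c k 2 x, c k 3 x])) $ i)) (at 0)"
      by (simp add: equiv)
    \<comment> \<open>The two derivatives at angle 0, one by the chain rule and one from
      equivariance, belong to the same curve.\<close>
    show ?thesis using fun_cong[OF has_derivative_unique[OF 1 2], of 1] by simp
  qed
  have "AE x in lebesgue. \<forall>p. (\<lambda>k. convolution (F p) (mollifier (\<epsilon> k)) x) \<longlonglongrightarrow> F p x"
    using lim by (simp add: AE_all_countable)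
  then show ?thesis unfolding AE_lebesgue_on[OF s]
  proof eventually_elim
    case (elim x)
    show ?case
    proof
      assume x: "x \<in> \<Omega>"
      obtain e where e: "e > 0" "cball x e \<subseteq> \<Omega>" using \<Omega>(1) x open_contains_cball by blast
      have cl: "(\<lambda>k. c k i x) \<longlonglongrightarrow> u x $ i" for i
        using elim[rule_format, of "(i, None)"] x by (simp add: F_def c_def f_def)
      have Gl: "(\<lambda>k. convolution (G i j) (mollifier (\<epsilon> k)) x) \<longlonglongrightarrow> weak_gradient \<Omega> u x $ i $ j" for i j
        using elim[rule_format, of "(i, Some j)"] x by (simp add: F_def G_def)
      have "eventually (\<lambda>k. 1 / real (Suc k) < e) sequentially"
        using LIMSEQ_inverse_real_of_nat e(1) by (auto simp: inverse_eq_divide intro: order_tendstoD)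
      \<comment> \<open>Once the ball of radius \<open>\<epsilon> k\<close> fits in \<Omega>, the
        derivatives of the mollified components are the mollified weak derivatives.\<close>
      then have ev: "eventually (\<lambda>k. cball x (\<epsilon> k) \<subseteq> \<Omega>) sequentially"
      proof eventually_elim
        case (elim k)
        then have "cball x (\<epsilon> k) \<subseteq> cball x e" using \<epsilon>(2)[of k] by auto
        then show ?case using e(2) by blast
      qed
      have "(weak_gradient \<Omega> u x *v Jrot x) $ i = Jrot (u x) $ i" for i
      proof (rule LIMSEQ_unique)
        show "(\<lambda>k. Jrot (vector [c k 1 x, c k 2 x, c k 3 x]) $ i) \<longlonglongrightarrow> Jrot (u x) $ i"
          using exhaust_3[of i] by (elim disjE) (auto intro!: tendsto_intros cl)
        have "(\<lambda>k. convolution (G i 1) (mollifier (\<epsilon> k)) x * (- x $ 2) + convolution (G i 2) (mollifier (\<epsilon> k)) x * x $ 1)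
            \<longlonglongrightarrow> weak_gradient \<Omega> u x $ i $ 1 * (- x $ 2) + weak_gradient \<Omega> u x $ i $ 2 * x $ 1"
          by (intro tendsto_intros Gl)
        also have "weak_gradient \<Omega> u x $ i $ 1 * (- x $ 2) + weak_gradient \<Omega> u x $ i $ 2 * x $ 1
            = (weak_gradient \<Omega> u x *v Jrot x) $ i"
          by (simp add: matrix_vector_mult_def sum_3)
        finally show "(\<lambda>k. Jrot (vector [c k 1 x, c k 2 x, c k 3 x]) $ i) \<longlonglongrightarrow> (weak_gradient \<Omega> u x *v Jrot x) $ i"
        proof (rule Lim_transform_eventually)
          show "eventually (\<lambda>k. convolution (G i 1) (mollifier (\<epsilon> k)) x * (- x $ 2) + convolution (G i 2) (mollifier (\<epsilon> k)) x * x $ 1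
              = Jrot (vector [c k 1 x, c k 2 x, c k 3 x]) $ i) sequentially"
            using ev
          proof eventually_elim
            case (elim k)
            have dG: "frechet_derivative (c k i) (at x) (axis j 1) = convolution (G i j) (mollifier (\<epsilon> k)) x" for j
              unfolding c_def f_def
              using mollified_derivative[OF fi(1)[unfolded f_def] W12_zero_ext(5)[OF \<Omega>(1,2) u(2)] \<epsilon>(1) elim, of "axis j 1" i]
              by (simp add: matrix_vector_axis G_def axis_in_Basis_iff)
            have lin: "linear (frechet_derivative (c k i) (at x))"
              unfolding c_def by (rule linear_frechet_derivative[OF smooth_differentiable[OF smooth_convolution[OF fi(1) mollifier_test[OF \<epsilon>(1)]]]])
            have "Jrot x = (- x $ 2) *\<^sub>R axis 1 1 + x $ 1 *\<^sub>R axis 2 1" by (simp add: vector3_eq axis_def)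
            then have "frechet_derivative (c k i) (at x) (Jrot x)
                = (- x $ 2) * frechet_derivative (c k i) (at x) (axis 1 1) + x $ 1 * frechet_derivative (c k i) (at x) (axis 2 1)"
              by (simp only: linear_add[OF lin] linear_scale[OF lin]) simp
            then show ?case using der[of k i x] by (simp add: dG mult.commute)
          qed
        qed
      qed
      then show "weak_gradient \<Omega> u x *v Jrot x = Jrot (u x)" by (simp add: vec_eq_iff)
    qed
  qed
qed

lemma smooth_vec_nth: "smooth_on UNIV (\<lambda>x::real^'n. x $ i)"
  by (rule smooth_bounded_linear[OF bounded_linear_vec_nth])

lemma frechet_derivative_mult_coordinate:
  fixes \<phi> :: "real^'n \<Rightarrow> real"
  assumes "smooth_on UNIV \<phi>"
  shows "frechet_derivative (\<lambda>x. \<phi> x * x $ k) (at x) v = \<phi> x * v $ k + frechet_derivative \<phi> (at x) v * x $ k"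
proof -
  have "((\<lambda>x. \<phi> x * x $ k) has_derivative (\<lambda>v. \<phi> x * v $ k + frechet_derivative \<phi> (at x) v * x $ k)) (at x)"
    by (rule has_derivative_mult[OF smooth_has_derivative[OF assms] bounded_linear_imp_has_derivative[OF bounded_linear_vec_nth]])
  then show ?thesis by (simp add: frechet_derivative_eq)
qed

text \<open>The product rule for \<open>x $ 2 * u x $ 1 - x $ 1 * u x $ 2\<close>, in weak form: the
  coordinate factor is moved to \<phi>, which remains a test function.\<close>

lemma no_swirl_derivative:
  assumes \<Omega>: "open \<Omega>" and u: "u \<in> W12 \<Omega>"
    and sw: "AE x in lebesgue_on \<Omega>. x $ 2 * u x $ 1 = x $ 1 * u x $ 2"
  shows "AE x in lebesgue_on \<Omega>. x $ 2 * weak_gradient \<Omega> u x $ 1 $ j - x $ 1 * weak_gradient \<Omega> u x $ 2 $ j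
      + (axis j 1 :: real^3) $ 2 * u x $ 1 - (axis j 1 :: real^3) $ 1 * u x $ 2 = 0"
proof (rule fundamental_lemma[OF _ \<Omega>])
  let ?D = "weak_gradient \<Omega> u" and ?e = "axis j 1 :: real^3"
  note h = W12_weak_gradient[OF u]
  note li = has_weak_gradient_locally_integrable[OF h]
  have mult: "locally_integrable \<Omega> (\<lambda>x. x $ k * f x)" if "locally_integrable \<Omega> f" for k and f :: "real^3 \<Rightarrow> real"
    unfolding locally_integrable_def
  proof (intro allI impI)
    fix K assume K: "compact K \<and> K \<subseteq> \<Omega>"
    then have Ks: "K \<in> sets lebesgue" using fmeasurableD[OF lmeasurable_compact] by blast
    obtain r where r: "\<And>x. x \<in> K \<Longrightarrow> norm x \<le> r" using K compact_imp_bounded bounded_iff by metis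
    have "integrable (lebesgue_on K) (\<lambda>x. f x * x $ k)"
    proof (rule integrable_mult_bounded)
      show "integrable (lebesgue_on K) f" using that K unfolding locally_integrable_def by blast
      show "(\<lambda>x::real^3. x $ k) \<in> borel_measurable (lebesgue_on K)"
        using smooth_borel_lebesgue[OF smooth_vec_nth] by (rule measurable_restrict_space1)
      show "AE x in lebesgue_on K. \<bar>x $ k\<bar> \<le> r"
        using r component_le_norm_cart order_trans by (intro AE_I2) (auto, blast)
    qed
    then show "integrable (lebesgue_on K) (\<lambda>x. x $ k * f x)" by (simp add: mult.commute)
  qed
  have cm: "locally_integrable \<Omega> (\<lambda>x. c * f x)" if "locally_integrable \<Omega> f" for c and f :: "real^3 \<Rightarrow> real"
    using that unfolding locally_integrable_def by auto
  show "locally_integrable \<Omega> (\<lambda>x. x $ 2 * ?D x $ 1 $ j - x $ 1 * ?D x $ 2 $ j + ?e $ 2 * u x $ 1 - ?e $ 1 * u x $ 2)"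
    using mult[OF li(2)[of 1 j], of 2] mult[OF li(2)[of 2 j], of 1] cm[OF li(1)[of 1], of "?e $ 2"] cm[OF li(1)[of 2], of "?e $ 1"]
    unfolding locally_integrable_def by auto
  fix \<phi> :: "real^3 \<Rightarrow> real" assume \<phi>: "\<phi> \<in> test_functions \<Omega>"
  note sm = test_functions_smooth[OF \<phi>]
  note \<phi>x = test_functions_mult[OF \<phi> smooth_vec_nth]
  note d\<phi> = test_functions_derivative[OF \<phi>, of ?e]
  have i: "integrable (lebesgue_on \<Omega>) (\<lambda>x. u x $ i * \<phi> x)"
    "integrable (lebesgue_on \<Omega>) (\<lambda>x. u x $ i * (frechet_derivative \<phi> (at x) ?e * x $ k))"
    "integrable (lebesgue_on \<Omega>) (\<lambda>x. ?D x $ i $ j * (\<phi> x * x $ k))" for i k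
    by (rule locally_integrable_mult_test[OF li(1) \<Omega> \<phi>],
        rule locally_integrable_mult_test[OF li(1) \<Omega> test_functions_mult[OF d\<phi> smooth_vec_nth]],
        rule locally_integrable_mult_test[OF li(2) \<Omega> \<phi>x])
  have w: "(\<integral>x. u x $ i * \<phi> x \<partial>lebesgue_on \<Omega>) * ?e $ k + (\<integral>x. u x $ i * (frechet_derivative \<phi> (at x) ?e * x $ k) \<partial>lebesgue_on \<Omega>)
      = - (\<integral>x. ?D x $ i $ j * (\<phi> x * x $ k) \<partial>lebesgue_on \<Omega>)" for i k
  proof -
    have "(\<integral>x. u x $ i * \<phi> x \<partial>lebesgue_on \<Omega>) * ?e $ k + (\<integral>x. u x $ i * (frechet_derivative \<phi> (at x) ?e * x $ k) \<partial>lebesgue_on \<Omega>)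
      = (\<integral>x. u x $ i * \<phi> x * ?e $ k + u x $ i * (frechet_derivative \<phi> (at x) ?e * x $ k) \<partial>lebesgue_on \<Omega>)"
      using i(1)[of i] i(2)[of i k] by simp
    also have "\<dots> = (\<integral>x. u x $ i * frechet_derivative (\<lambda>x. \<phi> x * x $ k) (at x) ?e \<partial>lebesgue_on \<Omega>)"
      by (simp add: frechet_derivative_mult_coordinate[OF sm] algebra_simps)
    also have "\<dots> = - (\<integral>x. ?D x $ i $ j * (\<phi> x * x $ k) \<partial>lebesgue_on \<Omega>)"
      by (rule has_weak_gradientD[OF h \<phi>x])
    finally show ?thesis .
  qed
  have "(\<integral>x. u x $ 1 * (frechet_derivative \<phi> (at x) ?e * x $ 2) \<partial>lebesgue_on \<Omega>)
      = (\<integral>x. u x $ 2 * (frechet_derivative \<phi> (at x) ?e * x $ 1) \<partial>lebesgue_on \<Omega>)"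
  proof (rule integral_cong_AE)
    show "AE x in lebesgue_on \<Omega>. u x $ 1 * (frechet_derivative \<phi> (at x) ?e * x $ 2) = u x $ 2 * (frechet_derivative \<phi> (at x) ?e * x $ 1)"
      using sw by eventually_elim (simp add: mult.left_commute mult.commute)
  qed (use i(2) borel_measurable_integrable in blast)+
  then have e: "(\<integral>x. u x $ 1 * \<phi> x \<partial>lebesgue_on \<Omega>) * ?e $ 2 + (\<integral>x. ?D x $ 1 $ j * (\<phi> x * x $ 2) \<partial>lebesgue_on \<Omega>)
      = (\<integral>x. u x $ 2 * \<phi> x \<partial>lebesgue_on \<Omega>) * ?e $ 1 + (\<integral>x. ?D x $ 2 $ j * (\<phi> x * x $ 1) \<partial>lebesgue_on \<Omega>)"
    using w[of 1 2] w[of 2 1] by linarith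
  have "(\<integral>x. (x $ 2 * ?D x $ 1 $ j - x $ 1 * ?D x $ 2 $ j + ?e $ 2 * u x $ 1 - ?e $ 1 * u x $ 2) * \<phi> x \<partial>lebesgue_on \<Omega>)
    = (\<integral>x. ?D x $ 1 $ j * (\<phi> x * x $ 2) - ?D x $ 2 $ j * (\<phi> x * x $ 1) + u x $ 1 * \<phi> x * ?e $ 2 - u x $ 2 * \<phi> x * ?e $ 1 \<partial>lebesgue_on \<Omega>)"
    by (rule Bochner_Integration.integral_cong) (simp_all add: algebra_simps)
  also have "\<dots> = 0" using i(1)[of 1] i(1)[of 2] i(3)[of 1 2] i(3)[of 2 1] e by simp
  finally show "(\<integral>x. (x $ 2 * ?D x $ 1 $ j - x $ 1 * ?D x $ 2 $ j + ?e $ 2 * u x $ 1 - ?e $ 1 * u x $ 2) * \<phi> x \<partial>lebesgue_on \<Omega>) = 0" .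
qed

section \<open>Weak continuity of the Jacobian\<close>

lemma smooth_line_derivative:
  fixes f :: "'a::euclidean_space \<Rightarrow> real"
  assumes "smooth_on UNIV f"
  shows "((\<lambda>s. f (y + s *\<^sub>R a)) has_real_derivative frechet_derivative f (at (y + s *\<^sub>R a)) a) (at s)"
proof -
  have "((\<lambda>s. y + s *\<^sub>R a) has_derivative (\<lambda>t. t *\<^sub>R a)) (at s)"
    by (auto intro!: derivative_eq_intros)
  from has_derivative_compose[OF this smooth_has_derivative[OF assms]]
  have "((\<lambda>s. f (y + s *\<^sub>R a)) has_derivative (\<lambda>t. frechet_derivative f (at (y + s *\<^sub>R a)) (t *\<^sub>R a))) (at s)" .
  moreover have "(\<lambda>t. frechet_derivative f (at (y + s *\<^sub>R a)) (t *\<^sub>R a)) = (*) (frechet_derivative f (at (y + s *\<^sub>R a)) a)"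
    using linear_scale[OF linear_frechet_derivative[OF smooth_differentiable[OF assms]]] by (auto simp: mult.commute)
  ultimately show ?thesis by (simp add: has_field_derivative_def)
qed

text \<open>The mean value theorem along \<open>a\<close> for the increment of \<open>f\<close> in
  direction \<open>b\<close>, and then along \<open>b\<close> for the derivative of \<open>f\<close>
  in direction \<open>a\<close>.\<close>

lemma second_difference_mean_value:
  fixes f :: "'a::euclidean_space \<Rightarrow> real"
  assumes f: "smooth_on UNIV f" and h: "h > 0"
  obtains s t where "0 < s" "s < h" "0 < t" "t < h"
    "f (x + h *\<^sub>R b + h *\<^sub>R a) - f (x + h *\<^sub>R a) - f (x + h *\<^sub>R b) + f x
      = h * h * frechet_derivative (\<lambda>y. frechet_derivative f (at y) a) (at (x + s *\<^sub>R a + t *\<^sub>R b)) b"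
proof -
  let ?D = "\<lambda>y. frechet_derivative f (at y) a"
  obtain s where s: "0 < s" "s < h" "(f (x + h *\<^sub>R b + h *\<^sub>R a) - f (x + h *\<^sub>R a)) - (f (x + h *\<^sub>R b + 0 *\<^sub>R a) - f (x + 0 *\<^sub>R a))
      = (h - 0) * (?D (x + h *\<^sub>R b + s *\<^sub>R a) - ?D (x + s *\<^sub>R a))"
    using MVT2[OF h, of "\<lambda>s. f (x + h *\<^sub>R b + s *\<^sub>R a) - f (x + s *\<^sub>R a)"
        "\<lambda>s. ?D (x + h *\<^sub>R b + s *\<^sub>R a) - ?D (x + s *\<^sub>R a)"] DERIV_diff[OF smooth_line_derivative[OF f] smooth_line_derivative[OF f]]
    by blast
  obtain t where t: "0 < t" "t < h" "?D (x + s *\<^sub>R a + h *\<^sub>R b) - ?D (x + s *\<^sub>R a + 0 *\<^sub>R b)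
      = (h - 0) * frechet_derivative ?D (at (x + s *\<^sub>R a + t *\<^sub>R b)) b"
    using MVT2[OF h, of "\<lambda>t. ?D (x + s *\<^sub>R a + t *\<^sub>R b)" "\<lambda>t. frechet_derivative ?D (at (x + s *\<^sub>R a + t *\<^sub>R b)) b"]
      smooth_line_derivative[OF smooth_derivative[OF f]] by blast
  show ?thesis using that[OF s(1,2) t(1,2)] s(3) t(3) by (simp add: add.commute add.left_commute)
qed

text \<open>The second difference of \<open>f\<close> over a parallelogram is symmetric in
  \<open>a\<close> and \<open>b\<close>. It therefore equals, up to the factor \<open>h * h\<close>,
  either mixed derivative at some point near \<open>x\<close>, and continuity transfers this to
  \<open>x\<close>.\<close>

lemma smooth_mixed_partials:
  fixes f :: "'a::euclidean_space \<Rightarrow> real"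
  assumes f: "smooth_on UNIV f"
  shows "frechet_derivative (\<lambda>y. frechet_derivative f (at y) a) (at x) b
      = frechet_derivative (\<lambda>y. frechet_derivative f (at y) b) (at x) a"
proof (rule ccontr)
  let ?P = "\<lambda>y. frechet_derivative (\<lambda>y. frechet_derivative f (at y) a) (at y) b"
  let ?Q = "\<lambda>y. frechet_derivative (\<lambda>y. frechet_derivative f (at y) b) (at y) a"
  assume "?P x \<noteq> ?Q x"
  define e where "e = \<bar>?P x - ?Q x\<bar> / 2"
  have e: "e > 0" using \<open>?P x \<noteq> ?Q x\<close> by (simp add: e_def)
  have "continuous (at x) ?P" "continuous (at x) ?Q"
    using smooth_continuous[OF smooth_derivative[OF smooth_derivative[OF f]]]
    by (auto simp: continuous_on_eq_continuous_at)
  then obtain d1 d2 where d: "d1 > 0" "d2 > 0" "\<And>y. dist y x < d1 \<Longrightarrow> dist (?P y) (?P x) < e"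
    "\<And>y. dist y x < d2 \<Longrightarrow> dist (?Q y) (?Q x) < e"
    unfolding continuous_at_eps_delta dist_real_def using e by metis
  \<comment> \<open>Small enough that \<open>s *\<^sub>R a + t *\<^sub>R b\<close> is shorter than
    \<open>min d1 d2\<close> for all \<open>s\<close> and \<open>t\<close> between 0 and
    \<open>h\<close>.\<close>
  define h where "h = min d1 d2 / (norm a + norm b + 1)"
  have pos: "norm a + norm b + 1 > 0" by (simp add: add_nonneg_pos)
  have h: "h > 0" unfolding h_def using d pos by simp
  have small: "norm (s *\<^sub>R a' + t *\<^sub>R b') < min d1 d2" if "0 < s" "s < h" "0 < t" "t < h" "norm a' + norm b' = norm a + norm b" for s t and a' b' :: 'a
  proof -
    have "norm (s *\<^sub>R a' + t *\<^sub>R b') \<le> s * norm a' + t * norm b'" using that norm_triangle_ineq[of "s *\<^sub>R a'" "t *\<^sub>R b'"] by simp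
    also have "\<dots> \<le> h * norm a' + h * norm b'" using that by (intro add_mono mult_right_mono) auto
    also have "\<dots> = h * (norm a + norm b)" using that(5) by (simp flip: distrib_left)
    also have "\<dots> < h * (norm a + norm b + 1)" using h by simp
    also have "\<dots> = min d1 d2" using pos by (simp add: h_def)
    finally show ?thesis .
  qed
  obtain s t where st: "0 < s" "s < h" "0 < t" "t < h"
    "f (x + h *\<^sub>R b + h *\<^sub>R a) - f (x + h *\<^sub>R a) - f (x + h *\<^sub>R b) + f x = h * h * ?P (x + s *\<^sub>R a + t *\<^sub>R b)"
    by (rule second_difference_mean_value[OF f h])
  obtain s' t' where st': "0 < s'" "s' < h" "0 < t'" "t' < h"
    "f (x + h *\<^sub>R a + h *\<^sub>R b) - f (x + h *\<^sub>R b) - f (x + h *\<^sub>R a) + f x = h * h * ?Q (x + s' *\<^sub>R b + t' *\<^sub>R a)"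
    by (rule second_difference_mean_value[OF f h])
  have "h * h * ?P (x + s *\<^sub>R a + t *\<^sub>R b) = h * h * ?Q (x + s' *\<^sub>R b + t' *\<^sub>R a)"
  proof -
    have "x + h *\<^sub>R b + h *\<^sub>R a = x + h *\<^sub>R a + h *\<^sub>R b" by simp
    then show ?thesis using st(5) st'(5) by (simp only:)
  qed
  then have eq: "?P (x + s *\<^sub>R a + t *\<^sub>R b) = ?Q (x + s' *\<^sub>R b + t' *\<^sub>R a)" using h by simp
  have "dist (?P (x + s *\<^sub>R a + t *\<^sub>R b)) (?P x) < e"
    by (rule d(3)) (use small[OF st(1-4)] in \<open>simp add: dist_norm add.assoc\<close>)
  moreover have "dist (?Q (x + s' *\<^sub>R b + t' *\<^sub>R a)) (?Q x) < e"
    by (rule d(4)) (use small[OF st'(1-4), of b a] in \<open>simp add: dist_norm add.assoc\<close>)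
  ultimately have "\<bar>?P x - ?Q x\<bar> < 2 * e" unfolding dist_real_def eq by linarith
  then show False by (simp add: e_def)
qed

text \<open>A gradient is curl free: moving the derivative of \<open>u\<close> onto the test
  function leaves second derivatives of \<open>F\<close>, whose order does not matter.\<close>

lemma curl_free_pairing:
  assumes \<Omega>: "open \<Omega>" and u: "u \<in> W12 \<Omega>" and F: "F \<in> test_functions \<Omega>"
  shows "(\<integral>x. frechet_derivative F (at x) (axis j 1) * weak_gradient \<Omega> u x $ i $ k
      - frechet_derivative F (at x) (axis k 1) * weak_gradient \<Omega> u x $ i $ j \<partial>lebesgue_on \<Omega>) = 0"
proof -
  note h = W12_weak_gradient[OF u]
  have i: "integrable (lebesgue_on \<Omega>) (\<lambda>x. frechet_derivative F (at x) v * weak_gradient \<Omega> u x $ i $ k)" for v k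
    using locally_integrable_mult_test[OF has_weak_gradient_locally_integrable(2)[OF h] \<Omega> test_functions_derivative[OF F]]
    by (simp add: mult.commute)
  have "(\<integral>x. frechet_derivative F (at x) (axis j 1) * weak_gradient \<Omega> u x $ i $ k \<partial>lebesgue_on \<Omega>)
      = - (\<integral>x. u x $ i * frechet_derivative (\<lambda>x. frechet_derivative F (at x) (axis j 1)) (at x) (axis k 1) \<partial>lebesgue_on \<Omega>)" for j k
    using has_weak_gradientD[OF h test_functions_derivative[OF F, of "axis j 1"], of i k] by (simp add: mult.commute)
  then show ?thesis using i
    by (simp add: smooth_mixed_partials[OF test_functions_smooth[OF F], of "axis j 1" _ "axis k 1"])
qed

lemma frechet_derivative_smooth_mult:
  fixes f g :: "'a::euclidean_space \<Rightarrow> real"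
  assumes "smooth_on UNIV f" "smooth_on UNIV g"
  shows "frechet_derivative (\<lambda>x. f x * g x) (at x) v = f x * frechet_derivative g (at x) v + frechet_derivative f (at x) v * g x"
  by (rule fun_cong[OF frechet_derivative_eq[OF has_derivative_mult[OF smooth_has_derivative[OF assms(1)] smooth_has_derivative[OF assms(2)]]]])

lemma frechet_derivative_smooth_add:
  fixes f g :: "'a::euclidean_space \<Rightarrow> real"
  assumes "smooth_on UNIV f" "smooth_on UNIV g"
  shows "frechet_derivative (\<lambda>x. f x + g x) (at x) v = frechet_derivative f (at x) v + frechet_derivative g (at x) v"
  by (rule fun_cong[OF frechet_derivative_eq[OF has_derivative_add[OF smooth_has_derivative[OF assms(1)] smooth_has_derivative[OF assms(2)]]]])

lemma frechet_derivative_smooth_power: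
  fixes f :: "'a::euclidean_space \<Rightarrow> real"
  assumes f: "smooth_on UNIV f"
  shows "frechet_derivative (\<lambda>x. f x ^ n) (at x) v = real n * f x ^ (n - 1) * frechet_derivative f (at x) v"
proof (induction n)
  case (Suc n)
  have "frechet_derivative (\<lambda>x. f x * f x ^ n) (at x) v = f x * (real n * f x ^ (n - 1) * frechet_derivative f (at x) v) + frechet_derivative f (at x) v * f x ^ n"
    by (simp add: frechet_derivative_smooth_mult[OF f smooth_power[OF f]] Suc)
  then show ?case by (cases n) (simp_all add: algebra_simps)
qed (simp add: frechet_derivative_const)

section \<open>Products of bounded and square integrable sequences\<close>

lemma L2_product_integrable:
  fixes f g :: "'a \<Rightarrow> real"
  assumes "f \<in> borel_measurable N" "g \<in> borel_measurable N"
    "integrable N (\<lambda>x. (f x)\<^sup>2)" "integrable N (\<lambda>x. (g x)\<^sup>2)"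
  shows "integrable N (\<lambda>x. f x * g x)"
proof (rule Bochner_Integration.integrable_bound[where f="\<lambda>x. (1 / 2) * (f x)\<^sup>2 + (1 / 2) * (g x)\<^sup>2"])
  show "AE x in N. norm (f x * g x) \<le> norm ((1 / 2) * (f x)\<^sup>2 + (1 / 2) * (g x)\<^sup>2)"
    using young_weighted[of 1] by (intro AE_I2) (simp add: abs_of_nonneg)
qed (use assms in auto)

text \<open>The factor \<open>an\<close> converges only almost everywhere and \<open>c\<close> is
  merely in L2, so \<open>bn\<close> is taken to converge strongly: the difference of
  \<open>bn n\<close> and \<open>b\<close>, times \<open>c\<close>, is small in L1 against the bound
  on \<open>an\<close>, and what remains converges by domination with a multiple of
  \<open>\<bar>b x * c x\<bar>\<close>.\<close>

lemma triple_product_convergence: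
  fixes a b c :: "'a \<Rightarrow> real"
  assumes am [measurable]: "\<And>n. an n \<in> borel_measurable N" "a \<in> borel_measurable N"
    and ab: "\<And>n. AE x in N. \<bar>an n x\<bar> \<le> A" and lim: "AE x in N. (\<lambda>n. an n x) \<longlonglongrightarrow> a x"
    and bm [measurable]: "\<And>n. bn n \<in> borel_measurable N" "b \<in> borel_measurable N"
    and b2: "integrable N (\<lambda>x. (b x)\<^sup>2)" and bd: "\<And>n. integrable N (\<lambda>x. (bn n x - b x)\<^sup>2)"
    and bl: "(\<lambda>n. \<integral>x. (bn n x - b x)\<^sup>2 \<partial>N) \<longlonglongrightarrow> 0"
    and cm [measurable]: "c \<in> borel_measurable N" and c2: "integrable N (\<lambda>x. (c x)\<^sup>2)"
  shows "\<And>n. integrable N (\<lambda>x. an n x * bn n x * c x)" "integrable N (\<lambda>x. a x * b x * c x)"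
    "(\<lambda>n. \<integral>x. an n x * bn n x * c x \<partial>N) \<longlonglongrightarrow> (\<integral>x. a x * b x * c x \<partial>N)"
proof -
  have "AE x in N. \<forall>n. \<bar>an n x\<bar> \<le> A" using ab by (simp add: AE_all_countable)
  then have aA: "AE x in N. \<bar>a x\<bar> \<le> A"
    using lim
  proof eventually_elim
    case (elim x)
    have "(\<lambda>n. \<bar>an n x\<bar>) \<longlonglongrightarrow> \<bar>a x\<bar>" by (intro tendsto_intros elim)
    then show ?case by (rule LIMSEQ_le_const2) (use elim in auto)
  qed
  have bc: "integrable N (\<lambda>x. b x * c x)" by (rule L2_product_integrable[OF bm(2) cm b2 c2])
  have dc: "integrable N (\<lambda>x. (bn n x - b x) * c x)" for n
    by (rule L2_product_integrable[OF _ cm bd c2]) measurable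
  have i1: "integrable N (\<lambda>x. an n x * ((bn n x - b x) * c x))" for n
    using integrable_mult_bounded[OF dc am(1) ab] by (simp add: mult_ac)
  have i2: "integrable N (\<lambda>x. an n x * (b x * c x))" for n
    using integrable_mult_bounded[OF bc am(1) ab] by (simp add: mult_ac)
  have eq: "(\<lambda>x. an n x * bn n x * c x) = (\<lambda>x. an n x * ((bn n x - b x) * c x) + an n x * (b x * c x))" for n
    by (simp add: algebra_simps)
  show "integrable N (\<lambda>x. an n x * bn n x * c x)" for n unfolding eq using i1 i2 by simp
  show "integrable N (\<lambda>x. a x * b x * c x)"
    using integrable_mult_bounded[OF bc am(2) aA] by (simp add: mult_ac)
  have l2: "(\<lambda>n. \<integral>x. an n x * (b x * c x) \<partial>N) \<longlonglongrightarrow> (\<integral>x. a x * (b x * c x) \<partial>N)"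
  proof (rule integral_dominated_convergence[where w="\<lambda>x. \<bar>A\<bar> * \<bar>b x * c x\<bar>"])
    show "AE x in N. (\<lambda>n. an n x * (b x * c x)) \<longlonglongrightarrow> a x * (b x * c x)"
      using lim by eventually_elim (intro tendsto_intros)
    show "AE x in N. norm (an n x * (b x * c x)) \<le> \<bar>A\<bar> * \<bar>b x * c x\<bar>" for n
      using ab[of n] by eventually_elim (auto simp: abs_mult intro!: mult_right_mono)
  qed (use bc in auto)
  have l1: "(\<lambda>n. \<integral>x. an n x * ((bn n x - b x) * c x) \<partial>N) \<longlonglongrightarrow> 0"
  proof (rule LIMSEQ_I)
    fix e :: real assume e: "e > 0"
    define C where "C = (\<integral>x. (c x)\<^sup>2 \<partial>N)"
    have C: "C \<ge> 0" by (simp add: C_def)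
    define B where "B = \<bar>A\<bar> + 1"
    have B: "B > 0" by (simp add: B_def)
    define t where "t = e / (B * (C + 1))"
    have t: "t > 0" using e C B by (auto simp: t_def intro!: divide_pos_pos mult_pos_pos)
    have tC: "B * (t * C) \<le> e"
    proof -
      have "B * (t * C) = e * C / (C + 1)" using B by (simp add: t_def)
      also have "\<dots> \<le> e" using e C by (simp add: divide_le_eq)
      finally show ?thesis .
    qed
    have "eventually (\<lambda>n. (\<integral>x. (bn n x - b x)\<^sup>2 \<partial>N) < e * t / B) sequentially"
      using bl e t B by (intro order_tendstoD) auto
    then obtain n0 where n0: "\<And>n. n \<ge> n0 \<Longrightarrow> (\<integral>x. (bn n x - b x)\<^sup>2 \<partial>N) < e * t / B"
      by (auto simp: eventually_sequentially)
    have "norm ((\<integral>x. an n x * ((bn n x - b x) * c x) \<partial>N) - 0) < e" if "n \<ge> n0" for n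
    proof -
      have "\<bar>\<integral>x. an n x * ((bn n x - b x) * c x) \<partial>N\<bar> \<le> (\<integral>x. \<bar>an n x * ((bn n x - b x) * c x)\<bar> \<partial>N)" by simp
      also have "\<dots> \<le> (\<integral>x. B * ((1 / (2 * t)) * (bn n x - b x)\<^sup>2 + (t / 2) * (c x)\<^sup>2) \<partial>N)"
      proof (rule integral_mono_AE)
        show "AE x in N. \<bar>an n x * ((bn n x - b x) * c x)\<bar> \<le> B * ((1 / (2 * t)) * (bn n x - b x)\<^sup>2 + (t / 2) * (c x)\<^sup>2)"
          using ab[of n]
        proof eventually_elim
          case (elim x)
          then show ?case using young_weighted[OF t, of "bn n x - b x" "c x"] B
            unfolding abs_mult[of "an n x"] by (intro mult_mono) (auto simp: B_def)
        qed
      qed (use i1 bd c2 in auto)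
      also have "\<dots> = B * ((1 / (2 * t)) * (\<integral>x. (bn n x - b x)\<^sup>2 \<partial>N) + (t / 2) * C)"
        using bd c2 by (simp add: C_def)
      also have "\<dots> < B * ((1 / (2 * t)) * (e * t / B) + (t / 2) * C)"
        using n0[OF that] t B by (intro mult_strict_left_mono add_strict_right_mono) auto
      also have "\<dots> = (e + B * (t * C)) / 2" using t B by (simp add: field_simps)
      also have "\<dots> \<le> e" using tC by simp
      finally show ?thesis by simp
    qed
    then show "\<exists>n0. \<forall>n\<ge>n0. norm ((\<integral>x. an n x * ((bn n x - b x) * c x) \<partial>N) - 0) < e" by blast
  qed
  have "(\<integral>x. an n x * bn n x * c x \<partial>N) = (\<integral>x. an n x * ((bn n x - b x) * c x) \<partial>N) + (\<integral>x. an n x * (b x * c x) \<partial>N)" for n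
    unfolding eq using i1 i2 by simp
  then show "(\<lambda>n. \<integral>x. an n x * bn n x * c x \<partial>N) \<longlonglongrightarrow> (\<integral>x. a x * b x * c x \<partial>N)"
    using tendsto_add[OF l1 l2] by (simp add: mult.assoc)
qed

text \<open>The weights that may multiply a weakly convergent factor. They are stable under products
  and powers, which nonlinear expressions in \<open>u\<close> require and which L2 convergence does
  not provide.\<close>

definition bounded_AE_conv :: "'a measure \<Rightarrow> (nat \<Rightarrow> 'a \<Rightarrow> real) \<Rightarrow> ('a \<Rightarrow> real) \<Rightarrow> bool" where
  "bounded_AE_conv N an a \<longleftrightarrow> (\<forall>n. an n \<in> borel_measurable N) \<and> a \<in> borel_measurable N \<and>
     (\<exists>A. \<forall>n. AE x in N. \<bar>an n x\<bar> \<le> A) \<and> (AE x in N. (\<lambda>n. an n x) \<longlonglongrightarrow> a x)"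

lemma bounded_AE_convI:
  assumes "\<And>n. an n \<in> borel_measurable N" "a \<in> borel_measurable N"
    "\<And>n. AE x in N. \<bar>an n x\<bar> \<le> A" "AE x in N. (\<lambda>n. an n x) \<longlonglongrightarrow> a x"
  shows "bounded_AE_conv N an a"
  using assms unfolding bounded_AE_conv_def by blast

lemma bounded_AE_convE:
  assumes "bounded_AE_conv N an a"
  obtains A where "\<And>n. an n \<in> borel_measurable N" "a \<in> borel_measurable N"
    "\<And>n. AE x in N. \<bar>an n x\<bar> \<le> A" "AE x in N. (\<lambda>n. an n x) \<longlonglongrightarrow> a x"
  using assms unfolding bounded_AE_conv_def by blast

lemma bounded_AE_conv_const:
  "c \<in> borel_measurable N \<Longrightarrow> AE x in N. \<bar>c x\<bar> \<le> A \<Longrightarrow> bounded_AE_conv N (\<lambda>n. c) c"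
  by (rule bounded_AE_convI[where A=A]) auto

lemma bounded_AE_conv_mult:
  assumes "bounded_AE_conv N an a" "bounded_AE_conv N bn b"
  shows "bounded_AE_conv N (\<lambda>n x. an n x * bn n x) (\<lambda>x. a x * b x)"
proof -
  obtain A where a: "\<And>n. an n \<in> borel_measurable N" "a \<in> borel_measurable N"
    "\<And>n. AE x in N. \<bar>an n x\<bar> \<le> A" "AE x in N. (\<lambda>n. an n x) \<longlonglongrightarrow> a x"
    by (rule bounded_AE_convE[OF assms(1)], rule that)
  obtain B where b: "\<And>n. bn n \<in> borel_measurable N" "b \<in> borel_measurable N"
    "\<And>n. AE x in N. \<bar>bn n x\<bar> \<le> B" "AE x in N. (\<lambda>n. bn n x) \<longlonglongrightarrow> b x"
    by (rule bounded_AE_convE[OF assms(2)], rule that)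
  show ?thesis
  proof (rule bounded_AE_convI[where A="\<bar>A\<bar> * \<bar>B\<bar>"])
    show "AE x in N. \<bar>an n x * bn n x\<bar> \<le> \<bar>A\<bar> * \<bar>B\<bar>" for n
      using a(3)[of n] b(3)[of n] by eventually_elim (auto simp: abs_mult intro!: mult_mono)
    show "AE x in N. (\<lambda>n. an n x * bn n x) \<longlonglongrightarrow> a x * b x"
      using a(4) b(4) by eventually_elim (intro tendsto_intros)
  qed (use a b in auto)
qed

lemma bounded_AE_conv_add:
  assumes "bounded_AE_conv N an a" "bounded_AE_conv N bn b"
  shows "bounded_AE_conv N (\<lambda>n x. an n x + bn n x) (\<lambda>x. a x + b x)"
proof -
  obtain A where a: "\<And>n. an n \<in> borel_measurable N" "a \<in> borel_measurable N"
    "\<And>n. AE x in N. \<bar>an n x\<bar> \<le> A" "AE x in N. (\<lambda>n. an n x) \<longlonglongrightarrow> a x"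
    by (rule bounded_AE_convE[OF assms(1)], rule that)
  obtain B where b: "\<And>n. bn n \<in> borel_measurable N" "b \<in> borel_measurable N"
    "\<And>n. AE x in N. \<bar>bn n x\<bar> \<le> B" "AE x in N. (\<lambda>n. bn n x) \<longlonglongrightarrow> b x"
    by (rule bounded_AE_convE[OF assms(2)], rule that)
  show ?thesis
  proof (rule bounded_AE_convI[where A="A + B"])
    show "AE x in N. \<bar>an n x + bn n x\<bar> \<le> A + B" for n
      using a(3)[of n] b(3)[of n] by eventually_elim linarith
    show "AE x in N. (\<lambda>n. an n x + bn n x) \<longlonglongrightarrow> a x + b x"
      using a(4) b(4) by eventually_elim (intro tendsto_intros)
  qed (use a b in auto)
qed

lemma bounded_AE_conv_power:
  assumes "bounded_AE_conv N an a"
  shows "bounded_AE_conv N (\<lambda>n x. an n x ^ k) (\<lambda>x. a x ^ k)"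
proof (induction k)
  case 0
  show ?case using bounded_AE_conv_const[of "\<lambda>_. 1" N 1] by simp
next
  case (Suc k)
  show ?case using bounded_AE_conv_mult[OF assms Suc] by simp
qed

definition L2_conv :: "'a measure \<Rightarrow> (nat \<Rightarrow> 'a \<Rightarrow> real) \<Rightarrow> ('a \<Rightarrow> real) \<Rightarrow> bool" where
  "L2_conv N bn b \<longleftrightarrow> (\<forall>n. bn n \<in> borel_measurable N) \<and> b \<in> borel_measurable N \<and>
     integrable N (\<lambda>x. (b x)\<^sup>2) \<and> (\<forall>n. integrable N (\<lambda>x. (bn n x - b x)\<^sup>2)) \<and>
     (\<lambda>n. \<integral>x. (bn n x - b x)\<^sup>2 \<partial>N) \<longlonglongrightarrow> 0"

lemma square_sum_le: "(a + b)\<^sup>2 \<le> 2 * a\<^sup>2 + 2 * (b::real)\<^sup>2"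
proof -
  have "0 \<le> (a - b)\<^sup>2" by simp
  then show ?thesis by (simp add: power2_sum power2_diff)
qed

lemma L2_conv_add:
  assumes "L2_conv N bn b" "L2_conv N cn c"
  shows "L2_conv N (\<lambda>n x. bn n x + cn n x) (\<lambda>x. b x + c x)"
proof -
  have [measurable]: "bn n \<in> borel_measurable N" "b \<in> borel_measurable N" "cn n \<in> borel_measurable N" "c \<in> borel_measurable N" for n
    using assms unfolding L2_conv_def by auto
  have i: "integrable N (\<lambda>x. (bn n x - b x)\<^sup>2)" "integrable N (\<lambda>x. (cn n x - c x)\<^sup>2)"
    "integrable N (\<lambda>x. (b x)\<^sup>2)" "integrable N (\<lambda>x. (c x)\<^sup>2)" for n using assms unfolding L2_conv_def by auto
  have le: "(bn n x + cn n x - (b x + c x))\<^sup>2 \<le> 2 * (bn n x - b x)\<^sup>2 + 2 * (cn n x - c x)\<^sup>2" for n x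
    using square_sum_le[of "bn n x - b x" "cn n x - c x"] by (simp add: algebra_simps)
  have i3: "integrable N (\<lambda>x. (bn n x + cn n x - (b x + c x))\<^sup>2)" for n
    by (rule Bochner_Integration.integrable_bound[where f="\<lambda>x. 2 * (bn n x - b x)\<^sup>2 + 2 * (cn n x - c x)\<^sup>2"])
      (use i le in auto)
  have "(\<lambda>n. 2 * (\<integral>x. (bn n x - b x)\<^sup>2 \<partial>N) + 2 * (\<integral>x. (cn n x - c x)\<^sup>2 \<partial>N)) \<longlonglongrightarrow> 2 * 0 + 2 * 0"
    using assms unfolding L2_conv_def by (intro tendsto_intros) auto
  then have "(\<lambda>n. 2 * (\<integral>x. (bn n x - b x)\<^sup>2 \<partial>N) + 2 * (\<integral>x. (cn n x - c x)\<^sup>2 \<partial>N)) \<longlonglongrightarrow> 0" by simp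
  then have "(\<lambda>n. \<integral>x. (bn n x + cn n x - (b x + c x))\<^sup>2 \<partial>N) \<longlonglongrightarrow> 0"
  proof (rule tendsto_sandwich[OF _ _ tendsto_const, rotated 2])
    show "eventually (\<lambda>n. (\<integral>x. (bn n x + cn n x - (b x + c x))\<^sup>2 \<partial>N)
        \<le> 2 * (\<integral>x. (bn n x - b x)\<^sup>2 \<partial>N) + 2 * (\<integral>x. (cn n x - c x)\<^sup>2 \<partial>N)) sequentially"
    proof (intro always_eventually allI)
      fix n
      have "(\<integral>x. (bn n x + cn n x - (b x + c x))\<^sup>2 \<partial>N) \<le> (\<integral>x. 2 * (bn n x - b x)\<^sup>2 + 2 * (cn n x - c x)\<^sup>2 \<partial>N)"
        using i le i3 by (intro integral_mono) auto
      then show "(\<integral>x. (bn n x + cn n x - (b x + c x))\<^sup>2 \<partial>N)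
        \<le> 2 * (\<integral>x. (bn n x - b x)\<^sup>2 \<partial>N) + 2 * (\<integral>x. (cn n x - c x)\<^sup>2 \<partial>N)" using i by simp
    qed
  qed auto
  moreover have "integrable N (\<lambda>x. (b x + c x)\<^sup>2)"
    by (rule Bochner_Integration.integrable_bound[where f="\<lambda>x. 2 * (b x)\<^sup>2 + 2 * (c x)\<^sup>2"])
      (use i square_sum_le in auto)
  ultimately show ?thesis using i3 unfolding L2_conv_def by auto
qed

lemma L2_conv_mult:
  assumes b: "L2_conv N bn b" and c: "c \<in> borel_measurable N" "AE x in N. \<bar>c x\<bar> \<le> C"
  shows "L2_conv N (\<lambda>n x. c x * bn n x) (\<lambda>x. c x * b x)"
proof -
  have c2: "AE x in N. \<bar>(c x)\<^sup>2\<bar> \<le> C\<^sup>2" "AE x in N. (c x)\<^sup>2 \<le> C\<^sup>2"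
    using c(2) by (eventually_elim, auto simp: power2_le_iff_abs_le[symmetric] abs_le_square_iff intro: order_trans[OF _ power_mono[of "\<bar>_\<bar>" _ 2]])+
  have [measurable]: "bn n \<in> borel_measurable N" "b \<in> borel_measurable N" for n
    using b unfolding L2_conv_def by auto
  have i: "integrable N (\<lambda>x. (bn n x - b x)\<^sup>2)" "integrable N (\<lambda>x. (b x)\<^sup>2)" for n using b unfolding L2_conv_def by auto
  have eq: "(c x * bn n x - c x * b x)\<^sup>2 = (bn n x - b x)\<^sup>2 * (c x)\<^sup>2" for n x
    by (simp add: power2_eq_square algebra_simps)
  have i3: "integrable N (\<lambda>x. (c x * bn n x - c x * b x)\<^sup>2)" for n
    unfolding eq using c by (intro integrable_mult_bounded[OF i(1) _ c2(1)]) auto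
  have i4: "integrable N (\<lambda>x. (c x * b x)\<^sup>2)"
    unfolding power_mult_distrib mult.commute[of "(c _)\<^sup>2"] using c by (intro integrable_mult_bounded[OF i(2) _ c2(1)]) auto
  have "(\<lambda>n. C\<^sup>2 * (\<integral>x. (bn n x - b x)\<^sup>2 \<partial>N)) \<longlonglongrightarrow> C\<^sup>2 * 0"
    using b unfolding L2_conv_def by (intro tendsto_intros) auto
  then have "(\<lambda>n. C\<^sup>2 * (\<integral>x. (bn n x - b x)\<^sup>2 \<partial>N)) \<longlonglongrightarrow> 0" by simp
  then have "(\<lambda>n. \<integral>x. (c x * bn n x - c x * b x)\<^sup>2 \<partial>N) \<longlonglongrightarrow> 0"
  proof (rule tendsto_sandwich[OF _ _ tendsto_const, rotated 2])
    show "eventually (\<lambda>n. (\<integral>x. (c x * bn n x - c x * b x)\<^sup>2 \<partial>N) \<le> C\<^sup>2 * (\<integral>x. (bn n x - b x)\<^sup>2 \<partial>N)) sequentially"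
    proof (intro always_eventually allI)
      fix n
      have "(\<integral>x. (c x * bn n x - c x * b x)\<^sup>2 \<partial>N) \<le> (\<integral>x. C\<^sup>2 * (bn n x - b x)\<^sup>2 \<partial>N)"
      proof (rule integral_mono_AE[OF i3])
        show "AE x in N. (c x * bn n x - c x * b x)\<^sup>2 \<le> C\<^sup>2 * (bn n x - b x)\<^sup>2"
          using c2(2) unfolding eq by eventually_elim (simp add: mult.commute mult_right_mono)
      qed (use i in auto)
      then show "(\<integral>x. (c x * bn n x - c x * b x)\<^sup>2 \<partial>N) \<le> C\<^sup>2 * (\<integral>x. (bn n x - b x)\<^sup>2 \<partial>N)" by simp
    qed
  qed auto
  then show ?thesis using i3 i4 c unfolding L2_conv_def by auto
qed

lemma L2_conv_const:
  "b \<in> borel_measurable N \<Longrightarrow> integrable N (\<lambda>x. (b x)\<^sup>2) \<Longrightarrow> L2_conv N (\<lambda>n. b) b"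
  unfolding L2_conv_def by simp

lemma triple_product:
  assumes a: "bounded_AE_conv N an a" and b: "L2_conv N bn b"
    and c: "c \<in> borel_measurable N" "integrable N (\<lambda>x. (c x)\<^sup>2)"
  shows "\<And>n. integrable N (\<lambda>x. an n x * bn n x * c x)" "integrable N (\<lambda>x. a x * b x * c x)"
    "(\<lambda>n. \<integral>x. an n x * bn n x * c x \<partial>N) \<longlonglongrightarrow> (\<integral>x. a x * b x * c x \<partial>N)"
proof -
  obtain A where A: "\<And>n. an n \<in> borel_measurable N" "a \<in> borel_measurable N"
    "\<And>n. AE x in N. \<bar>an n x\<bar> \<le> A" "AE x in N. (\<lambda>n. an n x) \<longlonglongrightarrow> a x"
    by (rule bounded_AE_convE[OF a], rule that)
  have B: "\<And>n. bn n \<in> borel_measurable N" "b \<in> borel_measurable N" "integrable N (\<lambda>x. (b x)\<^sup>2)"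
    "\<And>n. integrable N (\<lambda>x. (bn n x - b x)\<^sup>2)" "(\<lambda>n. \<integral>x. (bn n x - b x)\<^sup>2 \<partial>N) \<longlonglongrightarrow> 0"
    using b unfolding L2_conv_def by auto
  show "\<And>n. integrable N (\<lambda>x. an n x * bn n x * c x)" "integrable N (\<lambda>x. a x * b x * c x)"
    "(\<lambda>n. \<integral>x. an n x * bn n x * c x \<partial>N) \<longlonglongrightarrow> (\<integral>x. a x * b x * c x \<partial>N)"
    by (rule triple_product_convergence[OF A B c])+
qed

text \<open>On an axisymmetric map this is \<open>q = r v\<^sub>1\<close>; unlike \<open>v\<^sub>1\<close> it is polynomial in \<open>(x, y)\<close>. Given
  \<open>A = Du(x)\<close>, its partial derivative along the map is \<open>dqmap\<close>.\<close>

definition qmap :: "real^3 \<Rightarrow> real^3 \<Rightarrow> real" where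
  "qmap x y = x $ 1 * y $ 1 + x $ 2 * y $ 2"

definition dqmap :: "real^3 \<Rightarrow> real^3 \<Rightarrow> real^3^3 \<Rightarrow> 3 \<Rightarrow> real" where
  "dqmap x y A j = x $ 1 * A $ 1 $ j + x $ 2 * A $ 2 $ j
     + (axis j 1 :: real^3) $ 1 * y $ 1 + (axis j 1 :: real^3) $ 2 * y $ 2"

text \<open>Integration by parts on \<open>\<zeta> q\<^sup>k\<^sup>+\<^sup>1 s\<^sup>l\<close> turns the two-dimensional Jacobian of \<open>(q, s)\<close> into a
  first-order expression; this is what makes it weakly continuous.\<close>

lemma jacobian_identity:
  fixes k l :: nat and j m :: 3
  assumes \<Omega>: "open \<Omega>" "bounded \<Omega>" and u: "u \<in> W12 \<Omega>"
    and M: "\<And>i. AE x in lebesgue_on \<Omega>. \<bar>u x $ i\<bar> \<le> M" and \<zeta>: "\<zeta> \<in> test_functions \<Omega>"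
  defines "D \<equiv> weak_gradient \<Omega> u"
  shows "real (Suc k) * (\<integral>x. \<zeta> x * qmap x (u x) ^ k * u x $ 3 ^ l *
        (dqmap x (u x) (D x) j * D x $ 3 $ m - dqmap x (u x) (D x) m * D x $ 3 $ j) \<partial>lebesgue_on \<Omega>)
     = - (\<integral>x. qmap x (u x) ^ Suc k * u x $ 3 ^ l * (frechet_derivative \<zeta> (at x) (axis j 1) * D x $ 3 $ m
        - frechet_derivative \<zeta> (at x) (axis m 1) * D x $ 3 $ j) \<partial>lebesgue_on \<Omega>)"
proof -
  let ?N = "lebesgue_on \<Omega>"
  have s: "\<Omega> \<in> sets lebesgue" using \<Omega> by simp
  have lebN: "f \<in> borel_measurable ?N" if "f \<in> borel_measurable lebesgue" for f :: "real^3 \<Rightarrow> real"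
    using that by (rule measurable_restrict_space1)
  obtain C where C: "compact C" "C \<subseteq> \<Omega>" "\<And>x. x \<notin> C \<Longrightarrow> \<zeta> x = 0"
    by (rule test_functions_support[OF \<zeta>], rule that)
  \<comment> \<open>Radii at most \<open>e0\<close> keep the balls around \<open>C\<close> inside
    \<Omega>, so that on \<open>C\<close> the mollified derivatives are exact for every index and
    not just eventually.\<close>
  obtain e0 where e0: "e0 > 0" "(\<Union>x\<in>C. cball x e0) \<subseteq> \<Omega>"
    using compact_subset_open_imp_cball_epsilon_subset[OF C(1) \<Omega>(1) C(2)] .
  obtain R where R: "\<And>x. x \<in> \<Omega> \<Longrightarrow> norm x \<le> R" using \<Omega>(2) bounded_iff by metis
  define f where "f i = zero_ext \<Omega> (\<lambda>x. u x $ i)" for i :: 3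
  define G where "G i j = zero_ext \<Omega> (\<lambda>x. D x $ i $ j)" for i j :: 3
  note fi = W12_zero_ext(1,2)[OF \<Omega> u, folded f_def] and Gi = W12_zero_ext(3,4)[OF \<Omega> u, folded D_def, folded G_def]
  define F where "F p = (case snd p of None \<Rightarrow> f (fst p) | Some j \<Rightarrow> G (fst p) j)" for p :: "3 \<times> 3 option"
  have Fi: "integrable lebesgue (F p)" "integrable lebesgue (\<lambda>x. (F p x)\<^sup>2)" for p
    using fi Gi by (auto simp: F_def split: option.split)
  obtain \<epsilon> :: "nat \<Rightarrow> real" where \<epsilon>: "\<And>n. 0 < \<epsilon> n" "\<And>n. \<epsilon> n \<le> e0 / real (Suc n)"
    and lim: "\<And>p. AE x in lebesgue. (\<lambda>n. convolution (F p) (mollifier (\<epsilon> n)) x) \<longlonglongrightarrow> F p x"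
    and lim2: "\<And>p. (\<lambda>n. sqnorm (\<lambda>x. convolution (F p) (mollifier (\<epsilon> n)) x - F p x)) \<longlonglongrightarrow> 0"
    by (rule mollification_AE_sequence[of "UNIV :: (3 \<times> 3 option) set" F e0]) (use Fi e0 in auto)
  have \<epsilon>e: "\<epsilon> n \<le> e0" for n
  proof -
    have "e0 / real (Suc n) \<le> e0" using e0(1) by (simp add: divide_le_eq)
    then show ?thesis using \<epsilon>(2)[of n] by linarith
  qed
  define c where "c n i = convolution (f i) (mollifier (\<epsilon> n))" for n i
  define g where "g n i j = convolution (G i j) (mollifier (\<epsilon> n))" for n i j
  have cs: "smooth_on UNIV (c n i)" for n i unfolding c_def by (rule smooth_convolution[OF fi(1) mollifier_test[OF \<epsilon>(1)]])
  have gs: "smooth_on UNIV (g n i j)" for n i j unfolding g_def by (rule smooth_convolution[OF Gi(1) mollifier_test[OF \<epsilon>(1)]])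
  have Mf: "AE x in lebesgue. \<bar>f i x\<bar> \<le> \<bar>M\<bar>" for i
    using M[of i] unfolding AE_lebesgue_on[OF s] by eventually_elim (auto simp: f_def zero_ext_def indicator_def)
  have cconv: "bounded_AE_conv ?N (\<lambda>n. c n i) (\<lambda>x. u x $ i)" for i
  proof (rule bounded_AE_convI[where A="\<bar>M\<bar>"])
    show "c n i \<in> borel_measurable ?N" for n by (rule lebN[OF smooth_borel_lebesgue[OF cs]])
    show "AE x in ?N. \<bar>c n i x\<bar> \<le> \<bar>M\<bar>" for n
      unfolding c_def using convolution_mollifier_bound[OF fi(1) \<epsilon>(1) Mf] by simp
    show "AE x in ?N. (\<lambda>n. c n i x) \<longlonglongrightarrow> u x $ i"
      unfolding AE_lebesgue_on[OF s] using lim[of "(i, None)"] by eventually_elim (auto simp: F_def c_def f_def)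
  qed (rule W12_comp_measurable[OF u])
  have sq: "L2_conv ?N (\<lambda>n. convolution (F p) (mollifier (\<epsilon> n))) (F p)" for p
  proof -
    let ?h = "\<lambda>n x. convolution (F p) (mollifier (\<epsilon> n)) x - F p x"
    have cm: "convolution (F p) (mollifier (\<epsilon> n)) \<in> borel_measurable lebesgue" for n
      by (rule smooth_borel_lebesgue[OF smooth_convolution[OF Fi(1) mollifier_test[OF \<epsilon>(1)]]])
    have hm: "?h n \<in> borel_measurable lebesgue" for n using cm Fi(1) by auto
    have csupp: "integrable lebesgue (\<lambda>x. (?h n x)\<^sup>2)" for n
    proof -
      have "sqnorm (?h n) \<le> 3 * (sqnorm (convolution (F p) (mollifier (\<epsilon> n))) + sqnorm (F p) + sqnorm (\<lambda>x::real^3. 0))"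
        using sqnorm_triangle3[OF cm borel_measurable_uminus[OF borel_measurable_integrable[OF Fi(1)]], of "\<lambda>_. 0" n p] by simp
      also have "\<dots> \<le> 3 * (sqnorm (F p) + sqnorm (F p) + sqnorm (\<lambda>x::real^3. 0))"
        by (intro mult_left_mono add_mono sqnorm_convolution_le Fi \<epsilon>) auto
      also have "\<dots> < \<infinity>" using sqnorm_finite[OF Fi(2)] by (simp add: ennreal_mult_less_top)
      finally show ?thesis using hm by (intro integrableI_nonneg) auto
    qed
    have l0: "(\<lambda>n. \<integral>x. (?h n x)\<^sup>2 \<partial>lebesgue) \<longlonglongrightarrow> 0"
    proof (rule tendsto_ennrealD)
      show "(\<lambda>n. ennreal (\<integral>x. (?h n x)\<^sup>2 \<partial>lebesgue)) \<longlonglongrightarrow> ennreal 0"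
        using lim2[of p] nn_integral_eq_integral[OF csupp] by simp
    qed auto
    have ri: "integrable ?N h" if "integrable lebesgue h" for h :: "real^3 \<Rightarrow> real"
      unfolding integrable_lebesgue_on[OF s]
      using integrable_mult_bounded[OF that, of "indicator \<Omega>" 1] s by (simp add: mult.commute)
    have "(\<lambda>n. \<integral>x. (?h n x)\<^sup>2 \<partial>?N) \<longlonglongrightarrow> 0"
    proof (rule tendsto_sandwich[OF _ _ tendsto_const l0])
      have "(\<integral>x. (?h n x)\<^sup>2 \<partial>?N) \<le> (\<integral>x. (?h n x)\<^sup>2 \<partial>lebesgue)" for n
        unfolding integral_lebesgue_on[OF s]
        using ri[OF csupp, of n] csupp[of n] unfolding integrable_lebesgue_on[OF s]
        by (intro integral_mono) (auto simp: indicator_def)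
      then show "eventually (\<lambda>n. (\<integral>x. (?h n x)\<^sup>2 \<partial>?N) \<le> (\<integral>x. (?h n x)\<^sup>2 \<partial>lebesgue)) sequentially" by simp
    qed auto
    then show ?thesis unfolding L2_conv_def
      using ri[OF csupp] ri[OF Fi(2)] lebN[OF cm] lebN[OF borel_measurable_integrable[OF Fi(1)]] by auto
  qed
  have L2cong: "L2_conv ?N bn b'" if "L2_conv ?N bn b" "\<And>x. x \<in> \<Omega> \<Longrightarrow> b x = b' x" for bn b b'
  proof -
    have i: "integrable ?N (h b) \<longleftrightarrow> integrable ?N (h b')" "integral\<^sup>L ?N (h b) = integral\<^sup>L ?N (h b')"
      "b \<in> borel_measurable ?N \<longleftrightarrow> b' \<in> borel_measurable ?N"
      if "\<And>x. x \<in> \<Omega> \<Longrightarrow> h b x = h b' x" for h :: "(real^3 \<Rightarrow> real) \<Rightarrow> real^3 \<Rightarrow> real"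
      using that \<open>\<And>x. x \<in> \<Omega> \<Longrightarrow> b x = b' x\<close>
      by (auto intro!: Bochner_Integration.integrable_cong Bochner_Integration.integral_cong measurable_cong)
    show ?thesis using that i[of "\<lambda>b x. (b x)\<^sup>2"] i[of "\<lambda>b x. (bn _ x - b x)\<^sup>2"] unfolding L2_conv_def by simp
  qed
  have gconv: "L2_conv ?N (\<lambda>n. g n i j) (\<lambda>x. D x $ i $ j)" for i j
    by (rule L2cong[OF sq[of "(i, Some j)", unfolded F_def, simplified, folded g_def]]) (simp add: G_def)
  have cconv2: "L2_conv ?N (\<lambda>n. c n i) (\<lambda>x. u x $ i)" for i
    by (rule L2cong[OF sq[of "(i, None)", unfolded F_def, simplified, folded c_def]]) (simp add: f_def)
  have xm: "(\<lambda>x::real^3. x $ i) \<in> borel_measurable ?N" for i by (rule lebN[OF smooth_borel_lebesgue[OF smooth_vec_nth]])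
  have xb: "AE x in ?N. \<bar>x $ i\<bar> \<le> R" for i
    unfolding AE_lebesgue_on[OF s] using R component_le_norm_cart order_trans by (intro AE_I2) blast
  \<comment> \<open>The mollified counterparts of \<open>qmap\<close> and \<open>dqmap\<close>; on
    \<open>C\<close> the second is the derivative of the first.\<close>
  define q where "q n x = qmap x (vector [c n 1 x, c n 2 x, c n 3 x])" for n x
  define Q where "Q n j x = x $ 1 * g n 1 j x + x $ 2 * g n 2 j x
     + (axis j 1 :: real^3) $ 1 * c n 1 x + (axis j 1 :: real^3) $ 2 * c n 2 x" for n j x
  have q_eq: "q n = (\<lambda>x. x $ 1 * c n 1 x + x $ 2 * c n 2 x)" for n by (simp add: q_def qmap_def fun_eq_iff)
  have qs: "smooth_on UNIV (q n)" for n unfolding q_eq by (intro smooth_add smooth_mult smooth_vec_nth cs)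
  have qconv: "bounded_AE_conv ?N q (\<lambda>x. qmap x (u x))"
    unfolding q_eq qmap_def by (intro bounded_AE_conv_add bounded_AE_conv_mult cconv bounded_AE_conv_const[OF xm xb])
  have Qconv: "L2_conv ?N (\<lambda>n. Q n j) (\<lambda>x. dqmap x (u x) (D x) j)" for j
    unfolding Q_def dqmap_def
    by (intro L2_conv_add L2_conv_mult[OF gconv xm xb] L2_conv_mult[OF cconv2, where C="\<bar>_\<bar>"]) auto
  have dq: "frechet_derivative (q n) (at x) (axis j 1) = Q n j x" and dc: "frechet_derivative (c n i) (at x) (axis j 1) = g n i j x"
    if "x \<in> C" for n x i j
  proof -
    have "cball x (\<epsilon> n) \<subseteq> \<Omega>" using e0(2) that \<epsilon>e[of n] by fastforce
    then have dc: "frechet_derivative (c n i) (at x) (axis j 1) = g n i j x" for i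
      unfolding c_def f_def g_def
      using mollified_derivative[OF fi(1)[unfolded f_def] W12_zero_ext(5)[OF \<Omega> u] \<epsilon>(1), of x n "axis j 1" i]
      by (simp add: matrix_vector_axis G_def D_def axis_in_Basis_iff)
    then show "frechet_derivative (c n i) (at x) (axis j 1) = g n i j x" .
    have dx: "frechet_derivative (\<lambda>x::real^3. x $ i) (at x) v = v $ i" for i v
      using frechet_derivative_eq[OF bounded_linear_imp_has_derivative[OF bounded_linear_vec_nth]] by metis
    show "frechet_derivative (q n) (at x) (axis j 1) = Q n j x"
      unfolding q_eq Q_def
      by (simp add: frechet_derivative_smooth_add[OF smooth_mult[OF smooth_vec_nth cs] smooth_mult[OF smooth_vec_nth cs]]
          frechet_derivative_smooth_mult[OF smooth_vec_nth cs] dx dc)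
  qed
  \<comment> \<open>Only the scalar factor is regularised. The gradient of the third component, with
    which it is paired, remains the weak one, so the curl identity applies without error to each
    \<open>E n\<close>.\<close>
  define E where "E n x = \<zeta> x * (q n x ^ Suc k * c n 3 x ^ l)" for n x
  note \<zeta>s = test_functions_smooth[OF \<zeta>]
  have Et: "E n \<in> test_functions \<Omega>" for n
    unfolding E_def[abs_def] by (intro test_functions_mult[OF \<zeta>] smooth_mult smooth_power qs cs)
  \<comment> \<open>For \<open>l = 0\<close> the truncated exponent \<open>l - 1\<close> is
    harmless, as its term carries the factor \<open>real l\<close>.\<close>
  have dE: "frechet_derivative (E n) (at x) (axis j 1) = real (Suc k) * (\<zeta> x * q n x ^ k * c n 3 x ^ l * Q n j x)
     + real l * (\<zeta> x * q n x ^ Suc k * c n 3 x ^ (l - 1) * g n 3 j x)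
     + q n x ^ Suc k * c n 3 x ^ l * frechet_derivative \<zeta> (at x) (axis j 1)" for n x j
  proof -
    have "frechet_derivative (E n) (at x) (axis j 1) = \<zeta> x * (q n x ^ Suc k * (real l * c n 3 x ^ (l - 1) * frechet_derivative (c n 3) (at x) (axis j 1))
        + (real (Suc k) * q n x ^ k * frechet_derivative (q n) (at x) (axis j 1)) * c n 3 x ^ l)
        + frechet_derivative \<zeta> (at x) (axis j 1) * (q n x ^ Suc k * c n 3 x ^ l)"
      unfolding E_def[abs_def]
      by (simp only: frechet_derivative_smooth_mult[OF \<zeta>s smooth_mult[OF smooth_power[OF qs] smooth_power[OF cs]]]
          frechet_derivative_smooth_mult[OF smooth_power[OF qs] smooth_power[OF cs]]
          frechet_derivative_smooth_power[OF qs] frechet_derivative_smooth_power[OF cs] diff_Suc_1)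
    \<comment> \<open>The formulas for the derivatives of \<open>q n\<close> and
      \<open>c n 3\<close> are available only on \<open>C\<close>; elsewhere \<zeta> vanishes and
      removes them.\<close>
    then show ?thesis
      using dq[of x n j] dc[of x n 3 j] C(3)[of x] by (cases "x \<in> C") (simp_all add: algebra_simps)
  qed
  have bounded_test: "bounded_AE_conv ?N (\<lambda>n. \<psi>) \<psi>" if \<psi>: "\<psi> \<in> test_functions \<Omega>" for \<psi>
  proof -
    obtain B where "B > 0" "\<And>x. \<bar>\<psi> x\<bar> \<le> B" by (rule test_functions_bounded[OF \<psi>], rule that)
    then show ?thesis by (intro bounded_AE_conv_const[where A=B] lebN[OF smooth_borel_lebesgue[OF test_functions_smooth[OF \<psi>]]]) auto
  qed
  have a1: "bounded_AE_conv ?N (\<lambda>n x. \<zeta> x * q n x ^ a * c n 3 x ^ b) (\<lambda>x. \<zeta> x * qmap x (u x) ^ a * u x $ 3 ^ b)" for a b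
    by (intro bounded_AE_conv_mult bounded_AE_conv_power bounded_test \<zeta> qconv cconv)
  have a2: "bounded_AE_conv ?N (\<lambda>n x. q n x ^ Suc k * c n 3 x ^ l * frechet_derivative \<zeta> (at x) v)
     (\<lambda>x. qmap x (u x) ^ Suc k * u x $ 3 ^ l * frechet_derivative \<zeta> (at x) v)" for v
    by (intro bounded_AE_conv_mult bounded_AE_conv_power bounded_test test_functions_derivative[OF \<zeta>] qconv cconv)
  note Sm = W12_comp_measurable(2)[OF u, folded D_def] and S2 = W12_comp_square(2)[OF u, folded D_def]
  have one: "L2_conv ?N (\<lambda>n x. 1) (\<lambda>x. 1)"
    using finite_measure.integrable_const[OF finite_measure_bounded_open[OF \<Omega>]] by (intro L2_conv_const) auto
  let ?t1 = "\<lambda>n j m x. \<zeta> x * q n x ^ k * c n 3 x ^ l * Q n j x * D x $ 3 $ m"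
  let ?t2 = "\<lambda>n j m x. \<zeta> x * q n x ^ Suc k * c n 3 x ^ (l - 1) * g n 3 j x * D x $ 3 $ m"
  \<comment> \<open>The factor 1 is a constant L2 convergent sequence, which brings this term into
    the form of \<open>triple_product\<close>.\<close>
  let ?t3 = "\<lambda>n j m x. q n x ^ Suc k * c n 3 x ^ l * frechet_derivative \<zeta> (at x) (axis j 1) * 1 * D x $ 3 $ m"
  let ?T1 = "\<lambda>j m x. \<zeta> x * qmap x (u x) ^ k * u x $ 3 ^ l * dqmap x (u x) (D x) j * D x $ 3 $ m"
  let ?T2 = "\<lambda>j m x. \<zeta> x * qmap x (u x) ^ Suc k * u x $ 3 ^ (l - 1) * D x $ 3 $ j * D x $ 3 $ m"
  let ?T3 = "\<lambda>j m x. qmap x (u x) ^ Suc k * u x $ 3 ^ l * frechet_derivative \<zeta> (at x) (axis j 1) * 1 * D x $ 3 $ m"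
  note p1 = triple_product[OF a1[of k l] Qconv Sm S2] and p2 = triple_product[OF a1[of "Suc k" "l - 1"] gconv Sm S2]
    and p3 = triple_product[OF a2 one Sm S2]
  define P where "P I1 I2 I3 = real (Suc k) * (I1 j m - I1 m j) + real l * (I2 j m - I2 m j) + (I3 j m - I3 m j)"
    for I1 I2 I3 :: "3 \<Rightarrow> 3 \<Rightarrow> real"
  have zero: "P (\<lambda>j m. integral\<^sup>L ?N (?t1 n j m)) (\<lambda>j m. integral\<^sup>L ?N (?t2 n j m)) (\<lambda>j m. integral\<^sup>L ?N (?t3 n j m)) = 0" for n
  proof -
    have "(\<integral>x. real (Suc k) * (?t1 n j m x - ?t1 n m j x) + real l * (?t2 n j m x - ?t2 n m j x) + (?t3 n j m x - ?t3 n m j x) \<partial>?N)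
       = (\<integral>x. frechet_derivative (E n) (at x) (axis j 1) * D x $ 3 $ m - frechet_derivative (E n) (at x) (axis m 1) * D x $ 3 $ j \<partial>?N)"
      by (rule Bochner_Integration.integral_cong) (simp_all only: dE, simp add: algebra_simps)
    also have "\<dots> = 0" unfolding D_def by (rule curl_free_pairing[OF \<Omega>(1) u Et])
    finally show ?thesis using p1(1)[of n] p2(1)[of n] p3(1)[of n] unfolding P_def by simp
  qed
  have "(\<lambda>n. P (\<lambda>j m. integral\<^sup>L ?N (?t1 n j m)) (\<lambda>j m. integral\<^sup>L ?N (?t2 n j m)) (\<lambda>j m. integral\<^sup>L ?N (?t3 n j m)))
     \<longlonglongrightarrow> P (\<lambda>j m. integral\<^sup>L ?N (?T1 j m)) (\<lambda>j m. integral\<^sup>L ?N (?T2 j m)) (\<lambda>j m. integral\<^sup>L ?N (?T3 j m))"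
    unfolding P_def by (intro tendsto_intros p1(3) p2(3) p3(3))
  then have "P (\<lambda>j m. integral\<^sup>L ?N (?T1 j m)) (\<lambda>j m. integral\<^sup>L ?N (?T2 j m)) (\<lambda>j m. integral\<^sup>L ?N (?T3 j m)) = 0"
    unfolding zero by (simp add: LIMSEQ_const_iff)
  \<comment> \<open>In the limit the term from differentiating the power of \<open>s\<close> is
    symmetric in \<open>j\<close> and \<open>m\<close> and drops out of the antisymmetric
    expression. Before the limit it need not cancel, since one of its two gradient factors is
    mollified and the other is not.\<close>
  moreover have "integral\<^sup>L ?N (?T2 j m) = integral\<^sup>L ?N (?T2 m j)" by (rule Bochner_Integration.integral_cong) simp_all
  ultimately have "real (Suc k) * (integral\<^sup>L ?N (?T1 j m) - integral\<^sup>L ?N (?T1 m j)) = - (integral\<^sup>L ?N (?T3 j m) - integral\<^sup>L ?N (?T3 m j))"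
    unfolding P_def by simp
  moreover have "integral\<^sup>L ?N (?T1 j m) - integral\<^sup>L ?N (?T1 m j) = (\<integral>x. \<zeta> x * qmap x (u x) ^ k * u x $ 3 ^ l *
        (dqmap x (u x) (D x) j * D x $ 3 $ m - dqmap x (u x) (D x) m * D x $ 3 $ j) \<partial>?N)"
    unfolding Bochner_Integration.integral_diff[OF p1(2) p1(2), symmetric]
    by (rule Bochner_Integration.integral_cong) (simp_all add: algebra_simps)
  moreover have "integral\<^sup>L ?N (?T3 j m) - integral\<^sup>L ?N (?T3 m j) = (\<integral>x. qmap x (u x) ^ Suc k * u x $ 3 ^ l * (frechet_derivative \<zeta> (at x) (axis j 1) * D x $ 3 $ m
        - frechet_derivative \<zeta> (at x) (axis m 1) * D x $ 3 $ j) \<partial>?N)"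
    unfolding Bochner_Integration.integral_diff[OF p3(2) p3(2), symmetric]
    by (rule Bochner_Integration.integral_cong) (simp_all add: algebra_simps)
  ultimately show ?thesis by simp
qed

text \<open>Mollify the indicator of a compact neighbourhood \<open>C\<close> of \<open>K\<close>,
  with a radius below both the margin of \<open>K\<close> in \<open>C\<close> and the margin of
  \<open>C\<close> in \<open>U\<close>.\<close>

lemma smooth_cutoff:
  fixes K :: "'a::euclidean_space set"
  assumes K: "compact K" and U: "open U" "K \<subseteq> U"
  obtains \<zeta> where "\<zeta> \<in> test_functions U" "\<And>x. \<bar>\<zeta> x\<bar> \<le> (1::real)" "\<And>x. x \<in> K \<Longrightarrow> \<zeta> x = 1"
proof -
  obtain e C where C: "e > 0" "compact C" "C \<subseteq> U" "\<And>x. x \<in> K \<Longrightarrow> cball x e \<subseteq> C"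
    using compact_fattening[OF K U] by blast
  obtain e' C' where C': "e' > 0" "compact C'" "C' \<subseteq> U" "\<And>x. x \<in> C \<Longrightarrow> cball x e' \<subseteq> C'"
    using compact_fattening[OF C(2) U(1) C(3)] by blast
  define \<epsilon> where "\<epsilon> = min e e'"
  have \<epsilon>: "\<epsilon> > 0" "\<epsilon> \<le> e" "\<epsilon> \<le> e'" using C C' by (auto simp: \<epsilon>_def)
  let ?i = "indicator C :: 'a \<Rightarrow> real"
  have ii: "integrable lebesgue ?i"
    using lmeasurable_compact[OF C(2)] by (auto simp: fmeasurable_def intro!: integrable_real_indicator)
  show ?thesis
  proof (rule that[of "convolution ?i (mollifier \<epsilon>)"])
    have "convolution ?i (mollifier \<epsilon>) x = 0" if "x \<notin> C'" for x
    proof -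
      have "?i y * mollifier \<epsilon> (x - y) = 0" for y
      proof (cases "y \<in> C")
        case True
        then have "x \<notin> cball y e'" using C'(4) that by blast
        then have "norm (x - y) \<ge> \<epsilon>" using \<epsilon> by (simp add: dist_norm norm_minus_commute)
        then show ?thesis by (simp add: mollifier_eq_0[OF \<epsilon>(1)])
      qed simp
      then show ?thesis unfolding convolution_def by (simp only:) simp
    qed
    then show "convolution ?i (mollifier \<epsilon>) \<in> test_functions U"
      by (intro test_functionsI[OF smooth_convolution[OF ii mollifier_test[OF \<epsilon>(1)]] _ C'(2,3)])
    show "\<bar>convolution ?i (mollifier \<epsilon>) x\<bar> \<le> 1" for x
      by (rule convolution_mollifier_bound[OF ii \<epsilon>(1)]) (simp add: indicator_def)
    show "convolution ?i (mollifier \<epsilon>) x = 1" if "x \<in> K" for x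
    proof -
      have "?i y * mollifier \<epsilon> (x - y) = mollifier \<epsilon> (x - y)" for y
      proof (cases "y \<in> C")
        case False
        then have "y \<notin> cball x e" using C(4)[OF that] by blast
        then have "norm (x - y) \<ge> \<epsilon>" using \<epsilon> by (simp add: dist_norm)
        then show ?thesis by (simp add: mollifier_eq_0[OF \<epsilon>(1)])
      qed simp
      then have "convolution ?i (mollifier \<epsilon>) x = (\<integral>y. mollifier \<epsilon> (x - y) \<partial>lebesgue)"
        unfolding convolution_def by (simp only:)
      also have "\<dots> = (\<integral>y. mollifier \<epsilon> (x - y) \<partial>lborel)"
        using \<epsilon>(1) by (intro integral_completion) simp
      also have "\<dots> = (\<integral>y. mollifier \<epsilon> (y::'a) \<partial>lborel)" 
        using integral_reflect[OF mollifier_borel[OF \<epsilon>(1)], of x] .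
      also have "\<dots> = (\<integral>y. mollifier \<epsilon> (y::'a) \<partial>lebesgue)"
        using \<epsilon>(1) by (intro integral_completion[symmetric]) simp
      finally show ?thesis by (simp add: mollifier_integral[OF \<epsilon>(1)])
    qed
  qed
qed

section \<open>Weak convergence in L2\<close>

text \<open>Weak convergence in L1 with uniform L2 bounds, which are what pairing with a weight
  converging almost everywhere requires. The bound is uniform in \<open>n\<close> but left
  existential, so that sums and products need no explicit constants.\<close>

definition weak_L2 :: "'a measure \<Rightarrow> (nat \<Rightarrow> 'a \<Rightarrow> real) \<Rightarrow> ('a \<Rightarrow> real) \<Rightarrow> bool" where
  "weak_L2 N bn b \<longleftrightarrow> weak_L1 N bn b \<and> integrable N (\<lambda>x. (b x)\<^sup>2) \<and>
     (\<exists>C. \<forall>n. integrable N (\<lambda>x. (bn n x)\<^sup>2) \<and> (\<integral>x. (bn n x)\<^sup>2 \<partial>N) \<le> C)"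

lemma weak_L2_product:
  assumes N: "finite_measure N" and a: "bounded_AE_conv N an a" and b: "weak_L2 N bn b"
  shows "(\<lambda>n. \<integral>x. an n x * bn n x \<partial>N) \<longlonglongrightarrow> (\<integral>x. a x * b x \<partial>N)"
    "\<And>n. integrable N (\<lambda>x. an n x * bn n x)" "integrable N (\<lambda>x. a x * b x)"
proof -
  obtain A where A: "\<And>n. an n \<in> borel_measurable N" "a \<in> borel_measurable N"
    "\<And>n. AE x in N. \<bar>an n x\<bar> \<le> A" "AE x in N. (\<lambda>n. an n x) \<longlonglongrightarrow> a x"
    by (rule bounded_AE_convE[OF a], rule that)
  have w: "weak_L1 N bn b" using b unfolding weak_L2_def by blast
  obtain C where C: "\<And>n. integrable N (\<lambda>x. (bn n x)\<^sup>2)" "\<And>n. (\<integral>x. (bn n x)\<^sup>2 \<partial>N) \<le> C"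
    using b unfolding weak_L2_def by blast
  show "(\<lambda>n. \<integral>x. an n x * bn n x \<partial>N) \<longlonglongrightarrow> (\<integral>x. a x * b x \<partial>N)"
    by (rule weak_strong_product[OF N w C A])
  show "integrable N (\<lambda>x. an n x * bn n x)" for n
    using integrable_mult_bounded[OF weak_L1D(1)[OF w] A(1) A(3)] by (simp add: mult.commute)
  have "AE x in N. \<forall>n. \<bar>an n x\<bar> \<le> A" using A(3) by (simp add: AE_all_countable)
  then have "AE x in N. \<bar>a x\<bar> \<le> A"
    using A(4)
  proof eventually_elim
    case (elim x)
    have "(\<lambda>n. \<bar>an n x\<bar>) \<longlonglongrightarrow> \<bar>a x\<bar>" by (intro tendsto_intros elim)
    then show ?case by (rule LIMSEQ_le_const2) (use elim in auto)
  qed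
  then show "integrable N (\<lambda>x. a x * b x)"
    using integrable_mult_bounded[OF weak_L1D(2)[OF w] A(2)] by (simp add: mult.commute)
qed

lemma weak_L2_add:
  assumes "weak_L2 N bn b" "weak_L2 N cn c"
  shows "weak_L2 N (\<lambda>n x. bn n x + cn n x) (\<lambda>x. b x + c x)"
proof -
  have w: "weak_L1 N bn b" "weak_L1 N cn c" using assms unfolding weak_L2_def by auto
  have i0: "integrable N (\<lambda>x. (b x)\<^sup>2)" "integrable N (\<lambda>x. (c x)\<^sup>2)" using assms unfolding weak_L2_def by auto
  obtain B where B: "\<And>n. integrable N (\<lambda>x. (bn n x)\<^sup>2)" "\<And>n. (\<integral>x. (bn n x)\<^sup>2 \<partial>N) \<le> B"
    using assms(1) unfolding weak_L2_def by blast
  obtain C where C: "\<And>n. integrable N (\<lambda>x. (cn n x)\<^sup>2)" "\<And>n. (\<integral>x. (cn n x)\<^sup>2 \<partial>N) \<le> C"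
    using assms(2) unfolding weak_L2_def by blast
  note wa = weak_L1_add[OF w]
  have sq: "integrable N (\<lambda>x. (f x + g x)\<^sup>2)" "(\<integral>x. (f x + g x)\<^sup>2 \<partial>N) \<le> 2 * (\<integral>x. (f x)\<^sup>2 \<partial>N) + 2 * (\<integral>x. (g x)\<^sup>2 \<partial>N)"
    if "integrable N (\<lambda>x. f x + g x)" "integrable N (\<lambda>x. (f x)\<^sup>2)" "integrable N (\<lambda>x. (g x)\<^sup>2)" for f g :: "'a \<Rightarrow> real"
  proof -
    show i: "integrable N (\<lambda>x. (f x + g x)\<^sup>2)"
      by (rule Bochner_Integration.integrable_bound[where f="\<lambda>x. 2 * (f x)\<^sup>2 + 2 * (g x)\<^sup>2"])
        (use that square_sum_le in auto)
    have "(\<integral>x. (f x + g x)\<^sup>2 \<partial>N) \<le> (\<integral>x. 2 * (f x)\<^sup>2 + 2 * (g x)\<^sup>2 \<partial>N)"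
      using that i square_sum_le by (intro integral_mono) auto
    then show "(\<integral>x. (f x + g x)\<^sup>2 \<partial>N) \<le> 2 * (\<integral>x. (f x)\<^sup>2 \<partial>N) + 2 * (\<integral>x. (g x)\<^sup>2 \<partial>N)"
      using that by simp
  qed
  have "(\<integral>x. (bn n x + cn n x)\<^sup>2 \<partial>N) \<le> 2 * B + 2 * C" for n
    using sq(2)[OF weak_L1D(1)[OF wa, of n] B(1) C(1)] B(2)[of n] C(2)[of n] by linarith
  then show ?thesis
    unfolding weak_L2_def using wa sq(1)[OF weak_L1D(1)[OF wa] B(1) C(1)] sq(1)[OF weak_L1D(2)[OF wa] i0] by blast
qed

lemma weak_L2_mult:
  assumes b: "weak_L2 N bn b" and c: "c \<in> borel_measurable N" "AE x in N. \<bar>c x\<bar> \<le> A"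
  shows "weak_L2 N (\<lambda>n x. c x * bn n x) (\<lambda>x. c x * b x)"
proof -
  have w: "weak_L1 N bn b" and i0: "integrable N (\<lambda>x. (b x)\<^sup>2)" using b unfolding weak_L2_def by auto
  obtain B where B: "\<And>n. integrable N (\<lambda>x. (bn n x)\<^sup>2)" "\<And>n. (\<integral>x. (bn n x)\<^sup>2 \<partial>N) \<le> B"
    using b unfolding weak_L2_def by blast
  have c2: "AE x in N. (c x)\<^sup>2 \<le> A\<^sup>2"
    using c(2) by eventually_elim (metis abs_ge_zero power2_abs power_mono)
  then have c2': "AE x in N. \<bar>(c x)\<^sup>2\<bar> \<le> A\<^sup>2" by simp
  have i: "integrable N (\<lambda>x. (c x * f x)\<^sup>2)" if "integrable N (\<lambda>x. (f x)\<^sup>2)" for f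
    unfolding power_mult_distrib mult.commute[of "(c _)\<^sup>2"] using c by (intro integrable_mult_bounded[OF that _ c2']) auto
  have "(\<integral>x. (c x * bn n x)\<^sup>2 \<partial>N) \<le> A\<^sup>2 * B" for n
  proof -
    have "(\<integral>x. (c x * bn n x)\<^sup>2 \<partial>N) \<le> (\<integral>x. A\<^sup>2 * (bn n x)\<^sup>2 \<partial>N)"
    proof (rule integral_mono_AE[OF i[OF B(1)]])
      show "AE x in N. (c x * bn n x)\<^sup>2 \<le> A\<^sup>2 * (bn n x)\<^sup>2"
        using c2 by eventually_elim (simp add: power_mult_distrib mult_right_mono)
    qed (use B in simp)
    also have "\<dots> \<le> A\<^sup>2 * B" using B(2)[of n] by (simp add: mult_left_mono)
    finally show ?thesis .
  qed
  then show ?thesis unfolding weak_L2_def using weak_L1_mult[OF w c] i[OF i0] i[OF B(1)] by blast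
qed

text \<open>The first-order consequences of axisymmetry at \<open>x\<close>, with \<open>y = u(x)\<close> and \<open>A = Du(x)\<close>: no swirl,
  infinitesimal rotation invariance, and the derivative of the no-swirl identity.\<close>

definition axi_at :: "real^3 \<Rightarrow> real^3 \<Rightarrow> real^3^3 \<Rightarrow> bool" where
  "axi_at x y A \<longleftrightarrow> x $ 2 * y $ 1 = x $ 1 * y $ 2 \<and> A *v Jrot x = Jrot y \<and>
    (\<forall>j. x $ 2 * A $ 1 $ j - x $ 1 * A $ 2 $ j + (axis j 1 :: real^3) $ 2 * y $ 1 - (axis j 1 :: real^3) $ 1 * y $ 2 = 0)"

lemma axisymmetric_map_axi_at:
  assumes "open \<Omega>" "bounded \<Omega>" "axisymmetric_set \<Omega>" "axisymmetric_map \<Omega> u" "u \<in> W12 \<Omega>"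
  shows "AE x in lebesgue_on \<Omega>. axi_at x (u x) (weak_gradient \<Omega> u x)"
proof -
  note sw = axisymmetric_map_no_swirl[OF assms(1,3,4)]
  have "AE x in lebesgue_on \<Omega>. \<forall>j. x $ 2 * weak_gradient \<Omega> u x $ 1 $ j - x $ 1 * weak_gradient \<Omega> u x $ 2 $ j
      + (axis j 1 :: real^3) $ 2 * u x $ 1 - (axis j 1 :: real^3) $ 1 * u x $ 2 = 0"
    by (rule eventually_all_finite) (rule no_swirl_derivative[OF assms(1,5) sw])
  then show ?thesis
    using sw axisymmetric_map_rotation_derivative[OF assms] unfolding axi_at_def by eventually_elim blast
qed

text \<open>A minor of the map \<open>(q, s)\<close>, where \<open>s\<close> is the third component of the deformation.\<close>

definition Jac :: "3 \<Rightarrow> 3 \<Rightarrow> real^3 \<Rightarrow> real^3 \<Rightarrow> real^3^3 \<Rightarrow> real" where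
  "Jac j m x y A = dqmap x y A j * A $ 3 $ m - dqmap x y A m * A $ 3 $ j"

section \<open>Limits of sequences of axisymmetric maps\<close>

text \<open>What is kept of the minimizing sequence after extraction: uniform bounds, convergence
  almost everywhere, and axisymmetry in its pointwise first-order form, which passes to weak
  limits.\<close>

locale axi_limit =
  fixes \<Omega> :: "(real^3) set" and un :: "nat \<Rightarrow> real^3 \<Rightarrow> real^3" and u :: "real^3 \<Rightarrow> real^3" and M C :: real
  assumes \<Omega>: "open \<Omega>" "bounded \<Omega>"
    and wc: "weakly_converges_W12 \<Omega> un u"
    and bnd: "\<And>n. AE x in lebesgue_on \<Omega>. norm (un n x) \<le> M"
    and en: "\<And>n. (\<integral>x. (norm (weak_gradient \<Omega> (un n) x))\<^sup>2 \<partial>lebesgue_on \<Omega>) \<le> C"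
    and lim: "AE x in lebesgue_on \<Omega>. (\<lambda>n. un n x) \<longlonglongrightarrow> u x"
    and axi: "\<And>n. AE x in lebesgue_on \<Omega>. axi_at x (un n x) (weak_gradient \<Omega> (un n) x)"
begin

abbreviation "N \<equiv> lebesgue_on \<Omega>"
abbreviation "Dn n \<equiv> weak_gradient \<Omega> (un n)"
abbreviation "D \<equiv> weak_gradient \<Omega> u"

lemma fmN: "finite_measure N" by (rule finite_measure_bounded_open[OF \<Omega>])

lemma W: "un n \<in> W12 \<Omega>" "u \<in> W12 \<Omega>" using wc unfolding weakly_converges_W12_def by auto

lemma s\<Omega>: "\<Omega> \<in> sets lebesgue" using \<Omega> by simp

lemma u_bnd: "AE x in N. norm (u x) \<le> M"
proof -
  have "AE x in N. \<forall>n. norm (un n x) \<le> M" using bnd by (simp add: AE_all_countable)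
  then show ?thesis using lim
  proof eventually_elim
    case (elim x)
    have "(\<lambda>n. norm (un n x)) \<longlonglongrightarrow> norm (u x)" by (intro tendsto_intros elim)
    then show ?case by (rule LIMSEQ_le_const2) (use elim in auto)
  qed
qed

definition R where "R = (SOME R. \<forall>x\<in>\<Omega>. norm x \<le> R)"

lemma R: "x \<in> \<Omega> \<Longrightarrow> norm x \<le> R"
  using someI_ex[of "\<lambda>R. \<forall>x\<in>\<Omega>. norm x \<le> R"] \<Omega>(2) unfolding R_def bounded_iff by blast

lemma coord_meas: "(\<lambda>x::real^3. x $ i) \<in> borel_measurable N"
  using smooth_borel_lebesgue[OF smooth_vec_nth] by (rule measurable_restrict_space1)

lemma coord_bnd: "AE x in N. \<bar>x $ i\<bar> \<le> R"
  unfolding AE_lebesgue_on[OF s\<Omega>] using R component_le_norm_cart order_trans by (intro AE_I2) blast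

lemma u_conv: "bounded_AE_conv N (\<lambda>n x. un n x $ i) (\<lambda>x. u x $ i)"
proof (rule bounded_AE_convI[where A=M])
  show "AE x in N. \<bar>un n x $ i\<bar> \<le> M" for n
    using bnd[of n] by eventually_elim (rule order_trans[OF component_le_norm_cart])
  show "AE x in N. (\<lambda>n. un n x $ i) \<longlonglongrightarrow> u x $ i" using lim by eventually_elim (intro tendsto_intros)
qed (rule W12_comp_measurable[OF W(1)] W12_comp_measurable[OF W(2)])+

lemma q_conv: "bounded_AE_conv N (\<lambda>n x. qmap x (un n x)) (\<lambda>x. qmap x (u x))"
  unfolding qmap_def by (intro bounded_AE_conv_add bounded_AE_conv_mult u_conv bounded_AE_conv_const[OF coord_meas coord_bnd])

lemma u_weak: "weak_L2 N (\<lambda>n x. un n x $ i) (\<lambda>x. u x $ i)"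
  unfolding weak_L2_def
proof (intro conjI weak_L1_components[OF \<Omega> wc] W12_comp_square[OF W(2)] exI[of _ "M\<^sup>2 * measure N (space N)"] allI W12_comp_square[OF W(1)])
  interpret finite_measure N by (rule fmN)
  fix n
  have "(\<integral>x. (un n x $ i)\<^sup>2 \<partial>N) \<le> (\<integral>x. M\<^sup>2 \<partial>N)"
  proof (rule integral_mono_AE[OF W12_comp_square(1)[OF W(1)]])
    show "AE x in N. (un n x $ i)\<^sup>2 \<le> M\<^sup>2"
      using bnd[of n] by eventually_elim (meson component_square_le_norm(1) norm_ge_zero order_trans power_mono)
  qed simp
  then show "(\<integral>x. (un n x $ i)\<^sup>2 \<partial>N) \<le> M\<^sup>2 * measure N (space N)" by (simp add: mult.commute)
qed

lemma D_weak: "weak_L2 N (\<lambda>n x. Dn n x $ i $ j) (\<lambda>x. D x $ i $ j)"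
  unfolding weak_L2_def
proof (intro conjI weak_L1_components[OF \<Omega> wc] W12_comp_square[OF W(2)] exI[of _ C] allI W12_comp_square[OF W(1)])
  fix n
  have "(\<integral>x. (Dn n x $ i $ j)\<^sup>2 \<partial>N) \<le> (\<integral>x. (norm (Dn n x))\<^sup>2 \<partial>N)"
    by (intro integral_mono component_square_le_norm W12_comp_square[OF W(1)] W12_square_gradient[OF W(1)])
  then show "(\<integral>x. (Dn n x $ i $ j)\<^sup>2 \<partial>N) \<le> C" using en[of n] by linarith
qed

lemma dq_weak: "weak_L2 N (\<lambda>n x. dqmap x (un n x) (Dn n x) j) (\<lambda>x. dqmap x (u x) (D x) j)"
  unfolding dqmap_def
  by (intro weak_L2_add weak_L2_mult[OF D_weak coord_meas coord_bnd] weak_L2_mult[OF u_weak, where A="\<bar>_\<bar>"]) auto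

text \<open>Every condition in \<open>axi_at\<close> is linear in \<open>(y, A)\<close> with
  coefficients that are bounded functions of \<open>x\<close>, so it is inherited by weak
  limits.\<close>

lemma axi_u: "AE x in N. axi_at x (u x) (D x)"
proof -
  have l1: "weak_L1 N bn b" if "weak_L2 N bn b" for bn b using that unfolding weak_L2_def by blast
  note uw = l1[OF u_weak] and Dw = l1[OF D_weak]
  note xm = weak_L1_mult[OF _ coord_meas coord_bnd]
  have 1: "AE x in N. x $ 2 * u x $ 1 - x $ 1 * u x $ 2 = 0"
  proof (rule weak_L1_limit_0[OF fmN weak_L1_diff[OF xm[OF uw] xm[OF uw]]])
    show "AE x in N. x $ 2 * un n x $ 1 - x $ 1 * un n x $ 2 = 0" for n
      using axi[of n] by eventually_elim (simp add: axi_at_def)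
  qed
  have Jm: "(\<lambda>x. Jrot x $ j) \<in> borel_measurable N" and Jb: "AE x in N. \<bar>Jrot x $ j\<bar> \<le> \<bar>R\<bar>" for j
  proof -
    have c: "AE x in N. \<bar>x $ i\<bar> \<le> \<bar>R\<bar>" for i using coord_bnd[of i] by eventually_elim linarith
    show "(\<lambda>x. Jrot x $ j) \<in> borel_measurable N" "AE x in N. \<bar>Jrot x $ j\<bar> \<le> \<bar>R\<bar>"
      using exhaust_3[of j] coord_meas c by auto
  qed
  have 2: "AE x in N. (D x *v Jrot x) $ i - Jrot (u x) $ i = 0" for i
  proof -
    have mv: "(A *v v) $ i = v $ 1 * A $ i $ 1 + v $ 2 * A $ i $ 2 + v $ 3 * A $ i $ 3" for A :: "real^3^3" and v
      by (simp add: matrix_vector_mult_def sum_3 mult.commute)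
    have a: "weak_L1 N (\<lambda>n x. (Dn n x *v Jrot x) $ i) (\<lambda>x. (D x *v Jrot x) $ i)"
      unfolding mv by (intro weak_L1_add weak_L1_mult[OF Dw Jm Jb])
    have b: "weak_L1 N (\<lambda>n x. Jrot (un n x) $ i) (\<lambda>x. Jrot (u x) $ i)"
      using exhaust_3[of i] uw weak_L1_mult[OF uw[of 2], of "\<lambda>_. -1" 1] weak_L1_mult[OF uw[of 1], of "\<lambda>_. 0" 0]
      by (elim disjE) simp_all
    show ?thesis
    proof (rule weak_L1_limit_0[OF fmN weak_L1_diff[OF a b]])
      show "AE x in N. (Dn n x *v Jrot x) $ i - Jrot (un n x) $ i = 0" for n
        using axi[of n] by eventually_elim (simp add: axi_at_def)
    qed
  qed
  have 3: "AE x in N. x $ 2 * D x $ 1 $ j - x $ 1 * D x $ 2 $ j + (axis j 1 :: real^3) $ 2 * u x $ 1 - (axis j 1 :: real^3) $ 1 * u x $ 2 = 0" for j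
  proof (rule weak_L1_limit_0[OF fmN weak_L1_diff[OF weak_L1_add[OF weak_L1_diff[OF xm[OF Dw] xm[OF Dw]] weak_L1_mult[OF uw, where C="\<bar>_\<bar>"]] weak_L1_mult[OF uw, where C="\<bar>_\<bar>"]]])
    show "AE x in N. x $ 2 * Dn n x $ 1 $ j - x $ 1 * Dn n x $ 2 $ j + (axis j 1 :: real^3) $ 2 * un n x $ 1 - (axis j 1 :: real^3) $ 1 * un n x $ 2 = 0" for n
      using axi[of n] by eventually_elim (simp add: axi_at_def)
  qed auto
  have "AE x in N. \<forall>j. x $ 2 * D x $ 1 $ j - x $ 1 * D x $ 2 $ j + (axis j 1 :: real^3) $ 2 * u x $ 1 - (axis j 1 :: real^3) $ 1 * u x $ 2 = 0"
    by (rule eventually_all_finite) (rule 3)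
  moreover have "AE x in N. \<forall>i. (D x *v Jrot x) $ i - Jrot (u x) $ i = 0"
    by (rule eventually_all_finite) (rule 2)
  ultimately show ?thesis using 1
    unfolding axi_at_def by eventually_elim (simp add: vec_eq_iff[of "_ *v _"])
qed

lemma L2_meas: "weak_L2 N bn b \<Longrightarrow> bn n \<in> borel_measurable N" "weak_L2 N bn b \<Longrightarrow> b \<in> borel_measurable N"
  "weak_L2 N bn b \<Longrightarrow> integrable N (\<lambda>x. (bn n x)\<^sup>2)" "weak_L2 N bn b \<Longrightarrow> integrable N (\<lambda>x. (b x)\<^sup>2)"
  unfolding weak_L2_def weak_L1_def by auto

lemma Jac_integrable: "integrable N (\<lambda>x. Jac j m x (un n x) (Dn n x))" "integrable N (\<lambda>x. Jac j m x (u x) (D x))"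
  unfolding Jac_def
  by (intro Bochner_Integration.integrable_diff L2_product_integrable L2_meas[OF dq_weak] L2_meas[OF D_weak])+

text \<open>Young's inequality for the two products of L2 functions. Only an L1 bound results, and
  this dictates the uniform approximation of weights in \<open>coeff_Jac_conv\<close>.\<close>

lemma Jac_bound: "\<exists>B. \<forall>n. (\<integral>x. \<bar>Jac j m x (un n x) (Dn n x)\<bar> \<partial>N) \<le> B"
proof -
  obtain B where B: "\<And>n. (\<integral>x. (dqmap x (un n x) (Dn n x) j)\<^sup>2 \<partial>N) \<le> B" using dq_weak unfolding weak_L2_def by blast
  obtain B' where B': "\<And>n. (\<integral>x. (dqmap x (un n x) (Dn n x) m)\<^sup>2 \<partial>N) \<le> B'" using dq_weak unfolding weak_L2_def by blast
  obtain E where E: "\<And>n. (\<integral>x. (Dn n x $ 3 $ j)\<^sup>2 \<partial>N) \<le> E" using D_weak unfolding weak_L2_def by blast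
  obtain E' where E': "\<And>n. (\<integral>x. (Dn n x $ 3 $ m)\<^sup>2 \<partial>N) \<le> E'" using D_weak unfolding weak_L2_def by blast
  have "(\<integral>x. \<bar>Jac j m x (un n x) (Dn n x)\<bar> \<partial>N) \<le> (B + E' + B' + E) / 2" for n
  proof -
    let ?a = "\<lambda>j x. dqmap x (un n x) (Dn n x) j" and ?b = "\<lambda>j x. Dn n x $ 3 $ j"
    note i = L2_meas(3)[OF dq_weak, of n] L2_meas(3)[OF D_weak, of n]
    have "(\<integral>x. \<bar>Jac j m x (un n x) (Dn n x)\<bar> \<partial>N)
      \<le> (\<integral>x. (1/2) * (?a j x)\<^sup>2 + (1/2) * (?b m x)\<^sup>2 + ((1/2) * (?a m x)\<^sup>2 + (1/2) * (?b j x)\<^sup>2) \<partial>N)"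
    proof (rule integral_mono)
      fix x
      show "\<bar>Jac j m x (un n x) (Dn n x)\<bar> \<le> (1/2) * (?a j x)\<^sup>2 + (1/2) * (?b m x)\<^sup>2 + ((1/2) * (?a m x)\<^sup>2 + (1/2) * (?b j x)\<^sup>2)"
        using young_weighted[of 1 "?a j x" "?b m x"] young_weighted[of 1 "?a m x" "?b j x"] unfolding Jac_def by simp
    qed (use i Jac_integrable in auto)
    also have "\<dots> = (1/2) * (\<integral>x. (?a j x)\<^sup>2 \<partial>N) + (1/2) * (\<integral>x. (?b m x)\<^sup>2 \<partial>N) + ((1/2) * (\<integral>x. (?a m x)\<^sup>2 \<partial>N) + (1/2) * (\<integral>x. (?b j x)\<^sup>2 \<partial>N))"
      using i by simp
    also have "\<dots> \<le> (B + E' + B' + E) / 2" using B[of n] E'[of n] B'[of n] E[of n] by (simp add: field_simps)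
    finally show ?thesis .
  qed
  then show ?thesis by blast
qed

lemma test_conv: "\<zeta> \<in> test_functions \<Omega> \<Longrightarrow> bounded_AE_conv N (\<lambda>n. \<zeta>) \<zeta>"
proof -
  assume \<zeta>: "\<zeta> \<in> test_functions \<Omega>"
  obtain B where "B > 0" "\<And>x. \<bar>\<zeta> x\<bar> \<le> B" by (rule test_functions_bounded[OF \<zeta>], rule that)
  then show ?thesis
    by (intro bounded_AE_conv_const[where A=B] measurable_restrict_space1[OF smooth_borel_lebesgue[OF test_functions_smooth[OF \<zeta>]]]) auto
qed

text \<open>Through \<open>jacobian_identity\<close> both integrals are rewritten with one
  derivative of the third component against a weight that is bounded and converges almost
  everywhere, so the weak-strong product applies.\<close>

lemma Jac_monomial:
  assumes \<zeta>: "\<zeta> \<in> test_functions \<Omega>"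
  shows "(\<lambda>n. \<integral>x. \<zeta> x * qmap x (un n x) ^ k * un n x $ 3 ^ l * Jac j m x (un n x) (Dn n x) \<partial>N)
     \<longlonglongrightarrow> (\<integral>x. \<zeta> x * qmap x (u x) ^ k * u x $ 3 ^ l * Jac j m x (u x) (D x) \<partial>N)"
proof -
  let ?I = "\<lambda>w. \<integral>x. \<zeta> x * qmap x (w x) ^ k * w x $ 3 ^ l * Jac j m x (w x) (weak_gradient \<Omega> w x) \<partial>N"
  let ?J = "\<lambda>w j m. \<integral>x. (qmap x (w x) ^ Suc k * w x $ 3 ^ l * frechet_derivative \<zeta> (at x) (axis j 1)) * weak_gradient \<Omega> w x $ 3 $ m \<partial>N"
  have a: "bounded_AE_conv N (\<lambda>n x. qmap x (un n x) ^ Suc k * un n x $ 3 ^ l * frechet_derivative \<zeta> (at x) v)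
     (\<lambda>x. qmap x (u x) ^ Suc k * u x $ 3 ^ l * frechet_derivative \<zeta> (at x) v)" for v
    by (intro bounded_AE_conv_mult bounded_AE_conv_power q_conv u_conv test_conv test_functions_derivative \<zeta>)
  note p = weak_L2_product[OF fmN a D_weak]
  have eq: "?I w = - (?J w j m - ?J w m j) / real (Suc k)"
    if w: "w \<in> W12 \<Omega>" "AE x in N. norm (w x) \<le> M"
      "\<And>j m. integrable N (\<lambda>x. (qmap x (w x) ^ Suc k * w x $ 3 ^ l * frechet_derivative \<zeta> (at x) (axis j 1)) * weak_gradient \<Omega> w x $ 3 $ m)" for w
  proof -
    have "AE x in N. \<bar>w x $ i\<bar> \<le> M" for i using w(2) by eventually_elim (rule order_trans[OF component_le_norm_cart])
    from jacobian_identity[OF \<Omega> w(1) this \<zeta>, of k l j m]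
    have "real (Suc k) * ?I w = - (\<integral>x. qmap x (w x) ^ Suc k * w x $ 3 ^ l * (frechet_derivative \<zeta> (at x) (axis j 1) * weak_gradient \<Omega> w x $ 3 $ m
        - frechet_derivative \<zeta> (at x) (axis m 1) * weak_gradient \<Omega> w x $ 3 $ j) \<partial>N)"
      unfolding Jac_def .
    also have "\<dots> = - (?J w j m - ?J w m j)"
      unfolding Bochner_Integration.integral_diff[OF w(3) w(3), symmetric]
      by (intro arg_cong[where f=uminus] Bochner_Integration.integral_cong) (simp_all add: algebra_simps)
    finally show ?thesis by (simp add: field_simps)
  qed
  have "(\<lambda>n. - (?J (un n) j m - ?J (un n) m j) / real (Suc k)) \<longlonglongrightarrow> - (?J u j m - ?J u m j) / real (Suc k)"
    by (intro tendsto_intros p(1)) auto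
  then show ?thesis using eq[OF W(1) bnd p(2)] eq[OF W(2) u_bnd p(3)] by (simp only:)
qed

end

section \<open>The Jacobian against continuous weights\<close>

context axi_limit
begin

definition coeff :: "((real^3) \<times> real \<times> real \<Rightarrow> real) \<Rightarrow> (real^3 \<Rightarrow> real^3) \<Rightarrow> real^3 \<Rightarrow> real" where
  "coeff T w x = T (x, qmap x (w x), w x $ 3)"

text \<open>A cutoff in \<open>x\<close> is enough: \<open>qmap\<close> and the third component are
  uniformly bounded, so the arguments of \<open>T\<close> stay in a compact set wherever
  \<open>T\<close> can be nonzero.\<close>

lemma coeff_conv:
  assumes T: "continuous_on UNIV T" and K: "compact K" "\<And>x q s. x \<notin> K \<Longrightarrow> T (x, q, s) = 0"
  shows "bounded_AE_conv N (\<lambda>n. coeff T (un n)) (coeff T u)"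
proof -
  obtain A where A: "\<And>n. (\<lambda>x. qmap x (un n x)) \<in> borel_measurable N" "(\<lambda>x. qmap x (u x)) \<in> borel_measurable N"
    "\<And>n. AE x in N. \<bar>qmap x (un n x)\<bar> \<le> A" "AE x in N. (\<lambda>n. qmap x (un n x)) \<longlonglongrightarrow> qmap x (u x)"
    by (rule bounded_AE_convE[OF q_conv], rule that)
  obtain B where B: "\<And>n. (\<lambda>x. un n x $ 3) \<in> borel_measurable N" "(\<lambda>x. u x $ 3) \<in> borel_measurable N"
    "\<And>n. AE x in N. \<bar>un n x $ 3\<bar> \<le> B" "AE x in N. (\<lambda>n. un n x $ 3) \<longlonglongrightarrow> u x $ 3"
    by (rule bounded_AE_convE[OF u_conv[of 3]], rule that)
  have id: "(\<lambda>x::real^3. x) \<in> borel_measurable N"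
    by (rule measurable_restrict_space1) (simp add: measurable_completion)
  have S: "compact (K \<times> {-A..A} \<times> {-B..B})" using K by (intro compact_Times) auto
  have "compact (T ` (K \<times> {-A..A} \<times> {-B..B}))"
    by (rule compact_continuous_image[OF continuous_on_subset[OF T] S]) auto
  then obtain E where E: "E > 0" "\<And>p. p \<in> K \<times> {-A..A} \<times> {-B..B} \<Longrightarrow> norm (T p) \<le> E"
    by (metis compact_imp_bounded bounded_pos imageI)
  show ?thesis
  proof (rule bounded_AE_convI[where A=E])
    have m: "coeff T w \<in> borel_measurable N" if "(\<lambda>x. qmap x (w x)) \<in> borel_measurable N" "(\<lambda>x. w x $ 3) \<in> borel_measurable N" for w
      unfolding coeff_def
      by (rule borel_measurable_continuous_on[OF T]) (intro borel_measurable_Pair id that)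
    show "coeff T (un n) \<in> borel_measurable N" for n by (rule m[OF A(1) B(1)])
    show "coeff T u \<in> borel_measurable N" by (rule m[OF A(2) B(2)])
    show "AE x in N. \<bar>coeff T (un n) x\<bar> \<le> E" for n
      using A(3)[of n] B(3)[of n]
    proof eventually_elim
      case (elim x)
      then show ?case using E(1) E(2)[of "(x, qmap x (un n x), un n x $ 3)"] K(2)[of x]
        unfolding coeff_def by (cases "x \<in> K") (auto simp: abs_le_iff)
    qed
    show "AE x in N. (\<lambda>n. coeff T (un n) x) \<longlonglongrightarrow> coeff T u x"
      using A(4) B(4)
    proof eventually_elim
      case (elim x)
      have "isCont T (x, qmap x (u x), u x $ 3)" using T by (simp add: continuous_on_eq_continuous_at)
      then show ?case unfolding coeff_def by (rule isCont_tendsto_compose) (intro tendsto_intros elim)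
    qed
  qed
qed

lemma bounded_times_integrable:
  assumes a: "bounded_AE_conv N an a" and b: "\<And>n. integrable N (bn n)" "integrable N b"
  shows "\<And>n. integrable N (\<lambda>x. an n x * bn n x)" "integrable N (\<lambda>x. a x * b x)"
proof -
  obtain A where A: "\<And>n. an n \<in> borel_measurable N" "a \<in> borel_measurable N"
    "\<And>n. AE x in N. \<bar>an n x\<bar> \<le> A" "AE x in N. (\<lambda>n. an n x) \<longlonglongrightarrow> a x"
    by (rule bounded_AE_convE[OF a], rule that)
  show "integrable N (\<lambda>x. an n x * bn n x)" for n
    using integrable_mult_bounded[OF b(1) A(1) A(3)] by (simp add: mult.commute)
  have "AE x in N. \<forall>n. \<bar>an n x\<bar> \<le> A" using A(3) by (simp add: AE_all_countable)
  then have "AE x in N. \<bar>a x\<bar> \<le> A"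
    using A(4)
  proof eventually_elim
    case (elim x)
    have "(\<lambda>n. \<bar>an n x\<bar>) \<longlonglongrightarrow> \<bar>a x\<bar>" by (intro tendsto_intros elim)
    then show ?case by (rule LIMSEQ_le_const2) (use elim in auto)
  qed
  then show "integrable N (\<lambda>x. a x * b x)"
    using integrable_mult_bounded[OF b(2) A(2)] by (simp add: mult.commute)
qed

text \<open>Quantified over \<zeta>, \<open>k\<close> and \<open>l\<close> so that the predicate is
  stable under multiplication of \<open>g\<close> by any coordinate of \<open>(x, q, s)\<close>: a
  factor \<open>x $ i\<close> is absorbed by \<zeta>, and factors \<open>q\<close> and
  \<open>s\<close> raise the exponents.\<close>

definition Jac_converges :: "3 \<Rightarrow> 3 \<Rightarrow> ((real^3) \<times> real \<times> real \<Rightarrow> real) \<Rightarrow> bool" where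
  "Jac_converges j m g \<longleftrightarrow> continuous_on UNIV g \<and> (\<forall>\<zeta>\<in>test_functions \<Omega>. \<forall>k l.
     (\<lambda>n. \<integral>x. \<zeta> x * coeff g (un n) x * qmap x (un n x) ^ k * un n x $ 3 ^ l * Jac j m x (un n x) (Dn n x) \<partial>N)
     \<longlonglongrightarrow> (\<integral>x. \<zeta> x * coeff g u x * qmap x (u x) ^ k * u x $ 3 ^ l * Jac j m x (u x) (D x) \<partial>N))"

lemma Jac_factor_integrable:
  assumes g: "continuous_on UNIV g" and \<zeta>: "\<zeta> \<in> test_functions \<Omega>"
  shows "\<And>n. integrable N (\<lambda>x. \<zeta> x * coeff g (un n) x * qmap x (un n x) ^ k * un n x $ 3 ^ l * Jac j m x (un n x) (Dn n x))"
    "integrable N (\<lambda>x. \<zeta> x * coeff g u x * qmap x (u x) ^ k * u x $ 3 ^ l * Jac j m x (u x) (D x))"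
proof -
  let ?T = "\<lambda>p. \<zeta> (fst p) * g p"
  obtain K where K: "compact K" "K \<subseteq> \<Omega>" "\<And>x. x \<notin> K \<Longrightarrow> \<zeta> x = 0"
    by (rule test_functions_support[OF \<zeta>], rule that)
  have "continuous_on UNIV (\<lambda>p. \<zeta> (fst p))"
    by (rule continuous_on_compose2[OF smooth_continuous[OF test_functions_smooth[OF \<zeta>]]]) (auto intro: continuous_intros)
  then have "continuous_on UNIV ?T" by (intro continuous_intros g)
  from coeff_conv[OF this K(1)] K(3) have c: "bounded_AE_conv N (\<lambda>n. coeff ?T (un n)) (coeff ?T u)" by auto
  have eq: "coeff ?T w = (\<lambda>x. \<zeta> x * coeff g w x)" for w by (simp add: coeff_def fun_eq_iff)
  have "bounded_AE_conv N (\<lambda>n x. \<zeta> x * coeff g (un n) x * qmap x (un n x) ^ k * un n x $ 3 ^ l)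
     (\<lambda>x. \<zeta> x * coeff g u x * qmap x (u x) ^ k * u x $ 3 ^ l)"
    using bounded_AE_conv_mult[OF bounded_AE_conv_mult[OF c[unfolded eq] bounded_AE_conv_power[OF q_conv, of k]] bounded_AE_conv_power[OF u_conv, of 3 l]] .
  from bounded_times_integrable[OF this Jac_integrable]
  show "\<And>n. integrable N (\<lambda>x. \<zeta> x * coeff g (un n) x * qmap x (un n x) ^ k * un n x $ 3 ^ l * Jac j m x (un n x) (Dn n x))"
    "integrable N (\<lambda>x. \<zeta> x * coeff g u x * qmap x (u x) ^ k * u x $ 3 ^ l * Jac j m x (u x) (D x))" .
qed

lemma Jac_convergesD:
  "Jac_converges j m g \<Longrightarrow> \<zeta> \<in> test_functions \<Omega> \<Longrightarrow>
     (\<lambda>n. \<integral>x. \<zeta> x * coeff g (un n) x * qmap x (un n x) ^ k * un n x $ 3 ^ l * Jac j m x (un n x) (Dn n x) \<partial>N)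
     \<longlonglongrightarrow> (\<integral>x. \<zeta> x * coeff g u x * qmap x (u x) ^ k * u x $ 3 ^ l * Jac j m x (u x) (D x) \<partial>N)"
  "Jac_converges j m g \<Longrightarrow> continuous_on UNIV g"
  unfolding Jac_converges_def by blast+

lemma Jac_converges_1: "Jac_converges j m (\<lambda>_. 1)"
  unfolding Jac_converges_def using Jac_monomial by (simp add: coeff_def)

lemma Jac_converges_add:
  assumes "Jac_converges j m g" "Jac_converges j m h"
  shows "Jac_converges j m (\<lambda>p. g p + h p)"
  unfolding Jac_converges_def
proof (intro conjI ballI allI)
  note c = Jac_convergesD(2)[OF assms(1)] Jac_convergesD(2)[OF assms(2)]
  show "continuous_on UNIV (\<lambda>p. g p + h p)" by (intro continuous_intros c)
  fix \<zeta> :: "real^3 \<Rightarrow> real" and k l assume \<zeta>: "\<zeta> \<in> test_functions \<Omega>"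
  note i = Jac_factor_integrable[OF c(1) \<zeta>, where k=k and l=l and j=j and m=m] Jac_factor_integrable[OF c(2) \<zeta>, where k=k and l=l and j=j and m=m]
  have "(\<integral>x. \<zeta> x * coeff (\<lambda>p. g p + h p) (un n) x * qmap x (un n x) ^ k * un n x $ 3 ^ l * Jac j m x (un n x) (Dn n x) \<partial>N)
    = (\<integral>x. \<zeta> x * coeff g (un n) x * qmap x (un n x) ^ k * un n x $ 3 ^ l * Jac j m x (un n x) (Dn n x) \<partial>N)
    + (\<integral>x. \<zeta> x * coeff h (un n) x * qmap x (un n x) ^ k * un n x $ 3 ^ l * Jac j m x (un n x) (Dn n x) \<partial>N)" for n
    unfolding Bochner_Integration.integral_add[OF i(1) i(3), symmetric]
    by (rule Bochner_Integration.integral_cong) (simp_all add: coeff_def distrib_left distrib_right)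
  moreover have "(\<integral>x. \<zeta> x * coeff (\<lambda>p. g p + h p) u x * qmap x (u x) ^ k * u x $ 3 ^ l * Jac j m x (u x) (D x) \<partial>N)
    = (\<integral>x. \<zeta> x * coeff g u x * qmap x (u x) ^ k * u x $ 3 ^ l * Jac j m x (u x) (D x) \<partial>N)
    + (\<integral>x. \<zeta> x * coeff h u x * qmap x (u x) ^ k * u x $ 3 ^ l * Jac j m x (u x) (D x) \<partial>N)"
    unfolding Bochner_Integration.integral_add[OF i(2) i(4), symmetric]
    by (rule Bochner_Integration.integral_cong) (simp_all add: coeff_def distrib_left distrib_right)
  ultimately show "(\<lambda>n. \<integral>x. \<zeta> x * coeff (\<lambda>p. g p + h p) (un n) x * qmap x (un n x) ^ k * un n x $ 3 ^ l * Jac j m x (un n x) (Dn n x) \<partial>N)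
    \<longlonglongrightarrow> (\<integral>x. \<zeta> x * coeff (\<lambda>p. g p + h p) u x * qmap x (u x) ^ k * u x $ 3 ^ l * Jac j m x (u x) (D x) \<partial>N)"
    using tendsto_add[OF Jac_convergesD(1)[OF assms(1) \<zeta>] Jac_convergesD(1)[OF assms(2) \<zeta>]] by (simp only:)
qed

lemma Jac_converges_scale:
  assumes "Jac_converges j m g"
  shows "Jac_converges j m (\<lambda>p. c * g p)"
  unfolding Jac_converges_def
proof (intro conjI ballI allI)
  show "continuous_on UNIV (\<lambda>p. c * g p)" by (intro continuous_intros Jac_convergesD(2)[OF assms(1)])
  fix \<zeta> :: "real^3 \<Rightarrow> real" and k l assume \<zeta>: "\<zeta> \<in> test_functions \<Omega>"
  have eq: "\<zeta> x * coeff (\<lambda>p. c * g p) w x * a * b * d = c * (\<zeta> x * coeff g w x * a * b * d)" for x w a b d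
    by (simp add: coeff_def)
  show "(\<lambda>n. \<integral>x. \<zeta> x * coeff (\<lambda>p. c * g p) (un n) x * qmap x (un n x) ^ k * un n x $ 3 ^ l * Jac j m x (un n x) (Dn n x) \<partial>N)
    \<longlonglongrightarrow> (\<integral>x. \<zeta> x * coeff (\<lambda>p. c * g p) u x * qmap x (u x) ^ k * u x $ 3 ^ l * Jac j m x (u x) (D x) \<partial>N)"
    unfolding eq integral_mult_right_zero by (intro tendsto_intros Jac_convergesD(1)[OF assms(1) \<zeta>])
qed

lemma Jac_converges_coordinates:
  assumes "Jac_converges j m g"
  shows "Jac_converges j m (\<lambda>p. fst p $ i * g p)" "Jac_converges j m (\<lambda>p. fst (snd p) * g p)"
    "Jac_converges j m (\<lambda>p. snd (snd p) * g p)"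
proof -
  note c = Jac_convergesD(2)[OF assms]
  show "Jac_converges j m (\<lambda>p. fst p $ i * g p)"
    unfolding Jac_converges_def
  proof (intro conjI ballI allI)
    show "continuous_on UNIV (\<lambda>p. fst p $ i * g p)" by (intro continuous_intros c)
    fix \<zeta> :: "real^3 \<Rightarrow> real" and k l assume \<zeta>: "\<zeta> \<in> test_functions \<Omega>"
    have eq: "\<zeta> x * coeff (\<lambda>p. fst p $ i * g p) w x = (\<zeta> x * x $ i) * coeff g w x" for x w by (simp add: coeff_def)
    show "(\<lambda>n. \<integral>x. \<zeta> x * coeff (\<lambda>p. fst p $ i * g p) (un n) x * qmap x (un n x) ^ k * un n x $ 3 ^ l * Jac j m x (un n x) (Dn n x) \<partial>N)
      \<longlonglongrightarrow> (\<integral>x. \<zeta> x * coeff (\<lambda>p. fst p $ i * g p) u x * qmap x (u x) ^ k * u x $ 3 ^ l * Jac j m x (u x) (D x) \<partial>N)"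
      unfolding eq by (rule Jac_convergesD(1)[OF assms test_functions_mult[OF \<zeta> smooth_vec_nth]])
  qed
  show "Jac_converges j m (\<lambda>p. fst (snd p) * g p)"
    unfolding Jac_converges_def
  proof (intro conjI ballI allI)
    show "continuous_on UNIV (\<lambda>p. fst (snd p) * g p)" by (intro continuous_intros c)
    fix \<zeta> :: "real^3 \<Rightarrow> real" and k l assume \<zeta>: "\<zeta> \<in> test_functions \<Omega>"
    have eq: "\<zeta> x * coeff (\<lambda>p. fst (snd p) * g p) w x * qmap x (w x) ^ k = \<zeta> x * coeff g w x * qmap x (w x) ^ Suc k" for x w by (simp add: coeff_def)
    show "(\<lambda>n. \<integral>x. \<zeta> x * coeff (\<lambda>p. fst (snd p) * g p) (un n) x * qmap x (un n x) ^ k * un n x $ 3 ^ l * Jac j m x (un n x) (Dn n x) \<partial>N)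
      \<longlonglongrightarrow> (\<integral>x. \<zeta> x * coeff (\<lambda>p. fst (snd p) * g p) u x * qmap x (u x) ^ k * u x $ 3 ^ l * Jac j m x (u x) (D x) \<partial>N)"
      unfolding eq by (rule Jac_convergesD(1)[OF assms \<zeta>])
  qed
  show "Jac_converges j m (\<lambda>p. snd (snd p) * g p)"
    unfolding Jac_converges_def
  proof (intro conjI ballI allI)
    show "continuous_on UNIV (\<lambda>p. snd (snd p) * g p)" by (intro continuous_intros c)
    fix \<zeta> :: "real^3 \<Rightarrow> real" and k l assume \<zeta>: "\<zeta> \<in> test_functions \<Omega>"
    have eq: "\<zeta> x * coeff (\<lambda>p. snd (snd p) * g p) w x * qmap x (w x) ^ k * w x $ 3 ^ l = \<zeta> x * coeff g w x * qmap x (w x) ^ k * w x $ 3 ^ Suc l" for x w by (simp add: coeff_def)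
    show "(\<lambda>n. \<integral>x. \<zeta> x * coeff (\<lambda>p. snd (snd p) * g p) (un n) x * qmap x (un n x) ^ k * un n x $ 3 ^ l * Jac j m x (un n x) (Dn n x) \<partial>N)
      \<longlonglongrightarrow> (\<integral>x. \<zeta> x * coeff (\<lambda>p. snd (snd p) * g p) u x * qmap x (u x) ^ k * u x $ 3 ^ l * Jac j m x (u x) (D x) \<partial>N)"
      unfolding eq by (rule Jac_convergesD(1)[OF assms \<zeta>])
  qed
qed

text \<open>The arbitrary further factor \<open>g\<close> lets the induction pass through products of polynomials.\<close>

lemma Jac_converges_polynomial:
  assumes "real_polynomial_function p" "Jac_converges j m g"
  shows "Jac_converges j m (\<lambda>x. p x * g x)"
  using assms
proof (induction p arbitrary: g)
  case (linear f)
  have l: "linear f" by (rule bounded_linear.linear[OF linear(1)])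
  have f: "f p = fst p $ 1 * f (axis 1 1, 0, 0) + fst p $ 2 * f (axis 2 1, 0, 0) + fst p $ 3 * f (axis 3 1, 0, 0)
      + fst (snd p) * f (0, 1, 0) + snd (snd p) * f (0, 0, 1)" for p
  proof -
    have "p = fst p $ 1 *\<^sub>R (axis 1 1, 0, 0) + fst p $ 2 *\<^sub>R (axis 2 1, 0, 0) + fst p $ 3 *\<^sub>R (axis 3 1, 0, 0)
      + fst (snd p) *\<^sub>R (0, 1, 0) + snd (snd p) *\<^sub>R (0, 0, 1)"
      by (simp add: prod_eq_iff vector3_eq axis_def)
    then have "f p = f (fst p $ 1 *\<^sub>R (axis 1 1, 0, 0) + fst p $ 2 *\<^sub>R (axis 2 1, 0, 0) + fst p $ 3 *\<^sub>R (axis 3 1, 0, 0)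
      + fst (snd p) *\<^sub>R (0, 1, 0) + snd (snd p) *\<^sub>R (0, 0, 1))" by (rule arg_cong)
    then show ?thesis by (simp only: linear_add[OF l] linear_scale[OF l]) simp
  qed
  have "Jac_converges j m (\<lambda>p. f (axis 1 1, 0, 0) * (fst p $ 1 * g p) + f (axis 2 1, 0, 0) * (fst p $ 2 * g p)
     + f (axis 3 1, 0, 0) * (fst p $ 3 * g p) + f (0, 1, 0) * (fst (snd p) * g p) + f (0, 0, 1) * (snd (snd p) * g p))"
    by (intro Jac_converges_add Jac_converges_scale Jac_converges_coordinates linear(2))
  also have "(\<lambda>p. f (axis 1 1, 0, 0) * (fst p $ 1 * g p) + f (axis 2 1, 0, 0) * (fst p $ 2 * g p)
     + f (axis 3 1, 0, 0) * (fst p $ 3 * g p) + f (0, 1, 0) * (fst (snd p) * g p) + f (0, 0, 1) * (snd (snd p) * g p))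
     = (\<lambda>p. f p * g p)"
  proof
    fix p show "f (axis 1 1, 0, 0) * (fst p $ 1 * g p) + f (axis 2 1, 0, 0) * (fst p $ 2 * g p)
     + f (axis 3 1, 0, 0) * (fst p $ 3 * g p) + f (0, 1, 0) * (fst (snd p) * g p) + f (0, 0, 1) * (snd (snd p) * g p) = f p * g p"
      by (subst f) (simp add: algebra_simps)
  qed
  finally show ?case .
next
  case (const c)
  then show ?case by (rule Jac_converges_scale)
next
  case (add p1 p2)
  then show ?case using Jac_converges_add[OF add.IH(1)[OF add.prems] add.IH(2)[OF add.prems]] by (simp add: distrib_right)
next
  case (mult p1 p2)
  then show ?case using mult.IH(1)[OF mult.IH(2)[OF mult.prems]] by (simp add: mult.assoc)
qed

text \<open>The weights converge almost everywhere and the Jacobians only weakly, with L1 bounds, so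
  the products cannot be paired directly. A polynomial that is uniformly \<eta>-close to
  \<open>T\<close> on the compact range of \<open>(x, q, s)\<close> changes each integral by at most
  \<eta> times the L1 bound, uniformly in \<open>n\<close>.\<close>

lemma coeff_Jac_conv:
  assumes T: "continuous_on UNIV T" and K: "compact K" "K \<subseteq> \<Omega>" "\<And>x q s. x \<notin> K \<Longrightarrow> T (x, q, s) = 0"
  shows "(\<lambda>n. \<integral>x. coeff T (un n) x * Jac j m x (un n x) (Dn n x) \<partial>N) \<longlonglongrightarrow> (\<integral>x. coeff T u x * Jac j m x (u x) (D x) \<partial>N)"
proof (rule LIMSEQ_I)
  fix e :: real assume e: "e > 0"
  obtain \<zeta> where \<zeta>: "\<zeta> \<in> test_functions \<Omega>" "\<And>x. \<bar>\<zeta> x\<bar> \<le> (1::real)" "\<And>x. x \<in> K \<Longrightarrow> \<zeta> x = 1"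
    using smooth_cutoff[OF K(1) \<Omega>(1) K(2)] by blast
  obtain B0 where B0: "\<And>n. (\<integral>x. \<bar>Jac j m x (un n x) (Dn n x)\<bar> \<partial>N) \<le> B0" using Jac_bound by blast
  \<comment> \<open>A common L1 bound for the sequence and the limit; the added 1 keeps it positive
    for the division below.\<close>
  define B where "B = max \<bar>B0\<bar> (\<integral>x. \<bar>Jac j m x (u x) (D x)\<bar> \<partial>N) + 1"
  have B: "B > 0" "\<And>n. (\<integral>x. \<bar>Jac j m x (un n x) (Dn n x)\<bar> \<partial>N) \<le> B" "(\<integral>x. \<bar>Jac j m x (u x) (D x)\<bar> \<partial>N) \<le> B"
    using B0 unfolding B_def by (auto simp: le_max_iff_disj add_pos_nonneg intro: order_trans add_increasing2)
      (smt (verit) B0 max.cobounded1)+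
  obtain A where A: "\<And>n. AE x in N. \<bar>qmap x (un n x)\<bar> \<le> A" using q_conv unfolding bounded_AE_conv_def by blast
  have Au: "AE x in N. \<bar>qmap x (u x)\<bar> \<le> A"
  proof -
    have "AE x in N. (\<lambda>n. qmap x (un n x)) \<longlonglongrightarrow> qmap x (u x)" using q_conv unfolding bounded_AE_conv_def by blast
    moreover have "AE x in N. \<forall>n. \<bar>qmap x (un n x)\<bar> \<le> A" using A by (simp add: AE_all_countable)
    ultimately show ?thesis
    proof eventually_elim
      case (elim x)
      have "(\<lambda>n. \<bar>qmap x (un n x)\<bar>) \<longlonglongrightarrow> \<bar>qmap x (u x)\<bar>" by (intro tendsto_intros elim)
      then show ?case by (rule LIMSEQ_le_const2) (use elim in auto)
    qed
  qed
  define \<eta> where "\<eta> = e / (4 * B)"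
  have \<eta>: "\<eta> > 0" "\<eta> * B = e / 4" using e B by (auto simp: \<eta>_def)
  have "compact (closure \<Omega> \<times> {-A..A} \<times> {-M..M})" using \<Omega>(2) by (intro compact_Times) (auto simp: compact_closure)
  then obtain g where g: "real_polynomial_function g"
    "\<And>p. p \<in> closure \<Omega> \<times> {-A..A} \<times> {-M..M} \<Longrightarrow> \<bar>T p - g p\<bar> < \<eta>"
    using Stone_Weierstrass_real_polynomial_function[OF _ continuous_on_subset[OF T] \<eta>(1)] by (metis subset_UNIV)
  have gc: "Jac_converges j m g" using Jac_converges_polynomial[OF g(1) Jac_converges_1] by simp
  note gl = Jac_convergesD(1)[OF gc \<zeta>(1), where k=0 and l=0, simplified]
  note gi = Jac_factor_integrable[OF Jac_convergesD(2)[OF gc] \<zeta>(1), where k=0 and l=0 and j=j and m=m, simplified]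
  have cc: "bounded_AE_conv N (\<lambda>n. coeff T (un n)) (coeff T u)"
    by (rule coeff_conv[OF T K(1)]) (rule K(3))
  have Ti: "integrable N (\<lambda>x. coeff T (un n) x * Jac j m x (un n x) (Dn n x))"
    "integrable N (\<lambda>x. coeff T u x * Jac j m x (u x) (D x))" for n
    by (rule bounded_times_integrable[OF cc Jac_integrable])+
  have close: "\<bar>(\<integral>x. coeff T w x * Jac j m x (w x) (weak_gradient \<Omega> w x) \<partial>N) - (\<integral>x. \<zeta> x * coeff g w x * Jac j m x (w x) (weak_gradient \<Omega> w x) \<partial>N)\<bar> \<le> e / 4"
    if i: "integrable N (\<lambda>x. coeff T w x * Jac j m x (w x) (weak_gradient \<Omega> w x))"
      "integrable N (\<lambda>x. \<zeta> x * coeff g w x * Jac j m x (w x) (weak_gradient \<Omega> w x))"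
      "integrable N (\<lambda>x. Jac j m x (w x) (weak_gradient \<Omega> w x))"
      and b: "(\<integral>x. \<bar>Jac j m x (w x) (weak_gradient \<Omega> w x)\<bar> \<partial>N) \<le> B"
      and ae: "AE x in N. \<bar>qmap x (w x)\<bar> \<le> A" "AE x in N. norm (w x) \<le> M" for w
  proof -
    let ?J = "\<lambda>x. Jac j m x (w x) (weak_gradient \<Omega> w x)"
    have "\<bar>(\<integral>x. coeff T w x * ?J x \<partial>N) - (\<integral>x. \<zeta> x * coeff g w x * ?J x \<partial>N)\<bar> = \<bar>\<integral>x. coeff T w x * ?J x - \<zeta> x * coeff g w x * ?J x \<partial>N\<bar>"
      using i by simp
    also have "\<dots> \<le> (\<integral>x. \<bar>coeff T w x * ?J x - \<zeta> x * coeff g w x * ?J x\<bar> \<partial>N)" by simp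
    also have "\<dots> \<le> (\<integral>x. \<eta> * \<bar>?J x\<bar> \<partial>N)"
    proof (rule integral_mono_AE)
      have "AE x in N. x \<in> \<Omega>" by (simp add: AE_lebesgue_on[OF s\<Omega>])
      then show "AE x in N. \<bar>coeff T w x * ?J x - \<zeta> x * coeff g w x * ?J x\<bar> \<le> \<eta> * \<bar>?J x\<bar>"
        using ae
      proof eventually_elim
        case (elim x)
        have "\<bar>w x $ 3\<bar> \<le> M" using elim(3) component_le_norm_cart order_trans by blast
        then have "\<bar>T (x, qmap x (w x), w x $ 3) - g (x, qmap x (w x), w x $ 3)\<bar> < \<eta>"
          using elim closure_subset[of \<Omega>] by (intro g(2)) auto
        then have "\<bar>\<zeta> x\<bar> * \<bar>coeff T w x - coeff g w x\<bar> \<le> 1 * \<eta>"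
          unfolding coeff_def using \<zeta>(2)[of x] by (intro mult_mono) auto
        \<comment> \<open>The polynomial need not vanish off \<open>K\<close>, hence the cutoff;
          being 1 on \<open>K\<close>, it leaves \<open>T\<close> unchanged.\<close>
        moreover have "coeff T w x = \<zeta> x * coeff T w x" using \<zeta>(3)[of x] K(3)[of x] by (cases "x \<in> K") (auto simp: coeff_def)
        then have "coeff T w x - \<zeta> x * coeff g w x = \<zeta> x * (coeff T w x - coeff g w x)" by (simp add: right_diff_distrib)
        ultimately have "\<bar>coeff T w x - \<zeta> x * coeff g w x\<bar> \<le> \<eta>" by (simp add: abs_mult)
        then have "\<bar>coeff T w x - \<zeta> x * coeff g w x\<bar> * \<bar>?J x\<bar> \<le> \<eta> * \<bar>?J x\<bar>" by (intro mult_right_mono) auto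
        then show ?case by (simp add: abs_mult flip: left_diff_distrib)
      qed
    qed (use i in auto)
    also have "\<dots> \<le> \<eta> * B" using b \<eta>(1) by simp
    finally show ?thesis using \<eta>(2) by simp
  qed
  from LIMSEQ_D[OF gl, of "e / 4"] e obtain n0 where n0: "\<And>n. n \<ge> n0 \<Longrightarrow>
     norm ((\<integral>x. \<zeta> x * coeff g (un n) x * Jac j m x (un n x) (Dn n x) \<partial>N) - (\<integral>x. \<zeta> x * coeff g u x * Jac j m x (u x) (D x) \<partial>N)) < e / 4"
    by auto
  have "norm ((\<integral>x. coeff T (un n) x * Jac j m x (un n x) (Dn n x) \<partial>N) - (\<integral>x. coeff T u x * Jac j m x (u x) (D x) \<partial>N)) < e" if "n \<ge> n0" for n
    using close[of "un n", OF Ti(1) gi(1) Jac_integrable(1) B(2) A bnd] close[of u, OF Ti(2) gi(2) Jac_integrable(2) B(3) Au u_bnd] n0[OF that]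
    unfolding real_norm_def by linarith
  then show "\<exists>n0. \<forall>n\<ge>n0. norm ((\<integral>x. coeff T (un n) x * Jac j m x (un n x) (Dn n x) \<partial>N) - (\<integral>x. coeff T u x * Jac j m x (u x) (D x) \<partial>N)) < e"
    by blast
qed

end

section \<open>Graph integrands away from the axis\<close>

lemma alternating3_linear:
  assumes "alternating3 \<alpha>"
  shows "linear (\<lambda>a. \<alpha> a b c)" "linear (\<lambda>b. \<alpha> a b c)" "linear (\<lambda>c. \<alpha> a b c)"
  using assms unfolding alternating3_def by auto

lemma alternating3_expand:
  assumes "alternating3 \<alpha>"
  shows alternating3_add: "\<alpha> (a + a') b c = \<alpha> a b c + \<alpha> a' b c" "\<alpha> a (b + b') c = \<alpha> a b c + \<alpha> a b' c"
      "\<alpha> a b (c + c') = \<alpha> a b c + \<alpha> a b c'"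
    and alternating3_scale: "\<alpha> (r *\<^sub>R a) b c = r * \<alpha> a b c" "\<alpha> a (r *\<^sub>R b) c = r * \<alpha> a b c"
      "\<alpha> a b (r *\<^sub>R c) = r * \<alpha> a b c"
    and alternating3_same: "\<alpha> a a b = 0" "\<alpha> a b a = 0" "\<alpha> b a a = 0"
  using linear_add[OF alternating3_linear(1)[OF assms]] linear_add[OF alternating3_linear(2)[OF assms]]
    linear_add[OF alternating3_linear(3)[OF assms]] linear_scale[OF alternating3_linear(1)[OF assms]]
    linear_scale[OF alternating3_linear(2)[OF assms]] linear_scale[OF alternating3_linear(3)[OF assms]]
    assms unfolding alternating3_def by auto

lemma alternating3_swap:
  assumes "alternating3 \<alpha>"
  shows "\<alpha> b a c = - \<alpha> a b c" "\<alpha> a c b = - \<alpha> a b c" "\<alpha> c b a = - \<alpha> a b c"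
proof -
  note e = alternating3_expand[OF assms]
  have "\<alpha> (a + b) (a + b) c = \<alpha> a b c + \<alpha> b a c" "\<alpha> a (b + c) (b + c) = \<alpha> a b c + \<alpha> a c b"
    "\<alpha> (a + c) b (a + c) = \<alpha> a b c + \<alpha> c b a"
    by (simp_all only: alternating3_add[OF assms]) (simp_all add: alternating3_same[OF assms])
  moreover have "\<alpha> (a + b) (a + b) c = 0" "\<alpha> a (b + c) (b + c) = 0" "\<alpha> (a + c) b (a + c) = 0"
    by (simp_all only: alternating3_same[OF assms])
  ultimately show "\<alpha> b a c = - \<alpha> a b c" "\<alpha> a c b = - \<alpha> a b c" "\<alpha> c b a = - \<alpha> a b c" by linarith+
qed

lemma alternating3_basis_sum:
  fixes \<alpha> :: "'a::euclidean_space \<Rightarrow> 'a \<Rightarrow> 'a \<Rightarrow> real"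
  assumes "alternating3 \<alpha>"
  shows "\<alpha> a b c = (\<Sum>i\<in>Basis. \<Sum>j\<in>Basis. \<Sum>k\<in>Basis. (a \<bullet> i) * (b \<bullet> j) * (c \<bullet> k) * \<alpha> i j k)"
proof -
  note l = alternating3_linear[OF assms]
  have 1: "\<alpha> a b c = (\<Sum>i\<in>Basis. (a \<bullet> i) * \<alpha> i b c)" for a b c
  proof -
    have "\<alpha> a b c = \<alpha> (\<Sum>i\<in>Basis. (a \<bullet> i) *\<^sub>R i) b c" by (simp add: euclidean_representation)
    also have "\<dots> = (\<Sum>i\<in>Basis. (a \<bullet> i) * \<alpha> i b c)" by (simp add: linear_sum[OF l(1)] linear_scale[OF l(1)])
    finally show ?thesis .
  qed
  have 2: "\<alpha> a b c = (\<Sum>i\<in>Basis. (b \<bullet> i) * \<alpha> a i c)" for a b c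
  proof -
    have "\<alpha> a b c = \<alpha> a (\<Sum>i\<in>Basis. (b \<bullet> i) *\<^sub>R i) c" by (simp add: euclidean_representation)
    also have "\<dots> = (\<Sum>i\<in>Basis. (b \<bullet> i) * \<alpha> a i c)" by (simp add: linear_sum[OF l(2)] linear_scale[OF l(2)])
    finally show ?thesis .
  qed
  have 3: "\<alpha> a b c = (\<Sum>i\<in>Basis. (c \<bullet> i) * \<alpha> a b i)" for a b c
  proof -
    have "\<alpha> a b c = \<alpha> a b (\<Sum>i\<in>Basis. (c \<bullet> i) *\<^sub>R i)" by (simp add: euclidean_representation)
    also have "\<dots> = (\<Sum>i\<in>Basis. (c \<bullet> i) * \<alpha> a b i)" by (simp add: linear_sum[OF l(3)] linear_scale[OF l(3)])
    finally show ?thesis .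
  qed
  have "\<alpha> a b c = (\<Sum>i\<in>Basis. (a \<bullet> i) * (\<Sum>j\<in>Basis. (b \<bullet> j) * (\<Sum>k\<in>Basis. (c \<bullet> k) * \<alpha> i j k)))"
    by (subst 1, subst 2, subst 3) simp
  then show ?thesis by (simp add: sum_distrib_left mult.assoc)
qed

text \<open>The form is only assumed continuous in the base point for fixed arguments; expansion in
  a basis reduces joint continuity to that of finitely many coefficients.\<close>

lemma continuous_on_form:
  fixes \<omega> :: "'a::euclidean_space form3" and f \<alpha> \<beta> \<gamma> :: "'b::topological_space \<Rightarrow> 'a"
  assumes "\<And>p. alternating3 (\<omega> p)" "\<And>a b c. continuous_on UNIV (\<lambda>p. \<omega> p a b c)"
    "continuous_on S f" "continuous_on S \<alpha>" "continuous_on S \<beta>" "continuous_on S \<gamma>"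
  shows "continuous_on S (\<lambda>t. \<omega> (f t) (\<alpha> t) (\<beta> t) (\<gamma> t))"
proof -
  have "continuous_on S (\<lambda>t. \<omega> (f t) i j k)" for i j k
    using continuous_on_compose2[OF assms(2,3)] by simp
  then show ?thesis
    by (subst alternating3_basis_sum[OF assms(1)]) (intro continuous_intros assms)
qed

section \<open>The cylindrical frame\<close>

definition rsq :: "real^3 \<Rightarrow> real" where "rsq x = x $ 1 * x $ 1 + x $ 2 * x $ 2"
definition xhor :: "real^3 \<Rightarrow> real^3" where "xhor x = x $ 1 *\<^sub>R axis 1 1 + x $ 2 *\<^sub>R axis 2 1"
text \<open>Recovers the value of a map without swirl from \<open>(x, q, s)\<close>: with r the
  distance to the axis, the radial component is q / r and the radial unit vector is
  \<open>xhor x\<close> divided by r.\<close>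

definition ypoint :: "(real^3) \<times> real \<times> real \<Rightarrow> real^3" where
  "ypoint = (\<lambda>(x, q, s). (q / rsq x) *\<^sub>R xhor x + s *\<^sub>R axis 3 1)"
text \<open>The lift \<open>(v, A *v v)\<close> of \<open>v = xhor x\<close> is \<open>U0\<close>
  plus the derivatives of \<open>q\<close> and \<open>s\<close> along \<open>v\<close> times
  \<open>U1\<close> and \<open>U2\<close>; the lift of the axis direction starts from
  \<open>V0\<close>, and that of \<open>Jrot x\<close> is \<open>W0\<close>. The coefficient
  \<open>- q / rsq x\<close> comes from differentiating \<open>xhor x\<close> over
  \<open>rsq x\<close>, which is homogeneous of degree -1 in the horizontal variables.\<close>

definition U0 :: "(real^3) \<times> real \<times> real \<Rightarrow> (real^3) \<times> (real^3)" where
  "U0 = (\<lambda>(x, q, s). (xhor x, (- q / rsq x) *\<^sub>R xhor x))"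
definition U1 :: "(real^3) \<times> real \<times> real \<Rightarrow> (real^3) \<times> (real^3)" where
  "U1 = (\<lambda>(x, q, s). (0, (1 / rsq x) *\<^sub>R xhor x))"
definition U2 :: "(real^3) \<times> real \<times> real \<Rightarrow> (real^3) \<times> (real^3)" where
  "U2 = (\<lambda>_. (0, axis 3 1))"
definition V0 :: "(real^3) \<times> real \<times> real \<Rightarrow> (real^3) \<times> (real^3)" where
  "V0 = (\<lambda>_. (axis 3 1, 0))"
definition W0 :: "(real^3) \<times> real \<times> real \<Rightarrow> (real^3) \<times> (real^3)" where
  "W0 = (\<lambda>(x, q, s). (Jrot x, (q / rsq x) *\<^sub>R Jrot x))"

text \<open>The factor \<open>1 / rsq (fst p)\<close> is the determinant of the change from the
  first two basis vectors to \<open>xhor x\<close> and \<open>Jrot x\<close>. The angular lift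
  \<open>W0\<close> always fills the middle slot.\<close>

definition form_coeff :: "((real^3) \<times> (real^3)) form3 \<Rightarrow> ((real^3) \<times> real \<times> real \<Rightarrow> (real^3) \<times> (real^3)) \<Rightarrow>
    ((real^3) \<times> real \<times> real \<Rightarrow> (real^3) \<times> (real^3)) \<Rightarrow> (real^3) \<times> real \<times> real \<Rightarrow> real" where
  "form_coeff \<omega> \<alpha> \<gamma> p = (1 / rsq (fst p)) * \<omega> (fst p, ypoint p) (\<alpha> p) (W0 p) (\<gamma> p)"

definition graph_integrand :: "((real^3) \<times> (real^3)) form3 \<Rightarrow> real^3 \<Rightarrow> real^3 \<Rightarrow> real^3^3 \<Rightarrow> real" where
  "graph_integrand \<omega> x y A = \<omega> (x, y) (axis 1 1, A *v axis 1 1) (axis 2 1, A *v axis 2 1) (axis 3 1, A *v axis 3 1)"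

lemma rsq_0_iff: "rsq x = 0 \<longleftrightarrow> x \<in> axis_z"
  by (simp add: rsq_def axis_z_def sum_squares_eq_zero_iff)

lemma axis_nth: "(axis i 1 :: real^'n) $ j = (if j = i then 1 else 0)"
  by (simp add: axis_def)

text \<open>A plane vector \<open>(p, t)\<close> parallel to \<open>(a, b)\<close> equals its
  orthogonal projection onto that line.\<close>

lemma solve_parallel:
  fixes a b p t :: real
  assumes "b * p = a * t" "a * a + b * b \<noteq> 0"
  shows "p = a * ((a * p + b * t) / (a * a + b * b))" "t = b * ((a * p + b * t) / (a * a + b * b))"
proof -
  have "a * (a * p + b * t) = (a * a + b * b) * p" using assms(1) by algebra
  then have "a * ((a * p + b * t) / (a * a + b * b)) = (a * a + b * b) * p / (a * a + b * b)"
    by (simp only: times_divide_eq_right)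
  then show "p = a * ((a * p + b * t) / (a * a + b * b))"
    unfolding nonzero_mult_div_cancel_left[OF assms(2)] by (rule sym)
  have "b * (a * p + b * t) = (a * a + b * b) * t" using assms(1) by algebra
  then have "b * ((a * p + b * t) / (a * a + b * b)) = (a * a + b * b) * t / (a * a + b * b)"
    by (simp only: times_divide_eq_right)
  then show "t = b * ((a * p + b * t) / (a * a + b * b))"
    unfolding nonzero_mult_div_cancel_left[OF assms(2)] by (rule sym)
qed

text \<open>In the frame \<open>x' = (x\<^sub>1, x\<^sub>2, 0)\<close>, \<open>X = J x\<close>, \<open>e\<^sub>3\<close> an axisymmetric gradient only involves the
  derivatives of \<open>q\<close> and \<open>s\<close>, and the term quadratic in them is their Jacobian.\<close>

lemma axi_frame:
  assumes a: "axi_at x y A" and x: "x \<notin> axis_z"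
  defines "p \<equiv> (x, qmap x y, y $ 3)"
  shows "ypoint p = y"
    and "(xhor x, A *v xhor x) = U0 p + (x $ 1 * dqmap x y A 1 + x $ 2 * dqmap x y A 2) *\<^sub>R U1 p
        + (x $ 1 * A $ 3 $ 1 + x $ 2 * A $ 3 $ 2) *\<^sub>R U2 p"
    and "(Jrot x, A *v Jrot x) = W0 p"
    and "(axis 3 1, A *v axis 3 1) = V0 p + dqmap x y A 3 *\<^sub>R U1 p + A $ 3 $ 3 *\<^sub>R U2 p"
proof -
  have r: "x $ 1 * x $ 1 + x $ 2 * x $ 2 \<noteq> 0" using x by (simp add: rsq_0_iff[symmetric] rsq_def)
  have s1: "x $ 2 * y $ 1 = x $ 1 * y $ 2" using a by (simp add: axi_at_def)
  have s2: "A *v Jrot x = Jrot y" using a by (simp add: axi_at_def)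
  have s3: "x $ 2 * A $ 1 $ j - x $ 1 * A $ 2 $ j + (axis j 1 :: real^3) $ 2 * y $ 1 - (axis j 1 :: real^3) $ 1 * y $ 2 = 0" for j
    using a by (simp add: axi_at_def)
  note y = solve_parallel[OF s1 r]
  show yp: "ypoint p = y"
    using y by (simp add: p_def ypoint_def xhor_def vector3_eq axis_nth qmap_def rsq_def mult.commute)
  have Jy: "Jrot y = (qmap x y / rsq x) *\<^sub>R Jrot x"
    using y by (simp add: vector3_eq qmap_def rsq_def mult.commute)
  show "(Jrot x, A *v Jrot x) = W0 p" by (simp add: s2 Jy p_def W0_def)
  have Ae: "(A *v axis 3 1) $ i = A $ i $ 3" for i by (rule matrix_vector_axis)
  have "x $ 2 * A $ 1 $ 3 = x $ 1 * A $ 2 $ 3" using s3[of 3] by (simp add: axis_nth)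
  note y3 = solve_parallel[OF this r]
  show "(axis 3 1, A *v axis 3 1) = V0 p + dqmap x y A 3 *\<^sub>R U1 p + A $ 3 $ 3 *\<^sub>R U2 p"
    using y3 by (simp add: V0_def U1_def U2_def p_def vector3_eq Ae dqmap_def axis_nth xhor_def rsq_def mult.commute)
  have Ax: "(A *v xhor x) $ i = x $ 1 * A $ i $ 1 + x $ 2 * A $ i $ 2" for i
    by (simp add: matrix_vector_mult_def sum_3 xhor_def axis_nth mult.commute)
  have 1: "x $ 2 * A $ 1 $ 1 - x $ 1 * A $ 2 $ 1 - y $ 2 = 0" "x $ 2 * A $ 1 $ 2 - x $ 1 * A $ 2 $ 2 + y $ 1 = 0"
    using s3[of 1] s3[of 2] by (simp_all add: axis_nth)
  \<comment> \<open>The differentiated no-swirl identities in directions 1 and 2, weighted by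
    \<open>x $ 1\<close> and \<open>x $ 2\<close>. The terms in \<open>y\<close> cancel by the
    identity itself, and what is left says that the horizontal part of \<open>A *v xhor x\<close> is
    parallel to \<open>xhor x\<close>.\<close>
  have "x $ 1 * (x $ 2 * A $ 1 $ 1 - x $ 1 * A $ 2 $ 1 - y $ 2) + x $ 2 * (x $ 2 * A $ 1 $ 2 - x $ 1 * A $ 2 $ 2 + y $ 1) = 0"
    unfolding 1 by simp
  then have "x $ 2 * (x $ 1 * A $ 1 $ 1 + x $ 2 * A $ 1 $ 2) = x $ 1 * (x $ 1 * A $ 2 $ 1 + x $ 2 * A $ 2 $ 2)"
    using s1 by (simp add: algebra_simps)
  note yx = solve_parallel[OF this r]
  \<comment> \<open>The derivative of \<open>q\<close> along \<open>xhor x\<close> also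
    differentiates the explicit \<open>x\<close> in \<open>q\<close>, which contributes
    \<open>qmap x y\<close>.\<close>
  have dq: "x $ 1 * (x $ 1 * A $ 1 $ 1 + x $ 2 * A $ 1 $ 2) + x $ 2 * (x $ 1 * A $ 2 $ 1 + x $ 2 * A $ 2 $ 2)
      = (x $ 1 * dqmap x y A 1 + x $ 2 * dqmap x y A 2) - qmap x y"
    by (simp add: dqmap_def axis_nth qmap_def algebra_simps)
  show "(xhor x, A *v xhor x) = U0 p + (x $ 1 * dqmap x y A 1 + x $ 2 * dqmap x y A 2) *\<^sub>R U1 p
        + (x $ 1 * A $ 3 $ 1 + x $ 2 * A $ 3 $ 2) *\<^sub>R U2 p"
  proof -
    define a1 where "a1 = x $ 1 * dqmap x y A 1 + x $ 2 * dqmap x y A 2"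
    have sp: "v * ((a1 - q) / r) = (- q / r) * v + a1 * ((1 / r) * v)" for v q r :: real
      by (simp add: diff_divide_distrib algebra_simps)
    have "(A *v xhor x) $ 1 = (- qmap x y / rsq x) * x $ 1 + a1 * ((1 / rsq x) * x $ 1)"
      "(A *v xhor x) $ 2 = (- qmap x y / rsq x) * x $ 2 + a1 * ((1 / rsq x) * x $ 2)"
      unfolding sp[symmetric] unfolding Ax a1_def rsq_def using yx unfolding dq by blast+
    moreover have "(A *v xhor x) $ 3 = x $ 1 * A $ 3 $ 1 + x $ 2 * A $ 3 $ 2" by (rule Ax)
    ultimately show ?thesis unfolding a1_def[symmetric]
      by (simp only: U0_def U1_def U2_def p_def prod.case vector3_eq prod_eq_iff fst_add snd_add fst_scaleR snd_scaleR fst_conv snd_conv)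
        (simp add: axis_nth xhor_def)
  qed
qed

lemma graph_integrand_expansion:
  assumes \<omega>: "alternating3 (\<omega> (x, y))" and a: "axi_at x y A" and x: "x \<notin> axis_z"
  defines "p \<equiv> (x, qmap x y, y $ 3)"
  shows "graph_integrand \<omega> x y A = form_coeff \<omega> U0 V0 p + form_coeff \<omega> U0 U1 p * dqmap x y A 3
     + form_coeff \<omega> U0 U2 p * A $ 3 $ 3
     + form_coeff \<omega> U1 V0 p * (x $ 1 * dqmap x y A 1 + x $ 2 * dqmap x y A 2)
     + form_coeff \<omega> U2 V0 p * (x $ 1 * A $ 3 $ 1 + x $ 2 * A $ 3 $ 2)
     + (form_coeff \<omega> U1 U2 p * x $ 1 * Jac 1 3 x y A + form_coeff \<omega> U1 U2 p * x $ 2 * Jac 2 3 x y A)"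
proof -
  note fr = axi_frame[OF a x, folded p_def]
  define f where "f = \<omega> (x, y)"
  have af: "alternating3 f" using \<omega> by (simp add: f_def)
  note ex = alternating3_expand[OF af]
  let ?\<xi> = "\<lambda>v. (v, A *v v)"
  have r: "rsq x \<noteq> 0" using x by (simp add: rsq_0_iff)
  have \<xi>l: "?\<xi> (c *\<^sub>R v + d *\<^sub>R w) = c *\<^sub>R ?\<xi> v + d *\<^sub>R ?\<xi> w" for c d v w
    by (simp add: matrix_vector_right_distrib matrix_vector_mult_scaleR)
  have e1: "axis 1 1 = (x $ 1 / rsq x) *\<^sub>R xhor x + (- x $ 2 / rsq x) *\<^sub>R Jrot x"
    using r by (simp add: vector3_eq xhor_def axis_nth rsq_def flip: add_divide_distrib)
  have e2: "axis 2 1 = (x $ 2 / rsq x) *\<^sub>R xhor x + (x $ 1 / rsq x) *\<^sub>R Jrot x"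
    using r by (simp add: vector3_eq xhor_def axis_nth rsq_def add.commute flip: add_divide_distrib)
  have "graph_integrand \<omega> x y A = f (?\<xi> (axis 1 1)) (?\<xi> (axis 2 1)) (?\<xi> (axis 3 1))"
    by (simp add: graph_integrand_def f_def)
  \<comment> \<open>By alternation only the two mixed terms survive, and they combine to the
    determinant of the change of frame.\<close>
  also have "\<dots> = (x $ 1 / rsq x * (x $ 1 / rsq x) + x $ 2 / rsq x * (x $ 2 / rsq x)) * f (?\<xi> (xhor x)) (?\<xi> (Jrot x)) (?\<xi> (axis 3 1))"
    unfolding e1 e2 \<xi>l ex alternating3_swap(1)[OF af, of "?\<xi> (Jrot x)" "?\<xi> (xhor x)"] by (simp add: algebra_simps)
  also have "x $ 1 / rsq x * (x $ 1 / rsq x) + x $ 2 / rsq x * (x $ 2 / rsq x) = 1 / rsq x"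
    using r by (simp add: rsq_def flip: add_divide_distrib)
  \<comment> \<open>The middle slot contains no derivative, and terms with \<open>U1\<close> twice
    or \<open>U2\<close> twice vanish, so the only quadratic term is a minor of the other two
    lifts.\<close>
  also have "f (?\<xi> (xhor x)) (?\<xi> (Jrot x)) (?\<xi> (axis 3 1)) =
      f (U0 p) (W0 p) (V0 p) + dqmap x y A 3 * f (U0 p) (W0 p) (U1 p) + A $ 3 $ 3 * f (U0 p) (W0 p) (U2 p)
     + (x $ 1 * dqmap x y A 1 + x $ 2 * dqmap x y A 2) * f (U1 p) (W0 p) (V0 p)
     + (x $ 1 * A $ 3 $ 1 + x $ 2 * A $ 3 $ 2) * f (U2 p) (W0 p) (V0 p)
     + ((x $ 1 * dqmap x y A 1 + x $ 2 * dqmap x y A 2) * A $ 3 $ 3 - (x $ 1 * A $ 3 $ 1 + x $ 2 * A $ 3 $ 2) * dqmap x y A 3) * f (U1 p) (W0 p) (U2 p)"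
    unfolding fr ex alternating3_swap(3)[OF af, of "U2 p" "W0 p" "U1 p"] by (simp add: algebra_simps)
  finally show ?thesis
    by (rule trans) (simp add: form_coeff_def f_def Jac_def p_def fr(1)[unfolded p_def] algebra_simps add_divide_distrib diff_divide_distrib)
qed

lemma rsq_continuous: "continuous_on S rsq"
  unfolding rsq_def by (intro continuous_intros)

lemma xhor_continuous: "continuous_on S xhor"
  unfolding xhor_def by (intro continuous_intros)

lemma Jrot_continuous: "continuous_on S Jrot"
proof -
  have "Jrot = (\<lambda>x. (- x $ 2) *\<^sub>R axis 1 1 + x $ 1 *\<^sub>R axis 2 1)" by (simp add: fun_eq_iff vector3_eq axis_nth)
  then show ?thesis by (rule ssubst) (intro continuous_intros)
qed

text \<open>The formula is continuous off the axis, and the coefficient is 0 over the complement of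
  \<open>K\<close>; these two open sets cover the space because \<open>K\<close> misses the
  axis.\<close>

lemma form_coeff_continuous:
  assumes \<omega>: "\<And>p. alternating3 (\<omega> p)" "\<And>a b c. continuous_on UNIV (\<lambda>p. \<omega> p a b c)"
    and K: "compact K" "K \<inter> axis_z = {}" "\<And>x y a b c. x \<notin> K \<Longrightarrow> \<omega> (x, y) a b c = 0"
    and \<alpha>: "continuous_on {p. rsq (fst p) \<noteq> 0} \<alpha>" and \<gamma>: "continuous_on {p. rsq (fst p) \<noteq> 0} \<gamma>"
  shows "continuous_on UNIV (form_coeff \<omega> \<alpha> \<gamma>)"
proof -
  let ?S = "{p :: (real^3) \<times> real \<times> real. rsq (fst p) \<noteq> 0}" and ?T = "{p :: (real^3) \<times> real \<times> real. fst p \<notin> K}"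
  have rf: "continuous_on A (\<lambda>p. rsq (fst p))" for A :: "((real^3) \<times> real \<times> real) set"
    by (rule continuous_on_compose2[OF rsq_continuous[of UNIV]]) (auto intro: continuous_intros)
  have xf: "continuous_on A (\<lambda>p. xhor (fst p))" "continuous_on A (\<lambda>p. Jrot (fst p))" for A :: "((real^3) \<times> real \<times> real) set"
    by (rule continuous_on_compose2[OF xhor_continuous[of UNIV]] continuous_on_compose2[OF Jrot_continuous[of UNIV]], auto intro: continuous_intros)+
  have "open ?S" using open_Collect_neq[OF rf[of UNIV] continuous_on_const] by simp
  moreover have "open ?T"
  proof -
    have "?T = fst -` (- K)" by auto
    then show ?thesis using K(1) by (simp add: open_vimage_fst compact_imp_closed open_Compl)
  qed
  moreover have "continuous_on ?S (form_coeff \<omega> \<alpha> \<gamma>)"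
  proof -
    have i: "continuous_on ?S (\<lambda>p. 1 / rsq (fst p))" "continuous_on ?S (\<lambda>p. fst (snd p) / rsq (fst p))"
      by (intro continuous_on_divide rf continuous_intros; simp)+
    have y: "continuous_on ?S ypoint"
      unfolding ypoint_def case_prod_beta
      by (intro continuous_on_add continuous_on_scaleR i xf continuous_on_const continuous_on_snd continuous_on_id)
    have w: "continuous_on ?S W0"
      unfolding W0_def case_prod_beta by (intro continuous_on_Pair continuous_on_scaleR i xf)
    have f: "continuous_on ?S (\<lambda>p. (fst p, ypoint p))" by (intro continuous_on_Pair y continuous_on_fst continuous_on_id)
    show ?thesis unfolding form_coeff_def
      by (rule continuous_on_mult[OF i(1) continuous_on_form[OF \<omega> f \<alpha> w \<gamma>]])
  qed
  moreover have "continuous_on ?T (form_coeff \<omega> \<alpha> \<gamma>)"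
  proof -
    have "continuous_on ?T (\<lambda>p. 0 :: real)" by (rule continuous_on_const)
    then show ?thesis by (rule continuous_on_eq) (simp add: form_coeff_def K(3))
  qed
  ultimately have "continuous_on (?S \<union> ?T) (form_coeff \<omega> \<alpha> \<gamma>)" by (intro continuous_on_open_Un)
  moreover have "?S \<union> ?T = UNIV" using K(2) rsq_0_iff by auto
  ultimately show ?thesis by simp
qed

lemma frame_continuous:
  "continuous_on {p. rsq (fst p) \<noteq> 0} U0" "continuous_on {p. rsq (fst p) \<noteq> 0} U1"
  "continuous_on {p. rsq (fst p) \<noteq> 0} U2" "continuous_on {p. rsq (fst p) \<noteq> 0} V0"
proof -
  have rf: "continuous_on A (\<lambda>p. rsq (fst p))" for A :: "((real^3) \<times> real \<times> real) set"
    by (rule continuous_on_compose2[OF rsq_continuous[of UNIV]]) (auto intro: continuous_intros)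
  have xf: "continuous_on A (\<lambda>p. xhor (fst p))" for A :: "((real^3) \<times> real \<times> real) set"
    by (rule continuous_on_compose2[OF xhor_continuous[of UNIV]]) (auto intro: continuous_intros)
  show "continuous_on {p. rsq (fst p) \<noteq> 0} U0" "continuous_on {p. rsq (fst p) \<noteq> 0} U1"
    "continuous_on {p. rsq (fst p) \<noteq> 0} U2" "continuous_on {p. rsq (fst p) \<noteq> 0} V0"
    unfolding U0_def U1_def U2_def V0_def case_prod_beta by (intro continuous_intros rf xf; simp)+
qed

section \<open>Convergence on forms supported off the axis\<close>

context axi_limit
begin

lemma one_weak: "weak_L2 N (\<lambda>n x. 1) (\<lambda>x. 1)"
proof -
  interpret finite_measure N by (rule fmN)
  have "weak_L1 N (\<lambda>n x. 1) (\<lambda>x. 1)" unfolding weak_L1_def by simp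
  then show ?thesis unfolding weak_L2_def by auto
qed

text \<open>The support condition concerns \<open>x\<close> alone, as the values of the maps are
  bounded; this admits forms that are constant in \<open>y\<close>, such as
  \<open>det_form\<close>.\<close>

lemma form_convergence:
  assumes \<omega>: "\<And>p. alternating3 (\<omega> p)" "\<And>a b c. continuous_on UNIV (\<lambda>p. \<omega> p a b c)"
    and K: "compact K" "K \<subseteq> \<Omega> - axis_z" "\<And>x y a b c. x \<notin> K \<Longrightarrow> \<omega> (x, y) a b c = 0"
    and mn: "\<And>n. (\<lambda>x. graph_integrand \<omega> x (un n x) (Dn n x)) \<in> borel_measurable N"
      "(\<lambda>x. graph_integrand \<omega> x (u x) (D x)) \<in> borel_measurable N"
  shows "(\<lambda>n. \<integral>x. graph_integrand \<omega> x (un n x) (Dn n x) \<partial>N) \<longlonglongrightarrow> (\<integral>x. graph_integrand \<omega> x (u x) (D x) \<partial>N)"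
    "integrable N (\<lambda>x. graph_integrand \<omega> x (u x) (D x))"
proof -
  have K': "K \<inter> axis_z = {}" "K \<subseteq> \<Omega>" using K(2) by auto
  note fc = form_coeff_continuous[OF \<omega> K(1) K'(1)]
  have fz: "form_coeff \<omega> \<alpha> \<gamma> (x, q, s) = 0" if "x \<notin> K" for \<alpha> \<gamma> x q s
    using K(3)[OF that] by (simp add: form_coeff_def)
  have T: "continuous_on UNIV (form_coeff \<omega> U0 V0)" "continuous_on UNIV (form_coeff \<omega> U0 U1)" "continuous_on UNIV (form_coeff \<omega> U0 U2)"
    "continuous_on UNIV (form_coeff \<omega> U1 V0)" "continuous_on UNIV (form_coeff \<omega> U2 V0)" "continuous_on UNIV (form_coeff \<omega> U1 U2)"
    using fc[OF _ frame_continuous(1) frame_continuous(4)] fc[OF _ frame_continuous(1) frame_continuous(2)]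
      fc[OF _ frame_continuous(1) frame_continuous(3)] fc[OF _ frame_continuous(2) frame_continuous(4)]
      fc[OF _ frame_continuous(3) frame_continuous(4)] fc[OF _ frame_continuous(2) frame_continuous(3)] K(3) by blast+
  have cc: "bounded_AE_conv N (\<lambda>n. coeff (form_coeff \<omega> \<alpha> \<gamma>) (un n)) (coeff (form_coeff \<omega> \<alpha> \<gamma>) u)"
    if "continuous_on UNIV (form_coeff \<omega> \<alpha> \<gamma>)" for \<alpha> \<gamma>
    by (rule coeff_conv[OF that K(1)]) (rule fz)
  \<comment> \<open>The weights of the two minors in the quadratic term, with the factor
    \<open>x $ i\<close> of the expansion included.\<close>
  define S where "S i p = form_coeff \<omega> U1 U2 p * fst p $ i" for i p
  have Sc: "continuous_on UNIV (S i)" for i unfolding S_def by (intro continuous_intros T)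
  have Sz: "S i (x, q, s) = 0" if "x \<notin> K" for i x q s by (simp add: S_def fz[OF that])
  have a1: "weak_L2 N (\<lambda>n x. x $ 1 * dqmap x (un n x) (Dn n x) 1 + x $ 2 * dqmap x (un n x) (Dn n x) 2)
      (\<lambda>x. x $ 1 * dqmap x (u x) (D x) 1 + x $ 2 * dqmap x (u x) (D x) 2)"
    by (intro weak_L2_add weak_L2_mult[OF dq_weak coord_meas coord_bnd])
  have a2: "weak_L2 N (\<lambda>n x. x $ 1 * Dn n x $ 3 $ 1 + x $ 2 * Dn n x $ 3 $ 2) (\<lambda>x. x $ 1 * D x $ 3 $ 1 + x $ 2 * D x $ 3 $ 2)"
    by (intro weak_L2_add weak_L2_mult[OF D_weak coord_meas coord_bnd])
  note p0 = weak_L2_product[OF fmN cc[OF T(1)] one_weak] and p1 = weak_L2_product[OF fmN cc[OF T(2)] dq_weak[of 3]]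
    and p2 = weak_L2_product[OF fmN cc[OF T(3)] D_weak[of 3 3]] and p3 = weak_L2_product[OF fmN cc[OF T(4)] a1]
    and p4 = weak_L2_product[OF fmN cc[OF T(5)] a2]
  have p5: "(\<lambda>n. \<integral>x. coeff (S i) (un n) x * Jac i 3 x (un n x) (Dn n x) \<partial>N) \<longlonglongrightarrow> (\<integral>x. coeff (S i) u x * Jac i 3 x (u x) (D x) \<partial>N)" for i
    by (rule coeff_Jac_conv[OF Sc K(1) K'(2)]) (rule Sz)
  have Scc: "bounded_AE_conv N (\<lambda>n. coeff (S i) (un n)) (coeff (S i) u)" for i
    by (rule coeff_conv[OF Sc K(1)]) (rule Sz)
  have p6: "integrable N (\<lambda>x. coeff (S i) (un n) x * Jac i 3 x (un n x) (Dn n x))"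
    "integrable N (\<lambda>x. coeff (S i) u x * Jac i 3 x (u x) (D x))" for i n
    by (rule bounded_times_integrable[OF Scc Jac_integrable])+
  \<comment> \<open>The term of order zero carries a factor 1, a constant weakly convergent
    sequence, so that it falls under \<open>weak_L2_product\<close> like the linear terms.\<close>
  define E where "E w x = coeff (form_coeff \<omega> U0 V0) w x * 1 + coeff (form_coeff \<omega> U0 U1) w x * dqmap x (w x) (weak_gradient \<Omega> w x) 3
     + coeff (form_coeff \<omega> U0 U2) w x * weak_gradient \<Omega> w x $ 3 $ 3
     + coeff (form_coeff \<omega> U1 V0) w x * (x $ 1 * dqmap x (w x) (weak_gradient \<Omega> w x) 1 + x $ 2 * dqmap x (w x) (weak_gradient \<Omega> w x) 2)
     + coeff (form_coeff \<omega> U2 V0) w x * (x $ 1 * weak_gradient \<Omega> w x $ 3 $ 1 + x $ 2 * weak_gradient \<Omega> w x $ 3 $ 2)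
     + (coeff (S 1) w x * Jac 1 3 x (w x) (weak_gradient \<Omega> w x) + coeff (S 2) w x * Jac 2 3 x (w x) (weak_gradient \<Omega> w x))" for w x
  have AEax: "AE x in N. x \<notin> axis_z" unfolding AE_lebesgue_on[OF s\<Omega>] using axis_z_negligible by eventually_elim simp
  have eq: "AE x in N. graph_integrand \<omega> x (w x) (weak_gradient \<Omega> w x) = E w x"
    if "AE x in N. axi_at x (w x) (weak_gradient \<Omega> w x)" for w
    using that AEax
  proof eventually_elim
    case (elim x)
    show ?case
      unfolding graph_integrand_expansion[of \<omega>, OF \<omega>(1) elim] E_def coeff_def S_def by simp
  qed
  have Ei: "integrable N (E (un n))" "integrable N (E u)" for n
    unfolding E_def using p0(2,3) p1(2,3) p2(2,3) p3(2,3) p4(2,3) p6 by auto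
  have gE: "(\<integral>x. graph_integrand \<omega> x (w x) (weak_gradient \<Omega> w x) \<partial>N) = (\<integral>x. E w x \<partial>N)"
    if "(\<lambda>x. graph_integrand \<omega> x (w x) (weak_gradient \<Omega> w x)) \<in> borel_measurable N" "integrable N (E w)"
      "AE x in N. axi_at x (w x) (weak_gradient \<Omega> w x)" for w
    using that eq[OF that(3)] by (intro integral_cong_AE) auto
  have "(\<lambda>n. \<integral>x. E (un n) x \<partial>N) \<longlonglongrightarrow> (\<integral>x. E u x \<partial>N)"
  proof -
    have i: "(\<integral>x. E w x \<partial>N) = (\<integral>x. coeff (form_coeff \<omega> U0 V0) w x * 1 \<partial>N) + (\<integral>x. coeff (form_coeff \<omega> U0 U1) w x * dqmap x (w x) (weak_gradient \<Omega> w x) 3 \<partial>N)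
     + (\<integral>x. coeff (form_coeff \<omega> U0 U2) w x * weak_gradient \<Omega> w x $ 3 $ 3 \<partial>N)
     + (\<integral>x. coeff (form_coeff \<omega> U1 V0) w x * (x $ 1 * dqmap x (w x) (weak_gradient \<Omega> w x) 1 + x $ 2 * dqmap x (w x) (weak_gradient \<Omega> w x) 2) \<partial>N)
     + (\<integral>x. coeff (form_coeff \<omega> U2 V0) w x * (x $ 1 * weak_gradient \<Omega> w x $ 3 $ 1 + x $ 2 * weak_gradient \<Omega> w x $ 3 $ 2) \<partial>N)
     + ((\<integral>x. coeff (S 1) w x * Jac 1 3 x (w x) (weak_gradient \<Omega> w x) \<partial>N) + (\<integral>x. coeff (S 2) w x * Jac 2 3 x (w x) (weak_gradient \<Omega> w x) \<partial>N))"
      if "w = u \<or> (\<exists>n. w = un n)" for w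
      using that unfolding E_def
      by (elim disjE exE) (simp_all add: p0(2,3)[simplified] p1(2,3) p2(2,3) p3(2,3) p4(2,3) p6)
    have i1: "\<And>n. un n = u \<or> (\<exists>k. un n = un k)" by blast
    show ?thesis unfolding i[OF disjI1[OF refl]] i[OF i1]
      by (intro tendsto_add p0(1) p1(1) p2(1) p3(1) p4(1) p5)
  qed
  then show "(\<lambda>n. \<integral>x. graph_integrand \<omega> x (un n x) (Dn n x) \<partial>N) \<longlonglongrightarrow> (\<integral>x. graph_integrand \<omega> x (u x) (D x) \<partial>N)"
    unfolding gE[OF mn(1) Ei(1) axi] gE[OF mn(2) Ei(2) axi_u] .
  have "AE x in N. E u x = graph_integrand \<omega> x (u x) (D x)" using eq[OF axi_u] by eventually_elim simp
  then show "integrable N (\<lambda>x. graph_integrand \<omega> x (u x) (D x))"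
    using integrable_cong_AE[OF borel_measurable_integrable[OF Ei(2)] mn(2)] Ei(2) by blast
qed

end

section \<open>The defect current\<close>

definition det3 :: "real^3 \<Rightarrow> real^3 \<Rightarrow> real^3 \<Rightarrow> real" where
  "det3 a b c = a $ 1 * (b $ 2 * c $ 3 - b $ 3 * c $ 2) - a $ 2 * (b $ 1 * c $ 3 - b $ 3 * c $ 1)
     + a $ 3 * (b $ 1 * c $ 2 - b $ 2 * c $ 1)"

lemma det3_matrix: "det3 (A *v axis 1 1) (A *v axis 2 1) (A *v axis 3 1) = det A"
  by (simp add: det3_def det_3 matrix_vector_axis algebra_simps)

lemma det_measurable:
  fixes A :: "'a \<Rightarrow> real^3^3"
  assumes "\<And>i j. (\<lambda>x. A x $ i $ j) \<in> borel_measurable N"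
  shows "(\<lambda>x. det (A x)) \<in> borel_measurable N"
  unfolding det_3 by (intro borel_measurable_add borel_measurable_diff borel_measurable_times assms)

text \<open>The form \<phi>(x) times the volume form in \<open>y\<close>. Being constant in
  \<open>y\<close>, it is in general not compactly supported and hence not a test form on the
  product.\<close>

definition det_form :: "(real^3 \<Rightarrow> real) \<Rightarrow> ((real^3) \<times> (real^3)) form3" where
  "det_form \<phi> p a b c = \<phi> (fst p) * det3 (snd a) (snd b) (snd c)"

lemma det_form_alternating: "alternating3 (det_form \<phi> p)"
  unfolding alternating3_def det_form_def det3_def
  by (intro conjI allI linearI) (simp_all add: algebra_simps)

lemma graph_integrand_det_form: "graph_integrand (det_form \<phi>) x y A = \<phi> x * det A"
  by (simp add: graph_integrand_def det_form_def det3_matrix)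

lemma alternating3_det3:
  assumes "alternating3 g"
  shows "g a b c = det3 a b c * g (axis 1 1) (axis 2 1) (axis 3 1)"
proof -
  note ex = alternating3_expand[OF assms] and sw = alternating3_swap[OF assms]
  let ?e = "\<lambda>i::3. axis i 1 :: real^3"
  have rep: "v = v $ 1 *\<^sub>R ?e 1 + v $ 2 *\<^sub>R ?e 2 + v $ 3 *\<^sub>R ?e 3" for v
    by (simp add: vector3_eq axis_nth)
  have 1: "g (?e 2) (?e 1) (?e 3) = - g (?e 1) (?e 2) (?e 3)" "g (?e 1) (?e 3) (?e 2) = - g (?e 1) (?e 2) (?e 3)"
    "g (?e 3) (?e 2) (?e 1) = - g (?e 1) (?e 2) (?e 3)" by (rule sw)+
  have 2: "g (?e 2) (?e 3) (?e 1) = g (?e 1) (?e 2) (?e 3)" "g (?e 3) (?e 1) (?e 2) = g (?e 1) (?e 2) (?e 3)"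
    using sw(2)[of "?e 2" "?e 3" "?e 1"] sw(2)[of "?e 3" "?e 1" "?e 2"] 1 by simp_all
  have bc: "g v b c = b $ 1 * (c $ 1 * g v (?e 1) (?e 1) + c $ 2 * g v (?e 1) (?e 2) + c $ 3 * g v (?e 1) (?e 3))
     + b $ 2 * (c $ 1 * g v (?e 2) (?e 1) + c $ 2 * g v (?e 2) (?e 2) + c $ 3 * g v (?e 2) (?e 3))
     + b $ 3 * (c $ 1 * g v (?e 3) (?e 1) + c $ 2 * g v (?e 3) (?e 2) + c $ 3 * g v (?e 3) (?e 3))" for v
    by (subst rep[of b], subst rep[of c]) (simp add: ex(1-6) algebra_simps)
  have "g a b c = a $ 1 * g (?e 1) b c + a $ 2 * g (?e 2) b c + a $ 3 * g (?e 3) b c"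
    by (subst rep[of a]) (simp only: alternating3_add[OF assms] alternating3_scale[OF assms])
  also have "g (?e 1) b c = (b $ 2 * c $ 3 - b $ 3 * c $ 2) * g (?e 1) (?e 2) (?e 3)"
    unfolding bc[of "?e 1"] alternating3_same[OF assms] 1 by (simp add: left_diff_distrib)
  also have "g (?e 2) b c = - (b $ 1 * c $ 3 - b $ 3 * c $ 1) * g (?e 1) (?e 2) (?e 3)"
    unfolding bc[of "?e 2"] alternating3_same[OF assms] 1 2 by (simp add: left_diff_distrib)
  also have "g (?e 3) b c = (b $ 1 * c $ 2 - b $ 2 * c $ 1) * g (?e 1) (?e 2) (?e 3)"
    unfolding bc[of "?e 3"] alternating3_same[OF assms] 1 2 by (simp add: left_diff_distrib)
  finally show ?thesis by (simp only: det3_def) (simp add: left_diff_distrib right_diff_distrib distrib_right mult.assoc)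
qed

text \<open>The restriction of \<open>f\<close> to the vertical subspace is an alternating 3-form on
  a three-dimensional space, hence a multiple of the determinant.\<close>

lemma alternating3_vertical:
  fixes f :: "(real^3) \<times> (real^3) \<Rightarrow> (real^3) \<times> (real^3) \<Rightarrow> (real^3) \<times> (real^3) \<Rightarrow> real"
  assumes "alternating3 f"
  shows "f (0, A *v axis 1 1) (0, A *v axis 2 1) (0, A *v axis 3 1) = det A * f (0, axis 1 1) (0, axis 2 1) (0, axis 3 1)"
proof -
  let ?g = "\<lambda>a b c :: real^3. f (0, a) (0, b) (0, c)"
  have l: "linear (\<lambda>a. (0 :: real^3, a :: real^3))" by (rule linearI) simp_all
  note f = alternating3_linear[OF assms, THEN linear_compose[OF l], unfolded o_def]
  have "alternating3 ?g"
    unfolding alternating3_def using f alternating3_same[OF assms] by blast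
  from alternating3_det3[OF this] show ?thesis unfolding det3_matrix[symmetric] by this
qed

lemma closed_axis_z: "closed axis_z"
proof -
  have "axis_z = {x. x $ 1 = 0} \<inter> {x. x $ 2 = 0}" by (auto simp: axis_z_def)
  moreover have "closed {x::real^3. x $ i = 0}" for i by (intro closed_Collect_eq continuous_intros)
  ultimately show ?thesis using closed_Int by metis
qed

section \<open>Integrability of the limiting determinant\<close>

context axi_limit
begin

lemma Dn_det_measurable: "(\<lambda>x. det (Dn n x)) \<in> borel_measurable N" "(\<lambda>x. det (D x)) \<in> borel_measurable N"
  by (rule det_measurable[OF W12_comp_measurable(2)[OF W(1)]], rule det_measurable[OF W12_comp_measurable(2)[OF W(2)]])

text \<open>The second conclusion is not evident for a gradient in L2, whose determinant is cubic;
  it comes from the expansion in the cylindrical frame, where at most two derivatives are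
  multiplied.\<close>

lemma det_form_convergence:
  assumes \<phi>: "\<phi> \<in> test_functions (\<Omega> - axis_z)"
  shows "(\<lambda>n. \<integral>x. \<phi> x * det (Dn n x) \<partial>N) \<longlonglongrightarrow> (\<integral>x. \<phi> x * det (D x) \<partial>N)"
    "integrable N (\<lambda>x. \<phi> x * det (D x))"
proof -
  obtain K where K: "compact K" "K \<subseteq> \<Omega> - axis_z" "\<And>x. x \<notin> K \<Longrightarrow> \<phi> x = 0"
    by (rule test_functions_support[OF \<phi>], rule that)
  have \<phi>m: "\<phi> \<in> borel_measurable N"
    by (rule measurable_restrict_space1[OF smooth_borel_lebesgue[OF test_functions_smooth[OF \<phi>]]])
  have c: "continuous_on UNIV (\<lambda>p. det_form \<phi> p a b c)" for a b c
    unfolding det_form_def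
    by (intro continuous_intros continuous_on_compose2[OF smooth_continuous[OF test_functions_smooth[OF \<phi>]]]) auto
  have z: "det_form \<phi> (x, y) a b c = 0" if "x \<notin> K" for x y a b c using K(3)[OF that] by (simp add: det_form_def)
  have m: "(\<lambda>x. graph_integrand (det_form \<phi>) x (un n x) (Dn n x)) \<in> borel_measurable N"
    "(\<lambda>x. graph_integrand (det_form \<phi>) x (u x) (D x)) \<in> borel_measurable N" for n
    unfolding graph_integrand_det_form by (intro borel_measurable_times \<phi>m Dn_det_measurable)+
  show "(\<lambda>n. \<integral>x. \<phi> x * det (Dn n x) \<partial>N) \<longlonglongrightarrow> (\<integral>x. \<phi> x * det (D x) \<partial>N)"
    "integrable N (\<lambda>x. \<phi> x * det (D x))"
    by (rule form_convergence[OF det_form_alternating c K(1,2) z m, unfolded graph_integrand_det_form]; assumption)+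
qed

lemma det_limit_integrable:
  assumes di: "\<And>n. integrable N (\<lambda>x. det (Dn n x))" and db: "\<And>n. (\<integral>x. \<bar>det (Dn n x)\<bar> \<partial>N) \<le> B"
  shows "integrable N (\<lambda>x. det (D x))"
proof -
  let ?U = "\<Omega> - axis_z"
  have U: "open ?U" using \<Omega>(1) closed_axis_z by (rule open_Diff)
  have Us: "?U \<in> sets lebesgue" using U by simp
  \<comment> \<open>The duality bound presupposes local integrability. This is contained in the
    convergence result, applied to a cutoff that is 1 on \<open>K\<close>.\<close>
  have li: "locally_integrable ?U (\<lambda>x. det (D x))"
    unfolding locally_integrable_def
  proof (intro allI impI, elim conjE)
    fix K assume K: "compact K" "K \<subseteq> ?U"
    have Ks: "K \<in> sets lebesgue" by (rule fmeasurableD[OF lmeasurable_compact[OF K(1)]])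
    obtain \<zeta> where \<zeta>: "\<zeta> \<in> test_functions ?U" "\<And>x. x \<in> K \<Longrightarrow> \<zeta> x = (1::real)"
      by (rule smooth_cutoff[OF K(1) U K(2)], rule that)
    have "integrable lebesgue (\<lambda>x. indicator \<Omega> x * (\<zeta> x * det (D x)))"
      using det_form_convergence(2)[OF \<zeta>(1)] by (simp add: integrable_lebesgue_on[OF s\<Omega>])
    then have "integrable lebesgue (\<lambda>x. indicator \<Omega> x * (\<zeta> x * det (D x)) * indicator K x)"
      by (rule integrable_mult_bounded[where B=1]) (use Ks in auto)
    also have "(\<lambda>x. indicator \<Omega> x * (\<zeta> x * det (D x)) * indicator K x) = (\<lambda>x. indicator K x * det (D x))"
      using K(2) \<zeta>(2) by (auto simp: fun_eq_iff indicator_def)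
    finally show "integrable (lebesgue_on K) (\<lambda>x. det (D x))" by (simp add: integrable_lebesgue_on[OF Ks])
  qed
  have tests: "(\<integral>x. det (D x) * \<phi> x \<partial>lebesgue_on ?U) \<le> B" if \<phi>: "\<phi> \<in> test_functions ?U" "\<And>x. \<bar>\<phi> x\<bar> \<le> 1" for \<phi>
  proof -
    obtain K where K: "compact K" "K \<subseteq> ?U" "\<And>x. x \<notin> K \<Longrightarrow> \<phi> x = 0"
      by (rule test_functions_support[OF \<phi>(1)], rule that)
    have \<phi>m: "\<phi> \<in> borel_measurable N"
      by (rule measurable_restrict_space1[OF smooth_borel_lebesgue[OF test_functions_smooth[OF \<phi>(1)]]])
    have "(\<integral>x. det (D x) * \<phi> x \<partial>lebesgue_on ?U) = (\<integral>x. \<phi> x * det (D x) \<partial>N)"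
      unfolding integral_lebesgue_on[OF Us] integral_lebesgue_on[OF s\<Omega>]
      using K(2,3) by (intro Bochner_Integration.integral_cong) (auto simp: indicator_def)
    also have "\<dots> \<le> B"
    proof (rule LIMSEQ_le_const2[OF det_form_convergence(1)[OF \<phi>(1)]], intro exI allI impI)
      fix n
      have i: "integrable N (\<lambda>x. det (Dn n x) * \<phi> x)" by (rule integrable_mult_bounded[OF di \<phi>m]) (use \<phi>(2) in auto)
      have "(\<integral>x. \<phi> x * det (Dn n x) \<partial>N) \<le> (\<integral>x. \<bar>det (Dn n x)\<bar> \<partial>N)"
      proof (rule integral_mono)
        fix x
        have "\<phi> x * det (Dn n x) \<le> \<bar>\<phi> x\<bar> * \<bar>det (Dn n x)\<bar>" by (simp flip: abs_mult)
        also have "\<dots> \<le> 1 * \<bar>det (Dn n x)\<bar>" using \<phi>(2) by (intro mult_right_mono) auto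
        finally show "\<phi> x * det (Dn n x) \<le> \<bar>det (Dn n x)\<bar>" by simp
      qed (use i di in \<open>auto simp: mult.commute\<close>)
      then show "(\<integral>x. \<phi> x * det (Dn n x) \<partial>N) \<le> B" using db[of n] by linarith
    qed
    finally show ?thesis .
  qed
  have Kb: "(\<integral>x. \<bar>det (D x)\<bar> \<partial>lebesgue_on K) \<le> B" if "compact K" "K \<subseteq> ?U" for K
    by (rule local_L1_bound_by_tests[OF li U that tests])
  obtain F :: "nat \<Rightarrow> (real^3) set" where F: "\<And>n. compact (F n)" "\<And>n. F n \<subseteq> ?U" "(\<Union>n. F n) = ?U"
    using open_Union_compact_subsets[OF U] by metis
  define K where "K n = (\<Union>k\<le>n. F k)" for n
  have K: "compact (K n)" "K n \<subseteq> ?U" for n using F by (auto simp: K_def intro!: compact_UN)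
  have Ks: "K n \<in> sets lebesgue" for n by (rule fmeasurableD[OF lmeasurable_compact[OF K(1)]])
  have inc: "incseq K" unfolding K_def by (intro incseq_SucI UN_mono) auto
  have UK: "(\<Union>n. K n) = ?U" using F(3) by (auto simp: K_def)
  have KDi: "integrable lebesgue (\<lambda>x. indicator (K n) x * det (D x))" for n
    using li K unfolding locally_integrable_def by (simp add: integrable_lebesgue_on[OF Ks, symmetric])
  have UDm: "(\<lambda>x. indicator ?U x * det (D x)) \<in> borel_measurable lebesgue"
    using locally_integrable_measurable[OF li U] by (simp add: measurable_lebesgue_on[OF Us])
  let ?f = "\<lambda>n x. ennreal \<bar>indicator (K n) x * det (D x)\<bar>"
  \<comment> \<open>Monotone convergence along the exhaustion turns the uniform bound on compact
    sets into integrability over \<Omega> off the axis.\<close>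
  have "(\<lambda>n. integral\<^sup>N lebesgue (?f n)) \<longlonglongrightarrow> (\<integral>\<^sup>+x. ennreal \<bar>indicator ?U x * det (D x)\<bar> \<partial>lebesgue)"
  proof (rule nn_integral_LIMSEQ)
    show "incseq ?f"
    proof (rule incseq_SucI, rule le_funI, rule ennreal_leI)
      fix n x
      have "K n \<subseteq> K (Suc n)" using inc by (simp add: incseq_SucD)
      then show "\<bar>indicator (K n) x * det (D x)\<bar> \<le> \<bar>indicator (K (Suc n)) x * det (D x)\<bar>"
        by (auto simp: indicator_def)
    qed
    show "?f n \<in> borel_measurable lebesgue" for n using borel_measurable_integrable[OF KDi[of n]] by simp
    show "(\<lambda>n. ?f n x) \<longlonglongrightarrow> ennreal \<bar>indicator ?U x * det (D x)\<bar>" for x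
    proof (rule tendsto_eventually, cases "x \<in> ?U")
      case True
      then obtain m where "x \<in> K m" using UK by blast
      then have "x \<in> K n" if "n \<ge> m" for n using incseqD[OF inc that] by blast
      then show "eventually (\<lambda>n. ?f n x = ennreal \<bar>indicator ?U x * det (D x)\<bar>) sequentially"
        using True by (auto simp: eventually_sequentially intro!: exI[of _ m])
    next
      case False
      then have "x \<notin> K n" for n using K(2) by blast
      then show "eventually (\<lambda>n. ?f n x = ennreal \<bar>indicator ?U x * det (D x)\<bar>) sequentially"
        using False by simp
    qed
  qed
  moreover have "integral\<^sup>N lebesgue (?f n) \<le> ennreal B" for n
  proof -
    have "integral\<^sup>N lebesgue (?f n) = ennreal (\<integral>x. \<bar>indicator (K n) x * det (D x)\<bar> \<partial>lebesgue)"
      by (rule nn_integral_eq_integral[OF integrable_abs[OF KDi]]) simp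
    also have "(\<integral>x. \<bar>indicator (K n) x * det (D x)\<bar> \<partial>lebesgue) = (\<integral>x. \<bar>det (D x)\<bar> \<partial>lebesgue_on (K n))"
      unfolding integral_lebesgue_on[OF Ks] by (intro Bochner_Integration.integral_cong) (auto simp: abs_mult)
    also have "ennreal \<dots> \<le> ennreal B" by (rule ennreal_leI[OF Kb[OF K]])
    finally show ?thesis .
  qed
  ultimately have "(\<integral>\<^sup>+x. ennreal \<bar>indicator ?U x * det (D x)\<bar> \<partial>lebesgue) \<le> ennreal B"
    by (intro LIMSEQ_le_const2) auto
  also have "\<dots> < \<infinity>" by simp
  finally have "integrable lebesgue (\<lambda>x. indicator ?U x * det (D x))"
    using UDm by (simp add: integrable_iff_bounded)
  moreover have "AE x in lebesgue. indicator ?U x * det (D x) = indicator \<Omega> x * det (D x)"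
    using axis_z_negligible by eventually_elim (simp add: indicator_def)
  moreover have "(\<lambda>x. indicator \<Omega> x * det (D x)) \<in> borel_measurable lebesgue"
    using Dn_det_measurable(2) by (simp add: measurable_lebesgue_on[OF s\<Omega>])
  ultimately have "integrable lebesgue (\<lambda>x. indicator \<Omega> x * det (D x))"
    using integrable_cong_AE[OF UDm] by blast
  then show ?thesis by (simp add: integrable_lebesgue_on[OF s\<Omega>])
qed

end

section \<open>Moments and subsequences\<close>

text \<open>Monomials as lists of basis vectors with repetition: the lists over \<open>Basis\<close>
  are countable, and multiplication by a coordinate is prepending an element.\<close>

definition monomial_list :: "'b::euclidean_space list \<Rightarrow> 'b \<Rightarrow> real" where
  "monomial_list L y = prod_list (map (\<lambda>b. y \<bullet> b) L)"

lemma monomial_list_continuous: "continuous_on A (monomial_list L)"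
  unfolding monomial_list_def by (induction L) (auto intro!: continuous_intros)

text \<open>Countably many moments determine the limits against all continuous integrands, by
  Stone--Weierstrass.\<close>

lemma moment_subsequence:
  fixes w :: "nat \<Rightarrow> 'x \<Rightarrow> 'b::euclidean_space" and m :: "'t \<Rightarrow> nat \<Rightarrow> 'x \<Rightarrow> real"
  assumes T: "finite T" and S: "compact S" "\<And>n. AE x in N. w n x \<in> S"
    and wm: "\<And>n. w n \<in> borel_measurable N" and mi: "\<And>t n. t \<in> T \<Longrightarrow> integrable N (m t n)"
    and mb: "\<And>t n. t \<in> T \<Longrightarrow> (\<integral>x. \<bar>m t n x\<bar> \<partial>N) \<le> B"
  obtains r :: "nat \<Rightarrow> nat" where "strict_mono r"
    "\<And>t \<phi>. t \<in> T \<Longrightarrow> continuous_on UNIV \<phi> \<Longrightarrow> convergent (\<lambda>n. \<integral>x. \<phi> (w (r n) x) * m t (r n) x \<partial>N)"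
proof -
  have cb: "\<exists>c>0. \<forall>y\<in>S. \<bar>\<phi> y\<bar> \<le> c" if "continuous_on UNIV \<phi>" for \<phi> :: "'b \<Rightarrow> real"
  proof -
    have "compact (\<phi> ` S)" by (intro compact_continuous_image continuous_on_subset[OF that] S) auto
    then obtain c where "c > 0" "\<And>y. y \<in> \<phi> ` S \<Longrightarrow> norm y \<le> c" using compact_imp_bounded bounded_pos by metis
    then show ?thesis by (intro exI[of _ c]) auto
  qed
  have \<phi>i: "integrable N (\<lambda>x. \<phi> (w n x) * m t n x)" if \<phi>: "continuous_on UNIV \<phi>" and t: "t \<in> T" for \<phi> t n
  proof -
    obtain c where c: "\<And>y. y \<in> S \<Longrightarrow> \<bar>\<phi> y\<bar> \<le> c" using cb[OF \<phi>] by blast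
    have "integrable N (\<lambda>x. m t n x * \<phi> (w n x))"
    proof (rule integrable_mult_bounded[OF mi[OF t] borel_measurable_continuous_on[OF \<phi> wm]])
      show "AE x in N. \<bar>\<phi> (w n x)\<bar> \<le> c" using S(2)[of n] by eventually_elim (rule c)
    qed
    then show ?thesis by (simp add: mult.commute)
  qed
  have \<phi>b: "\<bar>\<integral>x. \<phi> (w n x) * m t n x \<partial>N\<bar> \<le> c * B"
    if \<phi>: "continuous_on UNIV \<phi>" and t: "t \<in> T" and c: "c \<ge> 0" "\<And>y. y \<in> S \<Longrightarrow> \<bar>\<phi> y\<bar> \<le> c" for \<phi> t n c
  proof -
    have "\<bar>\<integral>x. \<phi> (w n x) * m t n x \<partial>N\<bar> \<le> (\<integral>x. \<bar>\<phi> (w n x) * m t n x\<bar> \<partial>N)" by simp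
    also have "\<dots> \<le> (\<integral>x. c * \<bar>m t n x\<bar> \<partial>N)"
    proof (rule integral_mono_AE)
      show "AE x in N. \<bar>\<phi> (w n x) * m t n x\<bar> \<le> c * \<bar>m t n x\<bar>"
        using S(2)[of n] by eventually_elim (auto simp: abs_mult intro!: mult_right_mono c)
    qed (use \<phi>i[OF \<phi> t] mi[OF t] in auto)
    also have "\<dots> \<le> c * B" using mb[OF t] c(1) by (simp add: mult_left_mono)
    finally show ?thesis .
  qed
  obtain C where C: "\<And>L. C L > 0" "\<And>L y. y \<in> S \<Longrightarrow> \<bar>monomial_list L y\<bar> \<le> C L"
    using cb[OF monomial_list_continuous] by metis
  \<comment> \<open>Division by a bound for the monomial on \<open>S\<close> gives one bound
    \<open>B\<close> for all indices, as needed for the diagonal argument.\<close>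
  define f where "f n p = (\<integral>x. monomial_list (snd p) (w n x) * m (fst p) n x \<partial>N) / C (snd p)" for n p
  have cT: "countable (T \<times> lists (Basis :: 'b set))"
    using T by (intro countable_SIGMA countable_finite countable_lists) auto
  have fB: "norm (f n p) \<le> B" if "p \<in> T \<times> lists (Basis :: 'b set)" for n p
  proof -
    have "\<bar>\<integral>x. monomial_list (snd p) (w n x) * m (fst p) n x \<partial>N\<bar> \<le> C (snd p) * B"
      by (rule \<phi>b[OF monomial_list_continuous]) (use that C(2) less_imp_le[OF C(1)] in auto)
    then show ?thesis using C(1)[of "snd p"] by (simp add: f_def field_simps)
  qed
  obtain r :: "nat \<Rightarrow> nat" where r: "strict_mono r"
    and lim: "\<And>p. p \<in> T \<times> lists (Basis :: 'b set) \<Longrightarrow> \<exists>l. (\<lambda>n. f (r n) p) \<longlonglongrightarrow> l"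
    by (rule function_convergent_subsequence[OF cT fB], assumption, rule that)
  \<comment> \<open>All monomials are kept as an extra factor, so that convergence is inherited when
    \<phi> is multiplied by a coordinate.\<close>
  define conv where "conv \<phi> \<longleftrightarrow> continuous_on UNIV \<phi> \<and> (\<forall>t\<in>T. \<forall>L\<in>lists Basis.
     convergent (\<lambda>n. \<integral>x. \<phi> (w (r n) x) * monomial_list L (w (r n) x) * m t (r n) x \<partial>N))" for \<phi> :: "'b \<Rightarrow> real"
  have mono: "conv (\<lambda>_. 1)"
    unfolding conv_def
  proof (intro conjI ballI)
    fix t L assume t: "t \<in> T" and L: "L \<in> lists (Basis :: 'b set)"
    then obtain l where "(\<lambda>n. f (r n) (t, L)) \<longlonglongrightarrow> l" using lim[of "(t, L)"] by auto
    then have "(\<lambda>n. C L * f (r n) (t, L)) \<longlonglongrightarrow> C L * l" by (intro tendsto_intros)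
    moreover have "C L * f (r n) (t, L) = (\<integral>x. 1 * monomial_list L (w (r n) x) * m t (r n) x \<partial>N)" for n
      using C(1)[of L] by (simp add: f_def)
    ultimately show "convergent (\<lambda>n. \<integral>x. 1 * monomial_list L (w (r n) x) * m t (r n) x \<partial>N)"
      by (auto simp: convergent_def)
  qed simp
  have add: "conv (\<lambda>y. \<phi> y + \<psi> y)" if "conv \<phi>" "conv \<psi>" for \<phi> \<psi>
    unfolding conv_def
  proof (intro conjI ballI)
    have c: "continuous_on UNIV \<phi>" "continuous_on UNIV \<psi>" using that unfolding conv_def by auto
    then show "continuous_on UNIV (\<lambda>y. \<phi> y + \<psi> y)" by (intro continuous_intros)
    fix t L assume t: "t \<in> T" and L: "L \<in> lists (Basis :: 'b set)"
    have i: "integrable N (\<lambda>x. \<phi> (w n x) * monomial_list L (w n x) * m t n x)" if "continuous_on UNIV \<phi>" for \<phi> n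
      using \<phi>i[of "\<lambda>y. \<phi> y * monomial_list L y", OF _ t] that by (auto intro!: continuous_intros monomial_list_continuous)
    have "convergent (\<lambda>n. (\<integral>x. \<phi> (w (r n) x) * monomial_list L (w (r n) x) * m t (r n) x \<partial>N)
       + (\<integral>x. \<psi> (w (r n) x) * monomial_list L (w (r n) x) * m t (r n) x \<partial>N))"
      using that t L unfolding conv_def by (intro convergent_add) auto
    then show "convergent (\<lambda>n. \<integral>x. (\<phi> (w (r n) x) + \<psi> (w (r n) x)) * monomial_list L (w (r n) x) * m t (r n) x \<partial>N)"
      using i[OF c(1)] i[OF c(2)] by (simp add: distrib_right)
  qed
  have scale: "conv (\<lambda>y. c * \<phi> y)" if "conv \<phi>" for \<phi> c
    using that unfolding conv_def mult.assoc[of c] integral_mult_right_zero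
    by (auto intro!: continuous_intros convergent_mult convergent_const)
  have coord: "conv (\<lambda>y. (y \<bullet> b) * \<phi> y)" if "conv \<phi>" "b \<in> Basis" for \<phi> b
    unfolding conv_def
  proof (intro conjI ballI)
    show "continuous_on UNIV (\<lambda>y. (y \<bullet> b) * \<phi> y)" using that(1) unfolding conv_def by (auto intro!: continuous_intros)
    fix t L assume t: "t \<in> T" and L: "L \<in> lists (Basis :: 'b set)"
    have "convergent (\<lambda>n. \<integral>x. \<phi> (w (r n) x) * monomial_list (b # L) (w (r n) x) * m t (r n) x \<partial>N)"
      using that t L unfolding conv_def by auto
    then show "convergent (\<lambda>n. \<integral>x. (w (r n) x \<bullet> b) * \<phi> (w (r n) x) * monomial_list L (w (r n) x) * m t (r n) x \<partial>N)"
      by (simp add: monomial_list_def mult_ac)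
  qed
  have sums: "conv (\<lambda>y. \<Sum>b\<in>A. h b y)" if "finite A" "\<And>b. b \<in> A \<Longrightarrow> conv (h b)" for A :: "'b set" and h
    using that
  proof (induction A rule: finite_induct)
    case empty
    then show ?case using scale[OF mono, of 0] by simp
  next
    case (insert b A)
    then show ?case using add[of "h b" "\<lambda>y. \<Sum>b\<in>A. h b y"] by simp
  qed
  have poly: "conv (\<lambda>y. p y * \<phi> y)" if "real_polynomial_function p" "conv \<phi>" for p \<phi>
    using that
  proof (induction p arbitrary: \<phi>)
    case (linear f)
    have l: "linear f" by (rule bounded_linear.linear[OF linear(1)])
    have frep: "f y = (\<Sum>b\<in>Basis. f b * (y \<bullet> b))" for y
    proof -
      have "f y = f (\<Sum>b\<in>Basis. (y \<bullet> b) *\<^sub>R b)" by (simp add: euclidean_representation)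
      then show ?thesis by (simp add: linear_sum[OF l] linear_scale[OF l] mult.commute)
    qed
    have "(\<lambda>y. f y * \<phi> y) = (\<lambda>y. \<Sum>b\<in>Basis. f b * ((y \<bullet> b) * \<phi> y))"
      by (rule ext, subst frep) (simp add: sum_distrib_right mult.assoc)
    then show ?case by (rule ssubst) (rule sums[OF finite_Basis scale[OF coord[OF linear(2)]]])
  next
    case (const c)
    then show ?case by (rule scale)
  next
    case (add p1 p2)
    then show ?case using \<open>\<And>\<phi> \<psi>. conv \<phi> \<Longrightarrow> conv \<psi> \<Longrightarrow> conv (\<lambda>y. \<phi> y + \<psi> y)\<close>[OF add.IH(1)[OF add.prems] add.IH(2)[OF add.prems]]
      by (simp add: distrib_right)
  next
    case (mult p1 p2)
    then show ?case using mult.IH(1)[OF mult.IH(2)[OF mult.prems]] by (simp add: mult.assoc)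
  qed
  have "convergent (\<lambda>n. \<integral>x. \<phi> (w (r n) x) * m t (r n) x \<partial>N)" if t: "t \<in> T" and \<phi>: "continuous_on UNIV \<phi>" for t \<phi>
  proof (rule Cauchy_convergent, rule CauchyI)
    fix e :: real assume e: "e > 0"
    \<comment> \<open>Replacing \<phi> by a polynomial at the two indices of the Cauchy estimate
      costs at most \<open>e / 4\<close> each time.\<close>
    define \<eta> where "\<eta> = e / (4 * (\<bar>B\<bar> + 1))"
    have \<eta>: "\<eta> > 0" using e by (simp add: \<eta>_def)
    have \<eta>B: "\<eta> * B \<le> e / 4"
    proof -
      have "\<eta> * B \<le> \<eta> * (\<bar>B\<bar> + 1)" using \<eta> by (intro mult_left_mono) auto
      also have "\<dots> = e / 4" by (simp add: \<eta>_def add_pos_nonneg[THEN less_imp_neq, THEN not_sym] field_simps)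
      finally show ?thesis .
    qed
    obtain p where p: "real_polynomial_function p" "\<And>y. y \<in> S \<Longrightarrow> \<bar>\<phi> y - p y\<bar> < \<eta>"
      using Stone_Weierstrass_real_polynomial_function[OF S(1) continuous_on_subset[OF \<phi>] \<eta>] by (metis subset_UNIV)
    have pc: "conv p" using poly[OF p(1) mono] by simp
    then have pc': "continuous_on UNIV p" unfolding conv_def by blast
    have "convergent (\<lambda>n. \<integral>x. p (w (r n) x) * monomial_list [] (w (r n) x) * m t (r n) x \<partial>N)"
      using pc t unfolding conv_def by auto
    then have "convergent (\<lambda>n. \<integral>x. p (w (r n) x) * m t (r n) x \<partial>N)" by (simp add: monomial_list_def)
    then obtain n0 where n0: "\<And>i j. i \<ge> n0 \<Longrightarrow> j \<ge> n0 \<Longrightarrow>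
      norm ((\<integral>x. p (w (r i) x) * m t (r i) x \<partial>N) - (\<integral>x. p (w (r j) x) * m t (r j) x \<partial>N)) < e / 4"
      using e by (meson CauchyD convergent_Cauchy divide_pos_pos zero_less_numeral)
    have close: "\<bar>(\<integral>x. \<phi> (w n x) * m t n x \<partial>N) - (\<integral>x. p (w n x) * m t n x \<partial>N)\<bar> \<le> e / 4" for n
    proof -
      have "\<bar>\<integral>x. (\<phi> (w n x) - p (w n x)) * m t n x \<partial>N\<bar> \<le> \<eta> * B"
        by (rule \<phi>b[OF _ t, of "\<lambda>y. \<phi> y - p y"]) (use \<phi> pc' \<eta> p(2) in \<open>auto intro!: continuous_intros less_imp_le\<close>)
      then show ?thesis using \<phi>i[OF \<phi> t, of n] \<phi>i[OF pc' t, of n] \<eta>B by (simp add: left_diff_distrib)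
    qed
    have "norm ((\<integral>x. \<phi> (w (r i) x) * m t (r i) x \<partial>N) - (\<integral>x. \<phi> (w (r j) x) * m t (r j) x \<partial>N)) < e" if "i \<ge> n0" "j \<ge> n0" for i j
      using close[of "r i"] close[of "r j"] n0[OF that] unfolding real_norm_def by linarith
    then show "\<exists>n0. \<forall>i\<ge>n0. \<forall>j\<ge>n0. norm ((\<integral>x. \<phi> (w (r i) x) * m t (r i) x \<partial>N) - (\<integral>x. \<phi> (w (r j) x) * m t (r j) x \<partial>N)) < e"
      by blast
  qed
  with r that show ?thesis by blast
qed

section \<open>Minors of the gradient as multipliers of form components\<close>

definition graph_vector :: "real^3^3 \<Rightarrow> 3 \<Rightarrow> (real^3) \<times> (real^3)" where
  "graph_vector A i = (axis i 1, A *v axis i 1)"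

definition graph_index :: "(((real^3) \<times> (real^3)) \<times> ((real^3) \<times> (real^3)) \<times> ((real^3) \<times> (real^3))) option set" where
  "graph_index = insert None (Some ` (Basis \<times> Basis \<times> Basis))"

text \<open>The purely vertical minors are collected in the index \<^const>\<open>None\<close>, so that every other
  multiplier is at most quadratic in the gradient.\<close>

definition multiplier :: "(((real^3) \<times> (real^3)) \<times> ((real^3) \<times> (real^3)) \<times> ((real^3) \<times> (real^3))) option \<Rightarrow> real^3^3 \<Rightarrow> real" where
  "multiplier t A = (case t of None \<Rightarrow> det A | Some (a, b, c) \<Rightarrow>
     if fst a = 0 \<and> fst b = 0 \<and> fst c = 0 then 0
     else (graph_vector A 1 \<bullet> a) * (graph_vector A 2 \<bullet> b) * (graph_vector A 3 \<bullet> c))"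

definition form_component :: "((real^3) \<times> (real^3)) form3 \<Rightarrow>
    (((real^3) \<times> (real^3)) \<times> ((real^3) \<times> (real^3)) \<times> ((real^3) \<times> (real^3))) option \<Rightarrow> (real^3) \<times> (real^3) \<Rightarrow> real" where
  "form_component \<omega> t p = (case t of None \<Rightarrow> \<omega> p (0, axis 1 1) (0, axis 2 1) (0, axis 3 1) | Some (a, b, c) \<Rightarrow> \<omega> p a b c)"

lemma finite_graph_index: "finite graph_index"
  by (simp add: graph_index_def)

lemma Basis_prod_cases:
  assumes "a \<in> (Basis :: ((real^3) \<times> (real^3)) set)"
  obtains j where "a = (axis j 1, 0)" | j where "a = (0, axis j 1)"
  using assms Basis_real_vec_axis unfolding Basis_prod_def by blast

text \<open>In the expansion over triples of basis vectors the purely vertical triples taken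
  together give the determinant times one component; every other triple keeps its own
  multiplier.\<close>

lemma graph_integrand_multipliers:
  assumes "alternating3 (\<omega> (x, y))"
  shows "graph_integrand \<omega> x y A = (\<Sum>t\<in>graph_index. form_component \<omega> t (x, y) * multiplier t A)"
proof -
  define f where "f = \<omega> (x, y)"
  have f: "alternating3 f" using assms by (simp add: f_def)
  let ?B = "Basis :: ((real^3) \<times> (real^3)) set"
  let ?v = "\<lambda>i. (0 :: real^3, A *v axis i 1)"
  have split: "(graph_vector A 1 \<bullet> a) * (graph_vector A 2 \<bullet> b) * (graph_vector A 3 \<bullet> c) * f a b c
      = f a b c * multiplier (Some (a, b, c)) A + (?v 1 \<bullet> a) * (?v 2 \<bullet> b) * (?v 3 \<bullet> c) * f a b c"
    if "a \<in> ?B" "b \<in> ?B" "c \<in> ?B" for a b c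
  proof (cases "fst a = 0 \<and> fst b = 0 \<and> fst c = 0")
    case True
    then show ?thesis by (simp add: multiplier_def graph_vector_def inner_prod_def)
  next
    case False
    \<comment> \<open>A vertical vector is orthogonal to the horizontal basis vectors, so a triple
      that is not purely vertical contributes nothing to the vertical part.\<close>
    have "?v i \<bullet> d = 0" if "d \<in> ?B" "fst d \<noteq> 0" for i d
      using Basis_prod_cases[OF that(1)] that(2) by (metis inner_Pair_0(2) inner_zero_left fst_conv snd_conv inner_prod_def add_0 inner_zero_right)
    then have "(?v 1 \<bullet> a) * (?v 2 \<bullet> b) * (?v 3 \<bullet> c) = 0" using False that by (metis mult_zero_left mult_zero_right)
    then show ?thesis using False unfolding multiplier_def option.case prod.case by (simp only: if_False add_0_right mult_zero_left mult.commute)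
  qed
  have "graph_integrand \<omega> x y A = (\<Sum>a\<in>?B. \<Sum>b\<in>?B. \<Sum>c\<in>?B.
      (graph_vector A 1 \<bullet> a) * (graph_vector A 2 \<bullet> b) * (graph_vector A 3 \<bullet> c) * f a b c)"
    unfolding graph_integrand_def f_def[symmetric] graph_vector_def[symmetric] by (rule alternating3_basis_sum[OF f])
  also have "\<dots> = (\<Sum>a\<in>?B. \<Sum>b\<in>?B. \<Sum>c\<in>?B. f a b c * multiplier (Some (a, b, c)) A)
      + (\<Sum>a\<in>?B. \<Sum>b\<in>?B. \<Sum>c\<in>?B. (?v 1 \<bullet> a) * (?v 2 \<bullet> b) * (?v 3 \<bullet> c) * f a b c)"
    unfolding sum.distrib[symmetric] by (intro sum.cong refl split)
  also have "(\<Sum>a\<in>?B. \<Sum>b\<in>?B. \<Sum>c\<in>?B. (?v 1 \<bullet> a) * (?v 2 \<bullet> b) * (?v 3 \<bullet> c) * f a b c)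
      = form_component \<omega> None (x, y) * multiplier None A"
    unfolding alternating3_basis_sum[OF f, symmetric] alternating3_vertical[OF f]
    by (simp add: form_component_def multiplier_def f_def)
  also have "(\<Sum>a\<in>?B. \<Sum>b\<in>?B. \<Sum>c\<in>?B. f a b c * multiplier (Some (a, b, c)) A)
      = (\<Sum>p\<in>?B \<times> ?B \<times> ?B. form_component \<omega> (Some p) (x, y) * multiplier (Some p) A)"
    unfolding sum.cartesian_product by (intro sum.cong refl) (auto simp: form_component_def f_def)
  also have "\<dots> = (\<Sum>t\<in>Some ` (?B \<times> ?B \<times> ?B). form_component \<omega> t (x, y) * multiplier t A)"
    by (simp add: sum.reindex)
  finally show ?thesis unfolding graph_index_def by (subst sum.insert) auto
qed

text \<open>At most two of the three factors are vertical, and horizontal ones are at most 1.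
  Bounding a vertical factor by \<open>1 + norm A\<close>, which is at least 1, makes the square of
  this number cover all cases, and \<open>(1 + t)\<^sup>2 \<le> 2 + 2 * t\<^sup>2\<close>.\<close>

lemma multiplier_bound:
  assumes "a \<in> Basis" "b \<in> Basis" "c \<in> Basis"
  shows "\<bar>multiplier (Some (a, b, c)) A\<bar> \<le> 2 + 2 * (norm A)\<^sup>2"
proof (cases "fst a = 0 \<and> fst b = 0 \<and> fst c = 0")
  case True
  then show ?thesis by (simp add: multiplier_def)
next
  case False
  let ?P = "1 + norm A"
  have 1: "\<bar>graph_vector A i \<bullet> d\<bar> \<le> (if fst d = 0 then ?P else 1)" if "d \<in> Basis" for i d
    using that
  proof (cases rule: Basis_prod_cases)
    case (1 j)
    then show ?thesis by (simp add: graph_vector_def inner_axis axis_nth)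
  next
    case (2 j)
    then show ?thesis using abs_matrix_le_norm[of A j i] by (simp add: graph_vector_def inner_axis matrix_vector_axis)
  qed
  have P: "?P \<ge> 1" by simp
  let ?k = "\<lambda>d :: (real^3) \<times> (real^3). if fst d = 0 then ?P else 1"
  have "\<bar>multiplier (Some (a, b, c)) A\<bar> = \<bar>graph_vector A 1 \<bullet> a\<bar> * \<bar>graph_vector A 2 \<bullet> b\<bar> * \<bar>graph_vector A 3 \<bullet> c\<bar>"
    unfolding multiplier_def option.case prod.case if_not_P[OF False] abs_mult ..
  also have "\<dots> \<le> ?k a * ?k b * ?k c"
    by (intro mult_mono mult_nonneg_nonneg 1 assms abs_ge_zero) (use P in auto)
  also have "\<dots> \<le> ?P * ?P"
  proof -
    have q: "?P \<le> ?P * ?P" "1 \<le> ?P * ?P"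
      using mult_left_mono[OF P, of ?P] P unfolding mult_1_right by linarith+
    have "(if X then P else 1) * (if Y then P else 1) * (if Z then P else 1) \<le> P * P"
      if "\<not> (X \<and> Y \<and> Z)" "P \<le> P * P" "1 \<le> P * P" for X Y Z and P :: real
      using that by (cases X; cases Y; cases Z; simp only: if_True if_False mult_1_left mult_1_right order_refl simp_thms)
    from this[OF False q] show ?thesis .
  qed
  also have "\<dots> \<le> 2 + 2 * (norm A)\<^sup>2"
    using zero_le_power2[of "1 - norm A"] by (simp add: power2_eq_square algebra_simps)
  finally show ?thesis .
qed

lemma multiplier_measurable:
  assumes A: "\<And>i j. (\<lambda>x. A x $ i $ j) \<in> borel_measurable N"
  shows "(\<lambda>x. multiplier t (A x)) \<in> borel_measurable N"
proof (cases t)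
  case None
  then show ?thesis using det_measurable[OF A] by (simp add: multiplier_def)
next
  case (Some p)
  have "(\<lambda>x. graph_vector (A x) i \<bullet> d) \<in> borel_measurable N" for i d
    unfolding graph_vector_def inner_prod_def inner_vec_def[of "A _ *v _"] matrix_vector_axis fst_conv snd_conv
    unfolding inner_real_def by (intro borel_measurable_add borel_measurable_const borel_measurable_sum borel_measurable_times A)
  then show ?thesis using Some by (cases p) (simp add: multiplier_def)
qed

lemma graph_current_integral:
  "graph_current \<Omega> w \<omega> = (\<integral>x. graph_integrand \<omega> x (w x) (weak_gradient \<Omega> w x) \<partial>lebesgue_on \<Omega>)"
  by (simp add: graph_current_def graph_integrand_def Let_def)

lemma form_component_continuous:
  assumes "\<omega> \<in> test_forms3 U"
  shows "continuous_on UNIV (form_component \<omega> t)"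
proof -
  have "continuous_on UNIV (\<lambda>p. \<omega> p a b c)" for a b c
    using assms unfolding test_forms3_def by (intro smooth_continuous) blast
  then show ?thesis by (cases t) (simp_all add: form_component_def[abs_def] split_def)
qed

lemma multiplier_integrable:
  assumes \<Omega>: "open \<Omega>" "bounded \<Omega>" and w: "w \<in> W12 \<Omega>" "det_integrable \<Omega> w" and t: "t \<in> graph_index"
  shows "integrable (lebesgue_on \<Omega>) (\<lambda>x. multiplier t (weak_gradient \<Omega> w x))"
proof (cases t)
  case None
  then show ?thesis using w(2) by (simp add: multiplier_def det_integrable_def)
next
  case (Some p)
  interpret finite_measure "lebesgue_on \<Omega>" by (rule finite_measure_bounded_open[OF \<Omega>])
  obtain a b c where p: "p = (a, b, c)" "a \<in> Basis" "b \<in> Basis" "c \<in> Basis"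
    using t Some by (auto simp: graph_index_def)
  have "integrable (lebesgue_on \<Omega>) (\<lambda>x. 2 + 2 * (norm (weak_gradient \<Omega> w x))\<^sup>2)"
    using W12_square_gradient[OF w(1)] by simp
  then show ?thesis
  proof (rule Bochner_Integration.integrable_bound[OF _ multiplier_measurable[OF W12_comp_measurable(2)[OF w(1)]]])
    show "AE x in lebesgue_on \<Omega>. norm (multiplier t (weak_gradient \<Omega> w x)) \<le> norm (2 + 2 * (norm (weak_gradient \<Omega> w x))\<^sup>2)"
      using multiplier_bound[OF p(2-4)] unfolding Some p by (intro AE_I2) (simp add: order_trans[OF _ abs_ge_self])
  qed
qed

lemma graph_point_measurable:
  assumes "open \<Omega>" "w \<in> W12 \<Omega>"
  shows "(\<lambda>x. (x, w x)) \<in> borel_measurable (lebesgue_on \<Omega>)"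
  using assms by (intro borel_measurable_Pair W12_measurable continuous_imp_measurable_on_sets_lebesgue continuous_on_id) auto

lemma graph_point_compact:
  assumes \<Omega>: "open \<Omega>" "bounded \<Omega>" and b: "AE x in lebesgue_on \<Omega>. norm (w x) \<le> M"
  shows "compact (closure \<Omega> \<times> cball (0 :: real^3) M)" "AE x in lebesgue_on \<Omega>. (x, w x) \<in> closure \<Omega> \<times> cball (0 :: real^3) M"
proof -
  show "compact (closure \<Omega> \<times> cball (0 :: real^3) M)" using \<Omega> by (intro compact_Times) auto
  have "AE x in lebesgue_on \<Omega>. x \<in> \<Omega>" using \<Omega>(1) by (simp add: AE_lebesgue_on)
  then show "AE x in lebesgue_on \<Omega>. (x, w x) \<in> closure \<Omega> \<times> cball (0 :: real^3) M"
    using b by eventually_elim (use closure_subset in auto)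
qed

lemma graph_component_integrable:
  assumes \<Omega>: "open \<Omega>" "bounded \<Omega>" and w: "w \<in> W12 \<Omega>" "det_integrable \<Omega> w"
    and b: "AE x in lebesgue_on \<Omega>. norm (w x) \<le> M" and \<omega>: "\<omega> \<in> test_forms3 U" and t: "t \<in> graph_index"
  shows "integrable (lebesgue_on \<Omega>) (\<lambda>x. form_component \<omega> t (x, w x) * multiplier t (weak_gradient \<Omega> w x))"
proof -
  note S = graph_point_compact[OF \<Omega> b] and c = form_component_continuous[OF \<omega>, of t]
  have "compact (form_component \<omega> t ` (closure \<Omega> \<times> cball 0 M))"
    by (intro compact_continuous_image S continuous_on_subset[OF c]) auto
  then have "bounded (form_component \<omega> t ` (closure \<Omega> \<times> cball 0 M))" by (rule compact_imp_bounded)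
  then obtain k where k: "\<And>y. y \<in> form_component \<omega> t ` (closure \<Omega> \<times> cball 0 M) \<Longrightarrow> norm y \<le> k"
    unfolding bounded_iff by blast
  have "integrable (lebesgue_on \<Omega>) (\<lambda>x. multiplier t (weak_gradient \<Omega> w x) * form_component \<omega> t (x, w x))"
  proof (rule integrable_mult_bounded[OF multiplier_integrable[OF \<Omega> w t] borel_measurable_continuous_on[OF c graph_point_measurable[OF \<Omega>(1) w(1)]]])
    show "AE x in lebesgue_on \<Omega>. \<bar>form_component \<omega> t (x, w x)\<bar> \<le> k"
      using S(2) by eventually_elim (use k in auto)
  qed
  then show ?thesis by (simp add: mult.commute)
qed

lemma graph_integrand_sum:
  assumes "\<omega> \<in> test_forms3 U"
  shows "graph_integrand \<omega> x y A = (\<Sum>t\<in>graph_index. form_component \<omega> t (x, y) * multiplier t A)"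
  using assms unfolding test_forms3_def by (intro graph_integrand_multipliers) auto

lemma graph_integrand_integrable:
  assumes \<Omega>: "open \<Omega>" "bounded \<Omega>" and w: "w \<in> W12 \<Omega>" "det_integrable \<Omega> w"
    and b: "AE x in lebesgue_on \<Omega>. norm (w x) \<le> M" and \<omega>: "\<omega> \<in> test_forms3 U"
  shows "integrable (lebesgue_on \<Omega>) (\<lambda>x. graph_integrand \<omega> x (w x) (weak_gradient \<Omega> w x))"
  unfolding graph_integrand_sum[OF \<omega>]
  by (intro Bochner_Integration.integrable_sum graph_component_integrable[OF \<Omega> w b \<omega>])

text \<open>Additivity of the Bochner integral asks for integrable integrands, and this is where the
  integrability of the determinant enters.\<close>

lemma graph_current_add:
  assumes \<Omega>: "open \<Omega>" "bounded \<Omega>" and w: "w \<in> W12 \<Omega>" "det_integrable \<Omega> w"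
    and b: "AE x in lebesgue_on \<Omega>. norm (w x) \<le> M" and \<omega>: "\<omega> \<in> test_forms3 U" "\<eta> \<in> test_forms3 U"
  shows "graph_current \<Omega> w (\<lambda>p a b c. \<omega> p a b c + \<eta> p a b c) = graph_current \<Omega> w \<omega> + graph_current \<Omega> w \<eta>"
  unfolding graph_current_integral
  using graph_integrand_integrable[OF \<Omega> w b \<omega>(1)] graph_integrand_integrable[OF \<Omega> w b \<omega>(2)]
  by (subst Bochner_Integration.integral_add[symmetric]) (simp_all add: graph_integrand_def)

lemma graph_current_scale:
  "graph_current \<Omega> w (\<lambda>p a b c. k * \<omega> p a b c) = k * graph_current \<Omega> w \<omega>"
  unfolding graph_current_integral by (simp add: graph_integrand_def)

section \<open>The defect as a current\<close>

context axi_limit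
begin

text \<open>The current \<open>S\<close> is the limit minus the graph current of \<open>u\<close>,
  so linearity is inherited. If the support of a form avoids the fibres over the axis, its
  projection to \<Omega> is compact and misses the axis, and there the graph currents converge to
  that of \<open>u\<close>.\<close>

lemma defect_current:
  assumes di: "\<And>n. det_integrable \<Omega> (un n)" "det_integrable \<Omega> u" and db: "\<And>n. (\<integral>x. \<bar>det (Dn n x)\<bar> \<partial>N) \<le> B"
  shows "\<exists>(r :: nat \<Rightarrow> nat) S. strict_mono r \<and> current3 (\<Omega> \<times> UNIV) S \<and>
    currents_converge (\<Omega> \<times> UNIV) (\<lambda>n. graph_current \<Omega> (un (r n))) (\<lambda>\<omega>. graph_current \<Omega> u \<omega> + S \<omega>) \<and>
    current_support (\<Omega> \<times> UNIV) S \<subseteq> (\<Omega> \<inter> axis_z) \<times> UNIV"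
proof -
  interpret N: finite_measure N by (rule fmN)
  let ?U = "\<Omega> \<times> (UNIV :: (real^3) set)"
  \<comment> \<open>The determinant is bounded through \<open>B\<close>, every other multiplier
    through \<open>multiplier_bound\<close> and the gradient bound; the sum covers both.\<close>
  let ?B = "\<bar>B\<bar> + (2 * measure N (space N) + 2 * \<bar>C\<bar>)"
  note mi = multiplier_integrable[OF \<Omega> W(1) di(1)]
  have mb: "(\<integral>x. \<bar>multiplier t (Dn n x)\<bar> \<partial>N) \<le> ?B" if t: "t \<in> graph_index" for t n
  proof (cases t)
    case None
    have "0 \<le> 2 * measure N (space N) + 2 * \<bar>C\<bar>" by simp
    moreover have "(\<integral>x. \<bar>multiplier t (Dn n x)\<bar> \<partial>N) \<le> B" using None db[of n] by (simp add: multiplier_def)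
    ultimately show ?thesis by linarith
  next
    case (Some p)
    obtain a b c where p: "p = (a, b, c)" "a \<in> Basis" "b \<in> Basis" "c \<in> Basis"
      using t Some by (auto simp: graph_index_def)
    have "(\<integral>x. \<bar>multiplier t (Dn n x)\<bar> \<partial>N) \<le> (\<integral>x. 2 + 2 * (norm (Dn n x))\<^sup>2 \<partial>N)"
      using multiplier_bound[OF p(2-4)] mi[OF t] W12_square_gradient[OF W(1)] unfolding Some p
      by (intro integral_mono) auto
    also have "\<dots> = 2 * measure N (space N) + 2 * (\<integral>x. (norm (Dn n x))\<^sup>2 \<partial>N)"
      using W12_square_gradient[OF W(1)[of n]] by simp
    finally show ?thesis using en[of n] by linarith
  qed
  obtain r :: "nat \<Rightarrow> nat" where r: "strict_mono r"
    and conv: "\<And>t \<phi>. t \<in> graph_index \<Longrightarrow> continuous_on UNIV \<phi> \<Longrightarrow>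
      convergent (\<lambda>n. \<integral>x. \<phi> (x, un (r n) x) * multiplier t (Dn (r n) x) \<partial>N)"
    by (rule moment_subsequence[where w="\<lambda>n x. (x, un n x)" and m="\<lambda>t n x. multiplier t (Dn n x)" and N=N,
        OF finite_graph_index graph_point_compact[OF \<Omega> bnd] graph_point_measurable[OF \<Omega>(1) W(1)] mi mb])
      (assumption | rule that)+
  let ?G = "\<lambda>\<omega> n. graph_current \<Omega> (un (r n)) \<omega>"
  have Gc: "convergent (?G \<omega>)" if \<omega>: "\<omega> \<in> test_forms3 ?U" for \<omega>
  proof -
    have "?G \<omega> n = (\<Sum>t\<in>graph_index. \<integral>x. form_component \<omega> t (x, un (r n) x) * multiplier t (Dn (r n) x) \<partial>N)" for n
      unfolding graph_current_integral graph_integrand_sum[OF \<omega>]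
      by (rule Bochner_Integration.integral_sum) (rule graph_component_integrable[OF \<Omega> W(1) di(1) bnd \<omega>])
    then show ?thesis by (simp add: convergent_sum conv form_component_continuous[OF \<omega>])
  qed
  then have Gl: "?G \<omega> \<longlonglongrightarrow> lim (?G \<omega>)" if "\<omega> \<in> test_forms3 ?U" for \<omega> using that by (simp add: convergent_LIMSEQ_iff)
  define S where "S \<omega> = lim (?G \<omega>) - graph_current \<Omega> u \<omega>" for \<omega>
  have "current3 ?U S"
    unfolding current3_def
  proof (intro conjI ballI allI)
    fix \<omega> \<eta> assume \<omega>: "\<omega> \<in> test_forms3 ?U" "\<eta> \<in> test_forms3 ?U"
    have "lim (?G (\<lambda>p a b c. \<omega> p a b c + \<eta> p a b c)) = lim (?G \<omega>) + lim (?G \<eta>)"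
      unfolding graph_current_add[OF \<Omega> W(1) di(1) bnd \<omega>] by (rule limI[OF tendsto_add[OF Gl[OF \<omega>(1)] Gl[OF \<omega>(2)]]])
    then show "S (\<lambda>p a b c. \<omega> p a b c + \<eta> p a b c) = S \<omega> + S \<eta>"
      by (simp add: S_def graph_current_add[OF \<Omega> W(2) di(2) u_bnd \<omega>])
  next
    fix \<omega> k assume \<omega>: "\<omega> \<in> test_forms3 ?U"
    have "lim (?G (\<lambda>p a b c. k * \<omega> p a b c)) = k * lim (?G \<omega>)"
      unfolding graph_current_scale by (rule limI[OF tendsto_mult_left[OF Gl[OF \<omega>]]])
    then show "S (\<lambda>p a b c. k * \<omega> p a b c) = k * S \<omega>"
      by (simp add: S_def graph_current_scale right_diff_distrib)
  qed
  moreover have "currents_converge ?U (\<lambda>n. graph_current \<Omega> (un (r n))) (\<lambda>\<omega>. graph_current \<Omega> u \<omega> + S \<omega>)"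
    unfolding currents_converge_def S_def by (simp add: Gl)
  moreover have "current_support ?U S \<subseteq> (\<Omega> \<inter> axis_z) \<times> UNIV"
    unfolding current_support_def
  \<comment> \<open>The part of the product over the axis is shown to be one of the closed sets
    whose intersection is the support.\<close>
  proof (rule Inter_lower, rule CollectI, intro conjI ballI impI)
    have "(\<Omega> \<inter> axis_z) \<times> (UNIV :: (real^3) set) = ?U \<inter> (axis_z \<times> UNIV)" by auto
    then show "closedin (top_of_set ?U) ((\<Omega> \<inter> axis_z) \<times> UNIV)"
      using closed_Times[OF closed_axis_z closed_UNIV] by (metis closedin_closed_Int)
    fix \<omega> assume \<omega>: "\<omega> \<in> test_forms3 ?U" and supp: "form_support \<omega> \<subseteq> ?U - (\<Omega> \<inter> axis_z) \<times> UNIV"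
    let ?K = "fst ` form_support \<omega>"
    have al: "\<And>p. alternating3 (\<omega> p)" and co: "\<And>a b c. continuous_on UNIV (\<lambda>p. \<omega> p a b c)" and cs: "compact (form_support \<omega>)"
      using \<omega> unfolding test_forms3_def by (auto intro: smooth_continuous)
    have K: "compact ?K" "?K \<subseteq> \<Omega> - axis_z"
      using cs supp by (auto intro!: compact_continuous_image continuous_on_fst continuous_on_id)
    have z: "\<omega> (x, y) a b c = 0" if "x \<notin> ?K" for x y a b c
    proof (rule ccontr)
      assume "\<omega> (x, y) a b c \<noteq> 0"
      then have "(x, y) \<in> {p. \<exists>a b c. \<omega> p a b c \<noteq> 0}" by blast
      then have "(x, y) \<in> form_support \<omega>" unfolding form_support_def by (rule subsetD[OF closure_subset])
      then have "x \<in> ?K" by (rule image_eqI[rotated]) simp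
      with that show False by contradiction
    qed
    have "graph_current \<Omega> (un n) \<omega> = (\<integral>x. graph_integrand \<omega> x (un n x) (Dn n x) \<partial>N)" for n by (rule graph_current_integral)
    moreover have "(\<lambda>n. \<integral>x. graph_integrand \<omega> x (un n x) (Dn n x) \<partial>N) \<longlonglongrightarrow> (\<integral>x. graph_integrand \<omega> x (u x) (D x) \<partial>N)"
      by (rule form_convergence(1)[OF al co K z borel_measurable_integrable[OF graph_integrand_integrable[OF \<Omega> W(1) di(1) bnd \<omega>]]
          borel_measurable_integrable[OF graph_integrand_integrable[OF \<Omega> W(2) di(2) u_bnd \<omega>]]])
    ultimately have "(\<lambda>n. graph_current \<Omega> (un n) \<omega>) \<longlonglongrightarrow> graph_current \<Omega> u \<omega>"
      by (simp only: graph_current_integral)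
    from LIMSEQ_subseq_LIMSEQ[OF this r] have "?G \<omega> \<longlonglongrightarrow> graph_current \<Omega> u \<omega>" unfolding o_def .
    then show "S \<omega> = 0" by (simp add: S_def limI)
  qed
  ultimately show ?thesis using r by blast
qed

end

section \<open>Bounds from the energy\<close>

text \<open>From \<open>t0\<close> on \<open>H\<close> dominates the identity, so the determinant is
  at most \<open>t0\<close> plus an excess controlled by \<open>H\<close>. Positivity of the
  determinant ensures that \<open>H\<close> is nonnegative at it, so that each summand of the energy
  is bounded by the whole.\<close>

lemma energy_bounds:
  assumes \<Omega>: "open \<Omega>" "bounded \<Omega>" and w: "w \<in> W12 \<Omega>" "det_integrable \<Omega> w"
    and pos: "AE x in lebesgue_on \<Omega>. det (weak_gradient \<Omega> w x) > 0"
    and H: "\<And>t. t > 0 \<Longrightarrow> H t \<ge> 0" and t0: "t0 \<ge> 0" "\<And>t. t \<ge> t0 \<Longrightarrow> H t \<ge> t"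
    and E: "E \<ge> 0" "neo_hookean_energy \<Omega> H w \<le> ennreal E"
  shows "(\<integral>x. (norm (weak_gradient \<Omega> w x))\<^sup>2 \<partial>lebesgue_on \<Omega>) \<le> E"
    and "(\<integral>x. \<bar>det (weak_gradient \<Omega> w x)\<bar> \<partial>lebesgue_on \<Omega>) \<le> t0 * measure (lebesgue_on \<Omega>) (space (lebesgue_on \<Omega>)) + E"
proof -
  let ?N = "lebesgue_on \<Omega>" and ?D = "weak_gradient \<Omega> w"
  interpret finite_measure ?N by (rule finite_measure_bounded_open[OF \<Omega>])
  have "ennreal (\<integral>x. (norm (?D x))\<^sup>2 \<partial>?N) = (\<integral>\<^sup>+x. ennreal ((norm (?D x))\<^sup>2) \<partial>?N)"
    by (rule nn_integral_eq_integral[symmetric, OF W12_square_gradient[OF w(1)]]) simp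
  also have "\<dots> \<le> neo_hookean_energy \<Omega> H w"
    unfolding neo_hookean_energy_def
    by (rule nn_integral_mono_AE) (use pos in eventually_elim, intro ennreal_leI, use H in auto)
  also note E(2)
  finally show "(\<integral>x. (norm (?D x))\<^sup>2 \<partial>?N) \<le> E" using E(1) by (simp add: ennreal_le_iff)
  have di: "integrable ?N (\<lambda>x. \<bar>det (?D x)\<bar>)" using w(2) unfolding det_integrable_def by (rule integrable_abs)
  let ?g = "\<lambda>x. max 0 (\<bar>det (?D x)\<bar> - t0)"
  have gi: "integrable ?N ?g" using di by (intro integrable_max) auto
  have "ennreal (\<integral>x. ?g x \<partial>?N) = (\<integral>\<^sup>+x. ennreal (?g x) \<partial>?N)"
    by (rule nn_integral_eq_integral[symmetric, OF gi]) simp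
  also have "\<dots> \<le> neo_hookean_energy \<Omega> H w"
    unfolding neo_hookean_energy_def
  proof (rule nn_integral_mono_AE)
    show "AE x in ?N. ennreal (?g x) \<le> ennreal ((norm (?D x))\<^sup>2 + H (det (?D x)))"
      using pos
    proof eventually_elim
      case (elim x)
      have "?g x \<le> H (det (?D x))" using elim H[OF elim] t0(2)[of "det (?D x)"] t0(1) by (cases "det (?D x) \<ge> t0") auto
      then show ?case by (intro ennreal_leI) (simp add: add_increasing)
    qed
  qed
  also note E(2)
  finally have "(\<integral>x. ?g x \<partial>?N) \<le> E" using E(1) by (simp add: ennreal_le_iff)
  moreover have "(\<integral>x. \<bar>det (?D x)\<bar> \<partial>?N) \<le> (\<integral>x. t0 + ?g x \<partial>?N)"
    using di gi by (intro integral_mono) auto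
  moreover have "(\<integral>x. t0 + ?g x \<partial>?N) = t0 * measure ?N (space ?N) + (\<integral>x. ?g x \<partial>?N)"
    using gi by (simp add: mult.commute)
  ultimately show "(\<integral>x. \<bar>det (?D x)\<bar> \<partial>?N) \<le> t0 * measure ?N (space ?N) + E" by linarith
qed

lemma weakly_converges_W12_subseq:
  "weakly_converges_W12 \<Omega> un u \<Longrightarrow> strict_mono r \<Longrightarrow> weakly_converges_W12 \<Omega> (\<lambda>n. un (r n)) u"
  unfolding weakly_converges_W12_def using LIMSEQ_subseq_LIMSEQ unfolding o_def by blast

theorem proposition4p4:
  fixes \<Omega> \<Omega>' :: "(real^3) set"
    and g :: "real^3 \<Rightarrow> real^3"
    and M :: real
    and H :: "real \<Rightarrow> real"
    and un :: "nat \<Rightarrow> real^3 \<Rightarrow> real^3"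
    and u :: "real^3 \<Rightarrow> real^3"
  assumes "smooth_bounded_domain \<Omega>" and "axisymmetric_set \<Omega>"
    and "smooth_bounded_domain \<Omega>'" and "axisymmetric_set \<Omega>'"
    and "C1_diffeomorphism (closure \<Omega>) (closure \<Omega>') g" and "axisymmetric_map \<Omega> g"
    and "M > 0"
    and "\<And>t. t > 0 \<Longrightarrow> H t \<ge> 0" and "smooth_on {0<..} H" and "convex_on {0<..} H"
    and "filterlim (\<lambda>t. H t / t) at_top at_top"
    and "filterlim H at_top (at_right 0)"
    and "0 < (INF w\<in>admissible_nc_axi \<Omega> g M. neo_hookean_energy \<Omega> H w)"
    and "(INF w\<in>admissible_nc_axi \<Omega> g M. neo_hookean_energy \<Omega> H w) < \<infinity>"
    and "minimizing_sequence (neo_hookean_energy \<Omega> H) (admissible_nc_axi \<Omega> g M) un"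
    and "weakly_converges_W12 \<Omega> un u"
  shows "det_integrable \<Omega> u \<and>
    (\<exists>(r :: nat \<Rightarrow> nat) S. strict_mono r \<and>
       current3 (\<Omega> \<times> UNIV) S \<and>
       currents_converge (\<Omega> \<times> UNIV) (\<lambda>n. graph_current \<Omega> (un (r n)))
         (\<lambda>\<omega>. graph_current \<Omega> u \<omega> + S \<omega>) \<and>
       current_support (\<Omega> \<times> UNIV) S \<subseteq> (\<Omega> \<inter> axis_z) \<times> UNIV)"
proof -
  have \<Omega>: "open \<Omega>" "bounded \<Omega>" using assms(1) unfolding smooth_bounded_domain_def by auto
  have adm: "un n \<in> admissible_nc_axi \<Omega> g M" for n using assms(15) unfolding minimizing_sequence_def by blast
  have wW: "un n \<in> W12 \<Omega>" and wb: "AE x in lebesgue_on \<Omega>. norm (un n x) \<le> M"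
    and wp: "AE x in lebesgue_on \<Omega>. det (weak_gradient \<Omega> (un n) x) > 0"
    and wd: "det_integrable \<Omega> (un n)" and wa: "axisymmetric_map \<Omega> (un n)" for n
    using adm[of n] unfolding admissible_nc_axi_def admissible_nc_def admissible_def by auto
  \<comment> \<open>A finite level strictly above the infimum bounds the energy of all but finitely
    many terms.\<close>
  obtain e where e: "(INF w\<in>admissible_nc_axi \<Omega> g M. neo_hookean_energy \<Omega> H w) < e" "e < \<infinity>"
    using dense[OF assms(14)] by blast
  obtain E where E: "E \<ge> 0" "e = ennreal E" using e(2) by (cases e) auto
  have "eventually (\<lambda>n. neo_hookean_energy \<Omega> H (un n) < e) sequentially"
    using assms(15) order_tendstoD(2)[OF _ e(1)] unfolding minimizing_sequence_def by blast
  then obtain n0 where n0: "\<And>n. n \<ge> n0 \<Longrightarrow> neo_hookean_energy \<Omega> H (un n) \<le> ennreal E"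
    unfolding eventually_sequentially E(2) by (meson less_imp_le)
  have "eventually (\<lambda>t. 1 \<le> H t / t) at_top" using assms(11) unfolding filterlim_at_top by blast
  then have "eventually (\<lambda>t. t \<le> H t) at_top" using eventually_gt_at_top[of 0] by eventually_elim (simp add: field_simps)
  then obtain t1 where t1: "\<And>t. t \<ge> t1 \<Longrightarrow> t \<le> H t" unfolding eventually_at_top_linorder by blast
  define t0 where "t0 = max 0 t1"
  have t0: "t0 \<ge> 0" "\<And>t. t \<ge> t0 \<Longrightarrow> H t \<ge> t" using t1 by (auto simp: t0_def)
  let ?N = "lebesgue_on \<Omega>"
  \<comment> \<open>The bounds hold from the index \<open>n0\<close> on, so the sequence is shifted
    before any extraction.\<close>
  have bounds: "(\<integral>x. (norm (weak_gradient \<Omega> (un (n0 + n)) x))\<^sup>2 \<partial>?N) \<le> E"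
    "(\<integral>x. \<bar>det (weak_gradient \<Omega> (un (n0 + n)) x)\<bar> \<partial>?N) \<le> t0 * measure ?N (space ?N) + E" for n
    by (rule energy_bounds[OF \<Omega> wW wd wp _ t0(1) _ E(1) n0[OF le_add1]]; use assms(8) t0(2) in blast)+
  have sh: "strict_mono (\<lambda>n. n0 + n)" by (simp add: strict_mono_def)
  \<comment> \<open>This extraction yields convergence almost everywhere; \<open>r2\<close> below
    makes the graph currents converge, and the resulting index is
    \<open>n0 + r1 (r2 n)\<close>.\<close>
  obtain r1 :: "nat \<Rightarrow> nat" where r1: "strict_mono r1" "AE x in lebesgue_on \<Omega>. (\<lambda>n. un (n0 + r1 n) x) \<longlonglongrightarrow> u x"
    by (rule weak_convergence_AE_subsequence[OF \<Omega> weakly_converges_W12_subseq[OF assms(16) sh] wb bounds(1)], rule that)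
  have s1: "strict_mono (\<lambda>n. n0 + r1 n)" using r1(1) by (simp add: strict_mono_def)
  interpret axi_limit \<Omega> "\<lambda>n. un (n0 + r1 n)" u M E
    by unfold_locales (intro \<Omega> weakly_converges_W12_subseq[OF assms(16) s1] wb bounds(1) r1(2)
        axisymmetric_map_axi_at[OF \<Omega> assms(2) wa wW])+
  have di: "det_integrable \<Omega> u"
    unfolding det_integrable_def
    by (rule det_limit_integrable[OF wd[unfolded det_integrable_def] bounds(2)])
  from defect_current[OF wd di bounds(2)] obtain r2 :: "nat \<Rightarrow> nat" and S where r2: "strict_mono r2"
    and S: "current3 (\<Omega> \<times> UNIV) S"
      "currents_converge (\<Omega> \<times> UNIV) (\<lambda>n. graph_current \<Omega> (un (n0 + r1 (r2 n)))) (\<lambda>\<omega>. graph_current \<Omega> u \<omega> + S \<omega>)"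
      "current_support (\<Omega> \<times> UNIV) S \<subseteq> (\<Omega> \<inter> axis_z) \<times> UNIV"
    by blast
  have "strict_mono (\<lambda>n. n0 + r1 (r2 n))" using s1 r2 by (simp add: strict_mono_def)
  then show ?thesis using di S by blast
qed

end
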